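(* There is a polynomial-time (randomized) algorithm for the multi-armed bandit problem defined below whose expected total reward is at least $\frac{4}{27}\,\mathrm{OPT}_{\mathrm{LP}}$, where $\mathrm{OPT}_{\mathrm{LP}}$ is the optimal value of the linear program $(\mathrm{LP})$ below. Consequently the projection gap of $(\mathrm{LP})$ is at most $\frac{27}{4}$, i.e. for every instance $\mathrm{OPT}_{\mathrm{LP}}\le \frac{27}{4}\cdot(\text{maximum expected reward of any adaptive policy})$.
   Context: Multi-armed bandit problem. There are $n$ arms indexed by $i\in[n]$, where $[N]=\{1,\dots,N\}$. Arm $i$ is a Markov chain with finite node set $\mathcal{S}_i$ (the $\mathcal{S}_i$ are pairwise disjoint, $\mathcal{S}=\bigcup_i\mathcal{S}_i$) and root node $\rho_i\in\mathcal{S}_i$. For nodes $u,v$ of the same arm there are transition probabilities $p_{u,v}\ge 0$ with $\sum_v p_{u,v}=1$ for every $u$, and each node $u$ has a reward $r_u\ge 0$. Each arm is layered and acyclic: there is a function $\mathrm{depth}:\mathcal{S}_i\to\{0,1,\dots\}$ with $\mathrm{depth}(\rho_i)=0$ and $p_{u,v}>0\Rightarrow \mathrm{depth}(v)=\mathrm{depth}(u)+1$. Let $\mathrm{Par}(u)=\{v\in\mathcal{S}:p_{v,u}>0\}$. Initially every arm is on its root. At each time step $t=1,\dots,B$ the controller may pull one arm (or none); pulling an arm that is on node $u$ yields reward $r_u$ and moves that arm to node $v$ with probability $p_{u,v}$ (other arms do not move); the transition is observed before the next decision. An (adaptive) policy chooses which arm to pull based on everything observed so far; the goal is to maximize expected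 total reward over the $B$ time steps. No martingale assumption on rewards is made. $(\mathrm{LP})$ has variables $x_{u,t}$ and $s_{u,t}$ for $u\in\mathcal{S}$, $t\in[B]$: maximize $\sum_{u\in\mathcal{S}}r_u\sum_{t=1}^B x_{u,t}$ subject to $\sum_{u\in\mathcal{S}}x_{u,t}\le 1$ for all $t\in[B]$; $0\le x_{u,t}\le s_{u,t}$ for all $u,t$; $s_{\rho_i,1}=1$ for all $i$; $s_{u,1}=0$ for non-root $u$; and for $t>1$, $s_{u,t}=s_{u,t-1}-x_{u,t-1}+\sum_{v\in\mathrm{Par}(u)}x_{v,t-1}p_{v,u}$.
   Formalization: As stated, finite layered arms with outgoing probabilities summing to 1 at every node cannot exist (a deepest node has no successor); nodes are here also allowed to be terminal, with no transitions: pulling there yields the reward once and exhausts the arm. *)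

theory Defs
  imports
    "HOL-Probability.Probability"
    "HOL-Library.Discrete_Functions"
    "HOL-Computational_Algebra.Polynomial"
begin

section \<open>Instances\<close>

text \<open>The parameter \<open>'u\<close> is the type of nodes, \<open>'a\<close> the type of numbers (\<open>rat\<close> for an instance
  that is the input of an algorithm, \<open>real\<close> otherwise). Arms are numbered \<open>1, ..., arms I\<close>.\<close>

record ('u, 'a) bandit =
  arms :: nat
  nodes :: "nat \<Rightarrow> 'u set"
  root_node :: "nat \<Rightarrow> 'u"
  tprob :: "'u \<Rightarrow> 'u \<Rightarrow> 'a"
  reward :: "'u \<Rightarrow> 'a"
  horizon :: nat

definition all_nodes :: "('u, 'a) bandit \<Rightarrow> 'u set" where
  "all_nodes I = (\<Union>i\<in>{1..arms I}. nodes I i)"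

definition root_nodes :: "('u, 'a) bandit \<Rightarrow> 'u set" where
  "root_nodes I = root_node I ` {1..arms I}"

text \<open>In a finite layered arm the nodes of maximal depth have no successor, so the outgoing
  probabilities cannot sum to 1 at every node. Nodes are therefore allowed to be terminal (no
  outgoing transition at all), and the sum is 1 at all other nodes. Pulling an arm on a terminal
  node collects the reward of that node and exhausts the arm, in agreement with the
  balance equations of the linear program, where the flow through a terminal node disappears.\<close>

definition valid_bandit :: "('u, real) bandit \<Rightarrow> bool" where
  "valid_bandit I \<longleftrightarrow>
     (\<forall>i\<in>{1..arms I}. finite (nodes I i) \<and> root_node I i \<in> nodes I i) \<and>
     disjoint_family_on (nodes I) {1..arms I} \<and>
     (\<forall>u\<in>all_nodes I. 0 \<le> reward I u) \<and>
     (\<forall>i\<in>{1..arms I}. \<forall>u\<in>nodes I i.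
        (\<forall>v. 0 \<le> tprob I u v) \<and>
        (\<forall>v. tprob I u v > 0 \<longrightarrow> v \<in> nodes I i) \<and>
        ((\<Sum>v\<in>nodes I i. tprob I u v) = 1 \<or> (\<forall>v. tprob I u v = 0))) \<and>
     (\<exists>depth :: 'u \<Rightarrow> nat.
        (\<forall>i\<in>{1..arms I}. depth (root_node I i) = 0) \<and>
        (\<forall>u\<in>all_nodes I. \<forall>v. tprob I u v > 0 \<longrightarrow> depth v = depth u + 1))"

section \<open>The linear program\<close>

definition Par :: "('u, real) bandit \<Rightarrow> 'u \<Rightarrow> 'u set" where
  "Par I u = {v \<in> all_nodes I. tprob I v u > 0}"

definition lp_feasible :: "('u, real) bandit \<Rightarrow> ('u \<Rightarrow> nat \<Rightarrow> real) \<Rightarrow> ('u \<Rightarrow> nat \<Rightarrow> real) \<Rightarrow> bool" where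
  "lp_feasible I x s \<longleftrightarrow>
     (\<forall>t\<in>{1..horizon I}. (\<Sum>u\<in>all_nodes I. x u t) \<le> 1) \<and>
     (\<forall>u\<in>all_nodes I. \<forall>t\<in>{1..horizon I}. 0 \<le> x u t \<and> x u t \<le> s u t) \<and>
     (\<forall>i\<in>{1..arms I}. s (root_node I i) 1 = 1) \<and>
     (\<forall>u\<in>all_nodes I - root_nodes I. s u 1 = 0) \<and>
     (\<forall>u\<in>all_nodes I. \<forall>t\<in>{1<..horizon I}.
        s u t = s u (t - 1) - x u (t - 1) + (\<Sum>v\<in>Par I u. x v (t - 1) * tprob I v u))"

definition lp_value :: "('u, real) bandit \<Rightarrow> ('u \<Rightarrow> nat \<Rightarrow> real) \<Rightarrow> real" where
  "lp_value I x = (\<Sum>u\<in>all_nodes I. reward I u * (\<Sum>t=1..horizon I. x u t))"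

definition opt_lp :: "('u, real) bandit \<Rightarrow> real" where
  "opt_lp I = Sup {lp_value I x | x s. lp_feasible I x s}"

section \<open>The decision process and adaptive policies\<close>

text \<open>The position \<open>None\<close> stands for an exhausted (or nonexistent) arm. Pulling such an arm has no
  effect but uses up a time step; in particular \<open>0\<close> is not the number of an arm,
  so the action \<open>0\<close> means that no arm is pulled.\<close>

record 'u env =
  elapsed :: nat
  position :: "nat \<Rightarrow> 'u option"
  gained :: real

definition init_env :: "('u, real) bandit \<Rightarrow> 'u env" where
  "init_env I = \<lparr>elapsed = 0,
     position = (\<lambda>i. if i \<in> {1..arms I} then Some (root_node I i) else None),
     gained = 0\<rparr>"

text \<open>At a terminal node the subprobability \<open>embed_spmf (tprob I u)\<close> is concentrated on \<open>None\<close>.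
  The first component of the result is the observation: the new position of the pulled arm.
  Once the horizon has passed, nothing happens any more.\<close>

definition pull :: "('u, real) bandit \<Rightarrow> nat \<Rightarrow> 'u env \<Rightarrow> ('u option \<times> 'u env) pmf" where
  "pull I i e =
     (if elapsed e \<ge> horizon I then return_pmf (None, e)
      else case position e i of
        None \<Rightarrow> return_pmf (None, e\<lparr>elapsed := elapsed e + 1\<rparr>)
      | Some u \<Rightarrow> map_pmf
          (\<lambda>v. (v, \<lparr>elapsed = elapsed e + 1, position = (position e)(i := v),
                    gained = gained e + reward I u\<rparr>))
          (embed_spmf (tprob I u)))"

text \<open>A history lists the actions taken so far, each with the resulting observation.\<close>

type_synonym 'u history = "(nat \<times> 'u option) list"

type_synonym 'u policy = "'u history \<Rightarrow> nat"

primrec play :: "('u, real) bandit \<Rightarrow> 'u policy \<Rightarrow> nat \<Rightarrow> ('u history \<times> 'u env) pmf" where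
  "play I \<pi> 0 = return_pmf ([], init_env I)"
| "play I \<pi> (Suc k) = do {
     (h, e) \<leftarrow> play I \<pi> k;
     (v, e') \<leftarrow> pull I (\<pi> h) e;
     return_pmf (h @ [(\<pi> h, v)], e')
   }"

definition policy_value :: "('u, real) bandit \<Rightarrow> 'u policy \<Rightarrow> real" where
  "policy_value I \<pi> = measure_pmf.expectation (play I \<pi> (horizon I)) (\<lambda>(h, e). gained e)"

definition opt_policy :: "('u, real) bandit \<Rightarrow> real" where
  "opt_policy I = (SUP \<pi>. policy_value I \<pi>)"

section \<open>Randomized algorithms with logarithmic cost\<close>

text \<open>Algorithms are programs of a structured random access machine. The memory consists of cells
  that hold natural numbers, and the cost criterion is logarithmic: evaluating an
  expression costs, for every subexpression, the bit length of its value. Hence polynomial cost is the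
  same as polynomial time on a Turing machine.\<close>

type_synonym memory = "nat \<Rightarrow> nat"

datatype expr =
    Const nat
  | Cell expr
  | Plus expr expr
  | Minus expr expr
  | Times expr expr
  | Quot expr expr

text \<open>\<open>Minus\<close> is truncated subtraction.\<close>

primrec val :: "expr \<Rightarrow> memory \<Rightarrow> nat" where
  "val (Const k) m = k"
| "val (Cell a) m = m (val a m)"
| "val (Plus a b) m = val a m + val b m"
| "val (Minus a b) m = val a m - val b m"
| "val (Times a b) m = val a m * val b m"
| "val (Quot a b) m = val a m div val b m"

definition bit_len :: "nat \<Rightarrow> nat" where
  "bit_len k = Suc (floor_log k)"

primrec cost :: "expr \<Rightarrow> memory \<Rightarrow> nat" where
  "cost (Const k) m = bit_len k"
| "cost (Cell a) m = cost a m + bit_len (val (Cell a) m)"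
| "cost (Plus a b) m = cost a m + cost b m + bit_len (val (Plus a b) m)"
| "cost (Minus a b) m = cost a m + cost b m + bit_len (val (Minus a b) m)"
| "cost (Times a b) m = cost a m + cost b m + bit_len (val (Times a b) m)"
| "cost (Quot a b) m = cost a m + cost b m + bit_len (val (Quot a b) m)"

text \<open>\<open>Assign a b\<close> writes the value of \<open>b\<close> to the cell with address \<open>a\<close>; tests succeed on
  nonzero values. \<open>Rand a b\<close> writes a uniformly random number below the value of \<open>b\<close>
  to the cell \<open>a\<close>. \<open>Pull a b\<close> pulls the arm whose number is the value of \<open>b\<close> and writes the
  observation to the cell \<open>a\<close>. Programs have no other access to the arms.\<close>

datatype prog =
    Halt
  | Assign expr expr
  | Rand expr expr
  | Pull expr expr
  | Then prog prog
  | Cond expr prog prog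
  | Loop expr prog

definition uniform_below :: "nat \<Rightarrow> nat pmf" where
  "uniform_below k = (if k = 0 then return_pmf 0 else pmf_of_set {..<k})"

definition obs_code :: "nat option \<Rightarrow> nat" where
  "obs_code v = (case v of None \<Rightarrow> 0 | Some u \<Rightarrow> Suc u)"

text \<open>One computation step; the last component of the result is its cost.\<close>

primrec step :: "(nat, real) bandit \<Rightarrow> prog \<Rightarrow> memory \<Rightarrow> nat env \<Rightarrow>
    (prog \<times> memory \<times> nat env \<times> nat) pmf" where
  "step I Halt m e = return_pmf (Halt, m, e, 0)"
| "step I (Assign a b) m e =
     return_pmf (Halt, m(val a m := val b m), e, 1 + cost a m + cost b m)"
| "step I (Rand a b) m e =
     map_pmf (\<lambda>k. (Halt, m(val a m := k), e, 1 + cost a m + cost b m)) (uniform_below (val b m))"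
| "step I (Pull a b) m e =
     map_pmf (\<lambda>(v, e'). (Halt, m(val a m := obs_code v), e',
                          1 + cost a m + cost b m + bit_len (obs_code v)))
       (pull I (val b m) e)"
| "step I (Then c d) m e =
     (if c = Halt then return_pmf (d, m, e, 1)
      else map_pmf (\<lambda>(c', m', e', k). (Then c' d, m', e', k)) (step I c m e))"
| "step I (Cond b c d) m e =
     return_pmf (if val b m \<noteq> 0 then c else d, m, e, 1 + cost b m)"
| "step I (Loop b c) m e =
     return_pmf (if val b m \<noteq> 0 then Then c (Loop b c) else Halt, m, e, 1 + cost b m)"

primrec steps :: "(nat, real) bandit \<Rightarrow> nat \<Rightarrow> prog \<times> memory \<times> nat env \<times> nat \<Rightarrow>
    (prog \<times> memory \<times> nat env \<times> nat) pmf" where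
  "steps I 0 cfg = return_pmf cfg"
| "steps I (Suc j) cfg = do {
     (c, m, e, k) \<leftarrow> steps I j cfg;
     (c', m', e', k') \<leftarrow> step I c m e;
     return_pmf (c', m', e', k + k')
   }"

section \<open>Input encoding\<close>

definition real_bandit :: "('u, rat) bandit \<Rightarrow> ('u, real) bandit" where
  "real_bandit J = \<lparr>arms = arms J, nodes = nodes J, root_node = root_node J,
     tprob = (\<lambda>u v. of_rat (tprob J u v)), reward = (\<lambda>u. of_rat (reward J u)),
     horizon = horizon J\<rparr>"

text \<open>Algorithmic instances have rational data and the nodes \<open>0, ..., N - 1\<close>.\<close>

definition input_bandit :: "(nat, rat) bandit \<Rightarrow> bool" where
  "input_bandit J \<longleftrightarrow>
     valid_bandit (real_bandit J) \<and> all_nodes J = {..<card (all_nodes J)}"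

definition arm_of :: "(nat, rat) bandit \<Rightarrow> nat \<Rightarrow> nat" where
  "arm_of J u = (THE i. i \<in> {1..arms J} \<and> u \<in> nodes J i)"

definition rat_code :: "rat \<Rightarrow> nat list" where
  "rat_code q = (case quotient_of q of (a, b) \<Rightarrow> [nat a, nat b])"

definition encode :: "(nat, rat) bandit \<Rightarrow> nat list" where
  "encode J = (let N = card (all_nodes J) in
     [arms J, horizon J, N] @
     map (root_node J) [1..<Suc (arms J)] @
     concat (map (\<lambda>u. arm_of J u # rat_code (reward J u)) [0..<N]) @
     concat (map (\<lambda>u. concat (map (\<lambda>v. rat_code (tprob J u v)) [0..<N])) [0..<N]))"

text \<open>The horizon is counted in unary, since the process takes \<open>horizon J\<close> steps and the linear
  program has variables for each of them.\<close>

definition input_size :: "(nat, rat) bandit \<Rightarrow> nat" where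
  "input_size J = sum_list (map bit_len (encode J)) + horizon J"

definition init_memory :: "(nat, rat) bandit \<Rightarrow> memory" where
  "init_memory J = (\<lambda>k. if k < length (encode J) then encode J ! k else 0)"

definition run_for :: "nat \<Rightarrow> prog \<Rightarrow> (nat, rat) bandit \<Rightarrow> (prog \<times> memory \<times> nat env \<times> nat) pmf" where
  "run_for T c J = steps (real_bandit J) T (c, init_memory J, init_env (real_bandit J), 0)"

text \<open>Every step of a program that has not halted costs at least 1, so a run of cost at most \<open>T\<close>
  has halted after \<open>T\<close> steps.\<close>

definition halts_within :: "nat \<Rightarrow> prog \<Rightarrow> (nat, rat) bandit \<Rightarrow> bool" where
  "halts_within T c J \<longleftrightarrow> (\<forall>(c', m, e, k) \<in> set_pmf (run_for T c J). c' = Halt \<and> k \<le> T)"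

definition polynomial_time :: "prog \<Rightarrow> bool" where
  "polynomial_time c \<longleftrightarrow>
     (\<exists>q :: nat poly. \<forall>J. input_bandit J \<longrightarrow> halts_within (poly q (input_size J)) c J)"

text \<open>For a program that halts within a bounded time the sequence below is eventually constant,
  and its limit is the expected total reward at termination.\<close>

definition expected_reward :: "prog \<Rightarrow> (nat, rat) bandit \<Rightarrow> real" where
  "expected_reward c J =
     lim (\<lambda>T. measure_pmf.expectation (run_for T c J) (\<lambda>(c', m, e, k). gained e))"

end

theory Submission
  imports Defs
begin

text \<open>The linear program decouples over the arms once the constraints of the time steps are priced. A
  projected subgradient method on the prices yields polynomially many deterministic tables, each saying
  for every node and every number of remaining steps whether to play; drawn at random, the tables
  collect almost the optimal value of the linear program and play every time step almost at
  most once in expectation.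

  For the rounding, every arm independently takes a random table with probability \<open>1 / 3\<close> and
  stays idle otherwise. A table makes virtual plays of its arm, and the real
  play with the least slack (virtual time minus the number of earlier plays of the arm) goes first. A
  virtual play of slack \<open>\<sigma>\<close> is really made if the other arms have in total less than \<open>\<sigma>\<close> plays that delay
  it, where no arm counts more than \<open>\<sigma>\<close> times. These counts are independent, each of
  mean at most about \<open>\<sigma> / 3\<close> and of total mean at most about \<open>2 \<sigma> / 3\<close>, and a Samuels type inequality bounds the
  probability of a total below \<open>\<sigma>\<close> by \<open>4 / 9\<close>. This gives the factor \<open>1 / 3 \<cdot> 4 / 9 = 4 / 27\<close>; the
  errors of the subgradient method are absorbed by the slack between discrete and continuous means.

  The algorithm computes the tables exactly, with all rational numbers scaled to natural numbers by powers
  of a common denominator.\<close>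

section \<open>Sums of independent variables\<close>

text \<open>The linear program enters only through weak duality: the rounding works for any number
  \<open>v\<close> with \<open>bounded_by_dual v\<close>, i.e. lying below the Lagrangian value for
  all nonnegative prices. The constant \<open>4 / 27\<close> is the maximum of
  \<open>q * (1 - q) ^ 2\<close>, attained at \<open>q = 1 / 3\<close>. The extremal picture has two
  other arms, each of which blocks a play of slack \<sigma> with \<sigma> plays whenever it takes
  part. No more arms can be that busy: with the cut-off at \<sigma>, only virtual plays in the first
  \<open>2 * \<sigma> - 1\<close> time steps can delay, and each time step is used about once on
  average. Half of it pays for overloaded time steps (relative error at most
  \<open>1 / (4 * (B + 1))\<close>); the other half raises the probability by a factor
  \<open>1 + 1 / (6 * \<sigma>)\<close>, which outweighs the relative loss
  \<open>1 / (8 * (B + 1))\<close> in the collected reward. So \<open>4 / 27\<close> is reached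
  exactly and not only up to an error term.\<close>

lemma two_mean_bound:
  fixes a b :: real
  assumes "0 \<le> a" "a \<le> 1" "0 \<le> b" "b \<le> 1"
  shows "4 * (1 + a + b)\<^sup>2 \<le> 9 * ((1 + a) * (1 + b))"
proof -
  have "9 * ((1 + a) * (1 + b)) - 4 * (1 + a + b)\<^sup>2
      = 4 * (a * (1 - a)) + 4 * (b * (1 - b)) + (1 - a) * (1 - b) + 2 * (1 - a) + 2 * (1 - b)"
    by (simp add: algebra_simps power2_eq_square)
  moreover have "0 \<le> \<dots>"
    using assms by (intro add_nonneg_nonneg mult_nonneg_nonneg) auto
  ultimately show ?thesis by simp
qed

text \<open>Markov's inequality for two variables of means \<open>a\<close> and \<open>b\<close> at
  the threshold \<open>1 + a + b\<close>; the product of the resulting bounds is smallest at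
  \<open>a = b = 1\<close>, where it is \<open>(2 / 3) ^ 2\<close>.\<close>

lemma two_single_bound:
  fixes a b p q :: real
  assumes "0 \<le> a" "a \<le> 1" "0 \<le> b" "b \<le> 1"
    and p: "p * (1 + a + b) \<le> a" and q: "q * (1 + a + b) \<le> b"
  shows "4 / 9 \<le> (1 - p) * (1 - q)"
proof -
  define c where "c = 1 + a + b"
  have c: "c > 0" using assms by (simp add: c_def)
  have *: "(1 + b) / c \<le> 1 - p" "(1 + a) / c \<le> 1 - q"
    using p q c by (simp_all add: c_def[symmetric] divide_le_eq) (simp_all add: c_def algebra_simps)
  moreover have "0 \<le> (1 + a) / c" "0 \<le> (1 + b) / c" using assms c by auto
  ultimately have "((1 + b) / c) * ((1 + a) / c) \<le> (1 - p) * (1 - q)"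
    by (intro mult_mono) linarith+
  moreover have "4 / 9 \<le> ((1 + b) / c) * ((1 + a) / c)"
  proof -
    have "4 * c\<^sup>2 \<le> 9 * ((1 + b) * (1 + a))"
      using two_mean_bound[of a b] assms by (simp add: c_def mult.commute)
    then show ?thesis using c by (simp add: le_divide_eq power2_eq_square)
  qed
  ultimately show ?thesis by linarith
qed

text \<open>Concentrating the means only lowers the bound. Two means of sum at most 1 are merged
  into one. Otherwise \<open>(m2, m3)\<close> is replaced by \<open>(1, m2 + m3 - 1)\<close>, and
  then \<open>m1\<close> can be merged with the second entry because the total is at most 2. Both
  ways end at \<open>two_single_bound\<close>.\<close>

lemma three_single_bound:
  fixes m1 m2 m3 p1 p2 p3 :: real
  assumes m: "0 \<le> m1" "m1 \<le> 1" "0 \<le> m2" "m2 \<le> 1" "0 \<le> m3" "m3 \<le> 1"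
    and s: "m1 + m2 + m3 \<le> 2"
    and p: "p1 \<le> 1" "0 \<le> p2" "p2 \<le> 1" "0 \<le> p3" "p3 \<le> 1"
    and c: "p1 * (1 + m1 + m2 + m3) \<le> m1" "p2 * (1 + m1 + m2 + m3) \<le> m2" "p3 * (1 + m1 + m2 + m3) \<le> m3"
  shows "4 / 9 \<le> (1 - p1) * (1 - p2) * (1 - p3)"
proof (cases "m2 + m3 \<le> 1")
  case True
  have "4 / 9 \<le> (1 - p1) * (1 - (p2 + p3))"
    using m True c by (intro two_single_bound[of m1 "m2 + m3"]) (auto simp: algebra_simps)
  also have "\<dots> \<le> (1 - p1) * ((1 - p2) * (1 - p3))"
    using p by (intro mult_left_mono) (auto simp: algebra_simps)
  finally show ?thesis by (simp add: mult.assoc)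
next
  case False
  define d where "d = 1 + m1 + m2 + m3"
  have d: "d > 0" using m by (simp add: d_def)
  have b: "1 - m1 / d \<le> 1 - p1" "1 - m2 / d \<le> 1 - p2" "1 - m3 / d \<le> 1 - p3"
    using c d by (simp_all add: d_def[symmetric] le_divide_eq)
  have nn: "0 \<le> 1 - m1 / d" "0 \<le> 1 - m2 / d" "0 \<le> 1 - m3 / d"
    using m d by (auto simp: d_def divide_le_eq)
  have "(1 - 1 / d) * (1 - (m2 + m3 - 1) / d) \<le> (1 - m2 / d) * (1 - m3 / d)"
  proof -
    have "(1 - m2 / d) * (1 - m3 / d) - (1 - 1 / d) * (1 - (m2 + m3 - 1) / d)
       = (1 - m2) * (1 - m3) / d\<^sup>2"
      using d by (simp add: field_simps power2_eq_square)
    moreover have "0 \<le> (1 - m2) * (1 - m3) / d\<^sup>2" using m by auto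
    ultimately show ?thesis by argo
  qed
  then have 1: "(1 - m1 / d) * ((1 - 1 / d) * (1 - (m2 + m3 - 1) / d)) \<le> (1 - m1 / d) * ((1 - m2 / d) * (1 - m3 / d))"
    using nn by (intro mult_left_mono) auto
  have "4 / 9 \<le> (1 - 1 / d) * (1 - (m1 + m2 + m3 - 1) / d)"
  proof -
    have t: "1 + 1 + (m1 + m2 + m3 - 1) = d" by (simp add: d_def)
    show ?thesis
      by (rule two_single_bound[of 1 "m1 + m2 + m3 - 1", unfolded t]) (use m s False d in auto)
  qed
  also have "1 - (m1 + m2 + m3 - 1) / d \<le> (1 - m1 / d) * (1 - (m2 + m3 - 1) / d)"
  proof -
    have "(1 - m1 / d) * (1 - (m2 + m3 - 1) / d) = 1 - (m1 + m2 + m3 - 1) / d + m1 * (m2 + m3 - 1) / d\<^sup>2"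
      using d by (simp add: field_simps power2_eq_square)
    moreover have "0 \<le> m1 * (m2 + m3 - 1) / d\<^sup>2" using m False by auto
    ultimately show ?thesis by argo
  qed
  then have "(1 - 1 / d) * (1 - (m1 + m2 + m3 - 1) / d) \<le> (1 - 1 / d) * ((1 - m1 / d) * (1 - (m2 + m3 - 1) / d))"
    using m d by (intro mult_left_mono) (auto simp: d_def)
  also have "\<dots> \<le> (1 - m1 / d) * ((1 - m2 / d) * (1 - m3 / d))"
    using 1 by (simp add: mult_ac)
  also have "\<dots> \<le> (1 - p1) * ((1 - p2) * (1 - p3))"
    using b nn p by (intro mult_mono) auto
  finally show ?thesis by (simp add: mult.assoc)
qed

text \<open>For two heights \<open>a\<close>, \<open>b\<close> that reach the threshold only
  together: the joint event obeys the Markov bound of a single variable, of mean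
  \<open>q * b\<close> or \<open>p * a\<close>, at the threshold lowered by the mean of the other
  one. So a blocking pair can take the place of one variable in
  \<open>two_single_bound\<close>.\<close>

lemma pair_prob_bound:
  fixes p q a b c :: real
  assumes p: "0 \<le> p" "p \<le> 1" "0 \<le> q" "q \<le> 1" and a: "0 \<le> a" "0 \<le> b"
    and c: "c \<le> a + b"
  shows "p * q * (c - p * a) \<le> q * b \<or> p * q * (c - q * b) \<le> p * a"
proof (cases "c - q * b \<le> a")
  case True
  then have "p * (c - q * b) \<le> p * a" using p by (simp add: mult_left_mono)
  show ?thesis
  proof (cases "0 \<le> c - q * b")
    case True
    then have "q * (p * (c - q * b)) \<le> 1 * (p * (c - q * b))" using p by (intro mult_right_mono) auto
    then show ?thesis using \<open>p * (c - q * b) \<le> p * a\<close> by (simp add: mult_ac)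
  next
    case False
    then have "(p * q) * (c - q * b) \<le> 0" using p by (intro mult_nonneg_nonpos) auto
    also have "0 \<le> p * a" using p a by simp
    finally show ?thesis by simp
  qed
next
  case False
  have m: "p * a \<le> a" "q * b \<le> b" using p a by (simp_all add: mult_left_le_one_le)
  have 1: "0 \<le> (a - p * a) * (c - q * b - a)" using m False by (intro mult_nonneg_nonneg) auto
  have cb: "a * (c - a) \<le> a * b" using c a by (intro mult_left_mono) auto
  show ?thesis
  proof (cases "p * a \<le> q * b")
    case True
    have "(p * a) * (c - p * a) \<le> a * (c - a)"
    proof -
      have "0 \<le> (a - p * a) * (q * b - p * a)" using m True by (intro mult_nonneg_nonneg) auto
      with 1 show ?thesis by (simp add: algebra_simps)
    qed
    then have 2: "(p * a) * (c - p * a) \<le> a * b" using cb by linarith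
    show ?thesis
    proof (cases "a = 0")
      case True
      with c have "p * q * c \<le> p * q * b" using p by (intro mult_left_mono) auto
      also have "p * q * b \<le> q * b" using p a by (simp add: mult_left_le_one_le mult.assoc)
      finally show ?thesis using True by simp
    next
      case False
      with a 2 have "p * (c - p * a) \<le> b" by (simp add: mult_ac)
      then have "q * (p * (c - p * a)) \<le> q * b" using p by (intro mult_left_mono) auto
      then show ?thesis by (simp add: mult_ac)
    qed
  next
    case F: False
    have "(q * b) * (c - q * b) \<le> a * (c - a)"
    proof -
      have "0 \<le> (c - q * b - a) * (p * a - q * b)" using m F False by (intro mult_nonneg_nonneg) auto
      with 1 show ?thesis by (simp add: algebra_simps)
    qed
    then have 2: "(q * b) * (c - q * b) \<le> a * b" using cb by linarith
    show ?thesis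
    proof (cases "b = 0")
      case True
      with c False show ?thesis by simp
    next
      case False
      with a 2 have "q * (c - q * b) \<le> a" by (simp add: mult_ac)
      then have "p * (q * (c - q * b)) \<le> p * a" using p by (intro mult_left_mono) auto
      then show ?thesis by (simp add: mult_ac)
    qed
  qed
qed

text \<open>The polynomial inequality behind the bound \<open>5 / 9\<close> below, tight at
  \<open>y = 1\<close> and \<open>S = 2\<close>. In the variables \<open>u = 2 - S\<close> and
  \<open>v = 1 - y\<close> the difference is a sum of terms that are visibly nonnegative on the unit
  square.\<close>

lemma two_of_three_poly:
  fixes y S :: real
  assumes "0 \<le> y" "y \<le> 1" "1 \<le> S" "S \<le> 2"
  shows "9 * (S\<^sup>2 + y) \<le> 5 * ((2 - y) * (y + S)\<^sup>2)"
proof -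
  define u v where "u = 2 - S" and "v = 1 - y"
  have yS: "y = 1 - v" "S = 2 - u" by (simp_all add: u_def v_def)
  have uv: "0 \<le> u" "u \<le> 1" "0 \<le> v" "v \<le> 1" using assms by (simp_all add: u_def v_def)
  have "5 * ((2 - y) * (y + S)\<^sup>2) - 9 * (S\<^sup>2 + y)
      = (1 - v) * (u * (6 - 4 * u)) + v * (2 - u)\<^sup>2 + v * (1 - v) * (20 - 10 * u - 5 * v)"
    unfolding yS by (simp add: algebra_simps power2_eq_square)
  moreover have "0 \<le> (1 - v) * (u * (6 - 4 * u))" "0 \<le> v * (2 - u)\<^sup>2"
    "0 \<le> v * (1 - v) * (20 - 10 * u - 5 * v)"
    using uv by (auto intro!: mult_nonneg_nonneg)
  ultimately have "0 \<le> 5 * ((2 - y) * (y + S)\<^sup>2) - 9 * (S\<^sup>2 + y)" by (metis add_nonneg_nonneg)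
  then show ?thesis by simp
qed

lemma two_of_three_mono:
  fixes p1 p2 p3 q1 q2 q3 :: real
  assumes "0 \<le> p1" "p1 \<le> q1" "q1 \<le> 1" "0 \<le> p2" "p2 \<le> q2" "q2 \<le> 1" "0 \<le> p3" "p3 \<le> q3" "q3 \<le> 1"
  shows "p1 * p2 + p1 * p3 + p2 * p3 - 2 * p1 * p2 * p3 \<le> q1 * q2 + q1 * q3 + q2 * q3 - 2 * q1 * q2 * q3"
proof -
  have aux: "x * y + x * z + y * z - 2 * x * y * z \<le> x' * y + x' * z + y * z - 2 * x' * y * z"
    if "x \<le> x'" "0 \<le> y" "y \<le> 1" "0 \<le> z" "z \<le> 1" for x x' y z :: real
  proof -
    have "0 \<le> (x' - x) * (y * (1 - z) + z * (1 - y))" using that by (intro mult_nonneg_nonneg add_nonneg_nonneg) auto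
    then show ?thesis by (simp add: algebra_simps)
  qed
  have "p1 * p2 + p1 * p3 + p2 * p3 - 2 * p1 * p2 * p3 \<le> q1 * p2 + q1 * p3 + p2 * p3 - 2 * q1 * p2 * p3"
    using aux[of p1 q1 p2 p3] assms by auto
  also have "\<dots> \<le> q1 * q2 + q1 * p3 + q2 * p3 - 2 * q1 * q2 * p3"
    using aux[of p2 q2 q1 p3] assms by (auto simp: algebra_simps)
  also have "\<dots> \<le> q1 * q2 + q1 * q3 + q2 * q3 - 2 * q1 * q2 * q3"
    using aux[of p3 q3 q1 q2] assms by (auto simp: algebra_simps)
  finally show ?thesis .
qed

text \<open>The left-hand side is the probability that at least two of three independent events
  occur. Here \<open>x\<close> is the excess of the first height over its mean, so that each of the
  other two needs a height of at least \<open>1 - x + m2 + m3\<close> to block together with it. The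
  value \<open>5 / 9 = 1 - 4 / 9\<close> is attained at \<open>x = 0\<close>, \<open>p1 = 1\<close>,
  \<open>m2 = m3 = 1\<close>, \<open>p2 = p3 = 1 / 3\<close>.\<close>

lemma two_of_three_bound:
  fixes p1 p2 p3 m2 m3 x :: real
  assumes p: "0 \<le> p1" "p1 \<le> 1" "0 \<le> p2" "p2 \<le> 1" "0 \<le> p3" "p3 \<le> 1"
    and x: "0 \<le> x" "x < 1" and m: "0 \<le> m2" "m2 \<le> 1" "0 \<le> m3" "m3 \<le> 1"
    and c: "p1 * (1 + x) \<le> 1" "p2 * (1 - x + m2 + m3) \<le> m2" "p3 * (1 - x + m2 + m3) \<le> m3"
  shows "p1 * p2 + p1 * p3 + p2 * p3 - 2 * p1 * p2 * p3 \<le> 5 / 9"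
proof -
  define y S where "y = 1 - x" and "S = m2 + m3"
  define T where "T = y + S"
  have y: "0 < y" "y \<le> 1" using x by (auto simp: y_def)
  have S: "0 \<le> S" "S \<le> 2" using m by (auto simp: S_def)
  have T: "T > 0" using y S by (simp add: T_def)
  have xy: "1 + x = 2 - y" by (simp add: y_def)
  have q: "p1 \<le> 1 / (2 - y)" "p2 \<le> m2 / T" "p3 \<le> m3 / T"
  proof -
    have t: "1 - x + m2 + m3 = T" by (simp add: T_def S_def y_def)
    show "p1 \<le> 1 / (2 - y)" using c(1) y unfolding xy by (simp add: le_divide_eq)
    show "p2 \<le> m2 / T" "p3 \<le> m3 / T" using c(2,3) T unfolding t by (simp_all add: le_divide_eq)
  qed
  have "p1 * p2 + p1 * p3 + p2 * p3 - 2 * p1 * p2 * p3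
     \<le> 1 / (2 - y) * (m2 / T) + 1 / (2 - y) * (m3 / T) + m2 / T * (m3 / T) - 2 * (1 / (2 - y)) * (m2 / T) * (m3 / T)"
    using p q y m T by (intro two_of_three_mono) (auto simp: T_def S_def)
  also have "\<dots> = (S * T - y * (m2 * m3)) / ((2 - y) * T\<^sup>2)"
  proof -
    define v w where "v = 1 / T" and "w = 1 / (2 - y)"
    have v: "v * T = 1" and w: "w * (2 - y) = 1" using T y by (simp_all add: v_def w_def)
    have "w * (m2 * v) + w * (m3 * v) + (m2 * v) * (m3 * v) - 2 * w * (m2 * v) * (m3 * v)
        = w * S * v + (1 - 2 * w) * (m2 * m3) * v\<^sup>2"
      by (simp add: S_def algebra_simps power2_eq_square)
    also have "1 - 2 * w = - (y * w)" using w by (simp add: algebra_simps)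
    also have "w * S * v = w * S * v * (v * T)" using v by simp
    also have "w * S * v * (v * T) + - (y * w) * (m2 * m3) * v\<^sup>2 = (S * T - y * (m2 * m3)) * w * v\<^sup>2"
      by (simp add: algebra_simps power2_eq_square)
    finally show ?thesis by (simp add: v_def w_def power_divide)
  qed
  also have "\<dots> \<le> 5 / 9"
  \<comment> \<open>For small \<open>S\<close> the product \<open>m2 * m3\<close> is discarded and
    even \<open>1 / 2\<close> holds. For \<open>S > 1\<close> the bounds \<open>m2 \<le> 1\<close>
    and \<open>m3 \<le> 1\<close> force \<open>m2 * m3 \<ge> S - 1\<close>, which feeds the
    polynomial inequality.\<close>
  proof (cases "S \<le> 1")
    case True
    have "(S * T - y * (m2 * m3)) / ((2 - y) * T\<^sup>2) \<le> S * T / ((2 - y) * T\<^sup>2)"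
      using y m T by (intro divide_right_mono) auto
    also have "\<dots> = S / ((2 - y) * T)" using T y by (simp add: power2_eq_square)
    also have "\<dots> \<le> 1 / 2"
    proof -
      have "y * S \<le> y * 1" using True y by (intro mult_left_mono) auto
      moreover have "0 \<le> y * (1 - y)" using y by simp
      moreover have "0 \<le> y * (1 - S)" using True y by simp
      moreover have "(2 - y) * T - 2 * S = y * (1 - y) + y * (1 - S)" by (simp add: T_def algebra_simps)
      ultimately have "2 * S \<le> (2 - y) * T" by linarith
      then show ?thesis using T y by (simp add: field_simps)
    qed
    finally show ?thesis by (rule order_trans) simp
  next
    case False
    have "0 \<le> (1 - m2) * (1 - m3)" using m by simp
    then have "S - 1 \<le> m2 * m3" by (simp add: S_def algebra_simps)
    then have "y * (S - 1) \<le> y * (m2 * m3)" using y by (intro mult_left_mono) auto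
    then have "S * T - y * (m2 * m3) \<le> S\<^sup>2 + y" by (simp add: T_def algebra_simps power2_eq_square)
    moreover have "9 * (S\<^sup>2 + y) \<le> 5 * ((2 - y) * T\<^sup>2)"
      unfolding T_def using y S False by (intro two_of_three_poly) auto
    moreover have "(2 - y) * T\<^sup>2 > 0" using y T by simp
    ultimately show ?thesis by (simp add: divide_le_eq)
  qed
  finally show ?thesis .
qed

section \<open>A Samuels type bound for three two-point variables\<close>

definition below3 :: "real \<Rightarrow> real \<Rightarrow> real \<Rightarrow> real \<Rightarrow> real \<Rightarrow> real \<Rightarrow> real \<Rightarrow> real" where
  "below3 p1 p2 p3 a1 a2 a3 c =
     (1 - p1) * (1 - p2) * (1 - p3) * of_bool (0 < c)
   + p1 * (1 - p2) * (1 - p3) * of_bool (a1 < c)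
   + (1 - p1) * p2 * (1 - p3) * of_bool (a2 < c)
   + (1 - p1) * (1 - p2) * p3 * of_bool (a3 < c)
   + p1 * p2 * (1 - p3) * of_bool (a1 + a2 < c)
   + p1 * (1 - p2) * p3 * of_bool (a1 + a3 < c)
   + (1 - p1) * p2 * p3 * of_bool (a2 + a3 < c)
   + p1 * p2 * p3 * of_bool (a1 + a2 + a3 < c)"

lemma below3_swap12: "below3 p1 p2 p3 a1 a2 a3 c = below3 p2 p1 p3 a2 a1 a3 c"
  by (simp add: below3_def add_ac mult_ac)

lemma below3_swap23: "below3 p1 p2 p3 a1 a2 a3 c = below3 p1 p3 p2 a1 a3 a2 c"
  by (simp add: below3_def add_ac mult_ac)

text \<open>Three independent variables with values \<open>0\<close> and \<open>a_i\<close>, the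
  latter with probability \<open>p_i\<close>; \<open>below3\<close> is the probability that their
  sum stays below \<open>c\<close>. The unit is chosen so that no mean exceeds 1. The threshold is
  only asked to exceed the total mean by 1, instead of being 3, because subtracting the lower points
  of general two-point laws lowers threshold and total mean by the same amount and so preserves this
  inequality.\<close>

locale three_two_point =
  fixes p1 p2 p3 a1 a2 a3 c :: real
  assumes p: "0 \<le> p1" "p1 \<le> 1" "0 \<le> p2" "p2 \<le> 1" "0 \<le> p3" "p3 \<le> 1"
    and a: "0 \<le> a1" "0 \<le> a2" "0 \<le> a3"
    and m: "p1 * a1 \<le> 1" "p2 * a2 \<le> 1" "p3 * a3 \<le> 1"
    and s: "p1 * a1 + p2 * a2 + p3 * a3 \<le> 2"
    and c: "1 + p1 * a1 + p2 * a2 + p3 * a3 \<le> c"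
begin

lemma swap12: "three_two_point p2 p1 p3 a2 a1 a3 c"
  using p a m s c by unfold_locales auto

lemma swap23: "three_two_point p1 p3 p2 a1 a3 a2 c"
  using p a m s c by unfold_locales auto

lemma m_nonneg: "0 \<le> p1 * a1" "0 \<le> p2 * a2" "0 \<le> p3 * a3"
  using p a by auto

lemma single_prob:
  assumes "c \<le> a1" "d \<le> c" shows "p1 * d \<le> p1 * a1"
  using assms p by (intro mult_left_mono) auto

text \<open>The first variable has to vanish, which costs the factor \<open>1 - p1\<close>. The
  other two then never block, block through one of them, block only jointly
  (\<open>pair_prob_bound\<close>), or block through each of them
  (\<open>three_single_bound\<close>); all cases but the last involve at most two Markov
  events.\<close>

lemma bound_single:
  assumes s1: "c \<le> a1"
  shows "4 / 9 \<le> below3 p1 p2 p3 a1 a2 a3 c"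
proof -
  let ?m1 = "p1 * a1" and ?m2 = "p2 * a2" and ?m3 = "p3 * a3"
  have c0: "0 < c" using c m_nonneg by linarith
  have z: "\<not> a1 < c" "\<not> a1 + a2 < c" "\<not> a1 + a3 < c" "\<not> a1 + a2 + a3 < c" using s1 a by auto
  have B: "below3 p1 p2 p3 a1 a2 a3 c = (1 - p1) * ((1 - p2) * (1 - p3)
      + p2 * (1 - p3) * of_bool (a2 < c) + (1 - p2) * p3 * of_bool (a3 < c) + p2 * p3 * of_bool (a2 + a3 < c))"
    using z c0 by (simp add: below3_def algebra_simps)
  have one: "4 / 9 \<le> 1 - p1"
  proof -
    have "4 / 9 \<le> (1 - p1) * (1 - 0)"
      using m m_nonneg c s1 by (intro two_single_bound[of ?m1 0] single_prob) auto
    then show ?thesis by simp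
  qed
  have two: "4 / 9 \<le> (1 - p1) * (1 - q)"
    if "0 \<le> b" "b \<le> 1" "b \<le> ?m2 + ?m3" "q * (1 + ?m1 + b) \<le> b" for q b
    using m m_nonneg c s1 that by (intro two_single_bound[of ?m1 b] single_prob) auto
  show ?thesis
  proof (cases "a2 < c")
    case a2: True
    show ?thesis
    proof (cases "a3 < c")
      case a3: True
      show ?thesis
      proof (cases "a2 + a3 < c")
        case True
        have "below3 p1 p2 p3 a1 a2 a3 c = 1 - p1" using a2 a3 True by (simp add: B algebra_simps)
        with one show ?thesis by simp
      next
        case False
        have eq: "below3 p1 p2 p3 a1 a2 a3 c = (1 - p1) * (1 - p2 * p3)"
          using a2 a3 False by (simp add: B algebra_simps)
        have "p2 * p3 * (1 + ?m1 + ?m2 + ?m3 - ?m2) \<le> ?m3 \<or> p2 * p3 * (1 + ?m1 + ?m2 + ?m3 - ?m3) \<le> ?m2"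
          using False c by (intro pair_prob_bound p a) auto
        then show ?thesis
        proof
          assume "p2 * p3 * (1 + ?m1 + ?m2 + ?m3 - ?m2) \<le> ?m3"
          with two[of ?m3 "p2 * p3"] m m_nonneg show ?thesis unfolding eq by (simp add: algebra_simps)
        next
          assume "p2 * p3 * (1 + ?m1 + ?m2 + ?m3 - ?m3) \<le> ?m2"
          with two[of ?m2 "p2 * p3"] m m_nonneg show ?thesis unfolding eq by (simp add: algebra_simps)
        qed
      qed
    next
      case a3: False
      then have eq: "below3 p1 p2 p3 a1 a2 a3 c = (1 - p1) * (1 - p3)"
        using a2 a by (simp add: B algebra_simps)
      have "p3 * (1 + ?m1 + ?m3) \<le> p3 * a3"
        using a3 c m_nonneg p by (intro mult_left_mono) auto
      then show ?thesis unfolding eq using m m_nonneg by (intro two) auto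
    qed
  next
    case a2: False
    show ?thesis
    proof (cases "a3 < c")
      case a3: True
      then have eq: "below3 p1 p2 p3 a1 a2 a3 c = (1 - p1) * (1 - p2)"
        using a2 a by (simp add: B algebra_simps)
      have "p2 * (1 + ?m1 + ?m2) \<le> p2 * a2"
        using a2 c m_nonneg p by (intro mult_left_mono) auto
      then show ?thesis unfolding eq using m m_nonneg by (intro two) auto
    next
      case a3: False
      then have eq: "below3 p1 p2 p3 a1 a2 a3 c = (1 - p1) * (1 - p2) * (1 - p3)"
        using a2 a by (simp add: B algebra_simps)
      show ?thesis unfolding eq
      proof (rule three_single_bound[of ?m1 ?m2 ?m3])
        show "p1 * (1 + ?m1 + ?m2 + ?m3) \<le> ?m1" using s1 c by (intro single_prob) auto
        show "p2 * (1 + ?m1 + ?m2 + ?m3) \<le> ?m2" using a2 c p by (intro mult_left_mono) auto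
        show "p3 * (1 + ?m1 + ?m2 + ?m3) \<le> ?m3" using a3 c p by (intro mult_left_mono) auto
      qed (use m m_nonneg s p in auto)
    qed
  qed
qed

text \<open>With mean at most 1, a height exceeding its mean by \<open>x\<close> has probability at
  most \<open>1 / (1 + x)\<close>. This form suits joint events, where the threshold only gives a
  lower bound for the sum of the excesses.\<close>

lemma excess_prob: "p1 * (1 + (a1 - p1 * a1)) \<le> 1" "p1 * a1 \<le> a1"
proof -
  have "p1 * (1 + (a1 - p1 * a1)) = p1 + (p1 * a1) * (1 - p1)" by (simp add: algebra_simps)
  also have "\<dots> \<le> p1 + 1 * (1 - p1)" using m p by (intro add_left_mono mult_right_mono) auto
  finally show "p1 * (1 + (a1 - p1 * a1)) \<le> 1" by simp
  show "p1 * a1 \<le> a1" using p a by (simp add: mult_left_le_one_le)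
qed

lemma excess_half:
  assumes "1 \<le> a1 - p1 * a1" shows "p1 \<le> 1 / 2"
proof -
  have "p1 * 2 \<le> p1 * (1 + (a1 - p1 * a1))" using assms p by (intro mult_left_mono) auto
  with excess_prob(1) show ?thesis by linarith
qed

end

context three_two_point
begin

interpretation s12: three_two_point p2 p1 p3 a2 a1 a3 c by (rule swap12)
interpretation s23: three_two_point p1 p3 p2 a1 a3 a2 c by (rule swap23)
interpretation s13: three_two_point p3 p1 p2 a3 a1 a2 c by (rule s23.swap12)

text \<open>Excesses of sum at least 1 satisfy \<open>(1 + x) * (1 + y) \<ge> 2\<close>, so two
  events that block together have joint probability at most one half.\<close>

lemma prod_half:
  assumes "q * (1 + x) \<le> 1" "r * (1 + y) \<le> 1" "0 \<le> q" "0 \<le> r" "0 \<le> x" "0 \<le> y" "1 \<le> x + y"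
  shows "q * r \<le> 1 / (2 :: real)"
proof -
  have "(q * (1 + x)) * (r * (1 + y)) \<le> 1 * 1" using assms by (intro mult_mono) auto
  then have "(q * r) * (1 + x + y + x * y) \<le> 1" by (simp add: algebra_simps)
  moreover have "0 \<le> x * y" using assms by simp
  then have "2 \<le> 1 + x + y + x * y" using assms by linarith
  then have "(q * r) * 2 \<le> (q * r) * (1 + x + y + x * y)" using assms by (intro mult_left_mono) simp_all
  ultimately show ?thesis by simp
qed

lemma two_pairs:
  assumes "c \<le> a1 + a2" "c \<le> a1 + a3" "a1 - p1 * a1 < 1"
  shows "p1 * p2 + p1 * p3 + p2 * p3 - 2 * p1 * p2 * p3 \<le> 5 / 9"
proof (rule two_of_three_bound[of _ _ _ "a1 - p1 * a1" "p2 * a2" "p3 * a3"])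
  show "p1 * (1 + (a1 - p1 * a1)) \<le> 1" "0 \<le> a1 - p1 * a1" using excess_prob by auto
  show "p2 * (1 - (a1 - p1 * a1) + p2 * a2 + p3 * a3) \<le> p2 * a2"
    using assms c p by (intro mult_left_mono) auto
  show "p3 * (1 - (a1 - p1 * a1) + p2 * a2 + p3 * a3) \<le> p3 * a3"
    using assms c p by (intro mult_left_mono) auto
qed (use p m m_nonneg assms in auto)

text \<open>By symmetry \<open>ord\<close> covers everything: either some pair stays below the
  threshold and is numbered 2, 3, or all pairs reach it and the variable of least excess is numbered
  1. If at most one pair blocks, the failure probability is at most \<open>1 / 2\<close>. Otherwise
  a first excess of at least 1 makes \<open>p1\<close> (and in the symmetric case all three
  probabilities) at most \<open>1 / 2\<close>, and a smaller one is handled by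
  \<open>two_of_three_bound\<close>.\<close>

lemma bound_no_single:
  assumes ns: "a1 < c" "a2 < c" "a3 < c"
    and ord: "a2 + a3 < c \<or> c \<le> a1 + a2 \<and> c \<le> a1 + a3 \<and> a1 - p1 * a1 \<le> a2 - p2 * a2 \<and> a1 - p1 * a1 \<le> a3 - p3 * a3"
  shows "4 / 9 \<le> below3 p1 p2 p3 a1 a2 a3 c"
proof -
  have c0: "0 < c" using c m_nonneg by linarith
  have B: "below3 p1 p2 p3 a1 a2 a3 c = 1 - (p1 * p2 * (1 - p3) * of_bool (\<not> a1 + a2 < c)
   + p1 * (1 - p2) * p3 * of_bool (\<not> a1 + a3 < c)
   + (1 - p1) * p2 * p3 * of_bool (\<not> a2 + a3 < c)
   + p1 * p2 * p3 * of_bool (\<not> a1 + a2 + a3 < c))"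
    using ns c0 unfolding below3_def by (cases "a1 + a2 < c"; cases "a1 + a3 < c"; cases "a2 + a3 < c"; cases "a1 + a2 + a3 < c")
      (simp_all add: algebra_simps)
  have nn: "0 \<le> p1 * p2 * (1 - p3)" "0 \<le> p1 * (1 - p2) * p3" "0 \<le> (1 - p1) * p2 * p3" "0 \<le> p1 * p2 * p3"
    using p by auto
  have half: "p1 * p2 \<le> 1 / 2" if "c \<le> a1 + a2"
    using that c m_nonneg p excess_prob s12.excess_prob
    by (intro prod_half[of p1 "a1 - p1 * a1" p2 "a2 - p2 * a2"]) auto
  have half': "p1 * p3 \<le> 1 / 2" if "c \<le> a1 + a3"
    using that c m_nonneg p excess_prob s13.excess_prob
    by (intro prod_half[of p1 "a1 - p1 * a1" p3 "a3 - p3 * a3"]) auto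
  have sp: "p1 * p2 = p1 * p2 * (1 - p3) + p1 * p2 * p3" "p1 * p3 = p1 * (1 - p2) * p3 + p1 * p2 * p3"
    by (simp_all add: algebra_simps)
  have all: "p1 * p2 * (1 - p3) + p1 * (1 - p2) * p3 + (1 - p1) * p2 * p3 + p1 * p2 * p3
      = p1 * p2 + p1 * p3 + p2 * p3 - 2 * p1 * p2 * p3"
    by (simp add: algebra_simps)
  show ?thesis
  proof (cases "a2 + a3 < c")
    case a23: True
    show ?thesis
    proof (cases "a1 + a2 < c")
      case a12: True
      show ?thesis
      proof (cases "a1 + a3 < c")
        case a13: True
        show ?thesis
        proof (cases "a1 + a2 + a3 < c")
          case True
          then show ?thesis using a23 a12 a13 by (simp add: B)
        next
          case False
          let ?x1 = "a1 - p1 * a1" and ?x2 = "a2 - p2 * a2" and ?x3 = "a3 - p3 * a3"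
          \<comment> \<open>Only all three together block; the last two then act as one variable of
            excess \<open>?x2 + ?x3\<close>.\<close>
          have "p1 * (p2 * p3) \<le> 1 / 2"
          proof (rule prod_half[of p1 ?x1 _ "?x2 + ?x3"])
            have "(p2 * (1 + ?x2)) * (p3 * (1 + ?x3)) \<le> 1 * 1"
              using excess_prob s12.excess_prob s13.excess_prob p by (intro mult_mono) auto
            moreover have "(p2 * p3) * (1 + (?x2 + ?x3)) \<le> (p2 * p3) * ((1 + ?x2) * (1 + ?x3))"
              using s12.excess_prob s13.excess_prob p
              by (intro mult_left_mono) (auto simp: distrib_left distrib_right intro!: mult_nonneg_nonneg)
            ultimately show "(p2 * p3) * (1 + (?x2 + ?x3)) \<le> 1" by (simp add: mult_ac)
          qed (use False c m_nonneg p excess_prob s12.excess_prob s13.excess_prob in auto)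
          then show ?thesis using a23 a12 a13 False by (simp add: B mult.assoc)
        qed
      next
        case a13: False
        then have "p1 * p3 \<le> 1 / 2" using half' by auto
        then show ?thesis using a23 a12 a13 nn sp by (cases "a1 + a2 + a3 < c") (auto simp: B)
      qed
    next
      case a12: False
      show ?thesis
      proof (cases "a1 + a3 < c")
        case a13: True
        then have "p1 * p2 \<le> 1 / 2" using half a12 by auto
        then show ?thesis using a23 a12 a13 nn sp by (cases "a1 + a2 + a3 < c") (auto simp: B)
      next
        case a13: False
        have "below3 p1 p2 p3 a1 a2 a3 c \<ge> 1 - (p1 * p2 * (1 - p3) + p1 * (1 - p2) * p3 + p1 * p2 * p3)"
          unfolding B using a23 a12 a13 nn by (cases "a1 + a2 + a3 < c") auto
        moreover have "p1 * p2 * (1 - p3) + p1 * (1 - p2) * p3 + p1 * p2 * p3 \<le> 5 / 9"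
        proof (cases "a1 - p1 * a1 < 1")
          case True
          then show ?thesis using two_pairs a12 a13 nn all by linarith
        next
          case False
          have "p1 * (p2 * (1 - p3) + p3) \<le> 1 / 2 * 1"
          proof (intro mult_mono)
            have "p2 * (1 - p3) \<le> 1 * (1 - p3)" using p by (intro mult_right_mono) auto
            then show "p2 * (1 - p3) + p3 \<le> 1" by simp
          qed (use p False excess_half in auto)
          then show ?thesis by (simp add: algebra_simps)
        qed
        ultimately show ?thesis by linarith
      qed
    qed
  next
    case a23: False
    with ord have o: "c \<le> a1 + a2" "c \<le> a1 + a3" "a1 - p1 * a1 \<le> a2 - p2 * a2" "a1 - p1 * a1 \<le> a3 - p3 * a3" by auto
    have "below3 p1 p2 p3 a1 a2 a3 c \<ge> 1 - (p1 * p2 + p1 * p3 + p2 * p3 - 2 * p1 * p2 * p3)"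
      unfolding B all[symmetric] using nn a23 o by (cases "a1 + a2 + a3 < c") auto
    moreover have "p1 * p2 + p1 * p3 + p2 * p3 - 2 * p1 * p2 * p3 \<le> 5 / 9"
    proof (cases "a1 - p1 * a1 < 1")
      case True
      then show ?thesis using two_pairs o by auto
    next
      case False
      have "p1 * p2 + p1 * p3 + p2 * p3 - 2 * p1 * p2 * p3
         \<le> 1/2 * (1/2) + 1/2 * (1/2) + 1/2 * (1/2) - 2 * (1/2) * (1/2) * (1/2 :: real)"
        using p False o excess_half s12.excess_half s13.excess_half by (intro two_of_three_mono) auto
      then show ?thesis by simp
    qed
    ultimately show ?thesis by linarith
  qed
qed

end

lemma (in three_two_point) bound: "4 / 9 \<le> below3 p1 p2 p3 a1 a2 a3 c"
proof -
  interpret s12: three_two_point p2 p1 p3 a2 a1 a3 c by (rule swap12)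
  interpret s23: three_two_point p1 p3 p2 a1 a3 a2 c by (rule swap23)
  interpret s13: three_two_point p3 p1 p2 a3 a1 a2 c by (rule s23.swap12)
  have e2: "below3 p1 p2 p3 a1 a2 a3 c = below3 p2 p1 p3 a2 a1 a3 c" by (rule below3_swap12)
  have e3: "below3 p1 p2 p3 a1 a2 a3 c = below3 p3 p1 p2 a3 a1 a2 c"
    by (metis below3_swap12 below3_swap23)
  show ?thesis
  proof (cases "c \<le> a1 \<or> c \<le> a2 \<or> c \<le> a3")
    case True
    then show ?thesis using bound_single s12.bound_single s13.bound_single e2 e3 by metis
  next
    case False
    then have ns: "a1 < c" "a2 < c" "a3 < c" by auto
    show ?thesis
    proof (cases "a2 + a3 < c \<or> a1 + a3 < c \<or> a1 + a2 < c")
      case True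
      then show ?thesis using ns bound_no_single s12.bound_no_single s13.bound_no_single e2 e3 by metis
    next
      case F: False
      let ?x1 = "a1 - p1 * a1" and ?x2 = "a2 - p2 * a2" and ?x3 = "a3 - p3 * a3"
      consider "?x1 \<le> ?x2" "?x1 \<le> ?x3" | "?x2 \<le> ?x1" "?x2 \<le> ?x3" | "?x3 \<le> ?x1" "?x3 \<le> ?x2"
        by linarith
      then show ?thesis
      proof cases
        case 1 then show ?thesis using F ns by (intro bound_no_single) auto
      next
        case 2 then show ?thesis unfolding e2 using F ns by (intro s12.bound_no_single) auto
      next
        case 3 then show ?thesis unfolding e3 using F ns by (intro s13.bound_no_single) auto
      qed
    qed
  qed
qed

section \<open>Reduction of many arbitrary laws to three two-point laws\<close>

abbreviation mean :: "nat pmf \<Rightarrow> real" where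
  "mean p \<equiv> measure_pmf.expectation p real"

lemma expectation_finite:
  assumes "finite (set_pmf p)"
  shows "measure_pmf.expectation p f = (\<Sum>x\<in>set_pmf p. pmf p x * f x :: real)"
  using assms by (subst integral_measure_pmf[of "set_pmf p"]) auto

text \<open>For a fixed objective, a law can be replaced by a two-point law with the same mean: the line
  through the mean whose slope is determined by the best lower point must be undercut by an upper point.\<close>

lemma two_point_law:
  fixes H :: "nat \<Rightarrow> real"
  assumes fin: "finite (set_pmf p)"
  shows "\<exists>a b w. 0 \<le> w \<and> w \<le> 1 \<and> a \<le> b \<and> (1 - w) * real a + w * real b = mean p \<and>
           (1 - w) * H a + w * H b \<le> measure_pmf.expectation p H"
proof -
  define A where "A = set_pmf p"
  define \<mu> h where "\<mu> = mean p" and "h = measure_pmf.expectation p H"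
  have A: "finite A" "A \<noteq> {}" using fin by (auto simp: A_def set_pmf_not_empty)
  have \<mu>: "\<mu> = (\<Sum>x\<in>A. pmf p x * real x)" and h: "h = (\<Sum>x\<in>A. pmf p x * H x)"
    using fin by (simp_all add: \<mu>_def h_def A_def expectation_finite)
  have one: "(\<Sum>x\<in>A. pmf p x) = 1" using fin by (simp add: A_def sum_pmf_eq_1)
  have pos: "pmf p x > 0" if "x \<in> A" for x using that by (simp add: A_def pmf_positive)
  have lin: "(\<Sum>x\<in>A. pmf p x * (H x - h - s * (real x - \<mu>))) = 0" for s
    using one by (simp add: algebra_simps sum.distrib sum_subtractf flip: sum_distrib_left sum_distrib_right)
      (simp add: \<mu> h algebra_simps sum_distrib_left)
  have lin0: "(\<Sum>x\<in>A. pmf p x * (real x - \<mu>)) = 0"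
    using one by (simp add: algebra_simps sum.distrib sum_subtractf flip: sum_distrib_left sum_distrib_right)
      (simp add: \<mu> algebra_simps)
  show ?thesis
  proof (cases "\<exists>x\<in>A. real x = \<mu> \<and> H x \<le> h")
    case True
    then obtain x where "real x = \<mu>" "H x \<le> h" by auto
    then show ?thesis by (intro exI[of _ x] exI[of _ 0]) (auto simp: \<mu>_def h_def)
  next
    case False
    have ex1: "\<exists>a\<in>A. real a < \<mu>"
    proof (rule ccontr)
      assume "\<not> ?thesis"
      then have ge: "0 \<le> pmf p x * (real x - \<mu>)" if "x \<in> A" for x using that pos[OF that] by force
      then have "\<forall>x\<in>A. pmf p x * (real x - \<mu>) = 0" using lin0 A by (subst (asm) sum_nonneg_eq_0_iff) auto
      then have eq: "real x = \<mu>" if "x \<in> A" for x using that pos by force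
      have "(\<Sum>x\<in>A. pmf p x * (H x - h - 0 * (real x - \<mu>))) > 0"
        using False eq A pos by (intro sum_pos) force+
      with lin[of 0] show False by simp
    qed
    define sl where "sl a = (h - H a) / (\<mu> - real a)" for a
    let ?L = "{a\<in>A. real a < \<mu>}"
    define s where "s = Max (sl ` ?L)"
    have L: "finite ?L" "?L \<noteq> {}" using A ex1 by auto
    then have "s \<in> sl ` ?L" unfolding s_def by (intro Max_in) auto
    then obtain a where a: "a \<in> A" "real a < \<mu>" "s = sl a" by auto
    have smax: "sl x \<le> s" if "x \<in> A" "real x < \<mu>" for x
      unfolding s_def using that A by (intro Max_ge) auto
    have "\<exists>b\<in>A. real b > \<mu> \<and> H b \<le> h + s * (real b - \<mu>)"
    proof (rule ccontr)
      assume no: "\<not> ?thesis"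
      have ge: "H x - h - s * (real x - \<mu>) \<ge> 0 \<and> (real x \<ge> \<mu> \<longrightarrow> H x - h - s * (real x - \<mu>) > 0)" if x: "x \<in> A" for x
      proof (cases "real x < \<mu>")
        case True
        with smax[OF x] have "(h - H x) \<le> s * (\<mu> - real x)" by (simp add: sl_def divide_le_eq)
        with True show ?thesis by (simp add: algebra_simps)
      next
        case F: False
        then show ?thesis using no False x by (cases "real x = \<mu>") force+
      qed
      have "\<exists>b\<in>A. real b \<ge> \<mu>"
      proof (rule ccontr)
        assume "\<not> ?thesis"
        then have "(\<Sum>x\<in>A. pmf p x * (\<mu> - real x)) > 0" using A pos by (intro sum_pos) force+
        with lin0 show False by (simp add: algebra_simps sum_subtractf)
      qed
      then obtain b where b: "b \<in> A" "real b \<ge> \<mu>" by auto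
      have "(\<Sum>x\<in>A. pmf p x * (H x - h - s * (real x - \<mu>))) > 0"
        using A ge b pos by (intro sum_pos2[of A b] mult_pos_pos mult_nonneg_nonneg) auto
      with lin show False by simp
    qed
    then obtain b where b: "real b > \<mu>" "H b \<le> h + s * (real b - \<mu>)" by auto
    define w where "w = (\<mu> - real a) / (real b - real a)"
    have ab: "real b - real a > 0" using a b by simp
    have w: "0 \<le> w" "w \<le> 1" using a b by (auto simp: w_def)
    have wab: "w * (real b - real a) = \<mu> - real a" using ab by (simp add: w_def)
    have Ha: "H a = h - s * (\<mu> - real a)" using a by (simp add: sl_def)
    have "(1 - w) * H a + w * H b \<le> (1 - w) * H a + w * (h + s * (real b - \<mu>))"
      using w b by (intro add_left_mono mult_left_mono) auto
    also have "\<dots> = h + s * (w * (real b - real a) - (\<mu> - real a))" unfolding Ha by (simp add: algebra_simps)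
    finally have "(1 - w) * H a + w * H b \<le> h" using wab by simp
    moreover have "(1 - w) * real a + w * real b = \<mu>" using wab by (simp add: algebra_simps)
    ultimately show ?thesis using w a b
      by (intro exI[of _ a] exI[of _ b] exI[of _ w]) (auto simp: \<mu>_def h_def)
  qed
qed

text \<open>The laws are replaced by two-point laws one after the other, each time with the
  expectation over the remaining variables as objective. This keeps the means and does not increase
  the probability. Subtracting the lower points and dividing by \<open>c / 3\<close> produces an
  instance of \<open>three_two_point\<close>.\<close>

lemma three_sum_below:
  assumes fin: "finite (set_pmf p1)" "finite (set_pmf p2)" "finite (set_pmf p3)"
    and m: "mean p1 \<le> c / 3" "mean p2 \<le> c / 3" "mean p3 \<le> c / 3"
    and s: "mean p1 + mean p2 + mean p3 \<le> 2 * c / 3" and c: "c > 0"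
  shows "4 / 9 \<le> measure_pmf.expectation p1 (\<lambda>x. measure_pmf.expectation p2 (\<lambda>y.
      measure_pmf.expectation p3 (\<lambda>z. of_bool (real x + real y + real z < c) :: real)))"
proof -
  let ?f = "\<lambda>x y z. of_bool (real x + real y + real z < c) :: real"
  let ?E3 = "\<lambda>f. measure_pmf.expectation p3 f :: real"
  let ?E2 = "\<lambda>f. measure_pmf.expectation p2 f :: real"
  have int: "integrable (measure_pmf p2) f" "integrable (measure_pmf p3) f" for f :: "nat \<Rightarrow> real"
    using fin by (auto intro: integrable_measure_pmf_finite)
  from two_point_law[OF fin(1), of "\<lambda>x. ?E2 (\<lambda>y. ?E3 (\<lambda>z. ?f x y z))"]
  obtain a1 b1 w1 where 1: "0 \<le> w1" "w1 \<le> 1" "a1 \<le> b1" "(1 - w1) * real a1 + w1 * real b1 = mean p1"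
    "(1 - w1) * ?E2 (\<lambda>y. ?E3 (\<lambda>z. ?f a1 y z)) + w1 * ?E2 (\<lambda>y. ?E3 (\<lambda>z. ?f b1 y z))
      \<le> measure_pmf.expectation p1 (\<lambda>x. ?E2 (\<lambda>y. ?E3 (\<lambda>z. ?f x y z)))" by blast
  let ?g = "\<lambda>y z. (1 - w1) * ?f a1 y z + w1 * ?f b1 y z"
  have e1: "(1 - w1) * ?E2 (\<lambda>y. ?E3 (\<lambda>z. ?f a1 y z)) + w1 * ?E2 (\<lambda>y. ?E3 (\<lambda>z. ?f b1 y z))
     = ?E2 (\<lambda>y. ?E3 (\<lambda>z. ?g y z))"
    using int by simp
  from two_point_law[OF fin(2), of "\<lambda>y. ?E3 (\<lambda>z. ?g y z)"]
  obtain a2 b2 w2 where 2: "0 \<le> w2" "w2 \<le> 1" "a2 \<le> b2" "(1 - w2) * real a2 + w2 * real b2 = mean p2"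
    "(1 - w2) * ?E3 (\<lambda>z. ?g a2 z) + w2 * ?E3 (\<lambda>z. ?g b2 z) \<le> ?E2 (\<lambda>y. ?E3 (\<lambda>z. ?g y z))" by blast
  let ?h = "\<lambda>z. (1 - w2) * ?g a2 z + w2 * ?g b2 z"
  have e2: "(1 - w2) * ?E3 (\<lambda>z. ?g a2 z) + w2 * ?E3 (\<lambda>z. ?g b2 z) = ?E3 ?h"
    using int by simp
  from two_point_law[OF fin(3), of ?h]
  obtain a3 b3 w3 where 3: "0 \<le> w3" "w3 \<le> 1" "a3 \<le> b3" "(1 - w3) * real a3 + w3 * real b3 = mean p3"
    "(1 - w3) * ?h a3 + w3 * ?h b3 \<le> ?E3 ?h" by blast
  define U where "U = c / 3"
  have U: "U > 0" using c by (simp add: U_def)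
  define L where "L = real a1 + real a2 + real a3"
  let ?x1 = "(real b1 - real a1) / U" and ?x2 = "(real b2 - real a2) / U" and ?x3 = "(real b3 - real a3) / U"
  let ?c = "(c - L) / U"
  have mu: "w1 * (real b1 - real a1) = mean p1 - a1" "w2 * (real b2 - real a2) = mean p2 - a2" "w3 * (real b3 - real a3) = mean p3 - a3"
    using 1 2 3 by (simp_all add: algebra_simps)
  interpret three_two_point w1 w2 w3 ?x1 ?x2 ?x3 ?c
  proof
    have w: "w1 * ?x1 = (mean p1 - a1) / U" "w2 * ?x2 = (mean p2 - a2) / U" "w3 * ?x3 = (mean p3 - a3) / U"
      by (simp_all only: times_divide_eq_right mu)
    have "(mean p1 - a1) / U \<le> 1" "(mean p2 - a2) / U \<le> 1" "(mean p3 - a3) / U \<le> 1"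
      using m U by (simp_all add: divide_le_eq_1_pos U_def)
    then show "w1 * ?x1 \<le> 1" "w2 * ?x2 \<le> 1" "w3 * ?x3 \<le> 1" unfolding w .
    have "w1 * ?x1 + w2 * ?x2 + w3 * ?x3 = (mean p1 + mean p2 + mean p3 - L) / U"
      unfolding w by (simp add: L_def add_divide_distrib diff_divide_distrib)
    moreover have "(mean p1 + mean p2 + mean p3 - L) / U \<le> 2" "1 + (mean p1 + mean p2 + mean p3 - L) / U \<le> ?c"
      using s U by (auto simp: divide_simps U_def L_def)
    ultimately show "w1 * ?x1 + w2 * ?x2 + w3 * ?x3 \<le> 2" "1 + w1 * ?x1 + w2 * ?x2 + w3 * ?x3 \<le> ?c" by linarith+
  qed (use 1 2 3 U in auto)
  have "below3 w1 w2 w3 ?x1 ?x2 ?x3 ?c = (1 - w3) * ?h a3 + w3 * ?h b3"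
  proof -
    have i: "(0 < ?c) = (real a1 + real a2 + real a3 < c)"
      "(?x1 < ?c) = (real b1 + real a2 + real a3 < c)" "(?x2 < ?c) = (real a1 + real b2 + real a3 < c)" "(?x3 < ?c) = (real a1 + real a2 + real b3 < c)"
      "(?x1 + ?x2 < ?c) = (real b1 + real b2 + real a3 < c)" "(?x1 + ?x3 < ?c) = (real b1 + real a2 + real b3 < c)"
      "(?x2 + ?x3 < ?c) = (real a1 + real b2 + real b3 < c)" "(?x1 + ?x2 + ?x3 < ?c) = (real b1 + real b2 + real b3 < c)"
      using U by (auto simp: L_def divide_strict_right_mono divide_less_cancel zero_less_divide_iff simp flip: add_divide_distrib)
    show ?thesis unfolding below3_def i by (simp add: algebra_simps)
  qed
  with bound have "4 / 9 \<le> (1 - w3) * ?h a3 + w3 * ?h b3" by simp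
  also have "\<dots> \<le> ?E3 ?h" by (rule 3)
  also have "\<dots> \<le> ?E2 (\<lambda>y. ?E3 (\<lambda>z. ?g y z))" using 2 e2 by simp
  also have "\<dots> \<le> measure_pmf.expectation p1 (\<lambda>x. ?E2 (\<lambda>y. ?E3 (\<lambda>z. ?f x y z)))" using 1 e1 by simp
  finally show ?thesis .
qed

definition conv :: "nat pmf \<Rightarrow> nat pmf \<Rightarrow> nat pmf" where
  "conv p q = map_pmf (\<lambda>(x, y). x + y) (pair_pmf p q)"

lemma conv_commute: "conv p q = conv q p"
  unfolding conv_def by (subst pair_commute_pmf) (simp add: pmf.map_comp o_def case_prod_unfold add.commute)

lemma conv_bind: "conv p q = bind_pmf p (\<lambda>x. bind_pmf q (\<lambda>y. return_pmf (x + y)))"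
  by (simp add: conv_def pair_pmf_def map_bind_pmf)

lemma conv_assoc: "conv (conv p q) r = conv p (conv q r)"
  by (simp add: conv_bind bind_assoc_pmf bind_return_pmf add.assoc)

lemma conv_left_commute: "conv p (conv q r) = conv q (conv p r)"
  by (metis conv_assoc conv_commute)

lemma finite_conv: "finite (set_pmf p) \<Longrightarrow> finite (set_pmf q) \<Longrightarrow> finite (set_pmf (conv p q))"
  by (simp add: conv_def)

lemma expectation_conv:
  fixes f :: "nat \<Rightarrow> real"
  assumes "finite (set_pmf p)" "finite (set_pmf q)"
  shows "measure_pmf.expectation (conv p q) f
      = measure_pmf.expectation p (\<lambda>x. measure_pmf.expectation q (\<lambda>y. f (x + y)))"
proof -
  have "measure_pmf.expectation (conv p q) f
      = (\<Sum>xy\<in>set_pmf p \<times> set_pmf q. pmf p (fst xy) * pmf q (snd xy) * f (fst xy + snd xy))"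
  proof -
    have "pmf (pair_pmf p q) x = pmf p (fst x) * pmf q (snd x)" for x
      by (cases x) (simp add: pmf_pair)
    then show ?thesis using assms by (simp add: conv_def case_prod_unfold expectation_finite)
  qed
  also have "\<dots> = (\<Sum>x\<in>set_pmf p. \<Sum>y\<in>set_pmf q. pmf p x * pmf q y * f (x + y))"
    by (simp add: sum.cartesian_product case_prod_unfold)
  also have "\<dots> = measure_pmf.expectation p (\<lambda>x. measure_pmf.expectation q (\<lambda>y. f (x + y)))"
    using assms by (simp add: expectation_finite sum_distrib_left mult.assoc)
  finally show ?thesis .
qed

lemma mean_conv:
  assumes "finite (set_pmf p)" "finite (set_pmf q)"
  shows "mean (conv p q) = mean p + mean q"
  using assms by (simp add: expectation_conv integrable_measure_pmf_finite)

text \<open>Four means of total at most \<open>2 * m\<close> form two pairs, one of which has total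
  at most \<open>m\<close>; convolving this pair leaves three variables with the same sum.\<close>

lemma merge_step:
  assumes fin: "finite (set_pmf p1)" "finite (set_pmf p2)" "finite (set_pmf p3)" "finite (set_pmf q)"
    and m: "mean p1 \<le> m" "mean p2 \<le> m" "mean p3 \<le> m" "mean q \<le> m"
    and s: "mean p1 + mean p2 + mean p3 + mean q \<le> 2 * m"
  shows "\<exists>r1 r2 r3. finite (set_pmf r1) \<and> finite (set_pmf r2) \<and> finite (set_pmf r3) \<and>
     mean r1 \<le> m \<and> mean r2 \<le> m \<and> mean r3 \<le> m \<and> mean r1 + mean r2 + mean r3 = mean p1 + mean p2 + mean p3 + mean q \<and>
     conv q (conv p1 (conv p2 p3)) = conv r1 (conv r2 r3)"
proof (cases "mean p1 + mean p2 \<le> m")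
  case True
  moreover have "conv q (conv p1 (conv p2 p3)) = conv (conv p1 p2) (conv p3 q)"
    by (simp only: conv_assoc conv_commute conv_left_commute)
  ultimately show ?thesis using fin m
    by (intro exI[of _ "conv p1 p2"] exI[of _ p3] exI[of _ q]) (simp add: mean_conv finite_conv)
next
  case False
  then have "mean p3 + mean q \<le> m" using s by linarith
  moreover have "conv q (conv p1 (conv p2 p3)) = conv p1 (conv p2 (conv p3 q))"
    by (simp only: conv_assoc conv_commute conv_left_commute)
  ultimately show ?thesis using fin m
    by (intro exI[of _ p1] exI[of _ p2] exI[of _ "conv p3 q"]) (simp add: mean_conv finite_conv)
qed

text \<open>Starting from three zeros, every further variable is absorbed by
  \<open>merge_step\<close>. So three variables suffice for any number of arms, without weakening
  the bounds on single and total means.\<close>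

lemma merge_family:
  assumes "finite A" "\<And>j. j \<in> A \<Longrightarrow> finite (set_pmf (q j))" "\<And>j. j \<in> A \<Longrightarrow> mean (q j) \<le> m"
    and "(\<Sum>j\<in>A. mean (q j)) \<le> 2 * m" "0 \<le> m"
  shows "\<exists>r1 r2 r3. finite (set_pmf r1) \<and> finite (set_pmf r2) \<and> finite (set_pmf r3) \<and>
     mean r1 \<le> m \<and> mean r2 \<le> m \<and> mean r3 \<le> m \<and> mean r1 + mean r2 + mean r3 = (\<Sum>j\<in>A. mean (q j)) \<and>
     map_pmf (\<lambda>f. \<Sum>j\<in>A. f j) (Pi_pmf A 0 q) = conv r1 (conv r2 r3)"
  using assms
proof (induction A rule: finite_induct)
  case empty
  then show ?case
    by (intro exI[of _ "return_pmf 0"]) (simp add: conv_bind bind_return_pmf)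
next
  case (insert i A)
  have "0 \<le> mean (q i)" by simp
  then have "(\<Sum>j\<in>A. mean (q j)) \<le> 2 * m"
  proof -
    have "(\<Sum>j\<in>insert i A. mean (q j)) = mean (q i) + (\<Sum>j\<in>A. mean (q j))" using insert.hyps by simp
    with \<open>0 \<le> mean (q i)\<close> insert.prems(3) show ?thesis by linarith
  qed
  with insert obtain r1 r2 r3 where r: "finite (set_pmf r1)" "finite (set_pmf r2)" "finite (set_pmf r3)"
    "mean r1 \<le> m" "mean r2 \<le> m" "mean r3 \<le> m" "mean r1 + mean r2 + mean r3 = (\<Sum>j\<in>A. mean (q j))"
    "map_pmf (\<lambda>f. \<Sum>j\<in>A. f j) (Pi_pmf A 0 q) = conv r1 (conv r2 r3)" by auto
  have "map_pmf (\<lambda>f. \<Sum>j\<in>insert i A. f j) (Pi_pmf (insert i A) 0 q)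
      = conv (q i) (map_pmf (\<lambda>f. \<Sum>j\<in>A. f j) (Pi_pmf A 0 q))"
  proof -
    have "(\<Sum>j\<in>insert i A. (f(i := y)) j) = y + (\<Sum>j\<in>A. f j)" for f :: "_ \<Rightarrow> nat" and y
      using insert by (simp add: sum.insert) (intro sum.cong, auto)
    then show ?thesis using insert
      by (simp add: Pi_pmf_insert pmf.map_comp o_def case_prod_unfold conv_bind pair_pmf_def map_bind_pmf bind_map_pmf map_pmf_def bind_assoc_pmf bind_return_pmf)
  qed
  also have "\<dots> = conv (q i) (conv r1 (conv r2 r3))" using r by simp
  finally have eq: "map_pmf (\<lambda>f. \<Sum>j\<in>insert i A. f j) (Pi_pmf (insert i A) 0 q) = conv (q i) (conv r1 (conv r2 r3))" .
  have "(\<Sum>j\<in>insert i A. mean (q j)) = mean r1 + mean r2 + mean r3 + mean (q i)" using insert.hyps r by simp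
  then show ?case unfolding eq using merge_step[of r1 r2 r3 "q i" m] r(1-6) insert.prems by simp
qed

text \<open>An additional independent variable with values \<open>0\<close> and \<open>\<sigma>\<close> and mean \<open>1 / 6\<close> turns the
  unused part of the total mean into a gain of probability.\<close>

theorem sum_below_prob:
  fixes q :: "'i \<Rightarrow> nat pmf"
  assumes A: "finite A" and fin: "\<And>j. j \<in> A \<Longrightarrow> finite (set_pmf (q j))"
    and m: "\<And>j. j \<in> A \<Longrightarrow> mean (q j) \<le> real \<sigma> / 3"
    and s: "(\<Sum>j\<in>A. mean (q j)) \<le> 2 * real \<sigma> / 3 - 1 / 6" and \<sigma>: "\<sigma> \<ge> 1"
  shows "4 / 9 * (1 + 1 / (6 * real \<sigma>)) \<le> measure_pmf.prob (Pi_pmf A 0 q) {f. (\<Sum>j\<in>A. f j) < \<sigma>}"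
proof -
  obtain r1 r2 r3 where r: "finite (set_pmf r1)" "finite (set_pmf r2)" "finite (set_pmf r3)"
    "mean r1 \<le> real \<sigma> / 3" "mean r2 \<le> real \<sigma> / 3" "mean r3 \<le> real \<sigma> / 3" "mean r1 + mean r2 + mean r3 = (\<Sum>j\<in>A. mean (q j))"
    "map_pmf (\<lambda>f. \<Sum>j\<in>A. f j) (Pi_pmf A 0 q) = conv r1 (conv r2 r3)"
    using merge_family[of A q "real \<sigma> / 3"] assms by auto
  define \<delta> where "\<delta> = 1 / (6 * real \<sigma>)"
  have \<delta>: "0 \<le> \<delta>" "\<delta> < 1" using \<sigma> by (auto simp: \<delta>_def)
  define d where "d = map_pmf (\<lambda>b. if b then \<sigma> else 0) (bernoulli_pmf \<delta>)"
  have dE: "measure_pmf.expectation d f = \<delta> * f \<sigma> + (1 - \<delta>) * f 0" for f :: "nat \<Rightarrow> real"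
    using \<delta> by (simp add: d_def)
  have dm: "mean d = 1 / 6" unfolding dE using \<sigma> by (simp add: \<delta>_def)
  have df: "finite (set_pmf d)" by (simp add: d_def)
  define S where "S = conv r1 (conv r2 r3)"
  have Sf: "finite (set_pmf S)" using r by (simp add: S_def finite_conv)
  obtain t1 t2 t3 where t: "finite (set_pmf t1)" "finite (set_pmf t2)" "finite (set_pmf t3)"
    "mean t1 \<le> real \<sigma> / 3" "mean t2 \<le> real \<sigma> / 3" "mean t3 \<le> real \<sigma> / 3"
    "mean t1 + mean t2 + mean t3 = mean r1 + mean r2 + mean r3 + mean d" "conv d S = conv t1 (conv t2 t3)"
    using merge_step[of r1 r2 r3 d "real \<sigma> / 3"] r s dm df \<sigma> unfolding S_def by fastforce
  let ?f = "\<lambda>x. of_bool (x < \<sigma>) :: real"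
  have "4 / 9 \<le> measure_pmf.expectation (conv t1 (conv t2 t3)) ?f"
  proof -
    have eq: "(real x + real y + real z < real \<sigma>) = (x + (y + z) < \<sigma>)" for x y z by linarith
    show ?thesis
      using three_sum_below[of t1 t2 t3 "real \<sigma>"] t(1-7) r(7) s dm \<sigma> unfolding eq
      by (simp add: expectation_conv finite_conv)
  qed
  also have "\<dots> = measure_pmf.expectation (conv d S) ?f" using t by simp
  \<comment> \<open>If \<open>d\<close> takes the value \<sigma>, the sum cannot be below \<sigma>;
    only the value 0 contributes.\<close>
  also have "\<dots> = (1 - \<delta>) * measure_pmf.expectation S ?f"
    using df Sf by (simp add: expectation_conv dE)
  finally have 1: "4 / 9 \<le> (1 - \<delta>) * measure_pmf.expectation S ?f" .
  have "(1 - \<delta>) * (4 / 9 * (1 + \<delta>)) \<le> 4 / 9" by (simp add: algebra_simps)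
  with 1 have "(1 - \<delta>) * (4 / 9 * (1 + \<delta>)) \<le> (1 - \<delta>) * measure_pmf.expectation S ?f" by linarith
  then have "4 / 9 * (1 + \<delta>) \<le> measure_pmf.expectation S ?f" using \<delta> by (simp add: mult_le_cancel_left)
  also have "\<dots> = measure_pmf.expectation (Pi_pmf A 0 q) (\<lambda>f. indicator {f. (\<Sum>j\<in>A. f j) < \<sigma>} f)"
    unfolding S_def r(8)[symmetric] by (simp add: indicator_def of_bool_def)
  also have "\<dots> = measure_pmf.prob (Pi_pmf A 0 q) {f. (\<Sum>j\<in>A. f j) < \<sigma>}" by simp
  finally show ?thesis by (simp add: \<delta>_def)
qed

lemma expectation_bind_finite:
  fixes h :: "'b \<Rightarrow> real"
  assumes "finite (set_pmf p)" "\<And>x. x \<in> set_pmf p \<Longrightarrow> finite (set_pmf (f x))"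
  shows "measure_pmf.expectation (bind_pmf p f) h
    = measure_pmf.expectation p (\<lambda>x. measure_pmf.expectation (f x) h)"
  using assms by (subst pmf_expectation_bind[of "set_pmf p"]) (auto simp: expectation_finite)

lemma expectation_cong:
  assumes "\<And>x. x \<in> set_pmf p \<Longrightarrow> f x = g x"
  shows "measure_pmf.expectation p f = measure_pmf.expectation p g"
  using assms by (intro integral_cong_AE) (auto simp: AE_measure_pmf_iff)

lemma expectation_mono:
  fixes f g :: "'a \<Rightarrow> real"
  assumes "finite (set_pmf p)" "\<And>x. x \<in> set_pmf p \<Longrightarrow> f x \<le> g x"
  shows "measure_pmf.expectation p f \<le> measure_pmf.expectation p g"
  using assms by (simp add: expectation_finite sum_mono mult_left_mono)

section \<open>Basic facts about a bandit instance\<close>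

locale mab =
  fixes I :: "('u, real) bandit"
  assumes valid: "valid_bandit I"
begin

abbreviation "n \<equiv> arms I"
abbreviation "B \<equiv> horizon I"
abbreviation "p \<equiv> tprob I"
abbreviation "r \<equiv> reward I"
abbreviation "NN \<equiv> all_nodes I"
abbreviation "rt \<equiv> root_node I"

lemma finite_nodes: "finite NN"
  using valid by (auto simp: valid_bandit_def all_nodes_def)

lemma root_in_arm: "i \<in> {1..n} \<Longrightarrow> rt i \<in> nodes I i"
  using valid unfolding valid_bandit_def by blast

lemma root_in: "i \<in> {1..n} \<Longrightarrow> rt i \<in> NN"
  using root_in_arm unfolding all_nodes_def by blast

lemma reward_nonneg: "u \<in> NN \<Longrightarrow> 0 \<le> r u"
  using valid by (auto simp: valid_bandit_def)

lemma arm_probs: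
  assumes "i \<in> {1..n}" "u \<in> nodes I i"
  shows "0 \<le> p u v" "p u v > 0 \<Longrightarrow> v \<in> nodes I i"
    "(\<Sum>v\<in>nodes I i. p u v) = 1 \<or> (\<forall>v. p u v = 0)"
  using valid assms unfolding valid_bandit_def by blast+

lemma prob_nonneg: "u \<in> NN \<Longrightarrow> 0 \<le> p u v"
  using arm_probs(1) unfolding all_nodes_def by blast

lemma prob_pos_nodes: "u \<in> NN \<Longrightarrow> p u v > 0 \<Longrightarrow> v \<in> NN"
  using arm_probs(2) unfolding all_nodes_def by blast

lemma prob_zero: "u \<in> NN \<Longrightarrow> v \<notin> NN \<Longrightarrow> p u v = 0"
  using prob_nonneg[of u v] prob_pos_nodes[of u v] by force

lemma prob_sum_le_1: "u \<in> NN \<Longrightarrow> (\<Sum>v\<in>NN. p u v) \<le> 1"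
proof -
  assume "u \<in> NN"
  then obtain i where i: "i \<in> {1..n}" "u \<in> nodes I i" by (auto simp: all_nodes_def)
  note v = arm_probs[OF i]
  have "(\<Sum>v\<in>NN. p u v) = (\<Sum>v\<in>nodes I i. p u v)"
    using finite_nodes i v(1,2) by (intro sum.mono_neutral_right) (auto simp: all_nodes_def less_le)
  also have "\<dots> \<le> 1" using v(3) by auto
  finally show ?thesis .
qed

lemma inj_root: "inj_on rt {1..n}"
proof (rule inj_onI)
  fix i j assume ij: "i \<in> {1..n}" "j \<in> {1..n}" "rt i = rt j"
  then have "rt i \<in> nodes I i \<inter> nodes I j" using root_in_arm[of i] root_in_arm[of j] by simp
  moreover have "disjoint_family_on (nodes I) {1..n}" using valid by (simp add: valid_bandit_def)
  ultimately show "i = j" using ij unfolding disjoint_family_on_def by blast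
qed

section \<open>Dynamic programs with penalties\<close>

text \<open>Time is counted backwards: \<open>s\<close> is the number of time steps left, so that \<open>s = B + 1 - t\<close> at time \<open>t\<close>.\<close>

primrec V :: "(nat \<Rightarrow> real) \<Rightarrow> nat \<Rightarrow> 'u \<Rightarrow> real" where
  "V lam 0 u = 0"
| "V lam (Suc s) u = max (V lam s u) (r u - lam (Suc s) + (\<Sum>v\<in>NN. p u v * V lam s v))"

text \<open>Evaluates a fixed rule \<open>g\<close> under weights \<open>w\<close>. Rewards as
  weights give the gain of the rule, the indicator of a step gives its load, and keeping
  \<open>w\<close> general lets one linearity argument serve both.\<close>

primrec U :: "(nat \<Rightarrow> 'u \<Rightarrow> bool) \<Rightarrow> (nat \<Rightarrow> 'u \<Rightarrow> real) \<Rightarrow> nat \<Rightarrow> 'u \<Rightarrow> real" where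
  "U g w 0 u = 0"
| "U g w (Suc s) u = (if g (Suc s) u then w (Suc s) u + (\<Sum>v\<in>NN. p u v * U g w s v) else U g w s u)"

text \<open>Comparing consecutive values decides which argument of \<open>max\<close> in
  \<open>V\<close> is larger, with ties resolved in favour of waiting. In this form the rule can be
  read off from a stored table of values.\<close>

definition greedy :: "(nat \<Rightarrow> real) \<Rightarrow> nat \<Rightarrow> 'u \<Rightarrow> bool" where
  "greedy lam s u \<longleftrightarrow> V lam s u > V lam (s - 1) u"

definition load :: "(nat \<Rightarrow> 'u \<Rightarrow> bool) \<Rightarrow> nat \<Rightarrow> real" where
  "load g s = (\<Sum>i=1..n. U g (\<lambda>s' _. of_bool (s' = s)) B (rt i))"

definition gain :: "(nat \<Rightarrow> 'u \<Rightarrow> bool) \<Rightarrow> real" where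
  "gain g = (\<Sum>i=1..n. U g (\<lambda>_. r) B (rt i))"

text \<open>The Lagrangian dual function without its constant term: the full bound at prices
  \<open>lam\<close> is \<open>dual lam + (\<Sum>s=1..B. lam s)\<close>.\<close>

definition dual :: "(nat \<Rightarrow> real) \<Rightarrow> real" where
  "dual lam = (\<Sum>i=1..n. V lam B (rt i))"

lemma V_nonneg: "0 \<le> V lam s u"
  by (induction s) auto

lemma V_greedy: "V lam s u = U (greedy lam) (\<lambda>s u. r u - lam s) s u"
  by (induction s arbitrary: u) (auto simp: greedy_def max_def)

lemma U_add: "U g (\<lambda>s u. w s u + w' s u) s u = U g w s u + U g w' s u"
  by (induction s arbitrary: u) (simp_all add: sum.distrib distrib_left)

lemma U_scale: "U g (\<lambda>s u. c * w s u) s u = c * U g w s u"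
  by (induction s arbitrary: u) (simp_all add: sum_distrib_left distrib_left mult.left_commute)

lemma U_cong: "(\<And>s' u. 1 \<le> s' \<Longrightarrow> s' \<le> s \<Longrightarrow> w s' u = w' s' u) \<Longrightarrow> U g w s u = U g w' s u"
  by (induction s arbitrary: u) auto

lemma U_sum: "finite A \<Longrightarrow> U g (\<lambda>s u. \<Sum>a\<in>A. w a s u) s u = (\<Sum>a\<in>A. U g (w a) s u)"
proof (induction A rule: finite_induct)
  case empty
  have "U g (\<lambda>s u. 0) s u = 0" by (induction s arbitrary: u) auto
  then show ?case by simp
qed (simp add: U_add)

lemma U_nonneg:
  assumes "\<And>s u. u \<in> NN \<Longrightarrow> 0 \<le> w s u" "u \<in> NN"
  shows "0 \<le> U g w s u"
  using assms(2)
proof (induction s arbitrary: u)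
  case (Suc s)
  have "0 \<le> (\<Sum>v\<in>NN. p u v * U g w s v)"
    using Suc by (intro sum_nonneg mult_nonneg_nonneg prob_nonneg) auto
  then show ?case using Suc assms(1)[of u "Suc s"] by auto
qed simp

lemma U_le_V:
  assumes "u \<in> NN" shows "U g (\<lambda>s u. r u - lam s) s u \<le> V lam s u"
  using assms
proof (induction s arbitrary: u)
  case (Suc s)
  have "(\<Sum>v\<in>NN. p u v * U g (\<lambda>s u. r u - lam s) s v) \<le> (\<Sum>v\<in>NN. p u v * V lam s v)"
    using Suc by (intro sum_mono mult_left_mono prob_nonneg) auto
  then show ?case using Suc by (auto simp: le_max_iff_disj)
qed simp

lemma U_indicator_zero:
  "s < s' \<Longrightarrow> U g (\<lambda>t _. of_bool (t = s')) s u = 0"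
  by (induction s arbitrary: u) auto

lemma U_indicator_le_1:
  "u \<in> NN \<Longrightarrow> U g (\<lambda>t _. of_bool (t = s')) s u \<le> 1"
proof (induction s arbitrary: u)
  case (Suc s)
  show ?case
  proof (cases "Suc s = s'")
    case True
    then have "U g (\<lambda>t _. of_bool (t = s')) s v = 0" for v by (intro U_indicator_zero) auto
    then show ?thesis by simp
  next
    case False
    have "(\<Sum>v\<in>NN. p u v * U g (\<lambda>t _. of_bool (t = s')) s v) \<le> (\<Sum>v\<in>NN. p u v * 1)"
      using Suc by (intro sum_mono mult_left_mono prob_nonneg) auto
    also have "\<dots> \<le> 1" using prob_sum_le_1 Suc by simp
    finally show ?thesis using False Suc by simp
  qed
qed simp

lemma U_indicator_nonneg:
  "u \<in> NN \<Longrightarrow> 0 \<le> U g (\<lambda>t _. of_bool (t = s')) s u"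
  by (rule U_nonneg) auto

lemma load_bounds: "0 \<le> load g s" "load g s \<le> real n"
proof -
  show "0 \<le> load g s" unfolding load_def by (intro sum_nonneg U_indicator_nonneg root_in) auto
  have "load g s \<le> (\<Sum>i=1..n. 1)" unfolding load_def by (intro sum_mono U_indicator_le_1 root_in) auto
  then show "load g s \<le> real n" by simp
qed

lemma U_penalized:
  "U g (\<lambda>s u. r u - lam s) S u
    = U g (\<lambda>_. r) S u - (\<Sum>s=1..S. lam s * U g (\<lambda>t _. of_bool (t = s)) S u)"
proof -
  have "U g (\<lambda>s u. r u - lam s) S u
      = U g (\<lambda>s u. r u + (-1) * (\<Sum>s'\<in>{1..S}. lam s' * of_bool (s = s'))) S u"
  proof (rule U_cong)
    fix s u assume "1 \<le> s" "s \<le> S"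
    then have "(\<Sum>s'\<in>{1..S}. lam s' * of_bool (s = s')) = lam s"
      by (subst sum.remove[of _ s]) auto
    then show "r u - lam s = r u + (-1) * (\<Sum>s'\<in>{1..S}. lam s' * of_bool (s = s'))" by simp
  qed
  also have "\<dots> = U g (\<lambda>_. r) S u - U g (\<lambda>s u. \<Sum>s'\<in>{1..S}. lam s' * of_bool (s = s')) S u"
    by (subst U_add, subst U_scale) simp
  also have "U g (\<lambda>s u. \<Sum>s'\<in>{1..S}. lam s' * of_bool (s = s')) S u
      = (\<Sum>s'\<in>{1..S}. U g (\<lambda>s u. lam s' * of_bool (s = s')) S u)"
    by (rule U_sum) simp
  also have "\<dots> = (\<Sum>s=1..S. lam s * U g (\<lambda>t _. of_bool (t = s)) S u)"
    by (intro sum.cong refl U_scale)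
  finally show ?thesis .
qed

text \<open>The greedy table maximizes the Lagrangian at \<open>lam\<close>. Consequently
  \<open>1 - load\<close> is a subgradient of the Lagrangian bound, and the price update moves
  against it.\<close>

lemma dual_greedy: "dual lam = gain (greedy lam) - (\<Sum>s=1..B. lam s * load (greedy lam) s)"
proof -
  have "dual lam = (\<Sum>i=1..n. U (greedy lam) (\<lambda>_. r) B (rt i)
      - (\<Sum>s=1..B. lam s * U (greedy lam) (\<lambda>t _. of_bool (t = s)) B (rt i)))"
    unfolding dual_def V_greedy U_penalized ..
  also have "\<dots> = gain (greedy lam) - (\<Sum>s=1..B. lam s * load (greedy lam) s)"
    unfolding gain_def load_def sum_subtractf sum_distrib_left by (subst (2) sum.swap) simp
  finally show ?thesis .
qed

lemma gain_le: "gain g \<le> dual (\<lambda>_. 0)"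
  unfolding gain_def dual_def using U_le_V[of _ g "\<lambda>_. 0"] by (intro sum_mono) (auto simp: root_in)

text \<open>Weak duality as a property of a number. It is proved for the values of the linear
  program and also for the crude values below, against which the error of the subgradient method is
  measured.\<close>

definition bounded_by_dual :: "real \<Rightarrow> bool" where
  "bounded_by_dual v \<longleftrightarrow> (\<forall>lam. (\<forall>s. 0 \<le> lam s) \<longrightarrow> v - (\<Sum>s=1..B. lam s) \<le> dual lam)"

lemma bounded_by_dual_zero: "bounded_by_dual 0"
  unfolding bounded_by_dual_def
proof (intro allI impI)
  fix lam :: "nat \<Rightarrow> real" assume "\<forall>s. 0 \<le> lam s"
  then have "0 \<le> (\<Sum>s=1..B. lam s)" by (intro sum_nonneg) auto
  moreover have "0 \<le> dual lam" unfolding dual_def by (intro sum_nonneg V_nonneg)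
  ultimately show "0 - (\<Sum>s=1..B. lam s) \<le> dual lam" by simp
qed

text \<open>Without prices waiting never pays: rewards are nonnegative, so the value of always
  playing grows with the number of steps left. This yields a recursion without maximum for the
  program (\<open>WN\<close>) and a concrete rule for \<open>bounded_by_dual_arm\<close>.\<close>

lemma V_zero: "u \<in> NN \<Longrightarrow> V (\<lambda>_. 0) s u = U (\<lambda>_ _. True) (\<lambda>_. r) s u"
proof -
  have mono: "u \<in> NN \<Longrightarrow> U (\<lambda>_ _. True) (\<lambda>_. r) s u \<le> U (\<lambda>_ _. True) (\<lambda>_. r) (Suc s) u" for u s
  proof (induction s arbitrary: u)
    case 0
    then show ?case by (simp add: reward_nonneg)
  next
    case (Suc s)
    have "(\<Sum>v\<in>NN. p u v * U (\<lambda>_ _. True) (\<lambda>_. r) s v) \<le> (\<Sum>v\<in>NN. p u v * U (\<lambda>_ _. True) (\<lambda>_. r) (Suc s) v)"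
      using Suc by (intro sum_mono mult_left_mono prob_nonneg) auto
    then show ?case by simp
  qed
  show "u \<in> NN \<Longrightarrow> V (\<lambda>_. 0) s u = U (\<lambda>_ _. True) (\<lambda>_. r) s u"
  proof (induction s arbitrary: u)
    case (Suc s)
    have "(\<Sum>v\<in>NN. p u v * V (\<lambda>_. 0) s v) = (\<Sum>v\<in>NN. p u v * U (\<lambda>_ _. True) (\<lambda>_. r) s v)"
      using Suc by (intro sum.cong) auto
    then show ?case using Suc mono[of u s] by (simp add: max_def)
  qed simp
qed

text \<open>Playing only arm \<open>i\<close>, whenever possible, puts a load of at most 1 on each
  step, so the sum of all prices covers its penalties.\<close>

lemma bounded_by_dual_arm:
  assumes i: "i \<in> {1..n}" shows "bounded_by_dual (V (\<lambda>_. 0) B (rt i))"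
  unfolding bounded_by_dual_def
proof (intro allI impI)
  fix lam :: "nat \<Rightarrow> real" assume lam: "\<forall>s. 0 \<le> lam s"
  let ?g = "\<lambda>_ _. True"
  have "U ?g (\<lambda>s u. r u - lam s) B (rt i) \<le> V lam B (rt i)" using U_le_V root_in i by blast
  moreover have "(\<Sum>s=1..B. lam s * U ?g (\<lambda>t _. of_bool (t = s)) B (rt i)) \<le> (\<Sum>s=1..B. lam s * 1)"
    using lam i by (intro sum_mono mult_left_mono U_indicator_le_1 root_in) auto
  moreover have "V lam B (rt i) \<le> dual lam"
    unfolding dual_def using i by (intro member_le_sum) (auto simp: V_nonneg)
  ultimately show "V (\<lambda>_. 0) B (rt i) - (\<Sum>s=1..B. lam s) \<le> dual lam"
    unfolding V_zero[OF root_in[OF i]] U_penalized by simp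
qed

text \<open>The mean of the \<open>n\<close> single-arm values and of the value 0, the latter
  keeping the denominator positive if there are no arms. The step size is computed from
  \<open>dual (\<lambda>_. 0)\<close>, and this relates that quantity to values bounded by the
  dual.\<close>

lemma bounded_by_dual_average: "bounded_by_dual (dual (\<lambda>_. 0) / (real n + 1))"
  unfolding bounded_by_dual_def
proof (intro allI impI)
  fix lam :: "nat \<Rightarrow> real" assume lam: "\<forall>s. 0 \<le> lam s"
  let ?c = "dual lam + (\<Sum>s=1..B. lam s)"
  have "dual (\<lambda>_. 0) \<le> (\<Sum>i=1..n. ?c)"
    unfolding dual_def[of "\<lambda>_. 0"] using bounded_by_dual_arm lam
    by (intro sum_mono) (fastforce simp: bounded_by_dual_def algebra_simps)
  moreover have "0 \<le> ?c"
  proof -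
    have "0 - (\<Sum>s=1..B. lam s) \<le> dual lam" using bounded_by_dual_zero lam unfolding bounded_by_dual_def by blast
    then show ?thesis by simp
  qed
  ultimately have "dual (\<lambda>_. 0) \<le> ?c * (real n + 1)" by (simp add: algebra_simps)
  then have "dual (\<lambda>_. 0) / (real n + 1) \<le> ?c" by (simp add: divide_le_eq)
  then show "dual (\<lambda>_. 0) / (real n + 1) - (\<Sum>s=1..B. lam s) \<le> dual lam" by simp
qed

text \<open>Backward induction with a potential: the mass \<open>st u t\<close>, valued at
  \<open>V lam s u\<close>, dominates the priced reward of the remaining steps. At the start the
  mass is 1 on the roots, and the potential is \<open>dual lam\<close>.\<close>

lemma lp_bounded_by_dual:
  assumes feas: "lp_feasible I x st"
  shows "bounded_by_dual (lp_value I x)"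
  unfolding bounded_by_dual_def
proof (intro allI impI)
  fix lam :: "nat \<Rightarrow> real" assume lam: "\<forall>s. 0 \<le> lam s"
  have xs: "0 \<le> x u t" "x u t \<le> st u t" if "u \<in> NN" "t \<in> {1..B}" for u t
    using feas that by (auto simp: lp_feasible_def)
  have main: "s \<le> B \<Longrightarrow> (\<Sum>s'=1..s. \<Sum>u\<in>NN. x u (B + 1 - s') * (r u - lam s')) \<le> (\<Sum>u\<in>NN. st u (B + 1 - s) * V lam s u)" for s
  proof (induction s)
    case (Suc s)
    define t where "t = B + 1 - Suc s"
    have t: "t \<in> {1..B}" "B + 1 - s = Suc t" using Suc.prems by (auto simp: t_def)
    have "(\<Sum>u\<in>NN. st u (Suc t) * V lam s u)
       = (\<Sum>u\<in>NN. (st u t - x u t + (\<Sum>v\<in>NN. x v t * p v u)) * V lam s u)"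
    \<comment> \<open>For \<open>s = 0\<close> the time \<open>Suc t\<close> is
      \<open>B + 1\<close>, for which there is no balance equation; there \<open>V lam 0\<close>
      vanishes.\<close>
    proof (cases "s = 0")
      case False
      then have "Suc t \<in> {1<..B}" using t Suc.prems t_def by auto
      have Par: "(\<Sum>v\<in>Par I u. x v t * p v u) = (\<Sum>v\<in>NN. x v t * p v u)" for u
        using finite_nodes prob_nonneg by (intro sum.mono_neutral_left) (auto simp: Par_def less_le)
      have "st u (Suc t) = st u t - x u t + (\<Sum>v\<in>NN. x v t * p v u)" if "u \<in> NN" for u
        using feas that \<open>Suc t \<in> {1<..B}\<close> unfolding lp_feasible_def Par[symmetric] by fastforce
      then show ?thesis by (intro sum.cong) auto
    qed simp
    also have "\<dots> = (\<Sum>u\<in>NN. (st u t - x u t) * V lam s u) + (\<Sum>v\<in>NN. x v t * (\<Sum>u\<in>NN. p v u * V lam s u))"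
    proof -
      have "(\<Sum>u\<in>NN. (\<Sum>v\<in>NN. x v t * p v u) * V lam s u) = (\<Sum>v\<in>NN. x v t * (\<Sum>u\<in>NN. p v u * V lam s u))"
        unfolding sum_distrib_left sum_distrib_right by (subst sum.swap) (simp add: mult_ac)
      then show ?thesis by (simp add: distrib_right sum.distrib)
    qed
    finally have eq: "(\<Sum>u\<in>NN. st u (Suc t) * V lam s u)
      = (\<Sum>u\<in>NN. (st u t - x u t) * V lam s u) + (\<Sum>v\<in>NN. x v t * (\<Sum>u\<in>NN. p v u * V lam s u))" .
    have "(\<Sum>u\<in>NN. st u (Suc t) * V lam s u) + (\<Sum>u\<in>NN. x u t * (r u - lam (Suc s)))
       \<le> (\<Sum>u\<in>NN. st u t * V lam (Suc s) u)"
      unfolding eq sum.distrib[symmetric]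
    proof (rule sum_mono)
      fix u assume u: "u \<in> NN"
      have "(st u t - x u t) * V lam s u \<le> (st u t - x u t) * V lam (Suc s) u"
        using xs[OF u t(1)] by (intro mult_left_mono) auto
      moreover have "x u t * (\<Sum>v\<in>NN. p u v * V lam s v) + x u t * (r u - lam (Suc s)) \<le> x u t * V lam (Suc s) u"
        unfolding distrib_left[symmetric] using xs[OF u t(1)] by (intro mult_left_mono) auto
      ultimately show "(st u t - x u t) * V lam s u + x u t * (\<Sum>v\<in>NN. p u v * V lam s v)
          + x u t * (r u - lam (Suc s)) \<le> st u t * V lam (Suc s) u"
        by (simp add: algebra_simps del: V.simps)
    qed
    moreover have "(\<Sum>s'=1..s. \<Sum>u\<in>NN. x u (B + 1 - s') * (r u - lam s')) \<le> (\<Sum>u\<in>NN. st u (Suc t) * V lam s u)"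
      using Suc t by auto
    ultimately show ?case unfolding t_def[symmetric] by (simp add: t_def)
  qed simp
  have "(\<Sum>s'=1..B. \<Sum>u\<in>NN. x u (B + 1 - s') * (r u - lam s')) = (\<Sum>t=1..B. \<Sum>u\<in>NN. x u t * (r u - lam (B + 1 - t)))"
    by (rule sum.reindex_bij_witness[of _ "\<lambda>t. B + 1 - t" "\<lambda>t. B + 1 - t"]) auto
  also have "\<dots> = lp_value I x - (\<Sum>t=1..B. lam (B + 1 - t) * (\<Sum>u\<in>NN. x u t))"
    unfolding lp_value_def sum_distrib_left right_diff_distrib sum_subtractf
    by (subst sum.swap) (simp add: mult_ac)
  also have "\<dots> \<ge> lp_value I x - (\<Sum>t=1..B. lam (B + 1 - t) * 1)"
    using feas lam by (intro diff_left_mono sum_mono mult_left_mono) (auto simp: lp_feasible_def)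
  also have "(\<Sum>t=1..B. lam (B + 1 - t) * 1) = (\<Sum>s=1..B. lam s)"
    by (rule sum.reindex_bij_witness[of _ "\<lambda>t. B + 1 - t" "\<lambda>t. B + 1 - t"]) auto
  finally have 1: "lp_value I x - (\<Sum>s=1..B. lam s) \<le> (\<Sum>s'=1..B. \<Sum>u\<in>NN. x u (B + 1 - s') * (r u - lam s'))" .
  have "(\<Sum>u\<in>NN. st u (B + 1 - B) * V lam B u) = dual lam"
  proof -
    have "(\<Sum>u\<in>NN. st u 1 * V lam B u) = (\<Sum>u\<in>root_nodes I. st u 1 * V lam B u)"
      using finite_nodes feas root_in by (intro sum.mono_neutral_right) (auto simp: root_nodes_def lp_feasible_def)
    also have "\<dots> = (\<Sum>i=1..n. st (rt i) 1 * V lam B (rt i))"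
      unfolding root_nodes_def using inj_root by (subst sum.reindex) auto
    also have "\<dots> = dual lam" unfolding dual_def using feas by (intro sum.cong) (auto simp: lp_feasible_def)
    finally show ?thesis by simp
  qed
  with main[of B] 1 show "lp_value I x - (\<Sum>s=1..B. lam s) \<le> dual lam" by simp
qed

section \<open>The projected subgradient method\<close>

text \<open>The prices are \<eta> times this accumulated overload, so projecting the overload to
  nonnegative numbers projects the prices. Splitting off \<eta> leaves a quantity that is an integer
  up to a power of the common denominator, and this is what the program stores.\<close>

primrec excess :: "real \<Rightarrow> nat \<Rightarrow> nat \<Rightarrow> real" where
  "excess \<eta> 0 = (\<lambda>s. 0)"
| "excess \<eta> (Suc k) = (\<lambda>s. max 0 (excess \<eta> k s + load (greedy (\<lambda>s. \<eta> * excess \<eta> k s)) s - 1))"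

abbreviation table :: "real \<Rightarrow> nat \<Rightarrow> nat \<Rightarrow> 'u \<Rightarrow> bool" where
  "table \<eta> k \<equiv> greedy (\<lambda>s. \<eta> * excess \<eta> k s)"

lemma excess_nonneg: "0 \<le> excess \<eta> k s"
  by (cases k) auto

lemma excess_ge: "(\<Sum>j<k. load (table \<eta> j) s) - real k \<le> excess \<eta> k s"
  by (induction k) auto

text \<open>The usual potential argument: projection does not increase the square, whose growth is
  the cross term \<open>2 * L * (l - 1)\<close> plus at most \<open>(n + 1) ^ 2\<close>, and
  \<open>bounded_by_dual v\<close> at the current prices bounds the weighted cross terms by gain
  minus \<open>v\<close>. The inequality is used twice: with the left-hand side dropped it estimates
  the gain, with \<open>v = 0\<close> the loads.\<close>

lemma excess_energy:
  assumes \<eta>: "0 \<le> \<eta>" and v: "bounded_by_dual v"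
  shows "\<eta> * (\<Sum>s=1..B. (excess \<eta> k s)\<^sup>2)
    \<le> 2 * ((\<Sum>j<k. gain (table \<eta> j)) - real k * v) + real k * (\<eta> * (real B * (real n + 1)\<^sup>2))"
proof (induction k)
  case (Suc k)
  let ?L = "excess \<eta> k" and ?l = "load (table \<eta> k)"
  have sq: "(excess \<eta> (Suc k) s)\<^sup>2 \<le> (?L s)\<^sup>2 + 2 * (?L s * (?l s - 1)) + (real n + 1)\<^sup>2" for s
  proof -
    have "(excess \<eta> (Suc k) s)\<^sup>2 \<le> (?L s + ?l s - 1)\<^sup>2" by (simp add: max_def)
    moreover have "(?l s - 1)\<^sup>2 \<le> (real n + 1)\<^sup>2"
      using load_bounds[of "table \<eta> k" s] by (intro abs_le_square_iff[THEN iffD1]) auto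
    ultimately show ?thesis by (simp add: power2_eq_square algebra_simps)
  qed
  have "v - (\<Sum>s=1..B. \<eta> * ?L s) \<le> gain (table \<eta> k) - (\<Sum>s=1..B. \<eta> * ?L s * ?l s)"
    using v \<eta> excess_nonneg unfolding bounded_by_dual_def dual_greedy[symmetric] by auto
  then have g: "(\<Sum>s=1..B. \<eta> * (?L s * (?l s - 1))) \<le> gain (table \<eta> k) - v"
    by (simp add: algebra_simps sum_subtractf)
  have "\<eta> * (\<Sum>s=1..B. (excess \<eta> (Suc k) s)\<^sup>2) \<le> \<eta> * (\<Sum>s=1..B. (?L s)\<^sup>2 + 2 * (?L s * (?l s - 1)) + (real n + 1)\<^sup>2)"
    using \<eta> sq by (intro mult_left_mono sum_mono) auto
  also have "\<dots> = \<eta> * (\<Sum>s=1..B. (?L s)\<^sup>2) + 2 * (\<Sum>s=1..B. \<eta> * (?L s * (?l s - 1))) + \<eta> * (real B * (real n + 1)\<^sup>2)"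
    by (simp add: sum.distrib distrib_left sum_distrib_left mult_ac)
  also have "\<dots> \<le> \<eta> * (\<Sum>s=1..B. (?L s)\<^sup>2) + 2 * (gain (table \<eta> k) - v) + \<eta> * (real B * (real n + 1)\<^sup>2)"
    using g by (intro add_mono mult_left_mono order_refl) auto
  also have "\<dots> \<le> 2 * ((\<Sum>j<k. gain (table \<eta> j)) - real k * v) + real k * (\<eta> * (real B * (real n + 1)\<^sup>2))
      + 2 * (gain (table \<eta> k) - v) + \<eta> * (real B * (real n + 1)\<^sup>2)"
    using Suc.IH by (intro add_mono order_refl) auto
  also have "\<dots> = 2 * ((\<Sum>j<Suc k. gain (table \<eta> j)) - real (Suc k) * v) + real (Suc k) * (\<eta> * (real B * (real n + 1)\<^sup>2))"
    by (simp add: algebra_simps)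
  finally show ?case .
qed simp

text \<open>The constants balance the two estimates. With \<open>b = B + 1\<close> and
  \<open>m = n + 1\<close>, the rate makes the loss of gain \<open>rate * b * m ^ 2 / 2\<close>
  equal to \<open>dual (\<lambda>_. 0) / m / (8 * b)\<close>. The energy then bounds the square of
  an excess by \<open>KK * 9 * b ^ 2 * m ^ 3\<close>, and \<open>KK = 144 * b ^ 4 * m ^ 3\<close>
  turns this into \<open>(KK / (4 * b)) ^ 2\<close>.\<close>

definition QQ :: nat where "QQ = 4 * (B + 1)\<^sup>2 * (n + 1) ^ 3"
definition KK :: nat where "KK = 144 * (B + 1) ^ 4 * (n + 1) ^ 3"
definition rate :: real where "rate = dual (\<lambda>_. 0) / real QQ"

lemma KK_pos: "KK > 0" by (simp add: KK_def)
lemma QQ_pos: "QQ > 0" by (simp add: QQ_def)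

lemma rate_nonneg: "0 \<le> rate"
  unfolding rate_def dual_def by (intro divide_nonneg_nonneg sum_nonneg V_nonneg) auto

lemma average_gain:
  assumes v: "bounded_by_dual v"
  shows "(1 - 1 / (8 * real (B + 1))) * v \<le> (\<Sum>k<KK. gain (table rate k)) / real KK"
proof -
  define b m where "b = real (B + 1)" and "m = real n + 1"
  have bm: "b \<ge> 1" "m \<ge> 1" by (auto simp: b_def m_def)
  let ?W = "dual (\<lambda>_. 0)"
  let ?A = "(\<Sum>k<KK. gain (table rate k)) / real KK"
  have *: "w - rate * (b * m\<^sup>2) / 2 \<le> ?A" if "bounded_by_dual w" for w
  proof -
    have "0 \<le> rate * (\<Sum>s=1..B. (excess rate KK s)\<^sup>2)"
      using rate_nonneg by (intro mult_nonneg_nonneg sum_nonneg) auto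
    also note excess_energy[OF rate_nonneg that, of KK]
    finally have "real KK * (w - rate * (real B * m\<^sup>2) / 2) \<le> (\<Sum>j<KK. gain (table rate j))"
      by (simp add: m_def algebra_simps)
    then have "w - rate * (real B * m\<^sup>2) / 2 \<le> ?A" using KK_pos by (simp add: le_divide_eq mult.commute)
    moreover have "rate * (real B * m\<^sup>2) \<le> rate * (b * m\<^sup>2)"
      using rate_nonneg by (intro mult_left_mono mult_right_mono) (auto simp: b_def)
    ultimately show ?thesis by linarith
  qed
  have rate: "rate * (b * m\<^sup>2) / 2 = ?W / m / (8 * b)"
  proof -
    have "real QQ = 4 * b\<^sup>2 * m ^ 3" by (simp add: QQ_def b_def m_def add.commute)
    then show ?thesis using bm by (simp add: rate_def power2_eq_square power3_eq_cube field_simps)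
  qed
  have c: "0 \<le> 1 - 1 / (8 * b)" using bm by (simp add: divide_le_eq)
  show ?thesis
  \<comment> \<open>The additive error is the fraction \<open>1 / (8 * b)\<close> of
    \<open>?W / m\<close>. If \<open>v\<close> is smaller than \<open>?W / m\<close>, the latter,
    which is bounded by the dual as well, takes its place and gives a stronger estimate.\<close>
  proof (cases "?W / m \<le> v")
    case True
    then have "?W / m / (8 * b) \<le> v / (8 * b)" using bm by (intro divide_right_mono) auto
    then have "v - v / (8 * b) \<le> ?A" using *[OF v] rate by linarith
    then show ?thesis by (simp add: algebra_simps b_def)
  next
    case False
    have "(1 - 1 / (8 * b)) * v \<le> (1 - 1 / (8 * b)) * (?W / m)"
      using False c by (intro mult_left_mono) auto
    also have "\<dots> = ?W / m - ?W / m / (8 * b)"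
      using bm by (simp add: field_simps)
    also have "\<dots> \<le> ?A"
      using *[OF bounded_by_dual_average, folded m_def] unfolding rate .
    finally show ?thesis unfolding b_def .
  qed
qed

lemma average_load:
  assumes W: "dual (\<lambda>_. 0) > 0" and s: "s \<in> {1..B}"
  shows "(\<Sum>k<KK. load (table rate k) s) / real KK \<le> 1 + 1 / (4 * real (B + 1))"
proof -
  define b m where "b = real (B + 1)" and "m = real n + 1"
  have bm: "b \<ge> 1" "m \<ge> 1" by (auto simp: b_def m_def)
  have K: "real KK = 144 * b ^ 4 * m ^ 3" and Q: "real QQ = 4 * b\<^sup>2 * m ^ 3"
    by (simp_all add: KK_def QQ_def b_def m_def add.commute)
  let ?W = "dual (\<lambda>_. 0)"
  let ?e = "excess rate KK s"
  have W_rate: "?W = rate * real QQ" using QQ_pos by (simp add: rate_def)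
  have rp: "rate > 0" using W QQ_pos by (simp add: rate_def)
  have "rate * ?e\<^sup>2 \<le> rate * (\<Sum>s=1..B. (excess rate KK s)\<^sup>2)"
    using rate_nonneg s by (intro mult_left_mono member_le_sum) auto
  also note excess_energy[OF rate_nonneg bounded_by_dual_zero, of KK]
  also have "2 * ((\<Sum>j<KK. gain (table rate j)) - real KK * 0) + real KK * (rate * (real B * (real n + 1)\<^sup>2))
     \<le> 2 * (\<Sum>j<KK. ?W) + real KK * (rate * (b * m\<^sup>2))"
    using gain_le rate_nonneg unfolding mult_zero_right diff_zero
    by (intro add_mono mult_left_mono sum_mono mult_right_mono) (auto simp: b_def m_def)
  also have "\<dots> = rate * (real KK * (2 * real QQ + b * m\<^sup>2))"
    by (simp add: W_rate algebra_simps)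
  finally have "?e\<^sup>2 \<le> real KK * (2 * real QQ + b * m\<^sup>2)" using rp by simp
  also have "\<dots> \<le> real KK * (9 * b\<^sup>2 * m ^ 3)"
  proof (intro mult_left_mono)
    have "b * m\<^sup>2 \<le> b\<^sup>2 * m ^ 3"
      using bm by (intro mult_mono) (auto simp: power2_eq_square power3_eq_cube intro: power_increasing[of 2 3 m, simplified power2_eq_square power3_eq_cube])
    then show "2 * real QQ + b * m\<^sup>2 \<le> 9 * b\<^sup>2 * m ^ 3" unfolding Q by linarith
  qed simp
  also have "\<dots> = (real KK / (4 * b))\<^sup>2"
    using bm by (simp add: K power2_eq_square power4_eq_xxxx power3_eq_cube field_simps)
  finally have "?e \<le> real KK / (4 * b)"
    using bm by (intro power2_le_imp_le[of ?e]) auto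
  moreover have "(\<Sum>k<KK. load (table rate k) s) - real KK \<le> ?e" by (rule excess_ge)
  ultimately have "(\<Sum>k<KK. load (table rate k) s) \<le> real KK * (1 + 1 / (4 * b))" by (simp add: algebra_simps)
  then show ?thesis unfolding b_def using KK_pos by (simp add: divide_le_eq mult.commute)
qed

end

section \<open>Lists of plays, scores and ranks\<close>

text \<open>Scores include the number of earlier plays; subtracting the offset recovers the steps
  left at the virtual play, on which the weight depends.\<close>

fun tot :: "nat \<Rightarrow> (nat \<Rightarrow> 'u \<Rightarrow> real) \<Rightarrow> (nat \<times> 'u) list \<Rightarrow> real" where
  "tot d w [] = 0"
| "tot d w ((y, u) # L) = w (y - d) u + tot (Suc d) w L"

lemma tot_nth: "tot d w L = (\<Sum>e<length L. w (fst (L ! e) - (d + e)) (snd (L ! e)))"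
proof (induction L arbitrary: d)
  case (Cons a L)
  then show ?case by (cases a) (simp add: sum.lessThan_Suc_shift del: sum.lessThan_Suc)
qed simp

text \<open>The number of steps left at the next virtual play, 0 standing for none. The program
  stores tables in this compressed form (\<open>XN\<close>).\<close>

primrec nx :: "(nat \<Rightarrow> 'u \<Rightarrow> bool) \<Rightarrow> nat \<Rightarrow> 'u \<Rightarrow> nat" where
  "nx g 0 u = 0"
| "nx g (Suc s) u = (if g (Suc s) u then Suc s else nx g s u)"

lemma nx_le: "nx g s u \<le> s"
  by (induction s) auto

text \<open>Running maximum with the first maximizer, shaped like the program loop that computes it.
  A score of 0 never wins, so the result is arm \<open>0\<close> exactly if all scores are
  0.\<close>

primrec pick :: "(nat \<Rightarrow> nat) \<Rightarrow> nat \<Rightarrow> nat \<times> nat" where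
  "pick f 0 = (0, 0)"
| "pick f (Suc i) = (if f (Suc i) > fst (pick f i) then (f (Suc i), Suc i) else pick f i)"

lemma pick_le: "1 \<le> j \<Longrightarrow> j \<le> n \<Longrightarrow> f j \<le> fst (pick f n)"
  by (induction n) (auto simp: le_Suc_eq)

lemma pick_zero: "snd (pick f n) = 0 \<Longrightarrow> fst (pick f n) = 0"
  by (induction n) (auto split: if_splits)

lemma pick_arm: "snd (pick f n) \<noteq> 0 \<Longrightarrow> snd (pick f n) \<le> n \<and> f (snd (pick f n)) = fst (pick f n) \<and> 0 < fst (pick f n)"
  by (induction n) (auto split: if_splits)

lemma pick_cong: "(\<And>i. 1 \<le> i \<Longrightarrow> i \<le> n \<Longrightarrow> f i = g i) \<Longrightarrow> pick f n = pick g n"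
  by (induction n) auto

definition hdscore :: "(nat \<times> 'u) list \<Rightarrow> nat" where
  "hdscore L = (case L of [] \<Rightarrow> 0 | x # _ \<Rightarrow> fst x)"

lemma hdscore_nth: "L \<noteq> [] \<Longrightarrow> hdscore L = fst (L ! 0)"
  by (cases L) (auto simp: hdscore_def)

text \<open>An upper bound for the number of real plays made before play \<open>e\<close> of arm
  \<open>i\<close>. Ties count against the play, so that the rule for breaking them does not
  matter.\<close>

definition rank :: "nat \<Rightarrow> (nat \<Rightarrow> (nat \<times> 'u) list) \<Rightarrow> nat \<Rightarrow> nat \<Rightarrow> nat" where
  "rank n L i e = e + (\<Sum>j\<in>{1..n} - {i}. card {e'. e' < length (L j) \<and> fst (L i ! e) \<le> fst (L j ! e')})"

context mab
begin

section \<open>Virtual plays of a single arm\<close>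

lemma embed_prob: "u \<in> NN \<Longrightarrow> (\<integral>\<^sup>+ v. ennreal (p u v) \<partial>count_space UNIV) = ennreal (\<Sum>v\<in>NN. p u v)"
proof -
  assume u: "u \<in> NN"
  have "(\<integral>\<^sup>+ v. ennreal (p u v) \<partial>count_space UNIV) = (\<Sum>v\<in>NN. ennreal (p u v))"
    using finite_nodes prob_zero[OF u] by (intro nn_integral_count_space') auto
  then show ?thesis using prob_nonneg[OF u] by (simp add: sum_ennreal)
qed

lemma
  assumes u: "u \<in> NN"
  shows pmf_embed_Some: "pmf (embed_spmf (p u)) (Some v) = p u v"
    and pmf_embed_None: "pmf (embed_spmf (p u)) None = 1 - (\<Sum>v\<in>NN. p u v)"
proof -
  have le: "(\<integral>\<^sup>+ v. ennreal (p u v) \<partial>count_space UNIV) \<le> 1"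
    unfolding embed_prob[OF u] using prob_sum_le_1[OF u] by simp
  show "pmf (embed_spmf (p u)) (Some v) = p u v"
    using spmf_embed_spmf[OF le, of v] prob_nonneg[OF u, of v] by simp
  show "pmf (embed_spmf (p u)) None = 1 - (\<Sum>v\<in>NN. p u v)"
    unfolding pmf_embed_spmf_None[OF le] embed_prob[OF u]
    using prob_nonneg[OF u] by (simp add: sum_nonneg)
qed

lemma set_embed: "u \<in> NN \<Longrightarrow> set_pmf (embed_spmf (p u)) \<subseteq> insert None (Some ` NN)"
proof
  fix x assume u: "u \<in> NN" and x: "x \<in> set_pmf (embed_spmf (p u))"
  show "x \<in> insert None (Some ` NN)"
  proof (cases x)
    case (Some v)
    with x have "p u v \<noteq> 0" using pmf_embed_Some[OF u, of v] by (simp add: set_pmf_eq)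
    then show ?thesis using prob_zero[OF u] Some by auto
  qed simp
qed

lemma finite_embed: "u \<in> NN \<Longrightarrow> finite (set_pmf (embed_spmf (p u)))"
  by (rule finite_subset[OF set_embed]) (auto simp: finite_nodes)

lemma expectation_embed:
  fixes F :: "'u option \<Rightarrow> real"
  assumes u: "u \<in> NN"
  shows "measure_pmf.expectation (embed_spmf (p u)) F
    = (\<Sum>v\<in>NN. p u v * F (Some v)) + (1 - (\<Sum>v\<in>NN. p u v)) * F None"
proof -
  have "measure_pmf.expectation (embed_spmf (p u)) F
      = (\<Sum>x\<in>insert None (Some ` NN). pmf (embed_spmf (p u)) x * F x)"
    using set_embed[OF u] finite_nodes by (subst integral_measure_pmf[of "insert None (Some ` NN)"]) auto
  also have "\<dots> = pmf (embed_spmf (p u)) None * F None + (\<Sum>x\<in>Some ` NN. pmf (embed_spmf (p u)) x * F x)"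
    using finite_nodes by (subst sum.insert) auto
  also have "(\<Sum>x\<in>Some ` NN. pmf (embed_spmf (p u)) x * F x) = (\<Sum>v\<in>NN. p u v * F (Some v))"
    by (subst sum.reindex) (auto simp: pmf_embed_Some[OF u])
  finally show ?thesis by (simp add: pmf_embed_None[OF u])
qed

text \<open>An entry of a list of virtual plays consists of the score \<open>s + d\<close> of the play, where \<open>d\<close> is the
  number of earlier plays of the arm, and of the played node. The slack of the play, i.e. its virtual
  time minus \<open>d\<close>, is \<open>B + 1\<close> minus the score, and real plays are made in the order of decreasing scores.\<close>

primrec vp :: "(nat \<Rightarrow> 'u \<Rightarrow> bool) \<Rightarrow> nat \<Rightarrow> nat \<Rightarrow> 'u \<Rightarrow> (nat \<times> 'u) list pmf" where
  "vp g 0 d u = return_pmf []"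
| "vp g (Suc s) d u = (if g (Suc s) u then bind_pmf (embed_spmf (p u))
     (\<lambda>v. map_pmf (Cons (Suc s + d, u)) (case v of None \<Rightarrow> return_pmf [] | Some v \<Rightarrow> vp g s (Suc d) v))
   else vp g s d u)"

definition vpo :: "(nat \<Rightarrow> 'u \<Rightarrow> bool) \<Rightarrow> nat \<Rightarrow> nat \<Rightarrow> 'u option \<Rightarrow> (nat \<times> 'u) list pmf" where
  "vpo g s d v = (case v of None \<Rightarrow> return_pmf [] | Some v \<Rightarrow> vp g s d v)"

lemma vp_Suc: "vp g (Suc s) d u = (if g (Suc s) u then bind_pmf (embed_spmf (p u))
     (\<lambda>v. map_pmf (Cons (Suc s + d, u)) (vpo g s (Suc d) v)) else vp g s d u)"
  by (simp add: vpo_def)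

lemma finite_vp: "u \<in> NN \<Longrightarrow> finite (set_pmf (vp g s d u))"
proof (induction s arbitrary: d u)
  case (Suc s)
  have "finite (set_pmf (case v of None \<Rightarrow> return_pmf [] | Some v \<Rightarrow> vp g s (Suc d) v))"
    if "v \<in> set_pmf (embed_spmf (p u))" for v
    using that Suc set_embed[of u] by (cases v) auto
  then show ?case using Suc finite_embed by auto
qed simp

lemma finite_vpo: "v \<in> insert None (Some ` NN) \<Longrightarrow> finite (set_pmf (vpo g s d v))"
  by (cases v) (auto simp: vpo_def intro: finite_vp)

lemma expectation_tot: "u \<in> NN \<Longrightarrow> measure_pmf.expectation (vp g s d u) (tot d w) = U g w s u"
proof (induction s arbitrary: d u)
  case (Suc s)
  show ?case
  proof (cases "g (Suc s) u")
    case True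
    let ?q = "\<lambda>v. vpo g s (Suc d) v"
    have E: "measure_pmf.expectation (map_pmf (Cons (Suc s + d, u)) (?q v)) (tot d w)
        = w (Suc s) u + measure_pmf.expectation (?q v) (tot (Suc d) w)"
      if "v \<in> insert None (Some ` NN)" for v
      using finite_vpo[OF that] by (simp add: integrable_measure_pmf_finite)
    have "measure_pmf.expectation (vp g (Suc s) d u) (tot d w)
      = measure_pmf.expectation (embed_spmf (p u)) (\<lambda>v. measure_pmf.expectation (map_pmf (Cons (Suc s + d, u)) (?q v)) (tot d w))"
    proof -
      have "vp g (Suc s) d u = bind_pmf (embed_spmf (p u)) (\<lambda>v. map_pmf (Cons (Suc s + d, u)) (?q v))"
        using True by (simp add: vpo_def)
      then show ?thesis
        using finite_embed[OF Suc.prems] set_embed[OF Suc.prems] finite_vpo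
        by (simp only:, intro expectation_bind_finite) auto
    qed
    also have "\<dots> = measure_pmf.expectation (embed_spmf (p u)) (\<lambda>v. w (Suc s) u + measure_pmf.expectation (?q v) (tot (Suc d) w))"
      using set_embed[OF Suc.prems] E by (intro expectation_cong) auto
    also have "\<dots> = w (Suc s) u + (\<Sum>v\<in>NN. p u v * U g w s v)"
      using Suc.IH by (simp add: expectation_embed[OF Suc.prems] vpo_def algebra_simps sum.distrib flip: sum_distrib_left sum_distrib_right)
    finally show ?thesis using True by simp
  next
    case False
    then show ?thesis using Suc by simp
  qed
qed simp

text \<open>After an entry of score \<open>y\<close> there are \<open>y - d - 1\<close> steps left
  and one more play has been made, so the next score is again at most \<open>y\<close>. This is why
  scores decrease weakly along a list, and why choosing the largest head never conflicts with the
  order of the plays of one arm.\<close>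

fun play_list :: "nat \<Rightarrow> nat \<Rightarrow> (nat \<times> 'u) list \<Rightarrow> bool" where
  "play_list s d [] = True"
| "play_list s d ((y, u) # L) = (d + 1 \<le> y \<and> y \<le> s + d \<and> u \<in> NN \<and> play_list (y - d - 1) (Suc d) L)"

lemma play_list_mono: "play_list s d L \<Longrightarrow> s \<le> s' \<Longrightarrow> play_list s' d L"
  by (cases L; cases "hd L") auto

lemma vp_play_list: "u \<in> NN \<Longrightarrow> L \<in> set_pmf (vp g s d u) \<Longrightarrow> play_list s d L"
proof (induction s arbitrary: d u L)
  case (Suc s)
  show ?case
  proof (cases "g (Suc s) u")
    case True
    with Suc.prems obtain v L' where v: "v \<in> set_pmf (embed_spmf (p u))" and L: "L = (Suc s + d, u) # L'"
      and L': "L' \<in> set_pmf (case v of None \<Rightarrow> return_pmf [] | Some v \<Rightarrow> vp g s (Suc d) v)" by auto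
    have "play_list s (Suc d) L'"
      using L' v Suc.IH set_embed[OF Suc.prems(1)] by (cases v) auto
    then show ?thesis using L Suc.prems by simp
  next
    case False
    with Suc have "play_list s d L" by simp
    then show ?thesis by (rule play_list_mono) simp
  qed
qed simp

lemma play_list_nth:
  "play_list s d L \<Longrightarrow> e < length L \<Longrightarrow> d + e + 1 \<le> fst (L ! e) \<and> fst (L ! e) \<le> s + d \<and> snd (L ! e) \<in> NN"
proof (induction L arbitrary: s d e)
  case (Cons a L)
  obtain y u where a: "a = (y, u)" by (cases a)
  show ?case
  proof (cases e)
    case (Suc e')
    with Cons.IH[of "y - d - 1" "Suc d" e'] Cons.prems show ?thesis by (auto simp: a)
  qed (use Cons.prems a in auto)
qed simp

lemma play_list_sorted:
  "play_list s d L \<Longrightarrow> e \<le> e' \<Longrightarrow> e' < length L \<Longrightarrow> fst (L ! e') \<le> fst (L ! e)"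
proof (induction L arbitrary: s d e e')
  case (Cons a L)
  obtain y u where a: "a = (y, u)" by (cases a)
  show ?case
  proof (cases e)
    case (Suc k)
    then obtain k' where "e' = Suc k'" using Cons.prems by (cases e') auto
    with Suc Cons.IH[of "y - d - 1" "Suc d" k k'] Cons.prems show ?thesis by (auto simp: a)
  next
    case 0
    show ?thesis
    proof (cases e')
      case (Suc k')
      with play_list_nth[of "y - d - 1" "Suc d" L k'] Cons.prems 0 show ?thesis by (auto simp: a)
    qed (use 0 in auto)
  qed
qed simp

lemma vp_nx_zero: "nx g s u = 0 \<Longrightarrow> vp g s d u = return_pmf []"
  by (induction s) (auto split: if_splits)

lemma vp_nx_pos: "nx g s u \<noteq> 0 \<Longrightarrow> vp g s d u =
  bind_pmf (embed_spmf (p u)) (\<lambda>v. map_pmf (Cons (nx g s u + d, u)) (vpo g (nx g s u - 1) (Suc d) v))"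
  by (induction s) (auto simp: vp_Suc simp del: vp.simps(2) split: if_splits)

section \<open>Merging the virtual plays\<close>

text \<open>The clairvoyant counterpart of the policy: the reward of at most \<open>k\<close> real
  plays when all virtual lists are given in advance.\<close>

primrec merge :: "nat \<Rightarrow> (nat \<Rightarrow> (nat \<times> 'u) list) \<Rightarrow> real" where
  "merge 0 L = 0"
| "merge (Suc k) L = (let i = snd (pick (\<lambda>i. hdscore (L i)) n) in
     if i = 0 then 0 else r (snd (hd (L i))) + merge k (L(i := tl (L i))))"

definition sorted_plays :: "(nat \<times> 'u) list \<Rightarrow> bool" where
  "sorted_plays L \<longleftrightarrow> (\<forall>e<length L. 0 < fst (L ! e) \<and> snd (L ! e) \<in> NN) \<and>
     (\<forall>e' <length L. \<forall>e\<le>e'. fst (L ! e') \<le> fst (L ! e))"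

lemma sorted_plays_tl: "sorted_plays (a # L) \<Longrightarrow> sorted_plays L"
proof -
  assume h: "sorted_plays (a # L)"
  have 1: "0 < fst (L ! e) \<and> snd (L ! e) \<in> NN" if "e < length L" for e
    using h that unfolding sorted_plays_def by (metis Suc_less_eq length_Cons nth_Cons_Suc)
  have 2: "fst (L ! e') \<le> fst (L ! e)" if "e' < length L" "e \<le> e'" for e e'
  proof -
    have "Suc e' < length (a # L)" "Suc e \<le> Suc e'" using that by auto
    then have "fst ((a # L) ! Suc e') \<le> fst ((a # L) ! Suc e)" using h unfolding sorted_plays_def by blast
    then show ?thesis by simp
  qed
  show "sorted_plays L" unfolding sorted_plays_def using 1 2 by blast
qed

text \<open>Removing the largest head lowers the rank of every remaining play by one, because this
  head is counted in all of these ranks. So a play of rank below \<open>k\<close> comes up within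
  \<open>k\<close> rounds.\<close>

lemma merge_ge:
  assumes "\<And>i. i \<in> {1..n} \<Longrightarrow> sorted_plays (L i)"
  shows "(\<Sum>i=1..n. \<Sum>e<length (L i). r (snd (L i ! e)) * of_bool (rank n L i e < k)) \<le> merge k L"
  using assms
proof (induction k arbitrary: L)
  case (Suc k)
  define i0 where "i0 = snd (pick (\<lambda>i. hdscore (L i)) n)"
  show ?case
  proof (cases "i0 = 0")
    case True
    have "L i = []" if "i \<in> {1..n}" for i
    proof -
      have "hdscore (L i) = 0" using pick_le[of i n "\<lambda>i. hdscore (L i)"] pick_zero[of "\<lambda>i. hdscore (L i)" n] True that
        by (auto simp: i0_def)
      then show ?thesis using Suc.prems[OF that] by (cases "L i") (auto simp: hdscore_def sorted_plays_def)
    qed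
    then show ?thesis using True by (simp add: i0_def)
  next
    case False
    have i0: "i0 \<in> {1..n}" "hdscore (L i0) > 0" and mx: "\<And>j. j \<in> {1..n} \<Longrightarrow> hdscore (L j) \<le> hdscore (L i0)"
      using False pick_arm[of "\<lambda>i. hdscore (L i)" n] pick_le[of _ n "\<lambda>i. hdscore (L i)"] by (auto simp: i0_def)
    then obtain a L0 where L0: "L i0 = a # L0" by (cases "L i0") (auto simp: hdscore_def)
    define L' where "L' = L(i0 := L0)"
    have L'[simp]: "L' i0 = L0" "\<And>i. i \<noteq> i0 \<Longrightarrow> L' i = L i" by (auto simp: L'_def)
    have sorted': "sorted_plays (L' i)" if "i \<in> {1..n}" for i
      using Suc.prems[OF that] L0 sorted_plays_tl by (cases "i = i0") auto
    have own: "rank n L i0 (Suc e) = Suc (rank n L' i0 e)" for e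
    proof -
      have "(\<Sum>j\<in>{1..n} - {i0}. card {e'. e' < length (L j) \<and> fst (L i0 ! Suc e) \<le> fst (L j ! e')})
        = (\<Sum>j\<in>{1..n} - {i0}. card {e'. e' < length (L' j) \<and> fst (L' i0 ! e) \<le> fst (L' j ! e')})"
        using L0 by (intro sum.cong) auto
      then show ?thesis unfolding rank_def by simp
    qed
    have other: "rank n L i e = Suc (rank n L' i e)" if i: "i \<in> {1..n}" "i \<noteq> i0" "e < length (L i)" for i e
    proof -
      let ?y = "fst (L i ! e)"
      have "?y \<le> hdscore (L i)"
        using Suc.prems[OF i(1)] i(3) hdscore_nth[of "L i"] unfolding sorted_plays_def by (metis le0 length_0_conv less_nat_zero_code)
      then have y: "?y \<le> fst a" using mx[OF i(1)] L0 by (simp add: hdscore_def)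
      have "{e'. e' < length (L i0) \<and> ?y \<le> fst (L i0 ! e')} = insert 0 (Suc ` {e'. e' < length L0 \<and> ?y \<le> fst (L0 ! e')})"
      proof (rule set_eqI)
        fix x show "(x \<in> {e'. e' < length (L i0) \<and> ?y \<le> fst (L i0 ! e')}) \<longleftrightarrow>
          x \<in> insert 0 (Suc ` {e'. e' < length L0 \<and> ?y \<le> fst (L0 ! e')})"
          using y by (cases x) (auto simp: L0)
      qed
      then have c: "card {e'. e' < length (L i0) \<and> ?y \<le> fst (L i0 ! e')} = Suc (card {e'. e' < length L0 \<and> ?y \<le> fst (L0 ! e')})"
        by (simp add: card_image)
      let ?c = "\<lambda>L j. card {e'. e' < length (L j) \<and> ?y \<le> fst (L j ! e')}"
      have A: "(\<Sum>j\<in>{1..n} - {i}. ?c M j) = ?c M i0 + (\<Sum>j\<in>{1..n} - {i} - {i0}. ?c M j)" for M :: "nat \<Rightarrow> (nat \<times> 'u) list"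
        by (rule sum.remove) (use i0 i in auto)
      have "(\<Sum>j\<in>{1..n} - {i} - {i0}. ?c L j) = (\<Sum>j\<in>{1..n} - {i} - {i0}. ?c L' j)"
        by (intro sum.cong) auto
      with A[of L] A[of L'] c have "(\<Sum>j\<in>{1..n} - {i}. ?c L j) = Suc (\<Sum>j\<in>{1..n} - {i}. ?c L' j)" by simp
      then show ?thesis using i unfolding rank_def by simp
    qed
    let ?t = "\<lambda>k L i e. r (snd (L i ! e)) * of_bool (rank n L i e < k)"
    have "snd (L i0 ! 0) \<in> NN"
      using Suc.prems[OF i0(1)] L0 unfolding sorted_plays_def by (metis length_greater_0_conv list.distinct(1))
    then have nn: "0 \<le> r (snd a)" using L0 by (simp add: reward_nonneg)
    have "(\<Sum>i=1..n. \<Sum>e<length (L i). ?t (Suc k) L i e)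
      = (\<Sum>e<length (L i0). ?t (Suc k) L i0 e) + (\<Sum>i\<in>{1..n} - {i0}. \<Sum>e<length (L i). ?t (Suc k) L i e)"
      by (rule sum.remove) (use i0 in auto)
    also have "(\<Sum>i\<in>{1..n} - {i0}. \<Sum>e<length (L i). ?t (Suc k) L i e) = (\<Sum>i\<in>{1..n} - {i0}. \<Sum>e<length (L' i). ?t k L' i e)"
      by (intro sum.cong) (auto simp: other)
    also have "(\<Sum>e<length (L i0). ?t (Suc k) L i0 e) = ?t (Suc k) L i0 0 + (\<Sum>e<length L0. ?t k L' i0 e)"
      using L0 by (simp add: sum.lessThan_Suc_shift own del: sum.lessThan_Suc)
    also have "?t (Suc k) L i0 0 \<le> r (snd a)" using nn L0 by simp
    also have "r (snd a) + (\<Sum>e<length L0. ?t k L' i0 e) + (\<Sum>i\<in>{1..n} - {i0}. \<Sum>e<length (L' i). ?t k L' i e)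
        = r (snd a) + (\<Sum>i=1..n. \<Sum>e<length (L' i). ?t k L' i e)"
    proof -
      have "(\<Sum>i=1..n. \<Sum>e<length (L' i). ?t k L' i e)
        = (\<Sum>e<length (L' i0). ?t k L' i0 e) + (\<Sum>i\<in>{1..n} - {i0}. \<Sum>e<length (L' i). ?t k L' i e)"
        by (rule sum.remove) (use i0 in auto)
      then show ?thesis by simp
    qed
    also have "\<dots> \<le> r (snd a) + merge k L'" using Suc.IH[OF sorted'] by simp
    also have "\<dots> = merge (Suc k) L" using False L0 by (simp add: i0_def[symmetric] Let_def L'_def)
    finally show ?thesis by simp
  qed
qed simp

end

lemma finite_set_Pi_pmf:
  assumes "finite A" "\<And>j. j \<in> A \<Longrightarrow> finite (set_pmf (q j))"
  shows "finite (set_pmf (Pi_pmf A d q))"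
  using assms by (auto simp: set_Pi_pmf intro!: finite_PiE_dflt)

lemma expectation_Pi_split:
  fixes F :: "('i \<Rightarrow> 'b) \<Rightarrow> real"
  assumes "finite A" "i \<notin> A" "\<And>j. j \<in> insert i A \<Longrightarrow> finite (set_pmf (q j))"
  shows "measure_pmf.expectation (Pi_pmf (insert i A) d q) F
    = measure_pmf.expectation (q i) (\<lambda>x. measure_pmf.expectation (Pi_pmf A d q) (\<lambda>f. F (f(i := x))))"
  using assms finite_set_Pi_pmf[of A q d]
  by (subst Pi_pmf_insert') (auto simp: expectation_bind_finite)

lemma expectation_add_const:
  fixes F :: "'a \<Rightarrow> real"
  assumes "finite (set_pmf p)"
  shows "measure_pmf.expectation p (\<lambda>x. c + F x) = c + measure_pmf.expectation p F"
  using assms by (simp add: integrable_measure_pmf_finite)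

text \<open>Per arm: the steps left in its virtual time, the number of plays made, and the current
  position.\<close>

type_synonym 'u ctrl = "(nat \<Rightarrow> nat) \<times> (nat \<Rightarrow> nat) \<times> (nat \<Rightarrow> 'u option)"

context mab
begin

section \<open>The online policy\<close>

definition nxt :: "(nat \<Rightarrow> nat \<Rightarrow> 'u \<Rightarrow> bool) \<Rightarrow> 'u ctrl \<Rightarrow> nat \<Rightarrow> nat" where
  "nxt G st i = (case snd (snd st) i of None \<Rightarrow> 0 | Some u \<Rightarrow> nx (G i) (fst st i) u)"

definition score :: "(nat \<Rightarrow> nat \<Rightarrow> 'u \<Rightarrow> bool) \<Rightarrow> 'u ctrl \<Rightarrow> nat \<Rightarrow> nat" where
  "score G st i = (if nxt G st i = 0 then 0 else nxt G st i + fst (snd st) i)"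

definition sel :: "(nat \<Rightarrow> nat \<Rightarrow> 'u \<Rightarrow> bool) \<Rightarrow> 'u ctrl \<Rightarrow> nat" where
  "sel G st = snd (pick (score G st) n)"

definition upd :: "(nat \<Rightarrow> nat \<Rightarrow> 'u \<Rightarrow> bool) \<Rightarrow> 'u ctrl \<Rightarrow> nat \<Rightarrow> 'u option \<Rightarrow> 'u ctrl" where
  "upd G st i v = ((fst st)(i := nxt G st i - 1), (fst (snd st))(i := fst (snd st) i + 1), (snd (snd st))(i := v))"

primrec run :: "nat \<Rightarrow> (nat \<Rightarrow> nat \<Rightarrow> 'u \<Rightarrow> bool) \<Rightarrow> 'u ctrl \<Rightarrow> 'u env \<Rightarrow> real" where
  "run 0 G st e = gained e"
| "run (Suc k) G st e = measure_pmf.expectation (pull I (sel G st) e)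
     (\<lambda>(v, e'). run k G (upd G st (sel G st) v) e')"

definition law :: "(nat \<Rightarrow> nat \<Rightarrow> 'u \<Rightarrow> bool) \<Rightarrow> 'u ctrl \<Rightarrow> nat \<Rightarrow> (nat \<times> 'u) list pmf" where
  "law G st i = vpo (G i) (fst st i) (fst (snd st) i) (snd (snd st) i)"

text \<open>The score of the next play is determined before its transition is drawn, so the
  comparisons of heads made by \<open>merge\<close> can be made online.\<close>

lemma hdscore_law:
  assumes "L \<in> set_pmf (law G st i)" shows "hdscore L = score G st i"
proof (cases "snd (snd st) i")
  case None
  then show ?thesis using assms by (simp add: law_def vpo_def score_def nxt_def hdscore_def)
next
  case (Some u)
  then show ?thesis using assms
    by (cases "nx (G i) (fst st i) u = 0")
      (auto simp: law_def vpo_def score_def nxt_def hdscore_def vp_nx_zero vp_nx_pos)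
qed

lemma finite_law: "snd (snd st) i \<in> insert None (Some ` NN) \<Longrightarrow> finite (set_pmf (law G st i))"
  unfolding law_def by (rule finite_vpo)

lemma pick_law:
  assumes "L \<in> set_pmf (Pi_pmf {1..n} [] (law G st))"
  shows "snd (pick (\<lambda>i. hdscore (L i)) n) = sel G st"
proof -
  have "hdscore (L i) = score G st i" if "i \<in> {1..n}" for i
    using assms that hdscore_law by (auto simp: set_Pi_pmf PiE_dflt_def)
  then show ?thesis unfolding sel_def by (subst pick_cong[of n _ "score G st"]) auto
qed

text \<open>Deferred decisions: the lists of the arms are independent and the selected arm depends
  only on their heads. Hence drawing each transition at the moment of the pull gives the same
  expectation as drawing all lists beforehand.\<close>

lemma run_merge:
  assumes "elapsed e + k \<le> B" "\<And>i. i \<in> {1..n} \<Longrightarrow> position e i = snd (snd st) i"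
    "\<And>i. i \<in> {1..n} \<Longrightarrow> snd (snd st) i \<in> insert None (Some ` NN)" "position e 0 = None"
  shows "run k G st e = gained e + measure_pmf.expectation (Pi_pmf {1..n} [] (law G st)) (merge k)"
  using assms
proof (induction k arbitrary: st e)
  case 0
  have "merge 0 = (\<lambda>_. 0)" by auto
  then show ?case by simp
next
  case (Suc k)
  define i where "i = sel G st"
  have fin: "finite (set_pmf (law G st j))" if "j \<in> {1..n}" for j
    using Suc.prems(3)[OF that] by (rule finite_law)
  have el: "\<not> elapsed e \<ge> B" using Suc.prems(1) by simp
  show ?case
  proof (cases "i = 0")
    case True
    have pl: "pull I i e = return_pmf (None, e\<lparr>elapsed := elapsed e + 1\<rparr>)"
      using True Suc.prems(4) el by (simp add: pull_def)
    \<comment> \<open>No arm has a virtual play left, so \<open>merge\<close> stops here whatever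
      the number of remaining steps.\<close>
    have zero: "measure_pmf.expectation (Pi_pmf {1..n} [] (law G st)) (merge k) = 0" for k
    proof -
      have "measure_pmf.expectation (Pi_pmf {1..n} [] (law G st)) (merge k)
        = measure_pmf.expectation (Pi_pmf {1..n} [] (law G st)) (\<lambda>_. 0)"
        using pick_law[of _ G st] True by (intro expectation_cong) (cases k; simp add: i_def)
      then show ?thesis by simp
    qed
    have lawc: "Pi_pmf {1..n} [] (law G (upd G st i None)) = Pi_pmf {1..n} [] (law G st)"
      using True by (intro Pi_pmf_cong) (auto simp: law_def upd_def)
    have "run (Suc k) G st e = run k G (upd G st i None) (e\<lparr>elapsed := elapsed e + 1\<rparr>)"
      by (simp add: i_def[symmetric] pl)
    also have "\<dots> = gained e + measure_pmf.expectation (Pi_pmf {1..n} [] (law G (upd G st i None))) (merge k)"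
      using Suc.prems True by (subst Suc.IH) (auto simp: upd_def)
    finally show ?thesis unfolding lawc zero .
  next
    case False
    then have i: "i \<in> {1..n}" and sc: "score G st i > 0"
      using pick_arm[of "score G st" n] by (auto simp: i_def sel_def)
    define a where "a = nxt G st i"
    have a: "a \<noteq> 0" using sc by (auto simp: score_def a_def split: if_splits)
    then obtain u where u: "snd (snd st) i = Some u" and au: "a = nx (G i) (fst st i) u"
      by (auto simp: a_def nxt_def split: option.splits)
    have uN: "u \<in> NN" using Suc.prems(3)[OF i] u by auto
    define d where "d = fst (snd st) i"
    define A where "A = {1..n} - {i}"
    have A: "finite A" "i \<notin> A" "insert i A = {1..n}" using i by (auto simp: A_def)
    define E where "E = Pi_pmf A [] (law G st)"
    have finA: "finite (set_pmf (law G st j))" if "j \<in> insert i A" for j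
      using that fin unfolding A(3) by blast
    have finE: "finite (set_pmf E)" unfolding E_def using A(1) finA by (intro finite_set_Pi_pmf) auto
    define q where "q v = vpo (G i) (a - 1) (Suc d) v" for v
    define env' where "env' v = \<lparr>elapsed = elapsed e + 1, position = (position e)(i := v), gained = gained e + r u\<rparr>" for v
    have pl: "pull I i e = map_pmf (\<lambda>v. (v, env' v)) (embed_spmf (p u))"
      using el Suc.prems(2)[OF i] u by (simp add: pull_def env'_def)
    have lawi: "law G st i = bind_pmf (embed_spmf (p u)) (\<lambda>v. map_pmf (Cons (a + d, u)) (q v))"
      using a u by (simp add: law_def vpo_def[of _ _ _ "Some u"] vp_nx_pos au d_def q_def)
    have supp: "v \<in> insert None (Some ` NN)" if "v \<in> set_pmf (embed_spmf (p u))" for v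
      using that set_embed[OF uN] by blast
    have finq: "finite (set_pmf (q v))" if "v \<in> set_pmf (embed_spmf (p u))" for v
      unfolding q_def using supp[OF that] by (rule finite_vpo)
    have step: "run k G (upd G st i v) (env' v) = gained e + r u +
        measure_pmf.expectation (q v) (\<lambda>y. measure_pmf.expectation E (\<lambda>f. merge k (f(i := y))))"
      if v: "v \<in> set_pmf (embed_spmf (p u))" for v
    proof -
      have "run k G (upd G st i v) (env' v)
        = gained (env' v) + measure_pmf.expectation (Pi_pmf (insert i A) [] (law G (upd G st i v))) (merge k)"
        unfolding A using Suc.prems i supp[OF v] by (intro Suc.IH) (auto simp: upd_def env'_def)
      also have "measure_pmf.expectation (Pi_pmf (insert i A) [] (law G (upd G st i v))) (merge k)
        = measure_pmf.expectation (law G (upd G st i v) i)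
           (\<lambda>y. measure_pmf.expectation (Pi_pmf A [] (law G (upd G st i v))) (\<lambda>f. merge k (f(i := y))))"
      proof (rule expectation_Pi_split[OF A(1,2)])
        fix j assume "j \<in> insert i A"
        then show "finite (set_pmf (law G (upd G st i v) j))"
          using A Suc.prems(3) supp[OF v] by (intro finite_law) (auto simp: upd_def)
      qed
      also have "law G (upd G st i v) i = q v" by (simp add: law_def upd_def q_def a_def d_def)
      also have "Pi_pmf A [] (law G (upd G st i v)) = E"
        unfolding E_def using A by (intro Pi_pmf_cong) (auto simp: law_def upd_def)
      finally show ?thesis by (simp add: env'_def fun_upd_def)
    qed
    have inner: "merge (Suc k) (f(i := (a + d, u) # y)) = r u + merge k (f(i := y))"
      if v: "v \<in> set_pmf (embed_spmf (p u))" and y: "y \<in> set_pmf (q v)" and f: "f \<in> set_pmf E" for v y f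
    proof -
      have "f(i := (a + d, u) # y) \<in> set_pmf (Pi_pmf {1..n} [] (law G st))"
        using f v y A unfolding E_def A(3)[symmetric] by (auto simp: set_Pi_pmf PiE_dflt_def lawi)
      then have "snd (pick (\<lambda>j. hdscore ((f(i := (a + d, u) # y)) j)) n) = i"
        using pick_law i_def by blast
      then show ?thesis using False by (simp add: Let_def)
    qed
    have "run (Suc k) G st e = measure_pmf.expectation (embed_spmf (p u)) (\<lambda>v. run k G (upd G st i v) (env' v))"
      by (simp add: i_def[symmetric] pl)
    also have "\<dots> = measure_pmf.expectation (embed_spmf (p u)) (\<lambda>v. gained e + r u +
        measure_pmf.expectation (q v) (\<lambda>y. measure_pmf.expectation E (\<lambda>f. merge k (f(i := y)))))"
      using step by (rule expectation_cong)
    also have "\<dots> = measure_pmf.expectation (embed_spmf (p u)) (\<lambda>v. gained e +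
        measure_pmf.expectation (q v) (\<lambda>y. measure_pmf.expectation E (\<lambda>f. merge (Suc k) (f(i := (a + d, u) # y)))))"
    proof (rule expectation_cong)
      fix v assume v: "v \<in> set_pmf (embed_spmf (p u))"
      have "measure_pmf.expectation (q v) (\<lambda>y. measure_pmf.expectation E (\<lambda>f. merge (Suc k) (f(i := (a + d, u) # y))))
        = measure_pmf.expectation (q v) (\<lambda>y. measure_pmf.expectation E (\<lambda>f. r u + merge k (f(i := y))))"
        using inner[OF v] by (intro expectation_cong) auto
      also have "\<dots> = r u + measure_pmf.expectation (q v) (\<lambda>y. measure_pmf.expectation E (\<lambda>f. merge k (f(i := y))))"
        using finq[OF v] finE by (simp only: expectation_add_const)
      finally show "gained e + r u + measure_pmf.expectation (q v) (\<lambda>y. measure_pmf.expectation E (\<lambda>f. merge k (f(i := y))))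
        = gained e + measure_pmf.expectation (q v) (\<lambda>y. measure_pmf.expectation E (\<lambda>f. merge (Suc k) (f(i := (a + d, u) # y))))"
        by simp
    qed
    also have "\<dots> = gained e + measure_pmf.expectation (embed_spmf (p u)) (\<lambda>v.
        measure_pmf.expectation (q v) (\<lambda>y. measure_pmf.expectation E (\<lambda>f. merge (Suc k) (f(i := (a + d, u) # y)))))"
      using finite_embed[OF uN] by (simp only: expectation_add_const)
    also have "measure_pmf.expectation (embed_spmf (p u)) (\<lambda>v.
        measure_pmf.expectation (q v) (\<lambda>y. measure_pmf.expectation E (\<lambda>f. merge (Suc k) (f(i := (a + d, u) # y)))))
      = measure_pmf.expectation (law G st i) (\<lambda>x. measure_pmf.expectation E (\<lambda>f. merge (Suc k) (f(i := x))))"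
      unfolding lawi using finite_embed[OF uN] finq
      by (subst expectation_bind_finite) (simp_all del: merge.simps)
    also have "\<dots> = measure_pmf.expectation (Pi_pmf {1..n} [] (law G st)) (merge (Suc k))"
      unfolding E_def A(3)[symmetric] using A(1,2) finA by (subst expectation_Pi_split) (auto simp del: merge.simps)
    finally show ?thesis .
  qed
qed

definition ctrl0 :: "'u ctrl" where
  "ctrl0 = (\<lambda>_. B, \<lambda>_. 0, position (init_env I))"

lemma position_init: "position (init_env I) i \<in> insert None (Some ` NN)"
  by (auto simp: init_env_def root_in)

definition ctrl_of :: "(nat \<Rightarrow> nat \<Rightarrow> 'u \<Rightarrow> bool) \<Rightarrow> 'u history \<Rightarrow> 'u ctrl" where
  "ctrl_of G h = foldl (\<lambda>st (i, v). upd G st i v) ctrl0 h"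

definition reward_bound :: real where "reward_bound = (\<Sum>u\<in>NN. r u)"

lemma reward_le: "u \<in> NN \<Longrightarrow> r u \<le> reward_bound"
  unfolding reward_bound_def using finite_nodes reward_nonneg by (intro member_le_sum) auto

lemma pull_support:
  assumes "\<forall>j. position e j \<in> insert None (Some ` NN)"
  shows "finite (set_pmf (pull I i e))"
    and "(v, e') \<in> set_pmf (pull I i e) \<Longrightarrow> (\<forall>j. position e' j \<in> insert None (Some ` NN)) \<and> gained e' \<le> gained e + reward_bound"
proof -
  have nn: "0 \<le> reward_bound" unfolding reward_bound_def by (intro sum_nonneg reward_nonneg)
  have "finite (set_pmf (pull I i e)) \<and> (\<forall>(v, e') \<in> set_pmf (pull I i e).
     (\<forall>j. position e' j \<in> insert None (Some ` NN)) \<and> gained e' \<le> gained e + reward_bound)"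
  proof (cases "elapsed e \<ge> B \<or> position e i = None")
    case True
    then show ?thesis using assms nn by (auto simp: pull_def split: option.splits)
  next
    case False
    then obtain u where u: "position e i = Some u" by auto
    with assms have uN: "u \<in> NN" by (metis image_iff insertE option.distinct(1) option.inject)
    have "pull I i e = map_pmf (\<lambda>v. (v, \<lparr>elapsed = elapsed e + 1, position = (position e)(i := v),
                    gained = gained e + r u\<rparr>)) (embed_spmf (p u))" using False u by (simp add: pull_def)
    then show ?thesis using finite_embed[OF uN] set_embed[OF uN] reward_le[OF uN] assms by auto
  qed
  then show "finite (set_pmf (pull I i e))"
    and "(v, e') \<in> set_pmf (pull I i e) \<Longrightarrow> (\<forall>j. position e' j \<in> insert None (Some ` NN)) \<and> gained e' \<le> gained e + reward_bound"
    by blast+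
qed

lemma play_support:
  "finite (set_pmf (play I \<pi> k)) \<and> (\<forall>(h, e) \<in> set_pmf (play I \<pi> k).
     (\<forall>j. position e j \<in> insert None (Some ` NN)) \<and> gained e \<le> real k * reward_bound)"
proof (induction k)
  case 0
  then show ?case using position_init by (simp add: init_env_def)
next
  case (Suc k)
  have 1: "finite (set_pmf (play I \<pi> (Suc k)))"
    using Suc pull_support(1) by (auto simp: case_prod_unfold)
  have 2: "(\<forall>j. position e j \<in> insert None (Some ` NN)) \<and> gained e \<le> real (Suc k) * reward_bound"
    if he: "(h, e) \<in> set_pmf (play I \<pi> (Suc k))" for h e
  proof -
    from he obtain h1 e1 v where 1: "(h1, e1) \<in> set_pmf (play I \<pi> k)" and 2: "(v, e) \<in> set_pmf (pull I (\<pi> h1) e1)"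
      by (auto simp: case_prod_unfold)
    from Suc 1 have e1: "\<forall>j. position e1 j \<in> insert None (Some ` NN)" "gained e1 \<le> real k * reward_bound" by blast+
    with pull_support(2)[OF e1(1) 2] show ?thesis by (auto simp: algebra_simps)
  qed
  from 1 2 show ?case by blast
qed

text \<open>A crude bound, serving to show that the supremum in \<open>opt_policy\<close> is taken
  over a bounded set.\<close>

lemma policy_value_le: "policy_value I \<pi> \<le> real B * reward_bound"
proof -
  have "policy_value I \<pi> \<le> measure_pmf.expectation (play I \<pi> B) (\<lambda>_. real B * reward_bound)"
    unfolding policy_value_def using play_support[of \<pi> B] by (intro expectation_mono) auto
  then show ?thesis by simp
qed

lemma policy_value_le_opt: "policy_value I \<pi> \<le> opt_policy I"
  unfolding opt_policy_def using policy_value_le by (intro cSUP_upper bdd_aboveI2) auto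

text \<open>The control state is a function of the history, so for fixed tables \<open>run\<close>
  is the value of a deterministic adaptive policy. The generalization over \<open>k\<close> and
  \<open>j\<close> cuts the process after \<open>k\<close> steps.\<close>

lemma policy_value_run:
  "policy_value I (\<lambda>h. sel G (ctrl_of G h)) = run B G ctrl0 (init_env I)"
proof -
  let ?\<pi> = "\<lambda>h. sel G (ctrl_of G h)"
  have "measure_pmf.expectation (play I ?\<pi> k) (\<lambda>(h, e). run j G (ctrl_of G h) e) = run (k + j) G ctrl0 (init_env I)" for k j
  proof (induction k arbitrary: j)
    case 0
    then show ?case by (simp add: ctrl_of_def)
  next
    case (Suc k)
    have "measure_pmf.expectation (play I ?\<pi> (Suc k)) (\<lambda>(h, e). run j G (ctrl_of G h) e)
      = measure_pmf.expectation (play I ?\<pi> k) (\<lambda>(h, e). measure_pmf.expectation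
          (pull I (?\<pi> h) e) (\<lambda>(v, e'). run j G (ctrl_of G (h @ [(?\<pi> h, v)])) e'))"
    proof -
      have "measure_pmf.expectation (bind_pmf (pull I (?\<pi> h) e) (\<lambda>(v, e'). return_pmf (h @ [(?\<pi> h, v)], e'))) (\<lambda>(h, e). run j G (ctrl_of G h) e)
        = measure_pmf.expectation (pull I (?\<pi> h) e) (\<lambda>(v, e'). run j G (ctrl_of G (h @ [(?\<pi> h, v)])) e')"
        if "(h, e) \<in> set_pmf (play I ?\<pi> k)" for h e
        using that play_support[of ?\<pi> k] pull_support(1)[of e]
        by (subst expectation_bind_finite) (auto simp: case_prod_unfold)
      moreover have "finite (set_pmf (bind_pmf (pull I (?\<pi> h) e) (\<lambda>(v, e'). return_pmf (h @ [(?\<pi> h, v)], e'))))"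
        if "(h, e) \<in> set_pmf (play I ?\<pi> k)" for h e
        using that play_support[of ?\<pi> k] pull_support(1)[of e] by (auto simp: case_prod_unfold)
      ultimately show ?thesis using play_support[of ?\<pi> k]
        by (simp only: play.simps, subst expectation_bind_finite) (auto intro!: expectation_cong)
    qed
    also have "\<dots> = measure_pmf.expectation (play I ?\<pi> k) (\<lambda>(h, e). run (Suc j) G (ctrl_of G h) e)"
      by (simp add: ctrl_of_def)
    also have "\<dots> = run (Suc k + j) G ctrl0 (init_env I)" using Suc.IH[of "Suc j"] by simp
    finally show ?case .
  qed
  from this[of B 0] show ?thesis by (simp add: policy_value_def)
qed

section \<open>Analysis of the online policy\<close>

definition tabs :: "(nat \<Rightarrow> nat) \<Rightarrow> nat \<Rightarrow> nat \<Rightarrow> 'u \<Rightarrow> bool" where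
  "tabs c i = (if c i < KK then table rate (c i) else (\<lambda>_ _. False))"

text \<open>One uniform number answers two questions: below \<open>KK\<close>, which has probability
  \<open>1 / 3\<close>, it is the number of a table, and otherwise the arm stays idle. The program
  thus needs one \<open>Rand\<close> per arm.\<close>

definition coin :: "nat pmf" where "coin = pmf_of_set {..<3 * KK}"

definition vlaw :: "nat \<Rightarrow> (nat \<times> 'u) list pmf" where
  "vlaw i = bind_pmf coin (\<lambda>c. vp (if c < KK then table rate c else (\<lambda>_ _. False)) B 0 (rt i))"

lemma finite_coin: "finite (set_pmf coin)" and set_coin: "set_pmf coin = {..<3 * KK}"
  using KK_pos by (auto simp: coin_def set_pmf_of_set lessThan_empty_iff)

lemma expectation_coin: "measure_pmf.expectation coin f = (\<Sum>c<3 * KK. f c) / (3 * real KK)"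
  using KK_pos by (simp add: coin_def integral_pmf_of_set lessThan_empty_iff)

lemma vp_False: "vp (\<lambda>_ _. False) s d u = return_pmf []"
  by (induction s) auto

lemma finite_vlaw: "i \<in> {1..n} \<Longrightarrow> finite (set_pmf (vlaw i))"
  using finite_coin finite_vp[OF root_in] by (simp add: vlaw_def)

lemma play_list_vlaw: "i \<in> {1..n} \<Longrightarrow> L \<in> set_pmf (vlaw i) \<Longrightarrow> play_list B 0 L"
  using vp_play_list[OF root_in] by (auto simp: vlaw_def)

lemma expectation_vlaw:
  assumes i: "i \<in> {1..n}" and F: "F [] = 0"
  shows "measure_pmf.expectation (vlaw i) F
    = (\<Sum>k<KK. measure_pmf.expectation (vp (table rate k) B 0 (rt i)) F) / (3 * real KK)"
proof -
  let ?g = "\<lambda>c. if c < KK then table rate c else (\<lambda>_ _. False)"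
  let ?h = "\<lambda>c. measure_pmf.expectation (vp (?g c) B 0 (rt i)) F"
  have "measure_pmf.expectation (vlaw i) F = measure_pmf.expectation coin ?h"
    unfolding vlaw_def using finite_coin finite_vp[OF root_in[OF i]] by (intro expectation_bind_finite) auto
  also have "\<dots> = (\<Sum>c<3 * KK. ?h c) / (3 * real KK)" by (rule expectation_coin)
  also have "(\<Sum>c<3 * KK. ?h c) = (\<Sum>c<KK. ?h c)"
    by (rule sum.mono_neutral_right) (auto simp: vp_False F)
  also have "\<dots> = (\<Sum>k<KK. measure_pmf.expectation (vp (table rate k) B 0 (rt i)) F)" by simp
  finally show ?thesis .
qed

lemma expectation_tot_vlaw:
  "i \<in> {1..n} \<Longrightarrow> measure_pmf.expectation (vlaw i) (tot 0 w) = (\<Sum>k<KK. U (table rate k) w B (rt i)) / (3 * real KK)"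
  by (simp add: expectation_vlaw expectation_tot root_in)

text \<open>Drawing an independent table for each arm and then its list yields independent lists of
  law \<open>vlaw\<close>; this independence is what the probability bound needs.\<close>

lemma average_run:
  "measure_pmf.expectation (Pi_pmf {1..n} 0 (\<lambda>_. coin)) (\<lambda>c. run B (tabs c) ctrl0 (init_env I))
    = measure_pmf.expectation (Pi_pmf {1..n} [] vlaw) (merge B)"
proof -
  let ?q = "\<lambda>i c. vp (if c < KK then table rate c else (\<lambda>_ _. False)) B 0 (rt i)"
  have "run B (tabs c) ctrl0 (init_env I)
      = measure_pmf.expectation (Pi_pmf {1..n} [] (\<lambda>i. ?q i (c i))) (merge B)" for c
  proof -
    have "run B (tabs c) ctrl0 (init_env I) = measure_pmf.expectation (Pi_pmf {1..n} [] (law (tabs c) ctrl0)) (merge B)"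
      using position_init by (subst run_merge) (auto simp: init_env_def ctrl0_def root_in)
    also have "Pi_pmf {1..n} [] (law (tabs c) ctrl0) = Pi_pmf {1..n} [] (\<lambda>i. ?q i (c i))"
      by (intro Pi_pmf_cong) (auto simp: law_def ctrl0_def init_env_def vpo_def tabs_def)
    finally show ?thesis .
  qed
  moreover have "Pi_pmf {1..n} [] vlaw
      = bind_pmf (Pi_pmf {1..n} 0 (\<lambda>_. coin)) (\<lambda>c. Pi_pmf {1..n} [] (\<lambda>i. ?q i (c i)))"
    unfolding vlaw_def by (rule Pi_pmf_bind) simp
  ultimately show ?thesis
    using finite_coin finite_vp[OF root_in]
    by (simp, subst expectation_bind_finite) (auto intro!: finite_set_Pi_pmf)
qed

text \<open>The number of plays of another arm that can delay a play of score \<open>y\<close>, cut off at the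
  slack \<open>B + 1 - y\<close> of that play.\<close>

definition delay :: "nat \<Rightarrow> (nat \<times> 'u) list \<Rightarrow> nat" where
  "delay y L = min (card {e. e < length L \<and> y \<le> fst (L ! e)}) (B + 1 - y)"

lemma delay_Nil [simp]: "delay y [] = 0"
  by (simp add: delay_def)

text \<open>Scores decrease weakly, so the counted plays are the first ones of the list, and the
  cut-off restricts their indices to \<open>e \<le> B - y\<close>. At these plays at least
  \<open>y - e \<ge> 2 * y - B\<close> steps are left, so with \<sigma> for \<open>B + 1 - y\<close>
  they belong to the first \<open>2 * \<sigma> - 1\<close> virtual time steps.\<close>

lemma delay_le_tot:
  assumes L: "play_list B 0 L" and y: "1 \<le> y" "y \<le> B"
  shows "real (delay y L) \<le> tot 0 (\<lambda>s _. of_bool (2 * y \<le> s + B)) L"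
proof -
  let ?S = "{e. e < length L \<and> y \<le> fst (L ! e)}"
  let ?T = "{e. e < length L \<and> 2 * y \<le> fst (L ! e) - e + B}"
  have "e \<in> ?T" if e: "e < delay y L" for e
  proof -
    have "e \<in> ?S"
    proof (rule ccontr)
      assume n: "e \<notin> ?S"
      have "?S \<subseteq> {..<e}"
      proof
        fix x assume x: "x \<in> ?S"
        show "x \<in> {..<e}"
        proof (rule ccontr)
          assume "x \<notin> {..<e}"
          then show False using play_list_sorted[OF L, of e x] x n by auto
        qed
      qed
      then have "card ?S \<le> card {..<e}" by (intro card_mono) auto
      with e show False by (simp add: delay_def)
    qed
    moreover have "e + y \<le> B" using e y by (auto simp: delay_def)
    ultimately show ?thesis by auto
  qed
  then have "{..<delay y L} \<subseteq> ?T" by blast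
  then have "card {..<delay y L} \<le> card ?T" by (intro card_mono) auto
  also have "real (card ?T) = tot 0 (\<lambda>s _. of_bool (2 * y \<le> s + B)) L"
    unfolding tot_nth by (simp add: of_bool_def sum.If_cases Int_def)
  finally show ?thesis by simp
qed

lemma U_late:
  "U g (\<lambda>s _. of_bool (2 * y \<le> s + B)) B u = (\<Sum>s\<in>{s\<in>{1..B}. 2 * y \<le> s + B}. U g (\<lambda>t _. of_bool (t = s)) B u)"
proof -
  have "U g (\<lambda>s _. of_bool (2 * y \<le> s + B)) B u
    = U g (\<lambda>s _. \<Sum>s'\<in>{s\<in>{1..B}. 2 * y \<le> s + B}. of_bool (s = s')) B u"
    by (rule U_cong) auto
  also have "\<dots> = (\<Sum>s\<in>{s\<in>{1..B}. 2 * y \<le> s + B}. U g (\<lambda>t _. of_bool (t = s)) B u)"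
    by (rule U_sum) simp
  finally show ?thesis .
qed

lemma delay_prob:
  assumes W: "dual (\<lambda>_. 0) > 0" and y: "1 \<le> y" "y \<le> B" and A: "A \<subseteq> {1..n}"
  shows "4 / 9 * (1 + 1 / (6 * real (B + 1)))
     \<le> measure_pmf.prob (Pi_pmf A [] vlaw) {f. (\<Sum>j\<in>A. delay y (f j)) < B + 1 - y}"
proof -
  define \<sigma> where "\<sigma> = B + 1 - y"
  define q where "q j = map_pmf (delay y) (vlaw j)" for j
  have finA: "finite A" using A finite_subset by blast
  have \<sigma>: "\<sigma> \<ge> 1" "\<sigma> \<le> B" using y by (auto simp: \<sigma>_def)
  \<comment> \<open>Due to the cut-off the delay is at most \<sigma> for every table, and the arm
    takes part with probability \<open>1 / 3\<close>.\<close>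
  have m: "mean (q j) \<le> real \<sigma> / 3" if "j \<in> A" for j
  proof -
    have j: "j \<in> {1..n}" using that A by auto
    have "mean (q j) = (\<Sum>k<KK. measure_pmf.expectation (vp (table rate k) B 0 (rt j)) (\<lambda>L. real (delay y L))) / (3 * real KK)"
      unfolding q_def by (simp add: expectation_vlaw[OF j])
    also have "\<dots> \<le> (\<Sum>k<KK. real \<sigma>) / (3 * real KK)"
    proof (intro divide_right_mono sum_mono)
      fix k
      have "measure_pmf.expectation (vp (table rate k) B 0 (rt j)) (\<lambda>L. real (delay y L))
        \<le> measure_pmf.expectation (vp (table rate k) B 0 (rt j)) (\<lambda>_. real \<sigma>)"
        using finite_vp[OF root_in[OF j]] by (intro expectation_mono) (auto simp: delay_def \<sigma>_def)
      then show "measure_pmf.expectation (vp (table rate k) B 0 (rt j)) (\<lambda>L. real (delay y L)) \<le> real \<sigma>" by simp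
    qed simp
    also have "\<dots> = real \<sigma> / 3" using KK_pos by simp
    finally show ?thesis .
  qed
  have s: "(\<Sum>j\<in>A. mean (q j)) \<le> 2 * real \<sigma> / 3 - 1 / 6"
  proof -
    let ?R = "{s\<in>{1..B}. 2 * y \<le> s + B}"
    let ?c = "1 + 1 / (4 * real (B + 1))"
    have "(\<Sum>j\<in>A. mean (q j)) \<le> (\<Sum>j\<in>{1..n}. mean (q j))"
      using A by (intro sum_mono2) auto
    also have "\<dots> \<le> (\<Sum>j\<in>{1..n}. \<Sum>s\<in>?R. (\<Sum>k<KK. U (table rate k) (\<lambda>t _. of_bool (t = s)) B (rt j)) / (3 * real KK))"
    proof (intro sum_mono)
      fix j assume j: "j \<in> {1..n}"
      have "mean (q j) \<le> measure_pmf.expectation (vlaw j) (tot 0 (\<lambda>s _. of_bool (2 * y \<le> s + B)))"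
        unfolding q_def integral_map_pmf using finite_vlaw[OF j] delay_le_tot[OF play_list_vlaw[OF j] y]
        by (intro expectation_mono) auto
      also have "\<dots> = (\<Sum>s\<in>?R. (\<Sum>k<KK. U (table rate k) (\<lambda>t _. of_bool (t = s)) B (rt j)) / (3 * real KK))"
        unfolding expectation_tot_vlaw[OF j] U_late by (subst sum.swap) (simp add: sum_divide_distrib)
      finally show "mean (q j) \<le> (\<Sum>s\<in>?R. (\<Sum>k<KK. U (table rate k) (\<lambda>t _. of_bool (t = s)) B (rt j)) / (3 * real KK))" .
    qed
    also have "\<dots> = (\<Sum>s\<in>?R. (\<Sum>k<KK. load (table rate k) s) / (3 * real KK))"
    proof (subst sum.swap, intro sum.cong refl)
      fix s
      have "(\<Sum>j=1..n. \<Sum>k<KK. U (table rate k) (\<lambda>t _. of_bool (t = s)) B (rt j)) = (\<Sum>k<KK. load (table rate k) s)"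
        unfolding load_def by (rule sum.swap)
      then show "(\<Sum>j=1..n. (\<Sum>k<KK. U (table rate k) (\<lambda>t _. of_bool (t = s)) B (rt j)) / (3 * real KK))
        = (\<Sum>k<KK. load (table rate k) s) / (3 * real KK)"
        by (simp flip: sum_divide_distrib)
    qed
    also have "\<dots> \<le> (\<Sum>s\<in>?R. ?c / 3)"
    proof (intro sum_mono)
      fix s assume "s \<in> ?R"
      then show "(\<Sum>k<KK. load (table rate k) s) / (3 * real KK) \<le> ?c / 3"
        using average_load[OF W, of s] by simp
    qed
    also have "\<dots> = real (card ?R) * ?c / 3" by simp
    also have "\<dots> \<le> (2 * real \<sigma> - 1) * ?c / 3"
    proof -
      have "?R \<subseteq> {B + 2 - 2 * \<sigma>..B}" using y by (auto simp: \<sigma>_def)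
      then have "card ?R \<le> card {B + 2 - 2 * \<sigma>..B}" by (intro card_mono) auto
      also have "\<dots> \<le> 2 * \<sigma> - 1" by simp
      finally have "real (card ?R) \<le> 2 * real \<sigma> - 1" using \<sigma> by linarith
      then show ?thesis by (intro divide_right_mono mult_right_mono) auto
    qed
    \<comment> \<open>As \<sigma> is at most \<open>B\<close>, the overload costs at most
      \<open>1 / 6\<close>, half of the \<open>1 / 3\<close> left by the
      \<open>2 * \<sigma> - 1\<close> time steps.\<close>
    also have "\<dots> \<le> 2 * real \<sigma> / 3 - 1 / 6"
    proof -
      have "(2 * real \<sigma> - 1) / (4 * real (B + 1)) \<le> 1 / 2"
        using \<sigma> by (simp add: divide_le_eq)
      moreover have "(2 * x - 1) / 3 + z / 3 \<le> 2 * x / 3 - 1 / 6" if "z \<le> 1 / 2" for x z :: real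
        using that by (simp add: field_simps)
      ultimately have "(2 * real \<sigma> - 1) / 3 + (2 * real \<sigma> - 1) / (4 * real (B + 1)) / 3 \<le> 2 * real \<sigma> / 3 - 1 / 6" by blast
      moreover have "(2 * real \<sigma> - 1) * ?c / 3 = (2 * real \<sigma> - 1) / 3 + (2 * real \<sigma> - 1) / (4 * real (B + 1)) / 3"
        by (simp only: distrib_left add_divide_distrib times_divide_eq_right mult_1_right)
      ultimately show ?thesis by (simp only:)
    qed
    finally show ?thesis .
  qed
  have "4 / 9 * (1 + 1 / (6 * real (B + 1))) \<le> 4 / 9 * (1 + 1 / (6 * real \<sigma>))"
    using \<sigma> by (intro mult_left_mono add_left_mono divide_left_mono) auto
  also have "\<dots> \<le> measure_pmf.prob (Pi_pmf A 0 q) {f. (\<Sum>j\<in>A. f j) < \<sigma>}"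
    using m s \<sigma> finite_vlaw A by (intro sum_below_prob finA) (auto simp: q_def)
  also have "Pi_pmf A 0 q = map_pmf (\<lambda>h. delay y \<circ> h) (Pi_pmf A [] vlaw)"
    unfolding q_def using finA by (intro Pi_pmf_map) auto
  finally show ?thesis by (simp add: \<sigma>_def vimage_def o_def)
qed

text \<open>Given the list of arm \<open>i\<close>, the delays caused by the other arms are still
  independent, so each virtual play is really made with probability at least \<open>?c\<close>. The
  coin of arm \<open>i\<close> itself contributes the factor \<open>1 / 3\<close> that turns
  \<open>4 / 9\<close> into \<open>4 / 27\<close>.\<close>

lemma average_merge:
  assumes W: "dual (\<lambda>_. 0) > 0"
  shows "4 / 27 * (1 + 1 / (6 * real (B + 1))) * ((\<Sum>k<KK. gain (table rate k)) / real KK)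
    \<le> measure_pmf.expectation (Pi_pmf {1..n} [] vlaw) (merge B)"
proof -
  let ?P = "Pi_pmf {1..n} [] vlaw"
  let ?c = "4 / 9 * (1 + 1 / (6 * real (B + 1)))"
  have finP: "finite (set_pmf ?P)" using finite_vlaw by (intro finite_set_Pi_pmf) auto
  have pl: "play_list B 0 (L i)" if "L \<in> set_pmf ?P" "i \<in> {1..n}" for L i
    using that play_list_vlaw by (auto simp: set_Pi_pmf PiE_dflt_def)
  define F where "F i x f = (\<Sum>e<length x. r (snd (x ! e)) *
      of_bool ((\<Sum>j\<in>{1..n} - {i}. delay (fst (x ! e)) (f j)) < B + 1 - fst (x ! e)))" for i x and f :: "nat \<Rightarrow> _"
  have arm: "?c * ((\<Sum>k<KK. U (table rate k) (\<lambda>_. r) B (rt i)) / (3 * real KK))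
      \<le> measure_pmf.expectation ?P (\<lambda>L. F i (L i) L)" if i: "i \<in> {1..n}" for i
  proof -
    define A where "A = {1..n} - {i}"
    have A: "finite A" "i \<notin> A" "insert i A = {1..n}" using i by (auto simp: A_def)
    let ?E = "Pi_pmf A [] vlaw"
    have finE: "finite (set_pmf ?E)" using A finite_vlaw by (intro finite_set_Pi_pmf) (auto simp: A_def)
    have "?c * ((\<Sum>k<KK. U (table rate k) (\<lambda>_. r) B (rt i)) / (3 * real KK))
      = measure_pmf.expectation (vlaw i) (\<lambda>x. ?c * tot 0 (\<lambda>_. r) x)"
      by (simp add: expectation_tot_vlaw[OF i])
    also have "\<dots> \<le> measure_pmf.expectation (vlaw i) (\<lambda>x. measure_pmf.expectation ?E (\<lambda>f. F i x f))"
    proof (rule expectation_mono[OF finite_vlaw[OF i]])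
      fix x assume "x \<in> set_pmf (vlaw i)"
      then have x: "play_list B 0 x" by (rule play_list_vlaw[OF i])
      have "?c * tot 0 (\<lambda>_. r) x = (\<Sum>e<length x. r (snd (x ! e)) * ?c)"
        by (simp only: tot_nth sum_distrib_left mult.commute[of ?c])
      also have "\<dots> \<le> (\<Sum>e<length x. r (snd (x ! e)) *
          measure_pmf.prob ?E {f. (\<Sum>j\<in>A. delay (fst (x ! e)) (f j)) < B + 1 - fst (x ! e)})"
      proof (intro sum_mono mult_left_mono)
        fix e assume "e \<in> {..<length x}"
        then have e: "1 \<le> fst (x ! e)" "fst (x ! e) \<le> B" "snd (x ! e) \<in> NN" using play_list_nth[OF x, of e] by auto
        show "?c \<le> measure_pmf.prob ?E {f. (\<Sum>j\<in>A. delay (fst (x ! e)) (f j)) < B + 1 - fst (x ! e)}"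
          using A e W by (intro delay_prob) (auto simp: A_def)
        show "0 \<le> r (snd (x ! e))" using e reward_nonneg by blast
      qed
      also have "\<dots> = (\<Sum>e<length x. r (snd (x ! e)) *
          measure_pmf.expectation ?E (\<lambda>f. of_bool ((\<Sum>j\<in>A. delay (fst (x ! e)) (f j)) < B + 1 - fst (x ! e))))"
      proof (intro sum.cong refl arg_cong2[where f = times])
        fix e
        have "measure_pmf.prob ?E S = measure_pmf.expectation ?E (\<lambda>f. of_bool (f \<in> S))" for S
        proof -
          have "(\<lambda>f. of_bool (f \<in> S) :: real) = indicator S" by (auto simp: indicator_def)
          then show ?thesis by simp
        qed
        from this[of "{f. (\<Sum>j\<in>A. delay (fst (x ! e)) (f j)) < B + 1 - fst (x ! e)}"]
        show "measure_pmf.prob ?E {f. (\<Sum>j\<in>A. delay (fst (x ! e)) (f j)) < B + 1 - fst (x ! e)} =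
          measure_pmf.expectation ?E (\<lambda>f. of_bool ((\<Sum>j\<in>A. delay (fst (x ! e)) (f j)) < B + 1 - fst (x ! e)))"
          by simp
      qed
      also have "\<dots> = measure_pmf.expectation ?E (\<lambda>f. F i x f)"
        unfolding F_def A_def[symmetric] using finE
        by (subst Bochner_Integration.integral_sum) (auto intro: integrable_measure_pmf_finite)
      finally show "?c * tot 0 (\<lambda>_. r) x \<le> measure_pmf.expectation ?E (\<lambda>f. F i x f)" .
    qed
    also have "\<dots> = measure_pmf.expectation (Pi_pmf (insert i A) [] vlaw) (\<lambda>L. F i (L i) L)"
    proof -
      have "F i x (f(i := x)) = F i x f" for x f
        unfolding F_def by (intro sum.cong refl) (auto intro!: arg_cong2[where f = times] sum.cong simp: of_bool_def)
      moreover have "finite (set_pmf (vlaw j))" if "j \<in> insert i A" for j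
        using that finite_vlaw unfolding A(3) by blast
      ultimately show ?thesis using A(1,2) by (subst expectation_Pi_split) auto
    qed
    finally show ?thesis unfolding A(3) .
  qed
  have "4 / 27 * (1 + 1 / (6 * real (B + 1))) * ((\<Sum>k<KK. gain (table rate k)) / real KK)
      = (\<Sum>i=1..n. ?c * ((\<Sum>k<KK. U (table rate k) (\<lambda>_. r) B (rt i)) / (3 * real KK)))"
    unfolding gain_def by (subst sum.swap) (simp add: sum_distrib_left sum_divide_distrib mult.assoc)
  also have "\<dots> \<le> (\<Sum>i=1..n. measure_pmf.expectation ?P (\<lambda>L. F i (L i) L))"
    using arm by (rule sum_mono)
  also have "\<dots> = measure_pmf.expectation ?P (\<lambda>L. \<Sum>i=1..n. F i (L i) L)"
    using finP by (subst Bochner_Integration.integral_sum) (auto intro: integrable_measure_pmf_finite)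
  also have "\<dots> \<le> measure_pmf.expectation ?P (merge B)"
  proof (rule expectation_mono[OF finP])
    fix L assume L: "L \<in> set_pmf ?P"
    have "(\<Sum>i=1..n. F i (L i) L) \<le> (\<Sum>i=1..n. \<Sum>e<length (L i). r (snd (L i ! e)) * of_bool (rank n L i e < B))"
      unfolding F_def
    proof (intro sum_mono mult_left_mono)
      fix i e assume i: "i \<in> {1..n}" and "e \<in> {..<length (L i)}"
      then have e: "e + 1 \<le> fst (L i ! e)" "fst (L i ! e) \<le> B" "snd (L i ! e) \<in> NN"
        using play_list_nth[OF pl[OF L i], of e] by auto
      show "0 \<le> r (snd (L i ! e))" using e reward_nonneg by blast
      let ?y = "fst (L i ! e)"
      \<comment> \<open>A total below the slack means that no single cut-off was active, so
        truncated and true counts agree; \<open>e + 1 \<le> ?y\<close> then puts the rank below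
        \<open>B\<close>.\<close>
      have "rank n L i e < B" if lt: "(\<Sum>j\<in>{1..n} - {i}. delay ?y (L j)) < B + 1 - ?y"
      proof -
        have "delay ?y (L j) = card {e'. e' < length (L j) \<and> ?y \<le> fst (L j ! e')}" if "j \<in> {1..n} - {i}" for j
        proof -
          have "delay ?y (L j) \<le> (\<Sum>j\<in>{1..n} - {i}. delay ?y (L j))" using that by (intro member_le_sum) auto
          with lt show ?thesis by (simp add: delay_def min_def split: if_splits)
        qed
        then have "rank n L i e = e + (\<Sum>j\<in>{1..n} - {i}. delay ?y (L j))" unfolding rank_def by simp
        with lt e show ?thesis by simp
      qed
      then show "of_bool ((\<Sum>j\<in>{1..n} - {i}. delay ?y (L j)) < B + 1 - ?y) \<le> (of_bool (rank n L i e < B) :: real)"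
        by (simp add: of_bool_def)
    qed
    also have "\<dots> \<le> merge B L"
    proof (rule merge_ge)
      fix i assume i: "i \<in> {1..n}"
      show "sorted_plays (L i)" unfolding sorted_plays_def
        using play_list_nth[OF pl[OF L i]] play_list_sorted[OF pl[OF L i]] by fastforce
    qed
    finally show "(\<Sum>i=1..n. F i (L i) L) \<le> merge B L" .
  qed
  finally show ?thesis .
qed

lemma merge_nonneg:
  assumes "L \<in> set_pmf (Pi_pmf {1..n} [] vlaw)" shows "0 \<le> merge k L"
proof -
  have pl: "play_list B 0 (L i)" if "i \<in> {1..n}" for i
    using that play_list_vlaw assms by (auto simp: set_Pi_pmf PiE_dflt_def)
  have "0 \<le> (\<Sum>i=1..n. \<Sum>e<length (L i). r (snd (L i ! e)) * of_bool (rank n L i e < k))"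
    using play_list_nth[OF pl] by (intro sum_nonneg mult_nonneg_nonneg reward_nonneg) auto
  also have "\<dots> \<le> merge k L"
  proof (rule merge_ge)
    fix i assume i: "i \<in> {1..n}"
    show "sorted_plays (L i)" unfolding sorted_plays_def
      using play_list_nth[OF pl[OF i]] play_list_sorted[OF pl[OF i]] by fastforce
  qed
  finally show ?thesis .
qed

theorem average_run_ge:
  assumes v: "bounded_by_dual v"
  shows "4 / 27 * v \<le> measure_pmf.expectation (Pi_pmf {1..n} 0 (\<lambda>_. coin)) (\<lambda>c. run B (tabs c) ctrl0 (init_env I))"
  unfolding average_run
proof (cases "v > 0")
  case False
  have "measure_pmf.expectation (Pi_pmf {1..n} [] vlaw) (\<lambda>_. 0) \<le> measure_pmf.expectation (Pi_pmf {1..n} [] vlaw) (merge B)"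
    using merge_nonneg finite_vlaw by (intro expectation_mono finite_set_Pi_pmf) auto
  then show "4 / 27 * v \<le> measure_pmf.expectation (Pi_pmf {1..n} [] vlaw) (merge B)" using False by simp
next
  case True
  have "v - (\<Sum>s=1..B. 0) \<le> dual (\<lambda>_. 0)"
    using v unfolding bounded_by_dual_def by (elim allE[of _ "\<lambda>_. 0"]) simp
  with True have W: "dual (\<lambda>_. 0) > 0" by simp
  define b where "b = real (B + 1)"
  have b: "b \<ge> 1" by (simp add: b_def)
  have "v \<le> (1 + 1 / (6 * b)) * ((1 - 1 / (8 * b)) * v)"
  proof -
    have "(1 + 1 / (6 * b)) * (1 - 1 / (8 * b)) = 1 + (2 * b - 1) / (48 * b\<^sup>2)"
      using b by (simp add: field_simps power2_eq_square)
    moreover have "0 \<le> (2 * b - 1) / (48 * b\<^sup>2)" using b by simp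
    ultimately have "1 * v \<le> ((1 + 1 / (6 * b)) * (1 - 1 / (8 * b))) * v"
      using True by (intro mult_right_mono) auto
    then show ?thesis by (simp add: mult.assoc)
  qed
  also have "\<dots> \<le> (1 + 1 / (6 * b)) * ((\<Sum>k<KK. gain (table rate k)) / real KK)"
    using average_gain[OF v] b unfolding b_def by (intro mult_left_mono) auto
  finally have "4 / 27 * v \<le> 4 / 27 * ((1 + 1 / (6 * b)) * ((\<Sum>k<KK. gain (table rate k)) / real KK))"
    by (rule mult_left_mono) simp
  also have "\<dots> = 4 / 27 * (1 + 1 / (6 * b)) * ((\<Sum>k<KK. gain (table rate k)) / real KK)"
    by (simp only: mult.assoc)
  also have "\<dots> \<le> measure_pmf.expectation (Pi_pmf {1..n} [] vlaw) (merge B)"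
    unfolding b_def by (rule average_merge[OF W])
  finally show "4 / 27 * v \<le> measure_pmf.expectation (Pi_pmf {1..n} [] vlaw) (merge B)" .
qed

lemma lp_feasible_zero: "lp_feasible I (\<lambda>_ _. 0) (\<lambda>u _. of_bool (u \<in> root_nodes I))"
  by (auto simp: lp_feasible_def root_nodes_def)

lemma opt_lp_le:
  assumes "\<And>v. bounded_by_dual v \<Longrightarrow> v \<le> c" shows "opt_lp I \<le> c"
  unfolding opt_lp_def using lp_feasible_zero assms lp_bounded_by_dual by (intro cSup_least) auto

theorem average_run_ge_opt_lp:
  "4 / 27 * opt_lp I \<le> measure_pmf.expectation (Pi_pmf {1..n} 0 (\<lambda>_. coin)) (\<lambda>c. run B (tabs c) ctrl0 (init_env I))"
proof -
  let ?E = "measure_pmf.expectation (Pi_pmf {1..n} 0 (\<lambda>_. coin)) (\<lambda>c. run B (tabs c) ctrl0 (init_env I))"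
  have "opt_lp I \<le> 27 / 4 * ?E"
    using average_run_ge by (intro opt_lp_le) fastforce
  then show ?thesis by simp
qed

text \<open>The random choice of tables is an average of deterministic policies, none of which
  exceeds the supremum. This argument avoids the program and so covers real data and arbitrary node
  types.\<close>

theorem opt_lp_le_opt_policy: "opt_lp I \<le> 27 / 4 * opt_policy I"
proof -
  have "4 / 27 * opt_lp I \<le> measure_pmf.expectation (Pi_pmf {1..n} 0 (\<lambda>_. coin)) (\<lambda>c. run B (tabs c) ctrl0 (init_env I))"
    by (rule average_run_ge_opt_lp)
  also have "\<dots> \<le> measure_pmf.expectation (Pi_pmf {1..n} 0 (\<lambda>_. coin)) (\<lambda>_. opt_policy I)"
    using finite_coin policy_value_le_opt unfolding policy_value_run[symmetric]
    by (intro expectation_mono finite_set_Pi_pmf) auto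
  finally show ?thesis by simp
qed

end

section \<open>Reasoning about programs\<close>

lemma step_cost: "c \<noteq> Halt \<Longrightarrow> (c', m', e', k) \<in> set_pmf (step I c m e) \<Longrightarrow> 1 \<le> k"
proof (induction c arbitrary: c' m' e' k)
  case (Then c d)
  show ?case
  proof (cases "c = Halt")
    case False
    then obtain c'' where "(c'', m', e', k) \<in> set_pmf (step I c m e)" using Then.prems by auto
    then show ?thesis by (rule Then.IH(1)[OF False])
  qed (use Then.prems in auto)
qed (auto split: prod.splits)

text \<open>\<open>prov I P c m e T v\<close> certifies that every run of \<open>c\<close> halts at cost at most \<open>T\<close> in a state that satisfies \<open>P\<close>
  for the unspent budget and a claimed reward, and that \<open>v\<close> is at most the expectation of the claimed
  reward. So \<open>v\<close> is a lower bound for the expected reward if \<open>P\<close> bounds the claim by the reward gained.\<close>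

inductive prov :: "(nat, real) bandit \<Rightarrow> (memory \<Rightarrow> nat env \<Rightarrow> nat \<Rightarrow> real \<Rightarrow> bool) \<Rightarrow>
    prog \<Rightarrow> memory \<Rightarrow> nat env \<Rightarrow> nat \<Rightarrow> real \<Rightarrow> bool" for I P where
  prov_halt: "P m e T v \<Longrightarrow> prov I P Halt m e T v"
| prov_step: "c \<noteq> Halt \<Longrightarrow> finite (set_pmf (step I c m e)) \<Longrightarrow>
    (\<And>c' m' e' k. (c', m', e', k) \<in> set_pmf (step I c m e) \<Longrightarrow>
       k \<le> T \<and> prov I P c' m' e' (T - k) (w (c', m', e', k))) \<Longrightarrow>
    v \<le> measure_pmf.expectation (step I c m e) w \<Longrightarrow> prov I P c m e T v"

lemma steps_Halt: "steps I j (Halt, m, e, k) = return_pmf (Halt, m, e, k)"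
  by (induction j) (auto simp: bind_return_pmf)

lemma steps_Suc_first:
  "steps I (Suc j) (c, m, e, k) = bind_pmf (step I c m e) (\<lambda>(c', m', e', k'). steps I j (c', m', e', k + k'))"
proof (induction j arbitrary: c m e k)
  case 0
  then show ?case by (simp add: bind_return_pmf case_prod_unfold)
next
  case (Suc j)
  have "steps I (Suc (Suc j)) (c, m, e, k) = bind_pmf (steps I (Suc j) (c, m, e, k))
      (\<lambda>(c, m, e, k). bind_pmf (step I c m e) (\<lambda>(c', m', e', k'). return_pmf (c', m', e', k + k')))"
    by (simp only: steps.simps)
  also have "\<dots> = bind_pmf (step I c m e) (\<lambda>(c', m', e', k'). steps I (Suc j) (c', m', e', k + k'))"
    by (subst Suc.IH) (simp add: bind_assoc_pmf case_prod_unfold)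
  finally show ?case .
qed

text \<open>Every step of a program that has not halted costs at least 1, so a cost budget also
  bounds the number of steps. The cost \<open>k0\<close> already spent and the number
  \<open>j\<close> of steps are general because different branches spend different amounts.\<close>

lemma prov_sound:
  assumes "prov I (\<lambda>m e T v. v \<le> gained e) c m e T v" "T \<le> j"
  shows "finite (set_pmf (steps I j (c, m, e, k0))) \<and>
    (\<forall>(c', m', e', k) \<in> set_pmf (steps I j (c, m, e, k0)). c' = Halt \<and> k \<le> k0 + T) \<and>
    v \<le> measure_pmf.expectation (steps I j (c, m, e, k0)) (\<lambda>(c', m', e', k). gained e')"
  using assms
proof (induction arbitrary: j k0 rule: prov.induct)
  case (prov_halt m e T v)
  then show ?case by (simp add: steps_Halt)
next
  case (prov_step c m e T w v)
  obtain c1 m1 e1 k1 where 1: "(c1, m1, e1, k1) \<in> set_pmf (step I c m e)"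
    using set_pmf_not_empty[of "step I c m e"] by fastforce
  have "1 \<le> k1" using step_cost[OF prov_step.hyps(1) 1] .
  moreover have "k1 \<le> T" using prov_step.IH[OF 1] by blast
  ultimately obtain j' where j: "j = Suc j'" using prov_step.prems by (cases j) auto
  have IH: "finite (set_pmf (steps I j' (c', m', e', k0 + k))) \<and>
    (\<forall>(c'', m'', e'', k'') \<in> set_pmf (steps I j' (c', m', e', k0 + k)). c'' = Halt \<and> k'' \<le> k0 + T) \<and>
    w (c', m', e', k) \<le> measure_pmf.expectation (steps I j' (c', m', e', k0 + k)) (\<lambda>(c', m', e', k). gained e')"
    if h: "(c', m', e', k) \<in> set_pmf (step I c m e)" for c' m' e' k
  proof -
    have k: "k \<le> T" "1 \<le> k" using prov_step.IH[OF h] step_cost[OF prov_step.hyps(1) h] by auto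
    then have "T - k \<le> j'" "k0 + k + (T - k) = k0 + T" using prov_step.prems j by auto
    then show ?thesis using prov_step.IH[OF h] by metis
  qed
  have "finite (set_pmf (steps I j (c, m, e, k0)))"
    unfolding j steps_Suc_first using prov_step.hyps(2) IH by (auto simp: case_prod_unfold)
  moreover have "\<forall>(c', m', e', k) \<in> set_pmf (steps I j (c, m, e, k0)). c' = Halt \<and> k \<le> k0 + T"
    unfolding j steps_Suc_first using IH by (fastforce simp: case_prod_unfold)
  moreover have "v \<le> measure_pmf.expectation (steps I j (c, m, e, k0)) (\<lambda>(c', m', e', k). gained e')"
  proof -
    have "v \<le> measure_pmf.expectation (step I c m e) w" by (rule prov_step.hyps)
    also have "\<dots> \<le> measure_pmf.expectation (step I c m e) (\<lambda>x. measure_pmf.expectation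
       ((\<lambda>(c', m', e', k'). steps I j' (c', m', e', k0 + k')) x) (\<lambda>(c', m', e', k). gained e'))"
      using prov_step.hyps(2) IH by (intro expectation_mono) auto
    also have "\<dots> = measure_pmf.expectation (steps I j (c, m, e, k0)) (\<lambda>(c', m', e', k). gained e')"
      unfolding j steps_Suc_first using prov_step.hyps(2) IH by (subst expectation_bind_finite) auto
    finally show ?thesis .
  qed
  ultimately show ?case by blast
qed

text \<open>The certificate for \<open>d\<close> becomes the postcondition of \<open>c\<close>. The
  extra unit of budget pays for the step that removes the finished first component.\<close>

lemma prov_then:
  assumes "prov I (\<lambda>m e T v. 1 \<le> T \<and> prov I P d m e (T - 1) v) c m e T v"
  shows "prov I P (Then c d) m e T v"
  using assms
proof (induction rule: prov.induct)
  case (prov_halt m e T v)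
  show ?case
    by (rule prov_step[where w = "\<lambda>_. v"]) (use prov_halt in auto)
next
  case (prov_step c m e T w v)
  have s: "step I (Then c d) m e = map_pmf (\<lambda>(c', m', e', k). (Then c' d, m', e', k)) (step I c m e)"
    using prov_step by simp
  \<comment> \<open>Successors of the composed program carry \<open>d\<close> along; the claim of
    the first component is looked up after stripping it.\<close>
  let ?w = "\<lambda>(c', m', e', k). w (case c' of Then c'' _ \<Rightarrow> c'' | _ \<Rightarrow> c', m', e', k)"
  show ?case
  proof (rule prov.prov_step[where w = ?w])
    show "finite (set_pmf (step I (Then c d) m e))" unfolding s using prov_step by simp
    show "v \<le> measure_pmf.expectation (step I (Then c d) m e) ?w"
      unfolding s using prov_step.hyps by (simp add: case_prod_unfold)
  next
    fix c' m' e' k assume "(c', m', e', k) \<in> set_pmf (step I (Then c d) m e)"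
    then obtain c'' where "c' = Then c'' d" "(c'', m', e', k) \<in> set_pmf (step I c m e)" unfolding s by auto
    then show "k \<le> T \<and> prov I P c' m' e' (T - k) (?w (c', m', e', k))" using prov_step.IH by auto
  qed simp
qed

lemma prov_det_step:
  assumes "c \<noteq> Halt" "step I c m e = return_pmf (c', m', e, k)" "prov I P c' m' e T v"
  shows "prov I P c m e (k + T) v"
  by (rule prov_step[where w = "\<lambda>_. v"]) (use assms in auto)

text \<open>Deterministic behaviour in continuation style, uniform in the environment and the claim.
  \<open>P\<close> is required for all larger leftovers because the true cost may lie below
  \<open>T\<close>.\<close>

definition det :: "prog \<Rightarrow> memory \<Rightarrow> memory \<Rightarrow> nat \<Rightarrow> bool" where
  "det c m m' T \<longleftrightarrow> (\<forall>I P e T' v. (\<forall>T''\<ge>T'. P m' e T'' v) \<longrightarrow> prov I P c m e (T + T') v)"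

lemma det_mono: "det c m m' T \<Longrightarrow> T \<le> S \<Longrightarrow> det c m m' S"
  unfolding det_def
proof (intro allI impI)
  fix I :: "(nat, real) bandit" and P :: "memory \<Rightarrow> nat env \<Rightarrow> nat \<Rightarrow> real \<Rightarrow> bool" and e T' v
  assume d: "\<forall>I P e T' v. (\<forall>T''\<ge>T'. P m' e T'' v) \<longrightarrow> prov I P c m e (T + T') v" and "T \<le> S"
    and P: "\<forall>T''\<ge>T'. P m' e T'' v"
  have "prov I P c m e (T + (S - T + T')) v" using d P by auto
  then show "prov I P c m e (S + T') v" using \<open>T \<le> S\<close> by simp
qed

lemma det_assign: "det (Assign a b) m (m(val a m := val b m)) (1 + cost a m + cost b m)"
  unfolding det_def by (intro allI impI prov_det_step) (auto intro: prov_halt)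

lemma det_then:
  assumes "det c m m1 T1" "det d m1 m2 T2"
  shows "det (Then c d) m m2 (T1 + T2 + 1)"
  unfolding det_def
proof (intro allI impI)
  fix I :: "(nat, real) bandit" and P :: "memory \<Rightarrow> nat env \<Rightarrow> nat \<Rightarrow> real \<Rightarrow> bool" and e T' v assume P: "\<forall>T''\<ge>T'. P m2 e T'' v"
  have "1 \<le> T'' \<and> prov I P d m1 e (T'' - 1) v" if "T'' \<ge> T2 + 1 + T'" for T''
  proof -
    have "prov I P d m1 e (T2 + (T'' - 1 - T2)) v"
    proof -
      have "\<forall>T3\<ge>T'' - 1 - T2. P m2 e T3 v" using P that by auto
      then show ?thesis using assms(2) unfolding det_def by blast
    qed
    then show ?thesis using that by simp
  qed
  then have "\<forall>T''\<ge>T2 + 1 + T'. (\<lambda>m e T v. 1 \<le> T \<and> prov I P d m e (T - 1) v) m1 e T'' v" by blast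
  then have "prov I (\<lambda>m e T v. 1 \<le> T \<and> prov I P d m e (T - 1) v) c m e (T1 + (T2 + 1 + T')) v"
    by (intro assms(1)[unfolded det_def, rule_format]) blast
  then show "prov I P (Then c d) m e (T1 + T2 + 1 + T') v" by (intro prov_then) (simp only: ac_simps)
qed

lemma det_loop_end:
  assumes "val b m = 0" shows "det (Loop b c) m m (1 + cost b m)"
  unfolding det_def by (intro allI impI prov_det_step) (use assms in \<open>auto intro: prov_halt\<close>)

lemma det_loop_step:
  assumes "val b m \<noteq> 0" "det c m m1 T1" "det (Loop b c) m1 m2 T2"
  shows "det (Loop b c) m m2 (1 + cost b m + (T1 + T2 + 1))"
  unfolding det_def
proof (intro allI impI)
  fix I :: "(nat, real) bandit" and P :: "memory \<Rightarrow> nat env \<Rightarrow> nat \<Rightarrow> real \<Rightarrow> bool" and e T' v assume P: "\<forall>T''\<ge>T'. P m2 e T'' v"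
  have "prov I P (Then c (Loop b c)) m e (T1 + T2 + 1 + T') v"
    using det_then[OF assms(2,3)] P unfolding det_def by blast
  then have "prov I P (Loop b c) m e ((1 + cost b m) + (T1 + T2 + 1 + T')) v"
    using assms(1) prov_det_step[of "Loop b c" I m e "Then c (Loop b c)" m "1 + cost b m" P "T1 + T2 + 1 + T'" v]
    by simp
  then show "prov I P (Loop b c) m e (1 + cost b m + (T1 + T2 + 1) + T') v" by (simp add: add_ac)
qed

section \<open>Costs of expressions\<close>

primrec esz :: "expr \<Rightarrow> nat" where
  "esz (Const k) = 1"
| "esz (Cell a) = 1 + esz a"
| "esz (Plus a b) = 1 + esz a + esz b"
| "esz (Minus a b) = 1 + esz a + esz b"
| "esz (Times a b) = 1 + esz a + esz b"
| "esz (Quot a b) = 1 + esz a + esz b"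

primrec cmax :: "expr \<Rightarrow> nat" where
  "cmax (Const k) = k"
| "cmax (Cell a) = cmax a"
| "cmax (Plus a b) = max (cmax a) (cmax b)"
| "cmax (Minus a b) = max (cmax a) (cmax b)"
| "cmax (Times a b) = max (cmax a) (cmax b)"
| "cmax (Quot a b) = max (cmax a) (cmax b)"

lemma esz_pos: "1 \<le> esz e"
  by (cases e) auto

lemma bit_len_le: "k < 2 ^ x \<Longrightarrow> 1 \<le> x \<Longrightarrow> bit_len k \<le> x"
proof -
  assume k: "k < 2 ^ x" and x: "1 \<le> x"
  show ?thesis
  proof (cases "k = 0")
    case False
    then have "2 ^ floor_log k < (2 ^ x :: nat)" using floor_log_exp2_le[of k] k by linarith
    then have "floor_log k < x" by (metis nat_power_less_imp_less pos2)
    then show ?thesis by (simp add: bit_len_def)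
  qed (use x in \<open>simp add: bit_len_def\<close>)
qed

lemma val_bound:
  assumes b: "1 \<le> b" and m: "\<And>a. m a < 2 ^ b"
  shows "cmax e < 2 ^ b \<Longrightarrow> val e m < 2 ^ (b * esz e)"
proof (induction e)
  case (Const k)
  then show ?case by simp
next
  case (Cell e)
  have "m (val e m) < 2 ^ b" by (rule m)
  also have "\<dots> \<le> 2 ^ (b * esz (Cell e))" by (intro power_increasing) auto
  finally show ?case by simp
next
  case (Plus e f)
  let ?x = "val e m" and ?y = "val f m"
  have "?x + ?y < 2 ^ (b * esz e) + 2 ^ (b * esz f)" using Plus by (intro add_strict_mono) auto
  also have "\<dots> \<le> 2 ^ (b * (esz e + esz f)) + 2 ^ (b * (esz e + esz f))"
    by (intro add_mono power_increasing) auto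
  also have "\<dots> = 2 ^ (1 + b * (esz e + esz f))" by simp
  also have "\<dots> \<le> 2 ^ (b * esz (Plus e f))" using b by (intro power_increasing) (auto simp: algebra_simps)
  finally show ?case by simp
next
  case (Minus e f)
  then have "val e m < 2 ^ (b * esz e)" by simp
  also have "\<dots> \<le> 2 ^ (b * esz (Minus e f))" by (intro power_increasing) (auto simp: distrib_left)
  finally show ?case by simp
next
  case (Times e f)
  have "val e m * val f m < 2 ^ (b * esz e) * 2 ^ (b * esz f)" using Times by (intro mult_strict_mono) auto
  also have "\<dots> = 2 ^ (b * (esz e + esz f))" by (simp add: power_add distrib_left)
  also have "\<dots> \<le> 2 ^ (b * esz (Times e f))" by (intro power_increasing) (auto simp: distrib_left)
  finally show ?case by simp
next
  case (Quot e f)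
  have "val e m div val f m \<le> val e m" by simp
  also have "\<dots> < 2 ^ (b * esz e)" using Quot by simp
  also have "\<dots> \<le> 2 ^ (b * esz (Quot e f))" by (intro power_increasing) (auto simp: distrib_left)
  finally show ?case by simp
qed

text \<open>There are \<open>esz e\<close> subexpressions, and the value of each has at most
  \<open>b * esz e\<close> bits.\<close>

lemma cost_bound:
  assumes b: "1 \<le> b" and m: "\<And>a. m a < 2 ^ b"
  shows "cmax e < 2 ^ b \<Longrightarrow> cost e m \<le> b * (esz e)\<^sup>2"
proof -
  have bl: "bit_len (val e m) \<le> b * esz e" if "cmax e < 2 ^ b" for e
    using val_bound[of b m e] b m that esz_pos[of e] by (intro bit_len_le) (auto simp: Suc_le_eq)
  have sq: "b * x\<^sup>2 + b * y\<^sup>2 + b * (1 + x + y) \<le> b * (1 + x + y)\<^sup>2" for x y :: nat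
    by (simp add: power2_eq_square algebra_simps)
  have bin: "x1 + x2 + z \<le> b * (1 + x + y)\<^sup>2" if "x1 \<le> b * x\<^sup>2" "x2 \<le> b * y\<^sup>2" "z \<le> b * (1 + x + y)" for x1 x2 x y z
    using that sq[of x y] by linarith
  show "cmax e < 2 ^ b \<Longrightarrow> cost e m \<le> b * (esz e)\<^sup>2"
  proof (induction e)
    case (Const k)
    then show ?case using bl[of "Const k"] by simp
  next
    case (Cell e)
    have "bit_len (val (Cell e) m) \<le> b * (1 + esz e)" using bl[of "Cell e"] Cell by simp
    moreover have "b * (esz e)\<^sup>2 + b * (1 + esz e) \<le> b * (1 + esz e)\<^sup>2" by (simp add: power2_eq_square algebra_simps)
    ultimately show ?case using Cell by simp
  next
    case (Plus e f)
    then show ?case using bl[of "Plus e f"] bin[of "cost e m" "esz e" "cost f m" "esz f" "bit_len (val (Plus e f) m)"]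
      by (simp del: val.simps)
  next
    case (Minus e f)
    then show ?case using bl[of "Minus e f"] bin[of "cost e m" "esz e" "cost f m" "esz f" "bit_len (val (Minus e f) m)"]
      by (simp del: val.simps)
  next
    case (Times e f)
    then show ?case using bl[of "Times e f"] bin[of "cost e m" "esz e" "cost f m" "esz f" "bit_len (val (Times e f) m)"]
      by (simp del: val.simps)
  next
    case (Quot e f)
    then show ?case using bl[of "Quot e f"] bin[of "cost e m" "esz e" "cost f m" "esz f" "bit_len (val (Quot e f) m)"]
      by (simp del: val.simps)
  qed
qed

section \<open>Arrays\<close>

text \<open>The input occupies the cells below its length. The remaining cells are divided into 32
  interleaved arrays.\<close>

definition inp_len :: "(nat, rat) bandit \<Rightarrow> nat" where
  "inp_len J = 3 + arms J + 3 * card (all_nodes J) + 2 * (card (all_nodes J) * card (all_nodes J))"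

lemma length_encode: "length (encode J) = inp_len J"
proof -
  have r: "length (rat_code q) = 2" for q by (simp add: rat_code_def split: prod.splits)
  have c: "length (concat (map f xs)) = k * length xs" if "\<And>x. length (f x) = k" for f :: "nat \<Rightarrow> nat list" and xs k
    using that by (induction xs) auto
  have 1: "length (concat (map (\<lambda>v. rat_code (tprob J u v)) [0..<N])) = 2 * N" for u N
    using c[of "\<lambda>v. rat_code (tprob J u v)" 2 "[0..<N]"] r by simp
  have 2: "length (concat (map (\<lambda>u. arm_of J u # rat_code (reward J u)) [0..<N])) = 3 * N" for N
    using c[of "\<lambda>u. arm_of J u # rat_code (reward J u)" 3 "[0..<N]"] r by simp
  have 3: "length (concat (map (\<lambda>u. concat (map (\<lambda>v. rat_code (tprob J u v)) [0..<N])) [0..<N'])) = 2 * N * N'" for N N'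
    using c[of "\<lambda>u. concat (map (\<lambda>v. rat_code (tprob J u v)) [0..<N])" "2 * N" "[0..<N']"] 1 by simp
  show ?thesis unfolding encode_def Let_def inp_len_def by (simp add: 2 3)
qed

text \<open>Computes the length of the input from cells 0 and 2, which hold the numbers of arms and
  nodes. Array addresses can thus be relative to the end of an input of variable length.\<close>

definition base :: expr where
  "base = Plus (Plus (Const 3) (Cell (Const 0)))
     (Plus (Times (Const 3) (Cell (Const 2))) (Times (Const 2) (Times (Cell (Const 2)) (Cell (Const 2)))))"

definition adr :: "nat \<Rightarrow> expr \<Rightarrow> expr" where
  "adr k e = Plus base (Plus (Times e (Const 32)) (Const k))"

definition arr :: "nat \<Rightarrow> expr \<Rightarrow> expr" where
  "arr k e = Cell (adr k e)"

type_synonym store = "nat \<Rightarrow> nat \<Rightarrow> nat"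

text \<open>The arrays tile the memory behind the input without gaps or overlaps, so one assignment
  to an array element is exactly one memory update (\<open>mem_put\<close>) and reasoning can stay
  at the level of stores.\<close>

definition mem :: "(nat, rat) bandit \<Rightarrow> store \<Rightarrow> memory" where
  "mem J A a = (if a < inp_len J then encode J ! a else A ((a - inp_len J) mod 32) ((a - inp_len J) div 32))"

definition put :: "store \<Rightarrow> nat \<Rightarrow> nat \<Rightarrow> nat \<Rightarrow> store" where
  "put A k i v = A(k := (A k)(i := v))"

lemma put_same [simp]: "put A k i v k = (A k)(i := v)"
  by (simp add: put_def)

lemma put_other [simp]: "k' \<noteq> k \<Longrightarrow> put A k i v k' = A k'"
  by (simp add: put_def)

lemma mem_init: "init_memory J = mem J (\<lambda>_ _. 0)"
  by (auto simp: init_memory_def mem_def length_encode)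

lemma inp_len_pos: "3 \<le> inp_len J"
  by (simp add: inp_len_def)

lemma mem_inp: "a < inp_len J \<Longrightarrow> mem J A a = encode J ! a"
  by (simp add: mem_def)

lemma mem_012 [simp]:
  "mem J A 0 = arms J" "mem J A (Suc 0) = horizon J" "mem J A 2 = card (all_nodes J)"
  using inp_len_pos[of J] by (simp_all add: mem_def encode_def Let_def numeral_2_eq_2)

lemma val_adr: "val (adr k e) (mem J A) = inp_len J + (val e (mem J A) * 32 + k)"
  by (simp add: adr_def base_def inp_len_def)

lemma mem_adr: "k < 32 \<Longrightarrow> mem J A (inp_len J + (i * 32 + k)) = A k i"
  by (simp add: mem_def)

lemma val_arr [simp]: "k < 32 \<Longrightarrow> val (arr k e) (mem J A) = A k (val e (mem J A))"
  by (simp add: arr_def val_adr mem_adr)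

lemma mem_put: "k < 32 \<Longrightarrow> (mem J A)(inp_len J + (i * 32 + k) := v) = mem J (put A k i v)"
proof
  fix a assume k: "k < 32"
  show "((mem J A)(inp_len J + (i * 32 + k) := v)) a = mem J (put A k i v) a"
  proof (cases "a < inp_len J")
    case False
    then obtain d where a: "a = inp_len J + d" using le_Suc_ex not_less by metis
    have "d = i * 32 + k \<longleftrightarrow> d mod 32 = k \<and> d div 32 = i"
      using k div_mult_mod_eq[of d 32] by auto
    then show ?thesis by (auto simp: a mem_def put_def)
  qed (auto simp: mem_def)
qed

text \<open>The deterministic parts use a language of bounded loops with a total semantics
  \<open>ex\<close>. Their effect is then a function on stores, and running times and sizes of
  numbers are treated separately by \<open>ok\<close>.\<close>

datatype cmd = Asg nat expr expr | Seq cmd cmd | For nat expr cmd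

primrec loopn :: "nat \<Rightarrow> (store \<Rightarrow> store) \<Rightarrow> nat \<Rightarrow> store \<Rightarrow> store" where
  "loopn k f 0 A = put A k 0 0"
| "loopn k f (Suc j) A = put (f (loopn k f j A)) k 0 (Suc j)"

primrec ex :: "(nat, rat) bandit \<Rightarrow> cmd \<Rightarrow> store \<Rightarrow> store" where
  "ex J (Asg k a e) A = put A k (val a (mem J A)) (val e (mem J A))"
| "ex J (Seq c d) A = ex J d (ex J c A)"
| "ex J (For k e c) A = loopn k (ex J c) (val e (mem J (put A k 0 0))) A"

primrec writes :: "cmd \<Rightarrow> nat set" where
  "writes (Asg k a e) = {k}"
| "writes (Seq c d) = writes c \<union> writes d"
| "writes (For k e c) = insert k (writes c)"

lemma ex_frame: "k \<notin> writes c \<Longrightarrow> ex J c A k = A k"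
proof (induction c arbitrary: A)
  case (For l e c)
  have "loopn l (ex J c) j A k = A k" for j using For by (induction j) auto
  then show ?case by simp
qed auto

text \<open>Truncated subtraction makes the guard nonzero exactly while the counter is below the
  bound. The bound is evaluated again before every iteration, so \<open>ok\<close> demands that the
  loop keeps its value.\<close>

definition forp :: "nat \<Rightarrow> expr \<Rightarrow> prog \<Rightarrow> prog" where
  "forp k e c = Then (Assign (adr k (Const 0)) (Const 0))
     (Loop (Minus e (arr k (Const 0))) (Then c (Assign (adr k (Const 0)) (Plus (arr k (Const 0)) (Const 1)))))"

primrec compile :: "cmd \<Rightarrow> prog" where
  "compile (Asg k a e) = Assign (adr k a) e"
| "compile (Seq c d) = Then (compile c) (compile d)"
| "compile (For k e c) = forp k e (compile c)"

text \<open>Generous limits for all expressions of the program. Together with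
  \<open>8 \<le> b\<close> they give costs of at most \<open>900 ^ 2 * b = 810000 * b\<close>, so
  that two evaluations and the overhead of a command fit into one \<open>tick\<close>.\<close>

definition wfe :: "expr \<Rightarrow> bool" where
  "wfe e \<longleftrightarrow> esz e \<le> 900 \<and> cmax e < 256"

lemma esz_adr: "esz (adr k e) = esz e + 22"
  by (simp add: adr_def base_def)

lemma esz_arr: "esz (arr k e) = esz e + 23"
  by (simp add: arr_def esz_adr)

lemma cmax_adr: "k < 32 \<Longrightarrow> cmax (adr k e) < 256 \<longleftrightarrow> cmax e < 256"
  by (simp add: adr_def base_def)

lemma cmax_arr: "k < 32 \<Longrightarrow> cmax (arr k e) < 256 \<longleftrightarrow> cmax e < 256"
  by (simp add: arr_def cmax_adr)

definition bd :: "nat \<Rightarrow> store \<Rightarrow> bool" where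
  "bd b A \<longleftrightarrow> (\<forall>k i. A k i < 2 ^ b)"

lemma bd_put: "bd b A \<Longrightarrow> v < 2 ^ b \<Longrightarrow> bd b (put A k i v)"
  by (auto simp: bd_def put_def)

locale ram =
  fixes J :: "(nat, rat) bandit" and b :: nat
  assumes b: "8 \<le> b" and inp: "\<And>a. a < inp_len J \<Longrightarrow> encode J ! a < 2 ^ b"
begin

abbreviation "tick \<equiv> 2000000 * b"

lemma mem_bound: "bd b A \<Longrightarrow> mem J A a < 2 ^ b"
  using inp by (auto simp: mem_def bd_def)

lemma cost_wfe: "wfe e \<Longrightarrow> bd b A \<Longrightarrow> cost e (mem J A) \<le> 810000 * b"
proof -
  assume e: "wfe e" and A: "bd b A"
  have "(2::nat) ^ 8 \<le> 2 ^ b" using b by (intro power_increasing) auto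
  then have "cmax e < 2 ^ b" using e by (auto simp: wfe_def)
  then have "cost e (mem J A) \<le> b * (esz e)\<^sup>2" using b mem_bound[OF A] by (intro cost_bound) auto
  also have "\<dots> \<le> b * 900\<^sup>2" using e by (intro mult_left_mono power_mono) (auto simp: wfe_def)
  finally show ?thesis by simp
qed

lemma det_asg:
  assumes "bd b A" "wfe (adr k a)" "wfe e" "k < 32"
  shows "det (Assign (adr k a) e) (mem J A) (mem J (put A k (val a (mem J A)) (val e (mem J A)))) tick"
proof -
  have "det (Assign (adr k a) e) (mem J A) (mem J (put A k (val a (mem J A)) (val e (mem J A))))
      (1 + cost (adr k a) (mem J A) + cost e (mem J A))"
    using det_assign[of "adr k a" e "mem J A"] assms by (simp add: val_adr mem_put)
  then show ?thesis
    using cost_wfe[OF assms(2,1)] cost_wfe[OF assms(3,1)] b by (elim det_mono) linarith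
qed

text \<open>Certifies that all numbers stay below \<open>2 ^ b\<close> and that time
  \<open>t\<close> suffices. A loop has a single bound \<open>t1\<close> for all its iterations,
  which makes the total a product.\<close>

primrec ok :: "cmd \<Rightarrow> store \<Rightarrow> nat \<Rightarrow> bool" where
  "ok (Asg k a e) A t \<longleftrightarrow> k < 32 \<and> wfe (adr k a) \<and> wfe e \<and> val e (mem J A) < 2 ^ b \<and> tick \<le> t"
| "ok (Seq c d) A t \<longleftrightarrow> (\<exists>t1 t2. ok c A t1 \<and> ok d (ex J c A) t2 \<and> t1 + t2 + 1 \<le> t)"
| "ok (For k e c) A t \<longleftrightarrow> (\<exists>t1. k < 32 \<and> k \<notin> writes c \<and> wfe (Minus e (arr k (Const 0))) \<and>
     val e (mem J (put A k 0 0)) < 2 ^ b \<and>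
     (\<forall>j\<le>val e (mem J (put A k 0 0)). val e (mem J (loopn k (ex J c) j A)) = val e (mem J (put A k 0 0))) \<and>
     (\<forall>j<val e (mem J (put A k 0 0)). ok c (loopn k (ex J c) j A) t1) \<and>
     val e (mem J (put A k 0 0)) * (t1 + 3 * tick) + 3 * tick \<le> t)"

lemma ok_bd: "bd b A \<Longrightarrow> ok c A t \<Longrightarrow> bd b (ex J c A)"
proof (induction c arbitrary: A t)
  case (For k e c)
  let ?N = "val e (mem J (put A k 0 0))"
  from For.prems obtain t1 where ok: "\<forall>j<?N. ok c (loopn k (ex J c) j A) t1" and N: "?N < 2 ^ b" by auto
  have "j \<le> ?N \<Longrightarrow> bd b (loopn k (ex J c) j A)" for j
  proof (induction j)
    case (Suc j)
    then have "bd b (loopn k (ex J c) j A)" "ok c (loopn k (ex J c) j A) t1" using ok by auto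
    then have "bd b (ex J c (loopn k (ex J c) j A))" by (rule For.IH)
    moreover have "Suc j < 2 ^ b" using Suc.prems N by linarith
    ultimately show ?case by (simp add: bd_put)
  qed (use For.prems in \<open>simp add: bd_put\<close>)
  then show ?case by simp
qed (auto simp: bd_put)

lemma det_forp_loop:
  assumes body: "\<And>j. j < N \<Longrightarrow> det c (mem J (S j)) (mem J (S' j)) t1 \<and> bd b (S' j) \<and> S' j k 0 = j \<and> S (Suc j) = put (S' j) k 0 (Suc j)"
    and st: "\<And>j. j \<le> N \<Longrightarrow> bd b (S j) \<and> S j k 0 = j \<and> val e (mem J (S j)) = N"
    and k: "k < 32" "wfe (Minus e (arr k (Const 0)))"
  shows "j \<le> N \<Longrightarrow> det (Loop (Minus e (arr k (Const 0))) (Then c (Assign (adr k (Const 0)) (Plus (arr k (Const 0)) (Const 1)))))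
    (mem J (S (N - j))) (mem J (S N)) (j * (t1 + 3 * tick) + tick)"
proof (induction j)
  case 0
  have "det (Loop (Minus e (arr k (Const 0))) (Then c (Assign (adr k (Const 0)) (Plus (arr k (Const 0)) (Const 1)))))
    (mem J (S N)) (mem J (S N)) (1 + cost (Minus e (arr k (Const 0))) (mem J (S N)))"
    using st[of N] k by (intro det_loop_end) simp
  then show ?case using cost_wfe[OF k(2), of "S N"] st[of N] b by (simp, elim det_mono) linarith
next
  case (Suc j)
  let ?i = "N - Suc j"
  have i: "?i < N" "Suc ?i = N - j" using Suc.prems by auto
  have wf: "wfe (adr k (Const 0))" "wfe (Plus (arr k (Const 0)) (Const 1))"
    using k(1) by (auto simp: wfe_def esz_adr esz_arr cmax_adr cmax_arr)
  have "det (Assign (adr k (Const 0)) (Plus (arr k (Const 0)) (Const 1))) (mem J (S' ?i)) (mem J (S (N - j))) tick"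
    using det_asg[of "S' ?i" k "Const 0" "Plus (arr k (Const 0)) (Const 1)"] body[OF i(1)] wf k i by simp
  then have d: "det (Then c (Assign (adr k (Const 0)) (Plus (arr k (Const 0)) (Const 1)))) (mem J (S ?i)) (mem J (S (N - j))) (t1 + tick + 1)"
    using body[OF i(1)] by (intro det_then) auto
  have v: "val (Minus e (arr k (Const 0))) (mem J (S ?i)) \<noteq> 0"
    using st[of ?i] k i by simp
  have "det (Loop (Minus e (arr k (Const 0))) (Then c (Assign (adr k (Const 0)) (Plus (arr k (Const 0)) (Const 1)))))
    (mem J (S ?i)) (mem J (S N)) (1 + cost (Minus e (arr k (Const 0))) (mem J (S ?i)) + (t1 + tick + 1 + (j * (t1 + 3 * tick) + tick) + 1))"
    using Suc by (intro det_loop_step[OF v d]) auto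
  then show ?case
    using cost_wfe[OF k(2), of "S ?i"] st[of ?i] b by (elim det_mono) (simp add: algebra_simps)
qed

lemma det_forp:
  assumes "bd b A"
    and body: "\<And>j. j < N \<Longrightarrow> det c (mem J (S j)) (mem J (S' j)) t1 \<and> bd b (S' j) \<and> S' j k 0 = j \<and> S (Suc j) = put (S' j) k 0 (Suc j)"
    and st: "\<And>j. j \<le> N \<Longrightarrow> bd b (S j) \<and> S j k 0 = j \<and> val e (mem J (S j)) = N"
    and k: "k < 32" "wfe (Minus e (arr k (Const 0)))" and S0: "S 0 = put A k 0 0"
  shows "det (forp k e c) (mem J A) (mem J (S N)) (N * (t1 + 3 * tick) + 3 * tick)"
proof -
  have wf: "wfe (adr k (Const 0))" "wfe (Const 0)"
    using k(1) by (auto simp: wfe_def esz_adr cmax_adr)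
  have "det (Assign (adr k (Const 0)) (Const 0)) (mem J A) (mem J (S 0)) tick"
    using det_asg[of A k "Const 0" "Const 0"] assms(1) wf k S0 by simp
  moreover have "det (Loop (Minus e (arr k (Const 0))) (Then c (Assign (adr k (Const 0)) (Plus (arr k (Const 0)) (Const 1)))))
    (mem J (S 0)) (mem J (S N)) (N * (t1 + 3 * tick) + tick)"
    using det_forp_loop[OF body st k, of N] by simp
  ultimately have "det (forp k e c) (mem J A) (mem J (S N)) (tick + (N * (t1 + 3 * tick) + tick) + 1)"
    unfolding forp_def by (rule det_then)
  then show ?thesis using b by (elim det_mono) simp
qed

theorem compile_det: "bd b A \<Longrightarrow> ok c A t \<Longrightarrow> det (compile c) (mem J A) (mem J (ex J c A)) t"
proof (induction c arbitrary: A t)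
  case (Asg k a e)
  then show ?case using det_asg[of A k a e] by (auto elim: det_mono)
next
  case (Seq c d)
  from Seq.prems obtain t1 t2 where t: "ok c A t1" "ok d (ex J c A) t2" "t1 + t2 + 1 \<le> t" by auto
  have 1: "det (compile c) (mem J A) (mem J (ex J c A)) t1" by (rule Seq.IH(1)[OF Seq.prems(1) t(1)])
  have 2: "det (compile d) (mem J (ex J c A)) (mem J (ex J d (ex J c A))) t2"
    by (rule Seq.IH(2)[OF ok_bd[OF Seq.prems(1) t(1)] t(2)])
  show ?case using det_mono[OF det_then[OF 1 2] t(3)] by simp
next
  case (For k e c)
  let ?N = "val e (mem J (put A k 0 0))"
  let ?S = "\<lambda>j. loopn k (ex J c) j A"
  from For.prems obtain t1 where k: "k < 32" "k \<notin> writes c" "wfe (Minus e (arr k (Const 0)))" "?N < 2 ^ b"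
    and N: "\<And>j. j \<le> ?N \<Longrightarrow> val e (mem J (?S j)) = ?N" and ok: "\<And>j. j < ?N \<Longrightarrow> ok c (?S j) t1"
    and t: "?N * (t1 + 3 * tick) + 3 * tick \<le> t" by auto
  have bdS: "j \<le> ?N \<Longrightarrow> bd b (?S j)" for j
  proof (induction j)
    case (Suc j)
    then have "bd b (?S j)" "ok c (?S j) t1" using ok by auto
    then have "bd b (ex J c (?S j))" by (rule ok_bd)
    moreover have "Suc j < 2 ^ b" using Suc.prems k by linarith
    ultimately show ?case by (simp add: bd_put)
  qed (use For.prems in \<open>simp add: bd_put\<close>)
  have S0: "?S j k 0 = j" for j by (cases j) auto
  have "det (forp k e (compile c)) (mem J A) (mem J (?S ?N)) (?N * (t1 + 3 * tick) + 3 * tick)"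
  proof (rule det_forp[where S' = "\<lambda>j. ex J c (?S j)"])
    fix j assume j: "j < ?N"
    have "det (compile c) (mem J (?S j)) (mem J (ex J c (?S j))) t1" using For.IH bdS ok j by simp
    moreover have "bd b (ex J c (?S j))" using ok_bd[OF bdS ok[OF j]] j by simp
    ultimately show "det (compile c) (mem J (?S j)) (mem J (ex J c (?S j))) t1 \<and> bd b (ex J c (?S j)) \<and>
      ex J c (?S j) k 0 = j \<and> ?S (Suc j) = put (ex J c (?S j)) k 0 (Suc j)"
      using ex_frame[OF k(2)] S0 by simp
  qed (use For.prems bdS S0 N k in auto)
  then show ?case using t by (auto elim: det_mono)
qed

definition agree :: "nat set \<Rightarrow> store \<Rightarrow> store \<Rightarrow> bool" where
  "agree X A A' \<longleftrightarrow> (\<forall>k. k \<notin> X \<longrightarrow> A' k = A k)"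

lemma agree_ex: "agree (writes c) A (ex J c A)"
  by (simp add: agree_def ex_frame)

text \<open>\<open>agree\<close> takes care of the frame: what the loop does not write keeps its
  value throughout, so the invariant only has to describe what changes.\<close>

lemma for_rule:
  assumes A: "bd b A" and k: "k < 32" "k \<notin> writes c" "wfe (Minus e (arr k (Const 0)))" "N < 2 ^ b"
    and N: "\<And>A'. agree (insert k (writes c)) A A' \<Longrightarrow> val e (mem J A') = N"
    and init: "Inv 0 (put A k 0 0)"
    and step: "\<And>j A'. j < N \<Longrightarrow> bd b A' \<Longrightarrow> agree (insert k (writes c)) A A' \<Longrightarrow> A' k 0 = j \<Longrightarrow> Inv j A' \<Longrightarrow>
      ok c A' t \<and> Inv (Suc j) (put (ex J c A') k 0 (Suc j))"
  shows "ok (For k e c) A (N * (t + 3 * tick) + 3 * tick) \<and> Inv N (ex J (For k e c) A)"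
proof -
  let ?S = "\<lambda>j. loopn k (ex J c) j A"
  have agr: "agree (insert k (writes c)) A (?S j)" for j
    by (induction j) (auto simp: agree_def ex_frame)
  have S0: "?S j k 0 = j" for j by (cases j) auto
  have inv: "j \<le> N \<Longrightarrow> bd b (?S j) \<and> Inv j (?S j)" for j
  proof (induction j)
    case 0
    then show ?case using init A by (simp add: bd_put)
  next
    case (Suc j)
    then have I: "bd b (?S j)" "Inv j (?S j)" "j < N" by auto
    from step[OF I(3,1) agr S0 I(2)] have s: "ok c (?S j) t" "Inv (Suc j) (?S (Suc j))" by auto
    have "bd b (ex J c (?S j))" using ok_bd[OF I(1) s(1)] .
    moreover have "Suc j < 2 ^ b" using Suc.prems k by linarith
    ultimately show ?case using s by (simp add: bd_put)
  qed
  have v: "val e (mem J (put A k 0 0)) = N" using N[of "put A k 0 0"] by (simp add: agree_def)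
  have vj: "val e (mem J (?S j)) = N" for j by (rule N[OF agr])
  have okj: "j < N \<Longrightarrow> ok c (?S j) t" for j using step[of j "?S j"] inv[of j] agr S0 by auto
  have "ok (For k e c) A (N * (t + 3 * tick) + 3 * tick)"
    using k v vj okj by auto
  moreover have "Inv N (ex J (For k e c) A)" using v inv[of N] by simp
  ultimately show ?thesis ..
qed

lemma ok_mono: "ok c A t \<Longrightarrow> t \<le> t' \<Longrightarrow> ok c A t'"
  by (cases c) (auto intro: order_trans)

section \<open>Probabilistic triples\<close>

text \<open>Assertions speak about the claim \<open>v\<close> of \<open>prov\<close> as well, so an
  invariant can compare \<open>v\<close> with the conditional expectation of what is still to
  come.\<close>

definition ptr :: "prog \<Rightarrow> nat \<Rightarrow> (store \<Rightarrow> nat env \<Rightarrow> real \<Rightarrow> bool) \<Rightarrow> (store \<Rightarrow> nat env \<Rightarrow> real \<Rightarrow> bool) \<Rightarrow> bool" where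
  "ptr c T Pre Post \<longleftrightarrow> (\<forall>A e v P T'. bd b A \<longrightarrow> Pre A e v \<longrightarrow>
     (\<forall>A' e' v' T''. T'' \<ge> T' \<longrightarrow> bd b A' \<longrightarrow> Post A' e' v' \<longrightarrow> P (mem J A') e' T'' v') \<longrightarrow>
     prov (real_bandit J) P c (mem J A) e (T + T') v)"

lemma ptrD:
  assumes "ptr c T Pre Post" "bd b A" "Pre A e v" "T + T' \<le> S"
    "\<And>A' e' v' T''. T'' \<ge> T' \<Longrightarrow> bd b A' \<Longrightarrow> Post A' e' v' \<Longrightarrow> P (mem J A') e' T'' v'"
  shows "prov (real_bandit J) P c (mem J A) e S v"
proof -
  have "prov (real_bandit J) P c (mem J A) e (T + (S - T)) v"
  proof (rule assms(1)[unfolded ptr_def, rule_format, where P = P and T' = "S - T", OF assms(2,3)])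
    fix A' e' v' T'' assume "S - T \<le> T''" "bd b A'" "Post A' e' v'"
    then show "P (mem J A') e' T'' v'" using assms(4) by (intro assms(5)) auto
  qed
  then show ?thesis using assms(4) by simp
qed

lemma ptr_conseq:
  assumes "ptr c T Pre Post" "T \<le> T'"
    "\<And>A e v. bd b A \<Longrightarrow> Pre' A e v \<Longrightarrow> Pre A e v" "\<And>A e v. bd b A \<Longrightarrow> Post A e v \<Longrightarrow> Post' A e v"
  shows "ptr c T' Pre' Post'"
  unfolding ptr_def
proof (intro allI impI)
  fix A e v and P :: "memory \<Rightarrow> nat env \<Rightarrow> nat \<Rightarrow> real \<Rightarrow> bool" and S :: nat
  assume A: "bd b A" and pre: "Pre' A e v"
    and P: "\<forall>A' e' v' T''. T'' \<ge> S \<longrightarrow> bd b A' \<longrightarrow> Post' A' e' v' \<longrightarrow> P (mem J A') e' T'' v'"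
  show "prov (real_bandit J) P c (mem J A) e (T' + S) v"
  proof (rule ptrD[OF assms(1), OF A assms(3)[OF A pre], where T' = S and P = P])
    show "T + S \<le> T' + S" using assms(2) by simp
    fix A' e' v' T'' assume "S \<le> T''" "bd b A'" "Post A' e' v'"
    then show "P (mem J A') e' T'' v'" using P assms(4) by blast
  qed
qed

lemma ptr_det:
  assumes "\<And>A e v. bd b A \<Longrightarrow> Pre A e v \<Longrightarrow> ok c A T \<and> Post (ex J c A) e v"
  shows "ptr (compile c) T Pre Post"
  unfolding ptr_def
proof (intro allI impI)
  fix A e v and P :: "memory \<Rightarrow> nat env \<Rightarrow> nat \<Rightarrow> real \<Rightarrow> bool" and T' :: nat
  assume A: "bd b A" and pre: "Pre A e v"
    and P: "\<forall>A' e' v' T''. T'' \<ge> T' \<longrightarrow> bd b A' \<longrightarrow> Post A' e' v' \<longrightarrow> P (mem J A') e' T'' v'"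
  from assms[OF A pre] have c: "ok c A T" "Post (ex J c A) e v" by auto
  have "\<forall>T''\<ge>T'. P (mem J (ex J c A)) e T'' v" using P c ok_bd[OF A c(1)] by blast
  then show "prov (real_bandit J) P (compile c) (mem J A) e (T + T') v"
    using compile_det[OF A c(1)] unfolding det_def by blast
qed

lemma ptr_then:
  assumes "ptr c T1 Pre Mid" "ptr d T2 Mid Post"
  shows "ptr (Then c d) (T1 + T2 + 1) Pre Post"
  unfolding ptr_def
proof (intro allI impI)
  fix A e v and P :: "memory \<Rightarrow> nat env \<Rightarrow> nat \<Rightarrow> real \<Rightarrow> bool" and T' :: nat
  assume A: "bd b A" and pre: "Pre A e v"
    and P: "\<forall>A' e' v' T''. T'' \<ge> T' \<longrightarrow> bd b A' \<longrightarrow> Post A' e' v' \<longrightarrow> P (mem J A') e' T'' v'"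
  show "prov (real_bandit J) P (Then c d) (mem J A) e (T1 + T2 + 1 + T') v"
  proof (rule prov_then, rule ptrD[OF assms(1), OF A pre, where T' = "T2 + 1 + T'" and P = "\<lambda>m e T v. 1 \<le> T \<and> prov (real_bandit J) P d m e (T - 1) v"])
    fix A' e' v' T'' assume T: "T2 + 1 + T' \<le> T''" and A': "bd b A'" "Mid A' e' v'"
    have "prov (real_bandit J) P d (mem J A') e' (T'' - 1) v'"
    proof (rule ptrD[OF assms(2), OF A', where T' = T' and P = P])
      show "T2 + T' \<le> T'' - 1" using T by simp
      fix A'' e'' v'' S assume "T' \<le> S" "bd b A''" "Post A'' e'' v''"
      then show "P (mem J A'') e'' S v''" using P by blast
    qed
    then show "1 \<le> T'' \<and> prov (real_bandit J) P d (mem J A') e' (T'' - 1) v'" using T by simp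
  qed simp
qed

lemma ptr_forp:
  assumes body: "\<And>j. j < N \<Longrightarrow> ptr c t (\<lambda>A e v. A k 0 = j \<and> Inv j A e v) (\<lambda>A e v. A k 0 = j \<and> Inv (Suc j) (put A k 0 (Suc j)) e v)"
    and N: "\<And>j A e v. Inv j A e v \<Longrightarrow> val be (mem J A) = N"
    and k: "k < 32" "wfe (Minus be (arr k (Const 0)))" "N < 2 ^ b"
  shows "ptr (forp k be c) (N * (t + 3 * tick) + 3 * tick) (\<lambda>A e v. Inv 0 (put A k 0 0) e v) (Inv N)"
proof -
  let ?inc = "Assign (adr k (Const 0)) (Plus (arr k (Const 0)) (Const 1))"
  let ?L = "Loop (Minus be (arr k (Const 0))) (Then c ?inc)"
  have wf: "wfe (adr k (Const 0))" "wfe (Plus (arr k (Const 0)) (Const 1))" "wfe (Const 0)"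
    using k(1) by (auto simp: wfe_def esz_adr esz_arr cmax_adr cmax_arr)
  have inc: "ptr ?inc tick (\<lambda>A e v. A k 0 = j \<and> Inv (Suc j) (put A k 0 (Suc j)) e v) (\<lambda>A e v. A k 0 = Suc j \<and> Inv (Suc j) A e v)"
    if j: "j < N" for j
  proof -
    have "ptr (compile (Asg k (Const 0) (Plus (arr k (Const 0)) (Const 1)))) tick
      (\<lambda>A e v. A k 0 = j \<and> Inv (Suc j) (put A k 0 (Suc j)) e v) (\<lambda>A e v. A k 0 = Suc j \<and> Inv (Suc j) A e v)"
      using wf k j by (intro ptr_det) auto
    then show ?thesis by simp
  qed
  have loop: "j \<le> N \<Longrightarrow> ptr ?L (j * (t + 3 * tick) + tick) (\<lambda>A e v. A k 0 = N - j \<and> Inv (N - j) A e v) (Inv N)" for j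
  proof (induction j)
    case 0
    show ?case unfolding ptr_def
    proof (intro allI impI)
      fix A e v and P :: "memory \<Rightarrow> nat env \<Rightarrow> nat \<Rightarrow> real \<Rightarrow> bool" and T' :: nat
      assume A: "bd b A" and pre: "A k 0 = N - 0 \<and> Inv (N - 0) A e v"
        and P: "\<forall>A' e' v' T''. T'' \<ge> T' \<longrightarrow> bd b A' \<longrightarrow> Inv N A' e' v' \<longrightarrow> P (mem J A') e' T'' v'"
      have "det ?L (mem J A) (mem J A) (1 + cost (Minus be (arr k (Const 0))) (mem J A))"
      proof (rule det_loop_end)
        have "val be (mem J A) = N" using N pre by blast
        then show "val (Minus be (arr k (Const 0))) (mem J A) = 0" using pre k by simp
      qed
      then have "det ?L (mem J A) (mem J A) tick" using cost_wfe[OF k(2) A] b by (elim det_mono) linarith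
      moreover have "Inv N A e v" using pre by simp
      then have "\<forall>T''\<ge>T'. P (mem J A) e T'' v" using P A by blast
      ultimately have "prov (real_bandit J) P ?L (mem J A) e (tick + T') v"
        unfolding det_def by blast
      then show "prov (real_bandit J) P ?L (mem J A) e (0 * (t + 3 * tick) + tick + T') v"
        by (simp only: mult_0 add_0)
    qed
  next
    case (Suc j)
    let ?i = "N - Suc j"
    have i: "?i < N" "Suc ?i = N - j" using Suc.prems by auto
    have "ptr (Then c ?inc) (t + tick + 1) (\<lambda>A e v. A k 0 = ?i \<and> Inv ?i A e v) (\<lambda>A e v. A k 0 = N - j \<and> Inv (N - j) A e v)"
      using ptr_then[OF body[OF i(1)] inc[OF i(1)]] unfolding i(2) .
    then have th: "ptr (Then (Then c ?inc) ?L) (t + tick + 1 + (j * (t + 3 * tick) + tick) + 1) (\<lambda>A e v. A k 0 = ?i \<and> Inv ?i A e v) (Inv N)"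
    proof (rule ptr_then)
      show "ptr ?L (j * (t + 3 * tick) + tick) (\<lambda>A e v. A k 0 = N - j \<and> Inv (N - j) A e v) (Inv N)"
        using Suc by simp
    qed
    show ?case unfolding ptr_def
    proof (intro allI impI)
      fix A e v and P :: "memory \<Rightarrow> nat env \<Rightarrow> nat \<Rightarrow> real \<Rightarrow> bool" and T' :: nat
      assume A: "bd b A" and pre: "A k 0 = ?i \<and> Inv ?i A e v"
        and P: "\<forall>A' e' v' T''. T'' \<ge> T' \<longrightarrow> bd b A' \<longrightarrow> Inv N A' e' v' \<longrightarrow> P (mem J A') e' T'' v'"
      let ?c = "1 + cost (Minus be (arr k (Const 0))) (mem J A)"
      have c: "?c \<le> 810000 * b + 1" using cost_wfe[OF k(2) A] by simp
      have "val be (mem J A) = N" using N pre by blast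
      then have "val (Minus be (arr k (Const 0))) (mem J A) \<noteq> 0" using pre k i by simp
      then have st: "step (real_bandit J) ?L (mem J A) e = return_pmf (Then (Then c ?inc) ?L, mem J A, e, ?c)" by simp
      let ?S = "Suc j * (t + 3 * tick) + tick + T'"
      have "t + tick + 1 + (j * (t + 3 * tick) + tick) + 1 + T' \<le> ?S - ?c"
        using c b by (simp add: algebra_simps)
      then have "prov (real_bandit J) P (Then (Then c ?inc) ?L) (mem J A) e (?S - ?c) v"
      proof (rule ptrD[OF th, OF A pre, where T' = T' and P = P])
        fix A' e' v' T'' assume "T' \<le> T''" "bd b A'" "Inv N A' e' v'"
        then show "P (mem J A') e' T'' v'" using P by blast
      qed
      moreover have "?c \<le> ?S" using c b by (simp add: algebra_simps)
      ultimately show "prov (real_bandit J) P ?L (mem J A) e ?S v"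
        using prov_det_step[OF _ st, of P "?S - ?c" v] by (metis le_add_diff_inverse prog.distinct(11))
    qed
  qed
  have init: "ptr (compile (Asg k (Const 0) (Const 0))) tick (\<lambda>A e v. Inv 0 (put A k 0 0) e v) (\<lambda>A e v. A k 0 = N - N \<and> Inv (N - N) A e v)"
    using wf k by (intro ptr_det) auto
  have "ptr (forp k be c) (tick + (N * (t + 3 * tick) + tick) + 1) (\<lambda>A e v. Inv 0 (put A k 0 0) e v) (Inv N)"
    unfolding forp_def using ptr_then[OF init loop[OF order_refl]] by simp
  then show ?thesis using b by (elim ptr_conseq) auto
qed

end

section \<open>The algorithm in integer arithmetic\<close>

definition num :: "rat \<Rightarrow> nat" where "num q = nat (fst (quotient_of q))"
definition den :: "rat \<Rightarrow> nat" where "den q = nat (snd (quotient_of q))"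

lemma rat_code_eq: "rat_code q = [num q, den q]"
  by (simp add: rat_code_def num_def den_def case_prod_unfold)

lemma den_pos: "0 < den q"
  by (simp add: den_def quotient_of_denom_pos')

lemma num_den: "0 \<le> q \<Longrightarrow> real_of_rat q = real (num q) / real (den q)"
proof -
  assume q: "0 \<le> q"
  obtain a b where ab: "quotient_of q = (a, b)" by (cases "quotient_of q")
  have b: "b > 0" using quotient_of_denom_pos[OF ab] .
  have qe: "q = of_int a / of_int b" using quotient_of_div[OF ab] .
  with q b have a: "0 \<le> a" by (simp add: zero_le_divide_iff)
  have "real_of_rat q = of_int a / of_int b" unfolding qe by (simp add: of_rat_divide)
  then show ?thesis using a b by (simp add: num_def den_def ab)
qed

lemma nth_concat_uniform:
  assumes "\<And>i. i < m \<Longrightarrow> length (f i) = k" "i < m" "r < k"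
  shows "concat (map f [0..<m]) ! (k * i + r) = f i ! r"
  using assms
proof (induction m)
  case (Suc m)
  have len: "length (concat (map f [0..<m])) = k * m"
  proof -
    have "map (length \<circ> f) [0..<m] = map (\<lambda>_. k) [0..<m]" using Suc.prems(1) by auto
    then show ?thesis by (simp only: length_concat map_map) (simp add: sum_list_triv)
  qed
  show ?case
  proof (cases "i = m")
    case True
    then show ?thesis using len by (simp add: nth_append)
  next
    case False
    then have "i < m" using Suc.prems by simp
    then have "k * i + r < k * m" using Suc.prems(3)
      by (metis Suc_leI add.commute add_less_cancel_left le_trans mult_Suc_right mult_le_mono2 not_le)
    then show ?thesis using Suc False len by (simp add: nth_append)
  qed
qed simp

text \<open>The common shape of all dynamic programs of the algorithm: \<open>F s u acc prev\<close> is the value with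
  \<open>s + 1\<close> steps left at node \<open>u\<close>, where \<open>acc\<close> is the expected value after a transition and \<open>prev\<close> the value
  with \<open>s\<close> steps left.\<close>

primrec bk :: "nat \<Rightarrow> (nat \<Rightarrow> nat) \<Rightarrow> (nat \<Rightarrow> nat \<Rightarrow> nat \<Rightarrow> nat \<Rightarrow> nat) \<Rightarrow> nat \<Rightarrow> nat \<Rightarrow> nat" where
  "bk N M F 0 u = 0"
| "bk N M F (Suc s) u = F s u (\<Sum>v<N. M (u * N + v) * bk N M F s v) (bk N M F s u)"

locale inst =
  fixes J :: "(nat, rat) bandit"
  assumes input: "input_bandit J"
begin

abbreviation "I \<equiv> real_bandit J"

sublocale mab I
  using input by unfold_locales (simp add: input_bandit_def)

abbreviation "N \<equiv> card (all_nodes J)"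

lemma arms_I [simp]: "arms I = arms J" and horizon_I [simp]: "horizon I = horizon J"
  and tprob_I: "tprob I u v = real_of_rat (tprob J u v)" and reward_I: "reward I u = real_of_rat (reward J u)"
  and root_I [simp]: "root_node I = root_node J" and all_nodes_I [simp]: "all_nodes I = all_nodes J"
  by (simp_all add: real_bandit_def all_nodes_def)

lemma nodes_N: "all_nodes J = {..<N}"
  using input by (simp add: input_bandit_def)

lemma in_nodes [intro]: "u < N \<Longrightarrow> u \<in> all_nodes J"
  by (subst nodes_N) simp

text \<open>The plain product of all denominators serves as common denominator; its bit length is
  still bounded by the input size (\<open>DD_le\<close>).\<close>

definition DD :: nat where
  "DD = (\<Prod>u<N. den (reward J u)) * (\<Prod>w<N * N. den (tprob J (w div N) (w mod N)))"

definition RN :: "nat \<Rightarrow> nat" where "RN u = num (reward J u) * (DD div den (reward J u))"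
definition PN :: "nat \<Rightarrow> nat" where
  "PN w = num (tprob J (w div N) (w mod N)) * (DD div den (tprob J (w div N) (w mod N)))"

lemma DD_pos: "1 \<le> DD"
  unfolding DD_def using den_pos by (simp add: Suc_le_eq prod_pos)

lemma real_RN: "u < N \<Longrightarrow> real (RN u) = reward I u * real DD"
proof -
  assume u: "u < N"
  then have "den (reward J u) dvd DD" unfolding DD_def by (intro dvd_mult2 dvd_prodI) auto
  then have "real (DD div den (reward J u)) = real DD / real (den (reward J u))" by (rule real_of_nat_div)
  moreover have "0 \<le> reward J u" using reward_nonneg[of u] in_nodes[OF u] by (simp add: reward_I)
  ultimately show ?thesis by (simp add: RN_def reward_I num_den)
qed

lemma real_PN: "u < N \<Longrightarrow> v < N \<Longrightarrow> real (PN (u * N + v)) = tprob I u v * real DD"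
proof -
  assume u: "u < N" and v: "v < N"
  have dm: "(u * N + v) div N = u" "(u * N + v) mod N = v" using u v by auto
  have w: "u * N + v < N * N"
  proof -
    have "u * N + v < Suc u * N" using v by simp
    also have "\<dots> \<le> N * N" using u by (intro mult_le_mono1) auto
    finally show ?thesis .
  qed
  have "den (tprob J ((u * N + v) div N) ((u * N + v) mod N)) dvd DD"
    unfolding DD_def using w by (intro dvd_mult dvd_prodI[of _ _ "\<lambda>w. den (tprob J (w div N) (w mod N))"]) auto
  then have "den (tprob J u v) dvd DD" unfolding dm .
  then have "real (DD div den (tprob J u v)) = real DD / real (den (tprob J u v))" by (rule real_of_nat_div)
  moreover have "0 \<le> tprob J u v" using prob_nonneg[of u v] in_nodes[OF u] by (simp add: tprob_I)
  ultimately show ?thesis unfolding PN_def dm by (simp add: tprob_I num_den)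
qed

abbreviation "bkn \<equiv> bk N PN"

text \<open>Values with \<open>s\<close> steps left are scaled by \<open>DD ^ s\<close>, since every
  transition brings one more denominator; \<open>RN\<close> contains the missing factor for the
  immediate reward.\<close>

definition WN :: "nat \<Rightarrow> nat \<Rightarrow> nat" where
  "WN = bkn (\<lambda>s u acc prev. RN u * DD ^ s + acc)"

definition WT :: nat where "WT = (\<Sum>i<arms J. WN (horizon J) (root_node J (Suc i)))"

text \<open>With truncated subtraction \<open>a + (x - a)\<close> is a maximum, and truncating a
  negative priced value to 0 does not affect it as \<open>a\<close> is nonnegative. The factor
  \<open>QQ * DD ^ (2 * horizon J)\<close> clears the denominators of the prices: \<open>WT\<close>
  and \<open>L\<close> contribute one power \<open>DD ^ horizon J\<close> each, and the rate
  contributes \<open>QQ\<close>.\<close>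

definition VN :: "(nat \<Rightarrow> nat) \<Rightarrow> nat \<Rightarrow> nat \<Rightarrow> nat" where
  "VN L = bkn (\<lambda>s u acc prev. DD * prev +
     ((RN u * DD ^ s * (QQ * DD ^ (2 * horizon J)) + acc - WT * L (Suc s) * DD ^ Suc s) - DD * prev))"

text \<open>An entry equals its own row number exactly if the table plays there, so one array serves
  the load computation as well as the online lookup of the next play.\<close>

definition XN :: "(nat \<Rightarrow> nat) \<Rightarrow> nat \<Rightarrow> nat \<Rightarrow> nat" where
  "XN L = bkn (\<lambda>s u acc prev. if VN L (Suc s) u > DD * VN L s u then Suc s else prev)"

definition UX :: "(nat \<Rightarrow> nat) \<Rightarrow> nat \<Rightarrow> nat \<Rightarrow> nat \<Rightarrow> nat" where
  "UX L t = bkn (\<lambda>s u acc prev. if XN L (Suc s) u = Suc s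
     then (if Suc s = t then DD ^ Suc s else 0) + acc else DD * prev)"

definition LD :: "(nat \<Rightarrow> nat) \<Rightarrow> nat \<Rightarrow> nat" where
  "LD L t = (\<Sum>i<arms J. UX L t (horizon J) (root_node J (Suc i)))"

text \<open>Truncated subtraction performs the projection of the subgradient step.\<close>

primrec LN :: "nat \<Rightarrow> nat \<Rightarrow> nat" where
  "LN 0 = (\<lambda>s. 0)"
| "LN (Suc k) = (\<lambda>s. LN k s + LD (LN k) s - DD ^ horizon J)"

lemma sum_nodes: "(\<Sum>v\<in>all_nodes J. f v) = (\<Sum>v<N. f v)"
  by (subst nodes_N) simp

lemma real_acc:
  assumes "u < N" "\<And>v. v < N \<Longrightarrow> real (f v) = g v * c"
  shows "real (\<Sum>v<N. PN (u * N + v) * f v) = (\<Sum>v\<in>all_nodes J. tprob I u v * g v) * (real DD * c)"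
proof -
  have "real (\<Sum>v<N. PN (u * N + v) * f v) = (\<Sum>v<N. (tprob I u v * g v) * (real DD * c))"
    using assms by (simp add: real_PN) (intro sum.cong, auto)
  then show ?thesis by (simp add: sum_nodes sum_distrib_right)
qed

lemma real_WN: "u < N \<Longrightarrow> real (WN s u) = V (\<lambda>_. 0) s u * real DD ^ s"
proof -
  have "u < N \<Longrightarrow> real (WN s u) = U (\<lambda>_ _. True) (\<lambda>_. reward I) s u * real DD ^ s"
  proof (induction s arbitrary: u)
    case (Suc s)
    have "real (WN (Suc s) u) = real (RN u) * real DD ^ s + real (\<Sum>v<N. PN (u * N + v) * WN s v)"
      by (simp add: WN_def)
    then show ?case
      using real_acc[of u "WN s" "U (\<lambda>_ _. True) (\<lambda>_. reward I) s" "real DD ^ s"] Suc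
      by (simp add: real_RN algebra_simps)
  qed (simp add: WN_def)
  then show "u < N \<Longrightarrow> real (WN s u) = V (\<lambda>_. 0) s u * real DD ^ s"
    using V_zero[of u s] by (simp add: in_nodes)
qed

lemma nodes_lt: "u \<in> all_nodes J \<Longrightarrow> u < N"
  using nodes_N by (metis lessThan_iff)

lemma root_N: "i < arms J \<Longrightarrow> root_node J (Suc i) < N"
  using root_in[of "Suc i"] by (intro nodes_lt) simp

lemma sum_arms: "(\<Sum>i<arms J. f (Suc i)) = (\<Sum>i=1..arms J. f i)"
  by (rule sum.reindex_bij_witness[of _ "\<lambda>i. i - 1" Suc]) auto

lemma real_WT: "real WT = dual (\<lambda>_. 0) * real DD ^ horizon J"
  unfolding WT_def dual_def
  using sum_arms[of "\<lambda>i. V (\<lambda>_. 0) (horizon J) (root_node J i) * real DD ^ horizon J"]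
  by (simp add: real_WN root_N sum_distrib_right)

definition scale :: real where "scale = real QQ * real DD ^ (2 * horizon J)"

lemma scale_pos: "scale > 0"
  unfolding scale_def using QQ_pos DD_pos by auto

lemma real_max_diff: "real (a + ((y - l) - a)) = max (real a) (real y - real l)" for a y l :: nat
  by (simp add: max_def of_nat_diff)

context
  fixes L :: "nat \<Rightarrow> nat" and lam :: "nat \<Rightarrow> real"
  assumes lam: "\<And>s. 1 \<le> s \<Longrightarrow> s \<le> horizon J \<Longrightarrow> real WT * real (L s) = lam s * scale"
begin

lemma real_VN: "s \<le> horizon J \<Longrightarrow> u < N \<Longrightarrow> real (VN L s u) = V lam s u * (scale * real DD ^ s)"
proof (induction s arbitrary: u)
  case (Suc s)
  let ?a = "DD * VN L s u"
  let ?y = "RN u * DD ^ s * (QQ * DD ^ (2 * horizon J)) + (\<Sum>v<N. PN (u * N + v) * VN L s v)"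
  let ?l = "WT * L (Suc s) * DD ^ Suc s"
  let ?c = "scale * real DD ^ Suc s"
  have a: "real ?a = V lam s u * ?c" using Suc by simp
  have y: "real ?y = (reward I u + (\<Sum>v\<in>all_nodes J. tprob I u v * V lam s v)) * ?c"
    using real_acc[of u "VN L s" "V lam s" "scale * real DD ^ s"] Suc
    by (simp add: real_RN scale_def algebra_simps del: of_nat_sum)
  have l: "real ?l = lam (Suc s) * ?c" using lam[of "Suc s"] Suc.prems by (simp add: algebra_simps)
  have "real (VN L (Suc s) u) = max (real ?a) (real ?y - real ?l)"
    unfolding real_max_diff[symmetric] by (simp add: VN_def)
  also have "\<dots> = max (V lam s u * ?c) ((reward I u - lam (Suc s) + (\<Sum>v\<in>all_nodes J. tprob I u v * V lam s v)) * ?c)"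
    unfolding a y l by (simp add: algebra_simps)
  also have "\<dots> = V lam (Suc s) u * ?c"
    using scale_pos by (simp add: max_mult_distrib_right)
  finally show ?case .
qed (simp add: VN_def)

lemma XN_nx: "s \<le> horizon J \<Longrightarrow> u < N \<Longrightarrow> XN L s u = nx (greedy lam) s u"
proof (induction s arbitrary: u)
  case (Suc s)
  have "VN L (Suc s) u > DD * VN L s u \<longleftrightarrow> real (VN L (Suc s) u) > real (DD * VN L s u)" by (simp only: of_nat_less_iff)
  also have "\<dots> \<longleftrightarrow> V lam (Suc s) u * (scale * real DD ^ Suc s) > V lam s u * (scale * real DD ^ Suc s)"
    using real_VN[of "Suc s" u] real_VN[of s u] Suc.prems by (simp add: mult_ac del: V.simps)
  also have "\<dots> \<longleftrightarrow> greedy lam (Suc s) u"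
    unfolding greedy_def using scale_pos DD_pos by (subst mult_less_cancel_right_pos) auto
  finally show ?case using Suc by (simp add: XN_def)
qed (simp add: XN_def)

lemma XN_play: "s < horizon J \<Longrightarrow> u < N \<Longrightarrow> XN L (Suc s) u = Suc s \<longleftrightarrow> greedy lam (Suc s) u"
  using nx_le[of "greedy lam" s u] by (auto simp: XN_nx)

lemma real_UX: "s \<le> horizon J \<Longrightarrow> u < N \<Longrightarrow>
    real (UX L t s u) = U (greedy lam) (\<lambda>s' _. of_bool (s' = t)) s u * real DD ^ s"
proof (induction s arbitrary: u)
  case (Suc s)
  have "real (UX L t (Suc s) u) = (if greedy lam (Suc s) u
      then (if Suc s = t then real DD ^ Suc s else 0) + real (\<Sum>v<N. PN (u * N + v) * UX L t s v) else real DD * real (UX L t s u))"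
    using XN_play[of s u] Suc.prems by (simp add: UX_def)
  then show ?case
    using real_acc[of u "UX L t s" "U (greedy lam) (\<lambda>s' _. of_bool (s' = t)) s" "real DD ^ s"] Suc
    by (auto simp: algebra_simps)
qed (simp add: UX_def)

lemma real_LD: "real (LD L t) = load (greedy lam) t * real DD ^ horizon J"
  unfolding LD_def load_def
  using sum_arms[of "\<lambda>i. U (greedy lam) (\<lambda>s' _. of_bool (s' = t)) (horizon J) (root_node J i) * real DD ^ horizon J"]
  by (simp add: real_UX root_N sum_distrib_right)

end

text \<open>The prices are fractions and are never stored; the product with \<open>WT\<close> formed
  in \<open>VN\<close> is the price times \<open>scale\<close>.\<close>

lemma price: "real l = excess rate k s * real DD ^ horizon J \<Longrightarrow> real WT * real l = rate * excess rate k s * scale"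
  using QQ_pos by (simp add: real_WT rate_def scale_def power_add mult_2 mult_2_right)

lemma real_LN: "real (LN k s) = excess rate k s * real DD ^ horizon J"
proof (induction k arbitrary: s)
  case (Suc k)
  have pr: "\<And>s. 1 \<le> s \<Longrightarrow> s \<le> horizon J \<Longrightarrow> real WT * real (LN k s) = (rate * excess rate k s) * scale"
    using price[OF Suc] by simp
  let ?d = "real DD ^ horizon J"
  have "real (LN (Suc k) s) = max 0 (real (LN k s) + real (LD (LN k) s) - ?d)"
  proof -
    have "real (x - y) = max 0 (real x - real y)" for x y :: nat by auto
    from this[of "LN k s + LD (LN k) s" "DD ^ horizon J"] show ?thesis by simp
  qed
  also have "\<dots> = max 0 ((excess rate k s + load (table rate k) s - 1) * ?d)"
    using Suc real_LD[of "LN k" "\<lambda>s. rate * excess rate k s" s, OF pr] by (simp add: algebra_simps)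
  also have "\<dots> = excess rate (Suc k) s * ?d"
    using DD_pos by (simp add: max_mult_distrib_right)
  finally show ?case .
qed simp

theorem XN_table: "s \<le> horizon J \<Longrightarrow> u < N \<Longrightarrow> XN (LN k) s u = nx (table rate k) s u"
  using price[OF real_LN] by (intro XN_nx) auto

section \<open>Bounds on the numbers\<close>

lemma PN_sum: "u < N \<Longrightarrow> A \<subseteq> {..<N} \<Longrightarrow> (\<Sum>v\<in>A. PN (u * N + v)) \<le> DD"
proof -
  assume u: "u < N" and A: "A \<subseteq> {..<N}"
  have "real (\<Sum>v\<in>A. PN (u * N + v)) \<le> real (\<Sum>v<N. PN (u * N + v))"
    using A by (intro of_nat_mono sum_mono2) auto
  also have "\<dots> = (\<Sum>v<N. tprob I u v) * real DD" using u by (simp add: real_PN sum_distrib_right)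
  also have "\<dots> \<le> 1 * real DD"
    using prob_sum_le_1[of u] in_nodes[OF u] by (intro mult_right_mono) (simp_all add: sum_nodes)
  finally show ?thesis by (simp only: of_nat_le_iff mult_1)
qed

text \<open>Partial sums are included because the accumulator of the program passes through
  them.\<close>

lemma acc_bound: "u < N \<Longrightarrow> k \<le> N \<Longrightarrow> (\<And>v. v < N \<Longrightarrow> f v \<le> M) \<Longrightarrow> (\<Sum>v<k. PN (u * N + v) * f v) \<le> DD * M"
proof -
  assume u: "u < N" and k: "k \<le> N" and f: "\<And>v. v < N \<Longrightarrow> f v \<le> M"
  have "(\<Sum>v<k. PN (u * N + v) * f v) \<le> (\<Sum>v<k. PN (u * N + v) * M)"
    using f k by (intro sum_mono mult_left_mono) auto
  also have "\<dots> = (\<Sum>v<k. PN (u * N + v)) * M" by (simp add: sum_distrib_right)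
  also have "\<dots> \<le> DD * M" using PN_sum[OF u, of "{..<k}"] k by (intro mult_right_mono) auto
  finally show ?thesis .
qed

text \<open>All recursions add at most \<open>G\<close>, a subconvex combination scaled by
  \<open>DD\<close>, and \<open>DD\<close> times the previous value. One step therefore multiplies
  the bound by at most \<open>3 * DD\<close>, and the bit length grows linearly with the number of
  steps.\<close>

lemma bk_bound:
  assumes F: "\<And>s u acc prev. s < horizon J \<Longrightarrow> u < N \<Longrightarrow> F s u acc prev \<le> G + acc + DD * prev"
  shows "s \<le> horizon J \<Longrightarrow> u < N \<Longrightarrow> bkn F s u \<le> G * (3 * DD) ^ s"
proof (induction s arbitrary: u)
  case (Suc s)
  let ?M = "G * (3 * DD) ^ s"
  have "bkn F (Suc s) u \<le> G + (\<Sum>v<N. PN (u * N + v) * bkn F s v) + DD * bkn F s u"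
    using F[of s u] Suc.prems by simp
  also have "\<dots> \<le> G + DD * ?M + DD * ?M"
    using Suc by (intro add_mono acc_bound mult_left_mono) auto
  also have "\<dots> \<le> DD * ?M + DD * ?M + DD * ?M"
  proof -
    have "1 \<le> DD * (3 * DD) ^ s" using DD_pos by simp
    then have "G * 1 \<le> G * (DD * (3 * DD) ^ s)" by (intro mult_left_mono) auto
    then show ?thesis by (simp add: mult_ac)
  qed
  finally show ?case by (simp add: mult_ac)
qed simp

lemma bk_bound_max:
  assumes F: "\<And>s u acc prev. s < horizon J \<Longrightarrow> u < N \<Longrightarrow> F s u acc prev \<le> G + acc + DD * prev"
    and big: "DD * (G * (3 * DD) ^ horizon J) < X"
  shows "s \<le> horizon J \<Longrightarrow> u < N \<Longrightarrow> bkn F s u < X"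
    and "s \<le> horizon J \<Longrightarrow> u < N \<Longrightarrow> k \<le> N \<Longrightarrow> (\<Sum>v<k. PN (u * N + v) * bkn F s v) < X"
proof -
  have b: "bkn F s u \<le> G * (3 * DD) ^ horizon J" if "s \<le> horizon J" "u < N" for s u
  proof -
    have "bkn F s u \<le> G * (3 * DD) ^ s" using bk_bound[of F G, OF F] that by blast
    also have "\<dots> \<le> G * (3 * DD) ^ horizon J" using that DD_pos by (intro mult_left_mono power_increasing) auto
    finally show ?thesis .
  qed
  have "1 * (G * (3 * DD) ^ horizon J) \<le> DD * (G * (3 * DD) ^ horizon J)" using DD_pos by (intro mult_right_mono) auto
  then show "s \<le> horizon J \<Longrightarrow> u < N \<Longrightarrow> bkn F s u < X" using b[of s u] big by linarith
  show "s \<le> horizon J \<Longrightarrow> u < N \<Longrightarrow> k \<le> N \<Longrightarrow> (\<Sum>v<k. PN (u * N + v) * bkn F s v) < X"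
    using acc_bound[of u k "bkn F s" "G * (3 * DD) ^ horizon J"] b[of s] big by force
qed

definition RM :: nat where "RM = (\<Sum>u<N. RN u)"

lemma RN_le: "u < N \<Longrightarrow> RN u \<le> RM"
  unfolding RM_def by (intro member_le_sum) auto

lemma WN_step: "s < horizon J \<Longrightarrow> u < N \<Longrightarrow> RN u * DD ^ s + acc \<le> RM * DD ^ horizon J + acc + DD * prev"
proof -
  assume "s < horizon J" "u < N"
  then have "RN u * DD ^ s \<le> RM * DD ^ horizon J"
    using RN_le[of u] DD_pos by (intro mult_le_mono power_increasing) auto
  then show ?thesis by linarith
qed

lemma VN_step: "s < horizon J \<Longrightarrow> u < N \<Longrightarrow>
   DD * prev + ((RN u * DD ^ s * (QQ * DD ^ (2 * horizon J)) + acc - l) - DD * prev)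
   \<le> RM * DD ^ horizon J * (QQ * DD ^ (2 * horizon J)) + acc + DD * prev"
proof -
  assume "s < horizon J" "u < N"
  then have "RN u * DD ^ s * (QQ * DD ^ (2 * horizon J)) \<le> RM * DD ^ horizon J * (QQ * DD ^ (2 * horizon J))"
    using RN_le[of u] DD_pos by (intro mult_le_mono power_increasing) auto
  then show ?thesis by linarith
qed

lemma XN_step: "s < horizon J \<Longrightarrow> (if P then Suc s else prev) \<le> horizon J + acc + DD * prev"
proof -
  assume "s < horizon J"
  moreover have "1 * prev \<le> DD * prev" using DD_pos by (intro mult_right_mono) auto
  ultimately have "Suc s \<le> horizon J + acc + DD * prev" "prev \<le> horizon J + acc + DD * prev" by linarith+
  then show ?thesis by simp
qed

lemma UX_step: "s < horizon J \<Longrightarrow> (if P then (if P' then DD ^ Suc s else 0) + acc else DD * prev) \<le> DD ^ horizon J + acc + DD * prev"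
  using power_increasing[of "Suc s" "horizon J" DD] DD_pos by auto

lemma LN_bound: "LN k t \<le> k * (arms J * (DD ^ horizon J * (3 * DD) ^ horizon J))"
proof (induction k)
  case (Suc k)
  have "UX L t (horizon J) u \<le> DD ^ horizon J * (3 * DD) ^ horizon J" if "u < N" for L u
    unfolding UX_def using that by (intro bk_bound UX_step) auto
  then have "LD (LN k) t \<le> (\<Sum>i<arms J. DD ^ horizon J * (3 * DD) ^ horizon J)"
    unfolding LD_def using root_N by (intro sum_mono) auto
  then show ?case using Suc by simp
qed simp

lemma encode_eq: "encode J = [arms J, horizon J, N] @ map (root_node J) [1..<Suc (arms J)] @
     concat (map (\<lambda>u. [arm_of J u, num (reward J u), den (reward J u)]) [0..<N]) @
     concat (map (\<lambda>u. concat (map (\<lambda>v. [num (tprob J u v), den (tprob J u v)]) [0..<N])) [0..<N])"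
  by (simp add: encode_def Let_def rat_code_eq)

lemma length_rewards: "length (concat (map (\<lambda>u. [arm_of J u, num (reward J u), den (reward J u)]) [0..<m])) = 3 * m"
  by (induction m) auto

lemma length_row: "length (concat (map (\<lambda>v. [num (tprob J u v), den (tprob J u v)]) [0..<m])) = 2 * m"
  by (induction m) auto

lemma enc_root: "i < arms J \<Longrightarrow> encode J ! (3 + i) = root_node J (Suc i)"
  unfolding encode_eq by (simp add: nth_append del: upt_Suc)

lemma enc_reward:
  assumes "u < N" "q < 3"
  shows "encode J ! (3 + arms J + 3 * u + q) = [arm_of J u, num (reward J u), den (reward J u)] ! q"
proof -
  have "3 * u + q < 3 * N" using assms by linarith
  then show ?thesis
    unfolding encode_eq using nth_concat_uniform[of N "\<lambda>u. [arm_of J u, num (reward J u), den (reward J u)]" 3 u q] assms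
    by (simp add: nth_append length_rewards del: upt_Suc)
qed

lemma enc_prob:
  assumes "w < N * N" "q < 2"
  shows "encode J ! (3 + arms J + 3 * N + 2 * w + q) = [num (tprob J (w div N) (w mod N)), den (tprob J (w div N) (w mod N))] ! q"
proof -
  have N: "N > 0" using assms by (cases "N = 0") auto
  let ?u = "w div N" and ?v = "w mod N"
  let ?f = "\<lambda>u. concat (map (\<lambda>v. [num (tprob J u v), den (tprob J u v)]) [0..<N])"
  have u: "?u < N" using assms(1) by (simp add: less_mult_imp_div_less)
  have v: "?v < N" using N by simp
  have w: "2 * w + q = 2 * N * ?u + (2 * ?v + q)"
  proof -
    define d m where "d = ?u" and "m = ?v"
    have "N * d + m = w" by (simp add: d_def m_def)
    then have "2 * w + q = 2 * N * d + (2 * m + q)" by auto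
    then show ?thesis by (simp only: d_def m_def)
  qed
  have 1: "2 * ?v + q < 2 * N" using v assms by linarith
  have "concat (map ?f [0..<N]) ! (2 * w + q) = ?f ?u ! (2 * ?v + q)"
    unfolding w using nth_concat_uniform[of N ?f "2 * N" ?u "2 * ?v + q"] length_row u 1 by simp
  also have "\<dots> = [num (tprob J ?u ?v), den (tprob J ?u ?v)] ! q"
    using nth_concat_uniform[of N "\<lambda>v. [num (tprob J ?u v), den (tprob J ?u v)]" 2 ?v q] v assms by simp
  finally show ?thesis
    unfolding encode_eq by (simp add: nth_append length_rewards del: upt_Suc)
qed

section \<open>Bit lengths\<close>

definition z :: nat where "z = input_size J"
text \<open>Quadratic because the largest numbers contain powers of \<open>DD\<close> whose
  exponents are proportional to the horizon, while the bit length of \<open>DD\<close> and the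
  horizon are both of order \<open>z\<close>. The factor 20 leaves room for all products
  below.\<close>

definition bits :: nat where "bits = 20 * (z + 1)\<^sup>2"

lemma less_bit_len: "k < 2 ^ bit_len k"
proof (cases "k = 0")
  case False
  then show ?thesis using floor_log_exp2_gt[of k] by (simp add: bit_len_def)
qed (simp add: bit_len_def)

lemma bit_len_pos: "1 \<le> bit_len k"
  by (simp add: bit_len_def)

lemma sum_bits: "(\<Sum>a<inp_len J. bit_len (encode J ! a)) \<le> z"
  unfolding z_def input_size_def length_encode[symmetric]
  by (simp add: sum_list_sum_nth atLeast0LessThan)

lemma inp_len_le: "inp_len J \<le> z"
proof -
  have "(\<Sum>a<inp_len J. 1) \<le> (\<Sum>a<inp_len J. bit_len (encode J ! a))"
    using bit_len_pos by (intro sum_mono) auto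
  then show ?thesis using sum_bits by simp
qed

lemma small: "arms J \<le> z" "N \<le> z" "horizon J \<le> z" "3 \<le> z"
  using inp_len_le by (auto simp: inp_len_def z_def input_size_def)

lemma inp_le: "a < inp_len J \<Longrightarrow> encode J ! a \<le> 2 ^ z"
proof -
  assume a: "a < inp_len J"
  then have "bit_len (encode J ! a) \<le> (\<Sum>a<inp_len J. bit_len (encode J ! a))" by (intro member_le_sum) auto
  then have "bit_len (encode J ! a) \<le> z" using sum_bits by linarith
  then have "(2::nat) ^ bit_len (encode J ! a) \<le> 2 ^ z" by (intro power_increasing) auto
  then show ?thesis using less_bit_len[of "encode J ! a"] by linarith
qed

text \<open>The denominators stand in different cells of the input, so the sum of their bit lengths
  is at most the input size.\<close>

lemma DD_le: "DD \<le> 2 ^ z"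
proof -
  let ?f = "\<lambda>u. 3 + arms J + 3 * u + 2" and ?g = "\<lambda>w. 3 + arms J + 3 * N + 2 * w + 1"
  let ?b = "\<lambda>a. bit_len (encode J ! a)"
  have pb: "(\<Prod>u\<in>A. h u) \<le> 2 ^ (\<Sum>u\<in>A. bit_len (h u))" if "finite A" for A :: "nat set" and h
    using that
  proof (induction A rule: finite_induct)
    case (insert x A)
    then show ?case using less_bit_len[of "h x"] by (simp add: power_add mult_le_mono less_imp_le)
  qed simp
  have "DD \<le> 2 ^ (\<Sum>u<N. bit_len (den (reward J u))) * 2 ^ (\<Sum>w<N * N. bit_len (den (tprob J (w div N) (w mod N))))"
    unfolding DD_def by (intro mult_le_mono pb) auto
  also have "\<dots> = 2 ^ ((\<Sum>u<N. ?b (?f u)) + (\<Sum>w<N * N. ?b (?g w)))"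
    using enc_reward[of _ 2] enc_prob[of _ 1] by (simp add: power_add)
  also have "(\<Sum>u<N. ?b (?f u)) + (\<Sum>w<N * N. ?b (?g w)) = (\<Sum>a\<in>?f ` {..<N}. ?b a) + (\<Sum>a\<in>?g ` {..<N * N}. ?b a)"
    by (subst (1 2) sum.reindex) (auto simp: inj_on_def)
  also have "\<dots> = (\<Sum>a\<in>?f ` {..<N} \<union> ?g ` {..<N * N}. ?b a)"
    by (subst sum.union_disjoint) auto
  also have "(2::nat) ^ \<dots> \<le> 2 ^ z"
  proof (intro power_increasing)
    have "?f ` {..<N} \<union> ?g ` {..<N * N} \<subseteq> {..<inp_len J}" by (auto simp: inp_len_def)
    then have "(\<Sum>a\<in>?f ` {..<N} \<union> ?g ` {..<N * N}. ?b a) \<le> (\<Sum>a<inp_len J. ?b a)" by (intro sum_mono2) auto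
    then show "(\<Sum>a\<in>?f ` {..<N} \<union> ?g ` {..<N * N}. ?b a) \<le> z" using sum_bits by linarith
  qed simp
  finally show ?thesis .
qed

lemma le_pow_mult: "a \<le> 2 ^ i \<Longrightarrow> c \<le> 2 ^ j \<Longrightarrow> a * c \<le> (2::nat) ^ (i + j)"
  by (simp add: power_add mult_le_mono)

lemma le_pow_pow: "a \<le> 2 ^ i \<Longrightarrow> k \<le> j \<Longrightarrow> a ^ k \<le> (2::nat) ^ (i * j)"
proof -
  assume a: "a \<le> 2 ^ i" and k: "k \<le> j"
  have "a ^ k \<le> (2 ^ i) ^ k" using a by (intro power_mono) auto
  also have "\<dots> = 2 ^ (i * k)" by (simp add: power_mult)
  also have "\<dots> \<le> 2 ^ (i * j)" using k by (intro power_increasing) auto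
  finally show ?thesis .
qed

lemma less_pow: "k \<le> z \<Longrightarrow> k \<le> 2 ^ z" "k \<le> z \<Longrightarrow> k + 1 \<le> 2 ^ z"
  using less_exp[of z] by linarith+

lemma less_bits: "a \<le> (2 :: nat) ^ e \<Longrightarrow> e < bits \<Longrightarrow> a < 2 ^ bits"
proof -
  assume a: "a \<le> 2 ^ e" and "e < bits"
  then have "(2::nat) ^ e < 2 ^ bits" by (intro power_strict_increasing) auto
  then show ?thesis using a by linarith
qed

lemma bits_eq: "bits = 20 * (z * z) + 40 * z + 20"
  by (simp add: bits_def power2_eq_square algebra_simps)

lemma num_le: "u < N \<Longrightarrow> num (reward J u) \<le> 2 ^ z" "w < N * N \<Longrightarrow> num (tprob J (w div N) (w mod N)) \<le> 2 ^ z"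
proof -
  show "u < N \<Longrightarrow> num (reward J u) \<le> 2 ^ z"
    using inp_le[of "3 + arms J + 3 * u + 1"] enc_reward[of u 1] by (simp add: inp_len_def)
  show "w < N * N \<Longrightarrow> num (tprob J (w div N) (w mod N)) \<le> 2 ^ z"
    using inp_le[of "3 + arms J + 3 * N + 2 * w + 0"] enc_prob[of w 0] by (simp add: inp_len_def)
qed

lemma div_le_DD: "DD div k \<le> 2 ^ z"
  using DD_le div_le_dividend[of DD k] by linarith

lemma RN_pow: "u < N \<Longrightarrow> RN u \<le> 2 ^ (z + z)"
  unfolding RN_def by (intro le_pow_mult num_le div_le_DD)

lemma PN_pow: "w < N * N \<Longrightarrow> PN w \<le> 2 ^ (z + z)"
  unfolding PN_def by (intro le_pow_mult num_le div_le_DD)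

lemma RM_pow: "RM \<le> 2 ^ (z + (z + z))"
proof -
  have "RM \<le> (\<Sum>u<N. 2 ^ (z + z))" unfolding RM_def by (intro sum_mono RN_pow) auto
  also have "\<dots> = N * 2 ^ (z + z)" by simp
  also have "\<dots> \<le> 2 ^ (z + (z + z))" by (intro le_pow_mult less_pow small order_refl)
  finally show ?thesis .
qed

lemma DD_pow: "k \<le> horizon J \<Longrightarrow> DD ^ k \<le> 2 ^ (z * z)"
  using small by (intro le_pow_pow DD_le) auto

lemma DD_pow2: "k \<le> 2 * horizon J + 1 \<Longrightarrow> DD ^ k \<le> 2 ^ (z * (2 * z + 1))"
  using small by (intro le_pow_pow DD_le) auto

lemma DD3_pow: "(3 * DD) ^ horizon J \<le> 2 ^ ((2 + z) * z)"
proof -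
  have "3 * DD \<le> 2 ^ (2 + z)" by (rule le_pow_mult[OF _ DD_le]) simp
  then show ?thesis using small by (intro le_pow_pow) auto
qed

lemma QQ_pow: "QQ \<le> 2 ^ (2 + z * 2 + z * 3)"
  unfolding QQ_def using small
  by (intro le_pow_mult le_pow_pow order_refl) (auto intro: less_pow(2)[simplified])

lemma KK_pow: "KK \<le> 2 ^ (8 + z * 4 + z * 3)"
  unfolding KK_def using small
  by (intro le_pow_mult le_pow_pow order_refl) (auto intro: less_pow(2)[simplified])

lemma bound_W: "DD * (RM * DD ^ horizon J * (3 * DD) ^ horizon J) < 2 ^ bits"
  by (rule less_bits[OF le_pow_mult[OF DD_le le_pow_mult[OF le_pow_mult[OF RM_pow DD_pow[OF order_refl]] DD3_pow]]])
    (simp add: bits_eq algebra_simps)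

lemma bound_WT: "arms J * (RM * DD ^ horizon J * (3 * DD) ^ horizon J) < 2 ^ bits"
  by (rule less_bits[OF le_pow_mult[OF less_pow(1)[OF small(1)] le_pow_mult[OF le_pow_mult[OF RM_pow DD_pow[OF order_refl]] DD3_pow]]])
    (simp add: bits_eq algebra_simps)

lemma bound_V: "DD * (RM * DD ^ horizon J * (QQ * DD ^ (2 * horizon J)) * (3 * DD) ^ horizon J) < 2 ^ bits"
proof (rule less_bits[OF le_pow_mult[OF DD_le le_pow_mult[OF le_pow_mult[OF le_pow_mult[OF RM_pow DD_pow[OF order_refl]] le_pow_mult[OF QQ_pow DD_pow2]] DD3_pow]]])
qed (simp_all add: bits_eq algebra_simps)

lemma bound_X: "DD * (horizon J * (3 * DD) ^ horizon J) < 2 ^ bits"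
  by (rule less_bits[OF le_pow_mult[OF DD_le le_pow_mult[OF less_pow(1)[OF small(3)] DD3_pow]]])
    (simp add: bits_eq algebra_simps)

lemma bound_U: "DD * (DD ^ horizon J * (3 * DD) ^ horizon J) < 2 ^ bits"
  by (rule less_bits[OF le_pow_mult[OF DD_le le_pow_mult[OF DD_pow[OF order_refl] DD3_pow]]])
    (simp add: bits_eq algebra_simps)

lemma bound_L: "(KK + 1) * (arms J * (DD ^ horizon J * (3 * DD) ^ horizon J)) < 2 ^ bits"
proof -
  have "KK + 1 \<le> 2 ^ (9 + z * 4 + z * 3)"
  proof -
    have "KK + 1 \<le> 2 ^ (8 + z * 4 + z * 3) + 2 ^ (8 + z * 4 + z * 3)" using KK_pow by (intro add_mono) auto
    also have "\<dots> = 2 ^ Suc (8 + z * 4 + z * 3)" by (simp only: power_Suc mult_2)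
    also have "Suc (8 + z * 4 + z * 3) = 9 + z * 4 + z * 3" by simp
    finally show ?thesis .
  qed
  then show ?thesis
    by (rule less_bits[OF le_pow_mult[OF _ le_pow_mult[OF less_pow(1)[OF small(1)] le_pow_mult[OF DD_pow[OF order_refl] DD3_pow]]]])
      (simp add: bits_eq algebra_simps)
qed

lemma small_bits: "k \<le> 4 * z + 4 \<Longrightarrow> k < 2 ^ bits"
proof -
  assume k: "k \<le> 4 * z + 4"
  have "k < 2 ^ k" by simp
  also have "(2::nat) ^ k \<le> 2 ^ bits" using k by (intro power_increasing) (auto simp: bits_eq)
  finally show ?thesis .
qed

lemma bound_KK: "3 * KK < 2 ^ bits"
proof -
  have "3 * KK \<le> 2 ^ (2 + (8 + z * 4 + z * 3))" by (rule le_pow_mult[OF _ KK_pow]) simp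
  then show ?thesis by (rule less_bits) (simp add: bits_eq algebra_simps)
qed

lemma bound_misc: "DD < 2 ^ bits" "k \<le> 2 * horizon J + 1 \<Longrightarrow> DD ^ k < 2 ^ bits"
  "u < N \<Longrightarrow> RN u < 2 ^ bits" "w < N * N \<Longrightarrow> PN w < 2 ^ bits" "QQ < 2 ^ bits" "KK < 2 ^ bits"
  "N < 2 ^ bits" "N * N < 2 ^ bits" "horizon J < 2 ^ bits" "arms J < 2 ^ bits" "2 * horizon J + 1 < 2 ^ bits"
proof -
  show "DD < 2 ^ bits" by (rule less_bits[OF DD_le]) (simp add: bits_eq)
  show "k \<le> 2 * horizon J + 1 \<Longrightarrow> DD ^ k < 2 ^ bits" by (rule less_bits[OF DD_pow2]) (simp_all add: bits_eq algebra_simps)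
  show "u < N \<Longrightarrow> RN u < 2 ^ bits" by (rule less_bits[OF RN_pow]) (simp_all add: bits_eq)
  show "w < N * N \<Longrightarrow> PN w < 2 ^ bits" by (rule less_bits[OF PN_pow]) (simp_all add: bits_eq)
  show "QQ < 2 ^ bits" by (rule less_bits[OF QQ_pow]) (simp add: bits_eq)
  show "KK < 2 ^ bits" using bound_KK by simp
  show "N * N < 2 ^ bits"
    by (rule less_bits[OF le_pow_mult[OF less_pow(1)[OF small(2)] less_pow(1)[OF small(2)]]]) (simp add: bits_eq)
  show "N < 2 ^ bits" "horizon J < 2 ^ bits" "arms J < 2 ^ bits" "2 * horizon J + 1 < 2 ^ bits"
    using small by (auto intro!: small_bits)
qed

sublocale ram J bits
proof
  show "8 \<le> bits" by (simp add: bits_eq)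
  fix a assume "a < inp_len J"
  then show "encode J ! a < 2 ^ bits" by (rule less_bits[OF inp_le]) (simp add: bits_eq)
qed

end

section \<open>The program\<close>

abbreviation "c0 \<equiv> Const 0"
abbreviation "c1 \<equiv> Const (Suc 0)"
abbreviation "eA \<equiv> Cell (Const 0)"
abbreviation "eB \<equiv> Cell (Const (Suc 0))"
abbreviation "eN \<equiv> Cell (Const 2)"
abbreviation "reg k \<equiv> arr k c0"

text \<open>Column \<open>u + 1\<close> of a row belongs to node \<open>u\<close>, and column \<open>0\<close> to an exhausted arm.\<close>

definition idx :: "expr \<Rightarrow> expr \<Rightarrow> expr \<Rightarrow> expr" where
  "idx k s v = Plus (Times (Plus (Times k (Plus eB c1)) s) (Plus eN c1)) v"

definition ix :: "(nat, rat) bandit \<Rightarrow> nat \<Rightarrow> nat \<Rightarrow> nat \<Rightarrow> nat" where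
  "ix J k s v = (k * (horizon J + 1) + s) * (card (all_nodes J) + 1) + v"

lemma val_idx [simp]: "val (idx k s v) (mem J A) = ix J (val k (mem J A)) (val s (mem J A)) (val v (mem J A))"
  by (simp add: idx_def ix_def)

lemma ix_inj:
  assumes "ix J k s v = ix J k' s' v'" "s \<le> horizon J" "s' \<le> horizon J" "v \<le> card (all_nodes J)" "v' \<le> card (all_nodes J)"
  shows "k = k' \<and> s = s' \<and> v = v'"
proof -
  have aux: "a = a' \<and> b = b'" if "a * (m + 1) + b = a' * (m + 1) + b'" "b \<le> m" "b' \<le> m" for a a' b b' m :: nat
  proof -
    have "(a * (m + 1) + b) div (m + 1) = a" "(a' * (m + 1) + b') div (m + 1) = a'"
      using that(2,3) by (auto intro!: div_nat_eqI)
    then have "a = a'" using that(1) by metis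
    then show ?thesis using that(1) by simp
  qed
  from aux[of "k * (horizon J + 1) + s" "card (all_nodes J)" v "k' * (horizon J + 1) + s'" v'] assms
  have 1: "k * (horizon J + 1) + s = k' * (horizon J + 1) + s'" and 2: "v = v'" unfolding ix_def by blast+
  from aux[OF 1 assms(2,3)] 2 show ?thesis by blast
qed

lemma ix_eq_iff: "s \<le> horizon J \<Longrightarrow> s' \<le> horizon J \<Longrightarrow> v \<le> card (all_nodes J) \<Longrightarrow> v' \<le> card (all_nodes J) \<Longrightarrow>
  ix J k s v = ix J k' s' v' \<longleftrightarrow> k = k' \<and> s = s' \<and> v = v'"
  using ix_inj by blast

text \<open>Fills one block of array \<open>X\<close> with a recursion of the form
  \<open>bk\<close>. Register 6 accumulates the value after a transition; then \<open>ne\<close>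
  computes \<open>F\<close>, finding \<open>s\<close>, \<open>u\<close> and the accumulator in
  registers 1, 2 and 6. \<open>o1\<close> is the block number, so that array 14 can keep the tables
  of all rounds.\<close>

definition sweep :: "nat \<Rightarrow> expr \<Rightarrow> expr \<Rightarrow> cmd" where
  "sweep X o1 ne = For 1 eB (For 2 eN (Seq
     (Seq (Asg 6 c0 c0)
       (For 3 eN (Asg 6 c0 (Plus (reg 6) (Times (arr 10 (Plus (Times (reg 2) eN) (reg 3)))
          (arr X (idx o1 (reg 1) (Plus (reg 3) c1))))))))
     (Asg X (idx o1 (Plus (reg 1) c1) (Plus (reg 2) c1)) ne)))"

definition sumroots :: "nat \<Rightarrow> nat \<Rightarrow> expr \<Rightarrow> cmd" where
  "sumroots X d di = Seq (Seq (Asg 6 c0 c0)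
     (For 5 eA (Asg 6 c0 (Plus (reg 6) (arr X (idx c0 eB (Plus (Cell (Plus (Const 3) (reg 5))) c1)))))))
     (Asg d di (reg 6))"

lemma writes_sweep: "writes (sweep X o1 ne) = {1, 2, 3, 6, X}"
  by (auto simp: sweep_def)

lemma writes_sumroots: "writes (sumroots X d di) = {5, 6, d}"
  by (auto simp: sumroots_def)

lemmas wf_simps = wfe_def esz_adr esz_arr cmax_adr cmax_arr idx_def

context inst
begin

text \<open>In particular row 0 of a block is never written. Its initial zeros remain the base case,
  so an array can be swept again in the next round without being cleared.\<close>

definition rest :: "nat \<Rightarrow> store \<Rightarrow> store \<Rightarrow> nat \<Rightarrow> bool" where
  "rest X A A' k \<longleftrightarrow> (\<forall>i. (\<forall>s u. 1 \<le> s \<and> s \<le> horizon J \<and> u < N \<longrightarrow> i \<noteq> ix J k s (Suc u)) \<longrightarrow> A' X i = A X i)"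

lemma agreeD: "agree S A A' \<Longrightarrow> k \<notin> S \<Longrightarrow> A' k = A k"
  by (simp add: agree_def)

definition t_acc :: nat where "t_acc = N * (tick + 3 * tick) + 3 * tick"
definition t_row :: nat where "t_row = N * ((tick + t_acc + 1) + tick + 1 + 3 * tick) + 3 * tick"
definition t_sweep :: nat where "t_sweep = horizon J * (t_row + 3 * tick) + 3 * tick"
definition t_sum :: nat where "t_sum = tick + (arms J * (tick + 3 * tick) + 3 * tick) + 1 + tick + 1"

lemma ok_Seq: "ok c A t1 \<Longrightarrow> ok d (ex J c A) t2 \<Longrightarrow> t1 + t2 + 1 \<le> t \<Longrightarrow> ok (Seq c d) A t"
  by auto

lemma sweep_spec:
  assumes A: "bd bits A" and X: "X < 32" "X \<notin> {1, 2, 3, 6, 10}"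
    and wf: "wfe ne" "esz o1 \<le> 100" "cmax o1 < 256"
    and o1: "\<And>A'. agree {1, 2, 3, 6, X} A A' \<Longrightarrow> val o1 (mem J A') = k"
    and PP: "\<And>w. w < N * N \<Longrightarrow> A 10 w = PN w"
    and zero: "\<And>u. u < N \<Longrightarrow> A X (ix J k 0 (Suc u)) = 0"
    and ne: "\<And>A' s u. agree {1, 2, 3, 6, X} A A' \<Longrightarrow> A' 1 0 = s \<Longrightarrow> A' 2 0 = u \<Longrightarrow> s < horizon J \<Longrightarrow> u < N \<Longrightarrow>
      val ne (mem J A') = F s u (A' 6 0) (A' X (ix J k s (Suc u)))"
    and bound: "\<And>s u. s \<le> horizon J \<Longrightarrow> u < N \<Longrightarrow> bkn F s u < 2 ^ bits"
    and bound': "\<And>s u k. s \<le> horizon J \<Longrightarrow> u < N \<Longrightarrow> k \<le> N \<Longrightarrow> (\<Sum>v<k. PN (u * N + v) * bkn F s v) < 2 ^ bits"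
  shows "ok (sweep X o1 ne) A t_sweep \<and> (\<forall>s u. s \<le> horizon J \<longrightarrow> u < N \<longrightarrow> ex J (sweep X o1 ne) A X (ix J k s (Suc u)) = bkn F s u)
    \<and> rest X A (ex J (sweep X o1 ne) A) k"
proof -
  let ?W = "{1, 2, 3, 6, X}"
  let ?acc = "Plus (reg 6) (Times (arr 10 (Plus (Times (reg 2) eN) (reg 3))) (arr X (idx o1 (reg 1) (Plus (reg 3) c1))))"
  let ?in = "For 3 eN (Asg 6 c0 ?acc)"
  let ?upd = "Asg X (idx o1 (Plus (reg 1) c1) (Plus (reg 2) c1)) ne"
  let ?body = "Seq (Seq (Asg 6 c0 c0) ?in) ?upd"
  let ?row = "For 2 eN ?body"
  have wfs: "wfe (adr 6 c0)" "wfe ?acc" "wfe c0" "wfe (Minus eN (reg 3))" "wfe (Minus eN (reg 2))" "wfe (Minus eB (reg 1))"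
    "wfe (adr X (idx o1 (Plus (reg 1) c1) (Plus (reg 2) c1)))"
    using wf X by (auto simp: wf_simps)
  have Xn: "X \<noteq> 1" "X \<noteq> 2" "X \<noteq> 3" "X \<noteq> 6" "X \<noteq> 10" using X by auto
  define rows where "rows j A' \<longleftrightarrow> (\<forall>s u. s \<le> j \<longrightarrow> u < N \<longrightarrow> A' X (ix J k s (Suc u)) = bkn F s u) \<and> rest X A A' k" for j A'
  have body: "ok ?body A2 ((tick + t_acc + 1) + tick + 1) \<and>
      (let A3 = ex J ?body A2 in rows s A3 \<and> (\<forall>u'\<le>u. A3 X (ix J k (Suc s) (Suc u')) = bkn F (Suc s) u'))"
    if agr: "agree ?W A A2" and bdA: "bd bits A2" and s: "A2 1 0 = s" "s < horizon J" and u: "A2 2 0 = u" "u < N"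
      and rows: "rows s A2" "\<forall>u'<u. A2 X (ix J k (Suc s) (Suc u')) = bkn F (Suc s) u'" for A2 s u
  proof -
    let ?A0 = "put A2 6 0 0"
    have bd0: "bd bits ?A0" using bdA by (simp add: bd_put)
    have PPu: "A2 10 (u * N + v) = PN (u * N + v)" if "v < N" for v
    proof -
      have "u * N + v < Suc u * N" using that by simp
      also have "\<dots> \<le> N * N" using u by (intro mult_le_mono1) auto
      finally show ?thesis using PP agreeD[OF agr, of 10] Xn by simp
    qed
    define Inv where "Inv j A' \<longleftrightarrow> A' 6 0 = (\<Sum>v<j. PN (u * N + v) * bkn F s v)" for j and A' :: store
    have "ok ?in ?A0 (N * (tick + 3 * tick) + 3 * tick) \<and> Inv N (ex J ?in ?A0)"
    proof (rule for_rule)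
      fix j A' assume j: "j < N" "bd bits A'" "agree (insert 3 (writes (Asg 6 c0 ?acc))) ?A0 A'" "A' 3 0 = j" "Inv j A'"
      have eq: "A' l = A2 l" if "l \<noteq> 3" "l \<noteq> 6" for l using j(3) that by (auto simp: agree_def put_def)
      have agr': "agree ?W A A'" using agr eq by (auto simp: agree_def)
      have v: "val ?acc (mem J A') = (\<Sum>v<Suc j. PN (u * N + v) * bkn F s v)"
        using j X Xn eq s u PPu rows o1[OF agr'] by (simp add: Inv_def rows_def)
      have "val ?acc (mem J A') < 2 ^ bits" unfolding v using bound'[of s u "Suc j"] s u j by simp
      then show "ok (Asg 6 c0 ?acc) A' tick \<and> Inv (Suc j) (put (ex J (Asg 6 c0 ?acc) A') 3 0 (Suc j))"
        using wfs v by (simp add: Inv_def del: val.simps sum.lessThan_Suc add: val.simps(1))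
    qed (use wfs bd0 bound_misc in \<open>auto simp: Inv_def\<close>)
    then have ok_in: "ok ?in ?A0 t_acc" and acc: "ex J ?in ?A0 6 0 = (\<Sum>v<N. PN (u * N + v) * bkn F s v)"
      by (auto simp: Inv_def t_acc_def)
    let ?A1 = "ex J ?in ?A0"
    have eq1: "?A1 l = A2 l" if "l \<noteq> 3" "l \<noteq> 6" for l
    proof -
      have "?A1 l = ?A0 l" using that by (intro ex_frame) auto
      then show ?thesis using that by simp
    qed
    have agr1: "agree ?W A ?A1" using agr eq1 unfolding agree_def by auto
    have ok1: "ok (Seq (Asg 6 c0 c0) ?in) A2 (tick + t_acc + 1)"
      using ok_in wfs by (intro ok_Seq[of _ _ tick _ t_acc]) auto
    have ex1: "ex J (Seq (Asg 6 c0 c0) ?in) A2 = ?A1" by simp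
    have ne1: "val ne (mem J ?A1) = bkn F (Suc s) u"
    proof -
      have "val ne (mem J ?A1) = F s u (?A1 6 0) (?A1 X (ix J k s (Suc u)))"
        using ne[OF agr1] s u eq1 by simp
      moreover have "?A1 X (ix J k s (Suc u)) = bkn F s u" using rows u eq1[of X] Xn by (simp add: rows_def)
      ultimately show ?thesis using acc by simp
    qed
    have ok2: "ok ?upd ?A1 tick"
      unfolding ok.simps using wfs wf X ne1 bound[of "Suc s" u] s u by simp
    have okb: "ok ?body A2 ((tick + t_acc + 1) + tick + 1)"
      by (rule ok_Seq[OF ok1 _ order_refl]) (unfold ex1, rule ok2)
    have exb: "ex J ?body A2 = put ?A1 X (ix J k (Suc s) (Suc u)) (bkn F (Suc s) u)"
    proof -
      have "ex J ?body A2 = ex J ?upd ?A1" by simp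
      also have "\<dots> = put ?A1 X (ix J k (Suc s) (Suc u)) (bkn F (Suc s) u)"
        using ne1 o1[OF agr1] eq1 s u by simp
      finally show ?thesis .
    qed
    have X1: "?A1 X = A2 X" using eq1 Xn by blast
    let ?A3 = "put ?A1 X (ix J k (Suc s) (Suc u)) (bkn F (Suc s) u)"
    have "rows s ?A3"
      unfolding rows_def
    proof (intro conjI allI impI)
      fix s' u' assume "s' \<le> s" "u' < N"
      then have "ix J k s' (Suc u') \<noteq> ix J k (Suc s) (Suc u)" using s u by (subst ix_eq_iff) auto
      then show "?A3 X (ix J k s' (Suc u')) = bkn F s' u'" using rows \<open>s' \<le> s\<close> \<open>u' < N\<close> X1 by (simp add: rows_def)
    next
      show "rest X A ?A3 k" unfolding rest_def
      proof (intro allI impI)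
        fix i assume i: "\<forall>s u. 1 \<le> s \<and> s \<le> horizon J \<and> u < N \<longrightarrow> i \<noteq> ix J k s (Suc u)"
        then have "i \<noteq> ix J k (Suc s) (Suc u)" using s u by auto
        then show "?A3 X i = A X i" using rows(1) i X1 unfolding rows_def rest_def by simp
      qed
    qed
    moreover have "\<forall>u'\<le>u. ?A3 X (ix J k (Suc s) (Suc u')) = bkn F (Suc s) u'"
    proof (intro allI impI)
      fix u' assume u': "u' \<le> u"
      show "?A3 X (ix J k (Suc s) (Suc u')) = bkn F (Suc s) u'"
      proof (cases "u' = u")
        case False
        then have "ix J k (Suc s) (Suc u') \<noteq> ix J k (Suc s) (Suc u)" using s u u' by (subst ix_eq_iff) auto
        then show ?thesis using rows(2) u' False X1 by (simp del: bk.simps)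
      qed simp
    qed
    ultimately show ?thesis using okb unfolding exb Let_def by blast
  qed
  have row: "ok ?row A1 t_row \<and> rows (Suc s) (ex J ?row A1)"
    if agr: "agree ?W A A1" and bdA: "bd bits A1" and s: "A1 1 0 = s" "s < horizon J" and rows: "rows s A1" for A1 s
  proof -
    define Inv where "Inv j A' \<longleftrightarrow> rows s A' \<and> (\<forall>u'<j. A' X (ix J k (Suc s) (Suc u')) = bkn F (Suc s) u')" for j A'
    have "ok ?row A1 (N * (((tick + t_acc + 1) + tick + 1) + 3 * tick) + 3 * tick) \<and> Inv N (ex J ?row A1)"
    proof (rule for_rule)
      show "Inv 0 (put A1 2 0 0)" using rows Xn by (simp add: Inv_def rows_def rest_def)
      fix j A' assume j: "j < N" "bd bits A'" "agree (insert 2 (writes ?body)) A1 A'" "A' 2 0 = j" "Inv j A'"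
      have eq: "A' l = A1 l" if "l \<noteq> 2" "l \<noteq> 3" "l \<noteq> 6" "l \<noteq> X" for l using j(3) that by (auto simp: agree_def)
      have agr': "agree ?W A A'" using agr eq unfolding agree_def by auto
      have "A' 1 0 = s" using eq[of 1] s Xn by simp
      from body[OF agr' j(2) this s(2) j(4,1)] j(5)
      have "ok ?body A' ((tick + t_acc + 1) + tick + 1)" and r: "rows s (ex J ?body A')"
        "\<forall>u'\<le>j. ex J ?body A' X (ix J k (Suc s) (Suc u')) = bkn F (Suc s) u'" unfolding Inv_def Let_def by blast+
      moreover have "Inv (Suc j) (put (ex J ?body A') 2 0 (Suc j))"
        using r Xn unfolding Inv_def rows_def rest_def by (simp add: less_Suc_eq_le del: bk.simps ex.simps)
      ultimately show "ok ?body A' ((tick + t_acc + 1) + tick + 1) \<and> Inv (Suc j) (put (ex J ?body A') 2 0 (Suc j))" by blast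
    qed (use wfs bdA bound_misc Xn in auto)
    then have o: "ok ?row A1 t_row" and i: "Inv N (ex J ?row A1)" unfolding t_row_def by blast+
    have "rows (Suc s) (ex J ?row A1)"
      using i unfolding Inv_def rows_def by (auto simp: le_Suc_eq simp del: bk.simps ex.simps)
    with o show ?thesis by blast
  qed
  have "ok (For 1 eB ?row) A (horizon J * (t_row + 3 * tick) + 3 * tick) \<and> rows (horizon J) (ex J (For 1 eB ?row) A)"
  proof (rule for_rule)
    show "rows 0 (put A 1 0 0)" using zero Xn by (simp add: rows_def rest_def)
    fix j A' assume j: "j < horizon J" "bd bits A'" "agree (insert 1 (writes ?row)) A A'" "A' 1 0 = j" "rows j A'"
    have agr': "agree ?W A A'" using j(3) unfolding agree_def by auto
    from row[OF agr' j(2,4,1,5)]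
    have "ok ?row A' t_row" "rows (Suc j) (ex J ?row A')" by blast+
    then show "ok ?row A' t_row \<and> rows (Suc j) (put (ex J ?row A') 1 0 (Suc j))"
      using Xn unfolding rows_def rest_def by (simp del: bk.simps ex.simps ok.simps)
  qed (use wfs A bound_misc Xn in auto)
  then show ?thesis unfolding sweep_def[symmetric] rows_def t_sweep_def by blast
qed

lemma sumroots_spec:
  assumes A: "bd bits A" and X: "X < 32" "X \<notin> {5, 6}" and d: "d < 32" "d \<notin> {5, 6}"
    and wf: "esz di \<le> 100" "cmax di < 256" and di: "\<And>A'. agree {5, 6} A A' \<Longrightarrow> val di (mem J A') = m"
    and f: "\<And>u. u < N \<Longrightarrow> A X (ix J 0 (horizon J) (Suc u)) = f u"
    and bound: "(\<Sum>i<arms J. f (root_node J (Suc i))) < 2 ^ bits"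
  shows "ok (sumroots X d di) A t_sum \<and> ex J (sumroots X d di) A d = (A d)(m := (\<Sum>i<arms J. f (root_node J (Suc i))))"
proof -
  let ?acc = "Plus (reg 6) (arr X (idx c0 eB (Plus (Cell (Plus (Const 3) (reg 5))) c1)))"
  let ?in = "For 5 eA (Asg 6 c0 ?acc)"
  let ?A0 = "put A 6 0 0"
  have wfs: "wfe (adr 6 c0)" "wfe ?acc" "wfe c0" "wfe (Minus eA (reg 5))" "wfe (adr d di)" "wfe (reg 6)"
    using wf X d by (auto simp: wf_simps)
  define Inv where "Inv j A' \<longleftrightarrow> A' 6 0 = (\<Sum>i<j. f (root_node J (Suc i)))" for j and A' :: store
  have "ok ?in ?A0 (arms J * (tick + 3 * tick) + 3 * tick) \<and> Inv (arms J) (ex J ?in ?A0)"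
  proof (rule for_rule)
    show "bd bits ?A0" using A by (simp add: bd_put)
    fix j A' assume j: "j < arms J" "bd bits A'" "agree (insert 5 (writes (Asg 6 c0 ?acc))) ?A0 A'" "A' 5 0 = j" "Inv j A'"
    have eq: "A' X = A X" using j(3) X by (auto simp: agree_def)
    have "3 + j < inp_len J" using j by (simp add: inp_len_def)
    then have m: "mem J A' (3 + j) = root_node J (Suc j)" using enc_root j by (simp add: mem_inp)
    have v: "val ?acc (mem J A') = (\<Sum>i<Suc j. f (root_node J (Suc i)))"
      using j X eq m f[OF root_N[OF j(1)]] by (simp add: Inv_def)
    have "(\<Sum>i<Suc j. f (root_node J (Suc i))) \<le> (\<Sum>i<arms J. f (root_node J (Suc i)))"
      using j by (intro sum_mono2) auto
    then have "val ?acc (mem J A') < 2 ^ bits" unfolding v using bound by linarith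
    then show "ok (Asg 6 c0 ?acc) A' tick \<and> Inv (Suc j) (put (ex J (Asg 6 c0 ?acc) A') 5 0 (Suc j))"
      using wfs v by (simp add: Inv_def del: val.simps sum.lessThan_Suc add: val.simps(1))
  qed (use wfs bound_misc in \<open>auto simp: Inv_def\<close>)
  then have o: "ok ?in ?A0 (arms J * (tick + 3 * tick) + 3 * tick)" and acc: "ex J ?in ?A0 6 0 = (\<Sum>i<arms J. f (root_node J (Suc i)))"
    unfolding Inv_def by blast+
  let ?A1 = "ex J ?in ?A0"
  have eq1: "?A1 l = A l" if "l \<noteq> 5" "l \<noteq> 6" for l
  proof -
    have "?A1 l = ?A0 l" using that by (intro ex_frame) auto
    then show ?thesis using that by simp
  qed
  have m: "val di (mem J ?A1) = m" by (rule di) (simp add: agree_def eq1 del: ex.simps)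
  have "ok (Seq (Asg 6 c0 c0) ?in) A (tick + (arms J * (tick + 3 * tick) + 3 * tick) + 1)"
    using o wfs by (intro ok_Seq[of _ _ tick _ "arms J * (tick + 3 * tick) + 3 * tick"]) auto
  note ok1 = this
  have ex1: "ex J (Seq (Asg 6 c0 c0) ?in) A = ?A1" by simp
  have ok2: "ok (Asg d di (reg 6)) ?A1 tick"
    unfolding ok.simps using wfs d acc bound by (simp del: ex.simps)
  have "ok (sumroots X d di) A t_sum"
    unfolding sumroots_def t_sum_def by (rule ok_Seq[OF ok1 _ order_refl]) (unfold ex1, rule ok2)
  moreover have "ex J (sumroots X d di) A d = (A d)(m := (\<Sum>i<arms J. f (root_node J (Suc i))))"
  proof -
    have "ex J (sumroots X d di) A = put ?A1 d (val di (mem J ?A1)) (val (reg 6) (mem J ?A1))"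
      unfolding sumroots_def by simp
    then show ?thesis using m acc d eq1[of d] by (simp del: ex.simps)
  qed
  ultimately show ?thesis ..
qed

end

section \<open>Running times\<close>

text \<open>At the input size \<open>z\<close> these are \<open>tick\<close> and a bound for the
  iterations of any loop: \<open>40000000 = 2000000 * 20\<close> comes from \<open>tick\<close> and
  \<open>bits\<close>, and \<open>144 * (z + 1) ^ 7\<close> dominates \<open>KK\<close> because arms
  and horizon are at most \<open>z\<close>.\<close>

definition tick_poly :: "nat poly" where "tick_poly = 40000000 * ([:0, 1:] + 1)\<^sup>2"
definition loop_poly :: "nat poly" where "loop_poly = 144 * ([:0, 1:] + 1) ^ 7"

text \<open>This bounds the cost only if no loop has more than \<open>loop_poly\<close> iterations and all numbers have at most
  \<open>20 (z + 1)\<^sup>2\<close> bits, for inputs of size \<open>z\<close>; \<open>Cond\<close> does not occur in the algorithm and has a junk value.\<close>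

primrec time :: "prog \<Rightarrow> nat poly" where
  "time Halt = 0"
| "time (Assign a b) = tick_poly"
| "time (Rand a b) = tick_poly"
| "time (Pull a b) = tick_poly"
| "time (Then c d) = time c + time d + 1"
| "time (Cond b c d) = 0"
| "time (Loop b c) = loop_poly * (time c + 2 * tick_poly) + 2 * tick_poly"

text \<open>Arrays \<open>0\<close> to \<open>5\<close> and \<open>29\<close> are loop counters, array \<open>6\<close> is an accumulator. Preparation: \<open>7\<close> common
  denominator, \<open>8\<close> its powers, \<open>9\<close> and \<open>10\<close> scaled rewards and probabilities. Offline phase: \<open>30\<close> unpriced values with
  sum \<open>16\<close>, \<open>13\<close> priced values, \<open>14\<close> tables, \<open>15\<close> loads of single arms, \<open>18\<close> total loads, \<open>17\<close> prices. Online phase, for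
  each arm: \<open>19\<close> number of its table, \<open>20\<close> remaining virtual time, \<open>21\<close> code of its position, \<open>22\<close> number of
  plays, \<open>23\<close> next virtual play; \<open>24\<close> and \<open>25\<close> auxiliary, \<open>26\<close> arm of the best score \<open>27\<close>, \<open>28\<close> observation.\<close>

definition e_rew :: "nat \<Rightarrow> expr \<Rightarrow> expr" where
  "e_rew q u = Cell (Plus (Plus (Const 3) eA) (Plus (Times (Const 3) u) (Const q)))"
definition e_pr :: "nat \<Rightarrow> expr \<Rightarrow> expr" where
  "e_pr q w = Cell (Plus (Plus (Plus (Const 3) eA) (Times (Const 3) eN)) (Plus (Times (Const 2) w) (Const q)))"

definition prep :: cmd where
  "prep = Seq (Seq (Seq (Seq (Seq (Seq (Asg 7 c0 c1)
     (For 2 eN (Asg 7 c0 (Times (reg 7) (e_rew 2 (reg 2))))))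
     (For 3 (Times eN eN) (Asg 7 c0 (Times (reg 7) (e_pr 1 (reg 3))))))
     (Asg 8 c0 c1))
     (For 4 (Plus (Times (Const 2) eB) c1) (Asg 8 (Plus (reg 4) c1) (Times (arr 8 (reg 4)) (reg 7)))))
     (For 2 eN (Asg 9 (reg 2) (Times (e_rew 1 (reg 2)) (Quot (reg 7) (e_rew 2 (reg 2)))))))
     (For 3 (Times eN eN) (Asg 10 (reg 3) (Times (e_pr 0 (reg 3)) (Quot (reg 7) (e_pr 1 (reg 3))))))"

lemma size_rew: "esz (e_rew q u) = esz u + 10" "cmax (e_rew q u) < 256 \<longleftrightarrow> q < 256 \<and> cmax u < 256"
  by (auto simp: e_rew_def)

lemma size_pr: "esz (e_pr q w) = esz w + 15" "cmax (e_pr q w) < 256 \<longleftrightarrow> q < 256 \<and> cmax w < 256"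
  by (auto simp: e_pr_def)

lemma size_idx: "esz (idx k s v) = esz k + esz s + esz v + 12"
    "cmax (idx k s v) < 256 \<longleftrightarrow> cmax k < 256 \<and> cmax s < 256 \<and> cmax v < 256"
  by (auto simp: idx_def)

lemmas wfp_simps = wfe_def esz_adr esz_arr cmax_adr cmax_arr size_rew size_pr size_idx

context inst
begin

lemma poly_tick [simp]: "poly tick_poly z = tick"
  by (simp add: tick_poly_def bits_def)

definition MM :: nat where "MM = 144 * (z + 1) ^ 7"

lemma poly_loop [simp]: "poly loop_poly z = MM"
  by (simp add: loop_poly_def MM_def)

lemma loops: "N \<le> MM" "N * N \<le> MM" "arms J \<le> MM" "horizon J \<le> MM" "2 * horizon J + 1 \<le> MM" "KK \<le> MM"
proof -
  have p: "(z + 1) ^ k \<le> MM" if "k \<le> 7" for k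
  proof -
    have "(z + 1) ^ k \<le> 1 * (z + 1) ^ 7" using that by (simp only: mult_1) (intro power_increasing, auto)
    also have "\<dots> \<le> MM" unfolding MM_def by (intro mult_right_mono) auto
    finally show ?thesis .
  qed
  show "N \<le> MM" "arms J \<le> MM" "horizon J \<le> MM" using p[of 1] small by auto
  have "N * N \<le> (z + 1) ^ 2" using small unfolding power2_eq_square by (intro mult_le_mono) auto
  then show "N * N \<le> MM" using p[of 2] by linarith
  have "2 * horizon J + 1 \<le> (z + 1) ^ 2" using small by (simp add: power2_eq_square)
  then show "2 * horizon J + 1 \<le> MM" using p[of 2] by linarith
  have "KK \<le> 144 * (z + 1) ^ 4 * (z + 1) ^ 3"
    unfolding KK_def using small by (intro mult_le_mono power_mono order_refl) auto
  moreover have "(z + 1) ^ 7 = (z + 1) ^ 4 * (z + 1) ^ 3" by (simp only: power_add[symmetric]) simp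
  ultimately show "KK \<le> MM" by (simp only: MM_def mult.assoc)
qed

lemma time_for: "m \<le> MM \<Longrightarrow> m * (poly (time c) z + 3 * tick) + 3 * tick \<le> poly (time (forp k e c)) z"
proof -
  assume m: "m \<le> MM"
  then have "m * (poly (time c) z + 3 * tick) \<le> MM * (poly (time c) z + 3 * tick)" by (rule mult_le_mono1)
  also have "\<dots> \<le> MM * (poly (time c) z + tick + 1 + 2 * tick)" by (intro mult_le_mono2) linarith
  finally show ?thesis by (simp add: forp_def)
qed

text \<open>The time bound is no parameter but the polynomial read off from the program text,
  evaluated at the input size. Composing triples then requires no bookkeeping of running
  times.\<close>

definition hoare :: "cmd \<Rightarrow> (store \<Rightarrow> bool) \<Rightarrow> (store \<Rightarrow> bool) \<Rightarrow> bool" where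
  "hoare c P Q \<longleftrightarrow> (\<forall>A. bd bits A \<longrightarrow> P A \<longrightarrow> ok c A (poly (time (compile c)) z) \<and> Q (ex J c A))"

lemma hoareI: "(\<And>A. bd bits A \<Longrightarrow> P A \<Longrightarrow> ok c A (poly (time (compile c)) z) \<and> Q (ex J c A)) \<Longrightarrow> hoare c P Q"
  by (simp add: hoare_def)

lemma hoare_conseq: "hoare c P Q \<Longrightarrow> (\<And>A. bd bits A \<Longrightarrow> P' A \<Longrightarrow> P A) \<Longrightarrow> (\<And>A. Q A \<Longrightarrow> Q' A) \<Longrightarrow> hoare c P' Q'"
  unfolding hoare_def by blast

lemma hoare_pre: "hoare c P Q \<Longrightarrow> (\<And>A. bd bits A \<Longrightarrow> P' A \<Longrightarrow> P A) \<Longrightarrow> hoare c P' Q"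
  unfolding hoare_def by blast

lemma hoare_asg:
  assumes "k < 32" "wfe (adr k a)" "wfe e"
    "\<And>A. bd bits A \<Longrightarrow> P A \<Longrightarrow> val e (mem J A) < 2 ^ bits \<and> Q (put A k (val a (mem J A)) (val e (mem J A)))"
  shows "hoare (Asg k a e) P Q"
  using assms by (intro hoareI) auto

lemma hoare_seq: "hoare c P Q \<Longrightarrow> hoare d Q R \<Longrightarrow> hoare (Seq c d) P R"
  unfolding hoare_def
proof (intro allI impI)
  fix A assume c: "\<forall>A. bd bits A \<longrightarrow> P A \<longrightarrow> ok c A (poly (time (compile c)) z) \<and> Q (ex J c A)"
    and d: "\<forall>A. bd bits A \<longrightarrow> Q A \<longrightarrow> ok d A (poly (time (compile d)) z) \<and> R (ex J d A)"
    and A: "bd bits A" "P A"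
  have 1: "ok c A (poly (time (compile c)) z)" "Q (ex J c A)" using c A by blast+
  then have "bd bits (ex J c A)" using ok_bd A by blast
  then have 2: "ok d (ex J c A) (poly (time (compile d)) z)" "R (ex J d (ex J c A))" using d 1 by blast+
  have "ok (Seq c d) A (poly (time (compile (Seq c d))) z)" by (rule ok_Seq[OF 1(1) 2(1)]) simp
  then show "ok (Seq c d) A (poly (time (compile (Seq c d))) z) \<and> R (ex J (Seq c d) A)" using 2 by simp
qed

lemma hoare_for:
  assumes k: "k < 32" "k \<notin> writes c" "wfe (Minus e (reg k))" "m < 2 ^ bits" "m \<le> MM"
    and m: "\<And>A. val e (mem J A) = m"
    and body: "\<And>j. j < m \<Longrightarrow> hoare c (\<lambda>A. A k 0 = j \<and> Inv j A) (\<lambda>A. Inv (Suc j) (put A k 0 (Suc j)))"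
  shows "hoare (For k e c) (\<lambda>A. Inv 0 (put A k 0 0)) (Inv m)"
proof (rule hoareI)
  fix A assume A: "bd bits A" "Inv 0 (put A k 0 0)"
  have "ok (For k e c) A (m * (poly (time (compile c)) z + 3 * tick) + 3 * tick) \<and> Inv m (ex J (For k e c) A)"
  proof (rule for_rule[OF A(1) k(1-4) m])
    show "Inv 0 (put A k 0 0)" by (rule A)
    fix j A' assume "j < m" "bd bits A'" "A' k 0 = j" "Inv j A'"
    then show "ok c A' (poly (time (compile c)) z) \<and> Inv (Suc j) (put (ex J c A') k 0 (Suc j))"
      using body[of j] unfolding hoare_def by blast
  qed
  moreover have "m * (poly (time (compile c)) z + 3 * tick) + 3 * tick \<le> poly (time (compile (For k e c))) z"
    using time_for[OF k(5)] by simp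
  ultimately show "ok (For k e c) A (poly (time (compile (For k e c))) z) \<and> Inv m (ex J (For k e c) A)"
    using ok_mono by blast
qed

section \<open>The offline phase\<close>

lemma val_rew: "val u (mem J A) < N \<Longrightarrow> q < 3 \<Longrightarrow>
    val (e_rew q u) (mem J A) = [arm_of J (val u (mem J A)), num (reward J (val u (mem J A))), den (reward J (val u (mem J A)))] ! q"
  using enc_reward[of "val u (mem J A)" q]
  by (simp add: e_rew_def mem_inp inp_len_def add.assoc)

lemma val_pr: "val w (mem J A) < N * N \<Longrightarrow> q < 2 \<Longrightarrow>
    val (e_pr q w) (mem J A) = [num (tprob J (val w (mem J A) div N) (val w (mem J A) mod N)), den (tprob J (val w (mem J A) div N) (val w (mem J A) mod N))] ! q"
  using enc_prob[of "val w (mem J A)" q]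
  by (simp add: e_pr_def mem_inp inp_len_def add.assoc)

text \<open>The preparation leaves these arrays at zero; their zeros later provide base rows of the
  sweeps, initial prices and play counts.\<close>

definition fresh :: "store \<Rightarrow> bool" where "fresh A \<longleftrightarrow> (\<forall>k\<ge>11. A k = (\<lambda>_. 0))"

definition data :: "store \<Rightarrow> bool" where
  "data A \<longleftrightarrow> (\<forall>j\<le>2 * horizon J + 1. A 8 j = DD ^ j) \<and> (\<forall>u<N. A 9 u = RN u) \<and> (\<forall>w<N * N. A 10 w = PN w)"

lemma fresh_put [simp]: "k < 11 \<Longrightarrow> fresh (put A k i v) \<longleftrightarrow> fresh A"
  by (auto simp: fresh_def put_def)

text \<open>All intermediate products of denominators divide \<open>DD\<close>, which keeps them
  within the bit bound.\<close>

lemma prep_hoare: "hoare prep fresh (\<lambda>A. fresh A \<and> data A)"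
proof -
  let ?r = "\<lambda>u. den (reward J u)" and ?p = "\<lambda>w. den (tprob J (w div N) (w mod N))"
  let ?R = "\<Prod>u<N. ?r u"
  have pr: "(\<Prod>u<j. h u) \<le> (\<Prod>u<m. h u)" if "j \<le> m" "\<And>u. 0 < h u" for j m :: nat and h :: "nat \<Rightarrow> nat"
    using that by (intro dvd_imp_le prod_dvd_prod_subset) (auto simp: prod_pos)
  have pos: "1 \<le> (\<Prod>u<m. h u)" if "\<And>u. 0 < h u" for m :: nat and h :: "nat \<Rightarrow> nat"
    using that by (simp add: Suc_le_eq prod_pos)
  have b1: "(\<Prod>u<j. ?r u) < 2 ^ bits" if "j \<le> N" for j
  proof -
    have "(\<Prod>u<j. ?r u) * 1 \<le> DD" unfolding DD_def by (intro mult_le_mono pr pos that den_pos)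
    then show ?thesis using bound_misc(1) by simp
  qed
  have b2: "?R * (\<Prod>w<j. ?p w) < 2 ^ bits" if "j \<le> N * N" for j
  proof -
    have "?R * (\<Prod>w<j. ?p w) \<le> DD" unfolding DD_def by (intro mult_le_mono pr order_refl that den_pos)
    then show ?thesis using bound_misc(1) by simp
  qed
  have h1: "hoare (Asg 7 c0 c1) fresh (\<lambda>A. fresh A \<and> A 7 0 = 1)"
    using bound_misc(2)[of 0] by (intro hoare_asg) (auto simp: wfp_simps)
  have h2: "hoare (For 2 eN (Asg 7 c0 (Times (reg 7) (e_rew 2 (reg 2)))))
      (\<lambda>A. fresh A \<and> A 7 0 = 1) (\<lambda>A. fresh A \<and> A 7 0 = ?R)"
  proof (rule hoare_pre[OF hoare_for[where Inv = "\<lambda>j A. fresh A \<and> A 7 0 = (\<Prod>u<j. ?r u)"]])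
    fix j assume "j < N"
    then show "hoare (Asg 7 c0 (Times (reg 7) (e_rew 2 (reg 2)))) (\<lambda>A. A 2 0 = j \<and> fresh A \<and> A 7 0 = (\<Prod>u<j. ?r u))
      (\<lambda>A. fresh (put A 2 0 (Suc j)) \<and> put A 2 0 (Suc j) 7 0 = (\<Prod>u<Suc j. ?r u))"
      using b1[of "Suc j"] by (intro hoare_asg) (auto simp: wfp_simps val_rew)
  qed (use loops bound_misc in \<open>auto simp: wfp_simps\<close>)
  have h3: "hoare (For 3 (Times eN eN) (Asg 7 c0 (Times (reg 7) (e_pr 1 (reg 3)))))
      (\<lambda>A. fresh A \<and> A 7 0 = ?R) (\<lambda>A. fresh A \<and> A 7 0 = DD)"
  proof (rule hoare_conseq[OF hoare_for[where Inv = "\<lambda>j A. fresh A \<and> A 7 0 = ?R * (\<Prod>w<j. ?p w)"]])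
    fix j assume "j < N * N"
    then show "hoare (Asg 7 c0 (Times (reg 7) (e_pr 1 (reg 3)))) (\<lambda>A. A 3 0 = j \<and> fresh A \<and> A 7 0 = ?R * (\<Prod>w<j. ?p w))
      (\<lambda>A. fresh (put A 3 0 (Suc j)) \<and> put A 3 0 (Suc j) 7 0 = ?R * (\<Prod>w<Suc j. ?p w))"
      using b2[of "Suc j"] by (intro hoare_asg) (auto simp: wfp_simps val_pr mult.assoc)
  qed (use loops bound_misc in \<open>auto simp: wfp_simps DD_def\<close>)
  have h4: "hoare (Asg 8 c0 c1) (\<lambda>A. fresh A \<and> A 7 0 = DD) (\<lambda>A. fresh A \<and> A 7 0 = DD \<and> A 8 0 = 1)"
    using bound_misc(2)[of 0] by (intro hoare_asg) (auto simp: wfp_simps)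
  have h5: "hoare (For 4 (Plus (Times (Const 2) eB) c1) (Asg 8 (Plus (reg 4) c1) (Times (arr 8 (reg 4)) (reg 7))))
      (\<lambda>A. fresh A \<and> A 7 0 = DD \<and> A 8 0 = 1) (\<lambda>A. fresh A \<and> A 7 0 = DD \<and> (\<forall>j\<le>2 * horizon J + 1. A 8 j = DD ^ j))"
  proof (rule hoare_pre[OF hoare_for[where Inv = "\<lambda>j A. fresh A \<and> A 7 0 = DD \<and> (\<forall>i\<le>j. A 8 i = DD ^ i)"]])
    fix j assume j: "j < 2 * horizon J + 1"
    then have "DD ^ Suc j < 2 ^ bits" by (intro bound_misc) simp
    then show "hoare (Asg 8 (Plus (reg 4) c1) (Times (arr 8 (reg 4)) (reg 7))) (\<lambda>A. A 4 0 = j \<and> fresh A \<and> A 7 0 = DD \<and> (\<forall>i\<le>j. A 8 i = DD ^ i))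
      (\<lambda>A. fresh (put A 4 0 (Suc j)) \<and> put A 4 0 (Suc j) 7 0 = DD \<and> (\<forall>i\<le>Suc j. put A 4 0 (Suc j) 8 i = DD ^ i))"
      using j by (intro hoare_asg) (auto simp: wfp_simps le_Suc_eq mult.commute)
  qed (use loops bound_misc in \<open>auto simp: wfp_simps\<close>)
  have h6: "hoare (For 2 eN (Asg 9 (reg 2) (Times (e_rew 1 (reg 2)) (Quot (reg 7) (e_rew 2 (reg 2))))))
     (\<lambda>A. fresh A \<and> A 7 0 = DD \<and> (\<forall>j\<le>2 * horizon J + 1. A 8 j = DD ^ j))
     (\<lambda>A. fresh A \<and> A 7 0 = DD \<and> (\<forall>j\<le>2 * horizon J + 1. A 8 j = DD ^ j) \<and> (\<forall>u<N. A 9 u = RN u))"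
  proof (rule hoare_pre[OF hoare_for[where Inv = "\<lambda>i A. fresh A \<and> A 7 0 = DD \<and> (\<forall>j\<le>2 * horizon J + 1. A 8 j = DD ^ j) \<and> (\<forall>u<i. A 9 u = RN u)"]])
    fix i assume "i < N"
    then show "hoare (Asg 9 (reg 2) (Times (e_rew 1 (reg 2)) (Quot (reg 7) (e_rew 2 (reg 2)))))
      (\<lambda>A. A 2 0 = i \<and> fresh A \<and> A 7 0 = DD \<and> (\<forall>j\<le>2 * horizon J + 1. A 8 j = DD ^ j) \<and> (\<forall>u<i. A 9 u = RN u))
      (\<lambda>A. fresh (put A 2 0 (Suc i)) \<and> put A 2 0 (Suc i) 7 0 = DD \<and> (\<forall>j\<le>2 * horizon J + 1. put A 2 0 (Suc i) 8 j = DD ^ j)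
        \<and> (\<forall>u<Suc i. put A 2 0 (Suc i) 9 u = RN u))"
      using bound_misc(3)[of i] by (intro hoare_asg) (auto simp: wfp_simps val_rew RN_def less_Suc_eq)
  qed (use loops bound_misc in \<open>auto simp: wfp_simps\<close>)
  have h7: "hoare (For 3 (Times eN eN) (Asg 10 (reg 3) (Times (e_pr 0 (reg 3)) (Quot (reg 7) (e_pr 1 (reg 3))))))
     (\<lambda>A. fresh A \<and> A 7 0 = DD \<and> (\<forall>j\<le>2 * horizon J + 1. A 8 j = DD ^ j) \<and> (\<forall>u<N. A 9 u = RN u)) (\<lambda>A. fresh A \<and> data A)"
  proof (rule hoare_conseq[OF hoare_for[where Inv = "\<lambda>i A. fresh A \<and> A 7 0 = DD \<and> (\<forall>j\<le>2 * horizon J + 1. A 8 j = DD ^ j) \<and> (\<forall>u<N. A 9 u = RN u) \<and> (\<forall>w<i. A 10 w = PN w)"]])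
    fix i assume "i < N * N"
    then show "hoare (Asg 10 (reg 3) (Times (e_pr 0 (reg 3)) (Quot (reg 7) (e_pr 1 (reg 3)))))
      (\<lambda>A. A 3 0 = i \<and> fresh A \<and> A 7 0 = DD \<and> (\<forall>j\<le>2 * horizon J + 1. A 8 j = DD ^ j) \<and> (\<forall>u<N. A 9 u = RN u) \<and> (\<forall>w<i. A 10 w = PN w))
      (\<lambda>A. fresh (put A 3 0 (Suc i)) \<and> put A 3 0 (Suc i) 7 0 = DD \<and> (\<forall>j\<le>2 * horizon J + 1. put A 3 0 (Suc i) 8 j = DD ^ j)
        \<and> (\<forall>u<N. put A 3 0 (Suc i) 9 u = RN u) \<and> (\<forall>w<Suc i. put A 3 0 (Suc i) 10 w = PN w))"
      using bound_misc(4)[of i] by (intro hoare_asg) (auto simp: wfp_simps val_pr PN_def less_Suc_eq)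
  qed (use loops bound_misc in \<open>auto simp: wfp_simps data_def\<close>)
  show ?thesis
    unfolding prep_def by (rule hoare_seq[OF hoare_seq[OF hoare_seq[OF hoare_seq[OF hoare_seq[OF hoare_seq[OF h1 h2] h3] h4] h5] h6] h7])
qed

end

section \<open>Expressions and commands of the price computation\<close>

abbreviation "eU \<equiv> Plus (reg 2) c1"
abbreviation "eS \<equiv> Plus (reg (Suc 0)) c1"

definition eQ :: expr where
  "eQ = Times (Times (Const 4) (Times (Plus eB c1) (Plus eB c1))) (Times (Plus eA c1) (Times (Plus eA c1) (Plus eA c1)))"
definition eK :: expr where
  "eK = Times (Times (Const 144) (Times (Times (Plus eB c1) (Plus eB c1)) (Times (Plus eB c1) (Plus eB c1))))
     (Times (Plus eA c1) (Times (Plus eA c1) (Plus eA c1)))"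

definition eW :: expr where "eW = Plus (Times (arr 9 (reg 2)) (arr 8 (reg (Suc 0)))) (reg 6)"
definition eP :: expr where "eP = Times (arr 8 c1) (arr 13 (idx c0 (reg (Suc 0)) eU))"
definition eV :: expr where
  "eV = Plus eP (Minus (Minus (Plus (Times (Times (arr 9 (reg 2)) (arr 8 (reg (Suc 0)))) (Times eQ (arr 8 (Times (Const 2) eB)))) (reg 6))
     (Times (Times (reg 16) (arr 17 eS)) (arr 8 eS))) eP)"

text \<open>Truncated subtraction provides the tests: \<open>1 - (1 - k)\<close> is \<open>1\<close> if \<open>k\<close> is positive and \<open>0\<close> otherwise.\<close>

definition positive :: "expr \<Rightarrow> expr" where "positive a = Minus c1 (Minus c1 a)"
definition eG :: expr where "eG = positive (Minus (arr 13 (idx c0 eS eU)) eP)"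
definition eX :: expr where "eX = Plus (Times eG eS) (Times (Minus c1 eG) (arr 14 (idx (reg 0) (reg (Suc 0)) eU)))"
definition same :: "expr \<Rightarrow> expr \<Rightarrow> expr" where "same a b = Minus c1 (Plus (Minus a b) (Minus b a))"
definition eE :: expr where "eE = same (arr 14 (idx (reg 0) eS eU)) eS"
definition eL :: expr where
  "eL = Plus (Times eE (Plus (Times (same (reg (Suc 0)) (reg 4)) (arr 8 eS)) (reg 6)))
     (Times (Minus c1 eE) (Times (arr 8 c1) (arr 15 (idx c0 (reg (Suc 0)) eU))))"

lemma val_same: "val (same a b) m = (if val a m = val b m then 1 else 0)"
  by (auto simp: same_def)

lemma val_positive: "val (positive a) m = (if val a m > 0 then 1 else 0)"
  by (auto simp: positive_def)

lemmas e_defs = eQ_def eK_def eW_def eP_def eV_def positive_def eG_def eX_def same_def eE_def eL_def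

lemma sizes:
  "esz eW \<le> 900" "cmax eW < 256" "esz eV \<le> 900" "cmax eV < 256" "esz eX \<le> 900" "cmax eX < 256" "esz eL \<le> 900" "cmax eL < 256"
  "esz eK \<le> 100" "cmax eK < 256"
  by (simp_all add: e_defs esz_arr cmax_arr size_idx del: max_less_iff_conj) (simp_all add: cmax_arr size_idx)

definition price_round :: cmd where
  "price_round = Seq (Seq (Seq (sweep 13 c0 eV) (sweep 14 (reg 0) eX))
     (For 4 eB (Seq (sweep 15 c0 eL) (sumroots 15 18 (Plus (reg 4) c1)))))
     (For 4 eB (Asg 17 (Plus (reg 4) c1) (Minus (Plus (arr 17 (Plus (reg 4) c1)) (arr 18 (Plus (reg 4) c1))) (arr 8 eB))))"

definition offline :: cmd where
  "offline = Seq (Seq (Seq prep (sweep 30 c0 eW)) (sumroots 30 16 c0)) (For 0 eK price_round)"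

context inst
begin

lemma val_eQ [simp]: "val eQ (mem J A) = QQ"
  by (simp add: eQ_def QQ_def power2_eq_square power3_eq_cube)

lemma val_eK [simp]: "val eK (mem J A) = KK"
  by (simp add: eK_def KK_def power4_eq_xxxx power3_eq_cube mult.assoc del: mult_Suc mult_Suc_right)

lemma hoare_sweep:
  assumes X: "X < 32" "X \<notin> {1, 2, 3, 6, 10}"
    and wf: "wfe ne" "esz o1 \<le> 100" "cmax o1 < 256"
    and o1: "\<And>A A'. P A \<Longrightarrow> agree {1, 2, 3, 6, X} A A' \<Longrightarrow> val o1 (mem J A') = k"
    and data: "\<And>A. P A \<Longrightarrow> data A"
    and zero: "\<And>A u. P A \<Longrightarrow> u < N \<Longrightarrow> A X (ix J k 0 (Suc u)) = 0"
    and ne: "\<And>A A' s u. P A \<Longrightarrow> agree {1, 2, 3, 6, X} A A' \<Longrightarrow> A' 1 0 = s \<Longrightarrow> A' 2 0 = u \<Longrightarrow> s < horizon J \<Longrightarrow> u < N \<Longrightarrow>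
      val ne (mem J A') = F s u (A' 6 0) (A' X (ix J k s (Suc u)))"
    and F: "\<And>s u acc prev. s < horizon J \<Longrightarrow> u < N \<Longrightarrow> F s u acc prev \<le> G + acc + DD * prev"
    and big: "DD * (G * (3 * DD) ^ horizon J) < 2 ^ bits"
    and post: "\<And>A A'. P A \<Longrightarrow> agree {1, 2, 3, 6, X} A A' \<Longrightarrow>
      (\<And>s u. s \<le> horizon J \<Longrightarrow> u < N \<Longrightarrow> A' X (ix J k s (Suc u)) = bkn F s u) \<Longrightarrow> rest X A A' k \<Longrightarrow> Q A'"
  shows "hoare (sweep X o1 ne) P Q"
proof (rule hoareI)
  fix A assume A: "bd bits A" "P A"
  have s: "ok (sweep X o1 ne) A t_sweep \<and> (\<forall>s u. s \<le> horizon J \<longrightarrow> u < N \<longrightarrow> ex J (sweep X o1 ne) A X (ix J k s (Suc u)) = bkn F s u)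
    \<and> rest X A (ex J (sweep X o1 ne) A) k"
    using A data[OF A(2)] bk_bound_max[of F G, OF F big] unfolding data_def
    by (intro sweep_spec X wf o1 zero ne) auto
  have g: "m * (t + 3 * tick) + 3 * tick \<le> poly (time (forp l e c)) z" if "m \<le> MM" "t \<le> poly (time c) z" for m t l e c
  proof -
    have "m * (t + 3 * tick) \<le> m * (poly (time c) z + 3 * tick)" using that by (intro mult_le_mono2) simp
    then show ?thesis using time_for[OF that(1), of c l e] by linarith
  qed
  have acc: "N * (tick + 3 * tick) + 3 * tick \<le> poly (time (forp 3 eN (Assign a e))) z" for a e
    using time_for[OF loops(1), of "Assign a e"] by simp
  have "t_sweep \<le> poly (time (compile (sweep X o1 ne))) z"
    unfolding t_sweep_def t_row_def t_acc_def sweep_def compile.simps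
    by (intro g loops) (unfold time.simps poly_add poly_tick poly_1, intro add_mono order_refl acc)
  moreover have "Q (ex J (sweep X o1 ne) A)"
    using agree_ex[of "sweep X o1 ne" A] s unfolding writes_sweep by (intro post[OF A(2)]) auto
  ultimately show "ok (sweep X o1 ne) A (poly (time (compile (sweep X o1 ne))) z) \<and> Q (ex J (sweep X o1 ne) A)"
    using s ok_mono by blast
qed

lemma hoare_sumroots:
  assumes X: "X < 32" "X \<notin> {5, 6}" and d: "d < 32" "d \<notin> {5, 6}"
    and wf: "esz di \<le> 100" "cmax di < 256" and di: "\<And>A A'. P A \<Longrightarrow> agree {5, 6} A A' \<Longrightarrow> val di (mem J A') = m"
    and f: "\<And>A u. P A \<Longrightarrow> u < N \<Longrightarrow> A X (ix J 0 (horizon J) (Suc u)) = f u"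
    and bound: "(\<Sum>i<arms J. f (root_node J (Suc i))) < 2 ^ bits"
    and post: "\<And>A A'. P A \<Longrightarrow> agree {5, 6, d} A A' \<Longrightarrow> A' d = (A d)(m := (\<Sum>i<arms J. f (root_node J (Suc i)))) \<Longrightarrow> Q A'"
  shows "hoare (sumroots X d di) P Q"
proof (rule hoareI)
  fix A assume A: "bd bits A" "P A"
  have s: "ok (sumroots X d di) A t_sum \<and> ex J (sumroots X d di) A d = (A d)(m := (\<Sum>i<arms J. f (root_node J (Suc i))))"
    using A by (intro sumroots_spec X d wf di f bound) auto
  have "t_sum \<le> poly (time (compile (sumroots X d di))) z"
    using time_for[of "arms J" "compile (Asg 6 c0 (Plus (reg 6) (arr X (idx c0 eB (Plus (Cell (Plus (Const 3) (reg 5))) c1)))))" 5 eA] loops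
    unfolding t_sum_def sumroots_def by simp
  moreover have "Q (ex J (sumroots X d di) A)"
    using agree_ex[of "sumroots X d di" A] s unfolding writes_sumroots by (intro post[OF A(2)]) auto
  ultimately show "ok (sumroots X d di) A (poly (time (compile (sumroots X d di))) z) \<and> Q (ex J (sumroots X d di) A)"
    using s ok_mono by blast
qed

definition idle :: "store \<Rightarrow> bool" where "idle A \<longleftrightarrow> (\<forall>k. 19 \<le> k \<longrightarrow> k < 30 \<longrightarrow> A k = (\<lambda>_. 0))"

definition base_ok :: "store \<Rightarrow> bool" where
  "base_ok A \<longleftrightarrow> data A \<and> A 16 0 = WT \<and> idle A \<and> (\<forall>u<N. A 13 (ix J 0 0 (Suc u)) = 0) \<and> (\<forall>u<N. A 15 (ix J 0 0 (Suc u)) = 0)"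

definition prices :: "nat \<Rightarrow> store \<Rightarrow> bool" where
  "prices k A \<longleftrightarrow> (\<forall>t. 1 \<le> t \<longrightarrow> t \<le> horizon J \<longrightarrow> A 17 t = LN k t)"

text \<open>The zeros outside the filled entries are recorded because the online phase reads some of
  them as the answer "no further play" (\<open>rel_lookup\<close>).\<close>

definition tables :: "nat \<Rightarrow> store \<Rightarrow> bool" where
  "tables k A \<longleftrightarrow> (\<forall>k'<k. \<forall>s u. s \<le> horizon J \<longrightarrow> u < N \<longrightarrow> A 14 (ix J k' s (Suc u)) = XN (LN k') s u) \<and>
     (\<forall>i. (\<forall>k' s u. k' < k \<and> 1 \<le> s \<and> s \<le> horizon J \<and> u < N \<longrightarrow> i \<noteq> ix J k' s (Suc u)) \<longrightarrow> A 14 i = 0)"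

lemma tables_zero:
  assumes "tables k A" "\<And>k' s u. k' < k \<Longrightarrow> 1 \<le> s \<Longrightarrow> s \<le> horizon J \<Longrightarrow> u < N \<Longrightarrow> i \<noteq> ix J k' s (Suc u)"
  shows "A 14 i = 0"
  by (rule mp[OF spec[of _ i, OF conjunct2[OF assms(1)[unfolded tables_def]]]]) (use assms(2) in blast)

lemma rest_zero: "rest X A A' k \<Longrightarrow> u < N \<Longrightarrow> A' X (ix J k' 0 (Suc u)) = A X (ix J k' 0 (Suc u))"
proof -
  assume r: "rest X A A' k" and u: "u < N"
  have "\<forall>s v. 1 \<le> s \<and> s \<le> horizon J \<and> v < N \<longrightarrow> ix J k' 0 (Suc u) \<noteq> ix J k s (Suc v)"
    using u by (auto simp: ix_eq_iff)
  then show ?thesis using r unfolding rest_def by blast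
qed

lemma rest_row: "rest X A A' k \<Longrightarrow> k' \<noteq> k \<Longrightarrow> s \<le> horizon J \<Longrightarrow> u < N \<Longrightarrow> A' X (ix J k' s (Suc u)) = A X (ix J k' s (Suc u))"
proof -
  assume r: "rest X A A' k" and u: "k' \<noteq> k" "s \<le> horizon J" "u < N"
  have "\<forall>s' v. 1 \<le> s' \<and> s' \<le> horizon J \<and> v < N \<longrightarrow> ix J k' s (Suc u) \<noteq> ix J k s' (Suc v)"
    using u by (auto simp: ix_eq_iff)
  then show ?thesis using r unfolding rest_def by blast
qed

lemma data_agree: "agree W A A' \<Longrightarrow> data A \<Longrightarrow> W \<inter> {8, 9, 10} = {} \<Longrightarrow> data A'"
  unfolding data_def agree_def by auto

lemma idle_agree: "agree W A A' \<Longrightarrow> idle A \<Longrightarrow> (\<And>k. k \<in> W \<Longrightarrow> k < 19 \<or> 30 \<le> k) \<Longrightarrow> idle A'"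
  unfolding idle_def agree_def by (metis not_le)

lemma base_agree: "agree W A A' \<Longrightarrow> base_ok A \<Longrightarrow> W \<inter> {8, 9, 10, 13, 15, 16} = {} \<Longrightarrow> (\<And>k. k \<in> W \<Longrightarrow> k < 19 \<or> 30 \<le> k) \<Longrightarrow> base_ok A'"
proof -
  assume a: "agree W A A'" "base_ok A" "W \<inter> {8, 9, 10, 13, 15, 16} = {}" "\<And>k. k \<in> W \<Longrightarrow> k < 19 \<or> 30 \<le> k"
  have "data A'" using a by (intro data_agree[OF a(1)]) (auto simp: base_ok_def)
  moreover have "idle A'" using a by (intro idle_agree[OF a(1)]) (auto simp: base_ok_def)
  moreover have "A' 13 = A 13" "A' 15 = A 15" "A' 16 = A 16" using a(3) by (auto intro!: agreeD[OF a(1)])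
  ultimately show ?thesis using a(2) by (simp add: base_ok_def)
qed

lemma agree_put: "agree {k} A (put A k i v)"
  by (simp add: agree_def)

lemma base_put [simp]: "k \<in> {0, 1, 2, 3, 4, 5, 6, 14, 17, 18} \<Longrightarrow> base_ok A \<Longrightarrow> base_ok (put A k i v)"
  by (rule base_agree[OF agree_put]) auto

lemma prices_put [simp]: "k \<noteq> 17 \<Longrightarrow> prices l (put A k i v) = prices l A"
  by (simp add: prices_def)

lemma tables_put [simp]: "k \<noteq> 14 \<Longrightarrow> tables l (put A k i v) = tables l A"
  by (simp add: tables_def)

lemma LD_bits: "LD (LN k) t < 2 ^ bits" and LN_bits: "k \<le> KK + 1 \<Longrightarrow> LN k t < 2 ^ bits"
proof -
  let ?M = "arms J * (DD ^ horizon J * (3 * DD) ^ horizon J)"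
  have "UX L t (horizon J) u \<le> DD ^ horizon J * (3 * DD) ^ horizon J" if "u < N" for L u
    unfolding UX_def using that by (intro bk_bound UX_step) auto
  then have "LD (LN k) t \<le> (\<Sum>i<arms J. DD ^ horizon J * (3 * DD) ^ horizon J)"
    unfolding LD_def using root_N by (intro sum_mono) auto
  also have "\<dots> = 1 * ?M" by simp
  also have "\<dots> \<le> (KK + 1) * ?M" by (intro mult_le_mono1) simp
  finally show "LD (LN k) t < 2 ^ bits" using bound_L by linarith
  assume "k \<le> KK + 1"
  then have "k * ?M \<le> (KK + 1) * ?M" by (intro mult_le_mono1)
  then show "LN k t < 2 ^ bits" using LN_bound[of k t] bound_L by linarith
qed

lemma W_hoare: "hoare (sweep 30 c0 eW) (\<lambda>A. fresh A \<and> data A)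
    (\<lambda>A. data A \<and> (\<forall>k\<ge>11. k \<noteq> 30 \<longrightarrow> A k = (\<lambda>_. 0)) \<and> (\<forall>u<N. A 30 (ix J 0 (horizon J) (Suc u)) = WN (horizon J) u))"
proof (rule hoare_sweep[where F = "\<lambda>s u acc prev. RN u * DD ^ s + acc" and k = 0 and G = "RM * DD ^ horizon J"])
  fix A A' s u assume A: "fresh A \<and> data A" and a: "agree {1, 2, 3, 6, 30} A A'" "A' 1 0 = s" "A' 2 0 = u" "s < horizon J" "u < N"
  have "data A'" using A by (intro data_agree[OF a(1)]) auto
  then show "val eW (mem J A') = RN u * DD ^ s + A' 6 0" using a by (simp add: eW_def data_def)
next
  fix A A' assume A: "fresh A \<and> data A" and a: "agree {1, 2, 3, 6, 30} A A'"
    "\<And>s u. s \<le> horizon J \<Longrightarrow> u < N \<Longrightarrow> A' 30 (ix J 0 s (Suc u)) = bkn (\<lambda>s u acc prev. RN u * DD ^ s + acc) s u"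
  have "data A'" using A by (intro data_agree[OF a(1)]) auto
  moreover have "A' k = A k" if "k \<ge> 11" "k \<noteq> 30" for k using that by (intro agreeD[OF a(1)]) auto
  ultimately show "data A' \<and> (\<forall>k\<ge>11. k \<noteq> 30 \<longrightarrow> A' k = (\<lambda>_. 0)) \<and> (\<forall>u<N. A' 30 (ix J 0 (horizon J) (Suc u)) = WN (horizon J) u)"
    using A a(2) by (simp add: WN_def fresh_def)
qed (use sizes bound_W in \<open>auto simp: wfe_def fresh_def WN_step\<close>)

lemma WT_bits: "WT < 2 ^ bits"
proof -
  let ?G = "RM * DD ^ horizon J"
  have "WN (horizon J) u \<le> ?G * (3 * DD) ^ horizon J" if "u < N" for u
    unfolding WN_def using that by (intro bk_bound WN_step) auto
  then have "WT \<le> (\<Sum>i<arms J. ?G * (3 * DD) ^ horizon J)"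
    unfolding WT_def using root_N by (intro sum_mono) auto
  then show ?thesis using bound_WT by simp
qed

lemma WT_hoare: "hoare (sumroots 30 16 c0)
    (\<lambda>A. data A \<and> (\<forall>k\<ge>11. k \<noteq> 30 \<longrightarrow> A k = (\<lambda>_. 0)) \<and> (\<forall>u<N. A 30 (ix J 0 (horizon J) (Suc u)) = WN (horizon J) u))
    (\<lambda>A. base_ok A \<and> prices 0 A \<and> tables 0 A)"
proof (rule hoare_sumroots[where f = "WN (horizon J)" and m = 0])
  fix A A' assume A: "data A \<and> (\<forall>k\<ge>11. k \<noteq> 30 \<longrightarrow> A k = (\<lambda>_. 0)) \<and> (\<forall>u<N. A 30 (ix J 0 (horizon J) (Suc u)) = WN (horizon J) u)"
    and a: "agree {5, 6, 16} A A'" "A' 16 = (A 16)(0 := (\<Sum>i<arms J. WN (horizon J) (root_node J (Suc i))))"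
  have "data A'" using A by (intro data_agree[OF a(1)]) auto
  moreover have "A' k = (\<lambda>_. 0)" if "k \<ge> 11" "k \<noteq> 30" "k \<noteq> 16" for k
    using that A agreeD[OF a(1), of k] by auto
  ultimately show "base_ok A' \<and> prices 0 A' \<and> tables 0 A'"
    using a(2) by (simp add: base_ok_def prices_def tables_def idle_def WT_def)
qed (use WT_bits in \<open>auto simp: WT_def\<close>)

definition FV :: "(nat \<Rightarrow> nat) \<Rightarrow> nat \<Rightarrow> nat \<Rightarrow> nat \<Rightarrow> nat \<Rightarrow> nat" where
  "FV L s u acc prev = DD * prev +
     ((RN u * DD ^ s * (QQ * DD ^ (2 * horizon J)) + acc - WT * L (Suc s) * DD ^ Suc s) - DD * prev)"

lemma VN_FV: "VN L = bkn (FV L)"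
  unfolding VN_def FV_def ..

lemma V_hoare: "hoare (sweep 13 c0 eV) (\<lambda>A. A 0 0 = k \<and> base_ok A \<and> prices k A \<and> tables k A)
   (\<lambda>A. A 0 0 = k \<and> base_ok A \<and> prices k A \<and> tables k A \<and> (\<forall>s u. s \<le> horizon J \<longrightarrow> u < N \<longrightarrow> A 13 (ix J 0 s (Suc u)) = VN (LN k) s u))"
proof (rule hoare_sweep[where F = "FV (LN k)" and k = 0 and G = "RM * DD ^ horizon J * (QQ * DD ^ (2 * horizon J))"])
  fix A A' s u assume A: "A 0 0 = k \<and> base_ok A \<and> prices k A \<and> tables k A"
    and a: "agree {1, 2, 3, 6, 13} A A'" "A' 1 0 = s" "A' 2 0 = u" "s < horizon J" "u < N"
  have d: "data A'" using A by (intro data_agree[OF a(1)]) (auto simp: base_ok_def)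
  have "A' 16 0 = WT" "A' 17 (Suc s) = LN k (Suc s)"
    using A a(4) agreeD[OF a(1), of 16] agreeD[OF a(1), of 17] by (auto simp: base_ok_def prices_def simp del: LN.simps)
  moreover have "A' 8 (Suc s) = DD ^ Suc s" "A' 8 s = DD ^ s" "A' 8 (2 * horizon J) = DD ^ (2 * horizon J)" "A' 8 (Suc 0) = DD" "A' 9 u = RN u"
    using d a unfolding data_def by auto
  ultimately show "val eV (mem J A') = FV (LN k) s u (A' 6 0) (A' 13 (ix J 0 s (Suc u)))"
    using a by (simp add: eV_def eP_def FV_def del: LN.simps power_Suc)
next
  fix A A' assume A: "A 0 0 = k \<and> base_ok A \<and> prices k A \<and> tables k A" and a: "agree {1, 2, 3, 6, 13} A A'"
    "\<And>s u. s \<le> horizon J \<Longrightarrow> u < N \<Longrightarrow> A' 13 (ix J 0 s (Suc u)) = bkn (FV (LN k)) s u" "rest 13 A A' 0"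
  have "data A'" using A by (intro data_agree[OF a(1)]) (auto simp: base_ok_def)
  moreover have "idle A'" using A by (intro idle_agree[OF a(1)]) (auto simp: base_ok_def)
  moreover have "A' l = A l" if "l \<in> {0, 14, 15, 16, 17}" for l using that by (intro agreeD[OF a(1)]) auto
  ultimately show "A' 0 0 = k \<and> base_ok A' \<and> prices k A' \<and> tables k A' \<and> (\<forall>s u. s \<le> horizon J \<longrightarrow> u < N \<longrightarrow> A' 13 (ix J 0 s (Suc u)) = VN (LN k) s u)"
    using A a(2) rest_zero[OF a(3), of _ 0] by (simp add: VN_FV base_ok_def prices_def tables_def)
qed (use sizes bound_V VN_step in \<open>auto simp: wfe_def base_ok_def FV_def\<close>)

definition valued :: "nat \<Rightarrow> store \<Rightarrow> bool" where
  "valued k A \<longleftrightarrow> (\<forall>s u. s \<le> horizon J \<longrightarrow> u < N \<longrightarrow> A 13 (ix J 0 s (Suc u)) = VN (LN k) s u)"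

definition FX :: "(nat \<Rightarrow> nat) \<Rightarrow> nat \<Rightarrow> nat \<Rightarrow> nat \<Rightarrow> nat \<Rightarrow> nat" where
  "FX L s u acc prev = (if VN L (Suc s) u > DD * VN L s u then Suc s else prev)"

lemma XN_FX: "XN L = bkn (FX L)"
  unfolding XN_def FX_def ..

lemma X_hoare: "hoare (sweep 14 (reg 0) eX)
   (\<lambda>A. A 0 0 = k \<and> base_ok A \<and> prices k A \<and> tables k A \<and> valued k A)
   (\<lambda>A. A 0 0 = k \<and> base_ok A \<and> prices k A \<and> tables (Suc k) A)"
proof (rule hoare_sweep[where F = "FX (LN k)" and k = k and G = "horizon J"])
  fix A A' assume "A 0 0 = k \<and> base_ok A \<and> prices k A \<and> tables k A \<and> valued k A" "agree {1, 2, 3, 6, 14} A A'"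
  then show "val (reg 0) (mem J A') = k" using agreeD[of _ A A' 0] by simp
next
  fix A u assume A: "A 0 0 = k \<and> base_ok A \<and> prices k A \<and> tables k A \<and> valued k A" and u: "u < N"
  show "A 14 (ix J k 0 (Suc u)) = 0"
    by (rule tables_zero[of k]) (use A u in \<open>auto simp: ix_eq_iff\<close>)
next
  fix A A' s u assume A: "A 0 0 = k \<and> base_ok A \<and> prices k A \<and> tables k A \<and> valued k A"
    and a: "agree {1, 2, 3, 6, 14} A A'" "A' 1 0 = s" "A' 2 0 = u" "s < horizon J" "u < N"
  have d: "data A'" using A by (intro data_agree[OF a(1)]) (auto simp: base_ok_def)
  have "A' 13 (ix J 0 s (Suc u)) = VN (LN k) s u" "A' 13 (ix J 0 (Suc s) (Suc u)) = VN (LN k) (Suc s) u"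
    using A a agreeD[OF a(1), of 13] by (auto simp: valued_def)
  moreover have "A' 8 (Suc 0) = DD" using d unfolding data_def by auto
  moreover have "A' 0 0 = k" using A agreeD[OF a(1), of 0] by simp
  ultimately show "val eX (mem J A') = FX (LN k) s u (A' 6 0) (A' 14 (ix J k s (Suc u)))"
    using a by (simp add: eX_def eG_def eP_def val_positive FX_def)
next
  fix A A' assume A: "A 0 0 = k \<and> base_ok A \<and> prices k A \<and> tables k A \<and> valued k A" and a: "agree {1, 2, 3, 6, 14} A A'"
    "\<And>s u. s \<le> horizon J \<Longrightarrow> u < N \<Longrightarrow> A' 14 (ix J k s (Suc u)) = bkn (FX (LN k)) s u" "rest 14 A A' k"
  have "base_ok A'" using A by (intro base_agree[OF a(1)]) auto
  moreover have "A' l = A l" if "l \<in> {0, 17}" for l using that by (intro agreeD[OF a(1)]) auto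
  moreover have "tables (Suc k) A'"
    unfolding tables_def
  proof (intro conjI allI impI)
    fix k' s u assume h: "k' < Suc k" "s \<le> horizon J" "u < N"
    show "A' 14 (ix J k' s (Suc u)) = XN (LN k') s u"
    proof (cases "k' = k")
      case True
      then show ?thesis using a(2) h by (simp add: XN_FX)
    next
      case False
      then show ?thesis using rest_row[OF a(3) False] h A by (simp add: tables_def)
    qed
  next
    fix i assume i: "\<forall>k' s u. k' < Suc k \<and> 1 \<le> s \<and> s \<le> horizon J \<and> u < N \<longrightarrow> i \<noteq> ix J k' s (Suc u)"
    then have "A' 14 i = A 14 i" using a(3) unfolding rest_def by blast
    also have "\<dots> = 0" by (rule tables_zero[of k]) (use A i in auto)
    finally show "A' 14 i = 0" .
  qed
  ultimately show "A' 0 0 = k \<and> base_ok A' \<and> prices k A' \<and> tables (Suc k) A'"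
    using A by (simp add: prices_def)
qed (use sizes bound_X XN_step in \<open>auto simp: wfe_def base_ok_def FX_def esz_arr cmax_arr\<close>)

definition FU :: "(nat \<Rightarrow> nat) \<Rightarrow> nat \<Rightarrow> nat \<Rightarrow> nat \<Rightarrow> nat \<Rightarrow> nat \<Rightarrow> nat" where
  "FU L t s u acc prev = (if XN L (Suc s) u = Suc s then (if Suc s = t then DD ^ Suc s else 0) + acc else DD * prev)"

lemma UX_FU: "UX L t = bkn (FU L t)"
  unfolding UX_def FU_def ..

definition loads :: "nat \<Rightarrow> nat \<Rightarrow> store \<Rightarrow> bool" where
  "loads k t A \<longleftrightarrow> (\<forall>t'. 1 \<le> t' \<longrightarrow> t' \<le> t \<longrightarrow> A 18 t' = LD (LN k) t')"

lemma U_hoare: "hoare (sweep 15 c0 eL)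
   (\<lambda>A. A 4 0 = t \<and> A 0 0 = k \<and> base_ok A \<and> prices k A \<and> tables (Suc k) A \<and> loads k t A)
   (\<lambda>A. A 4 0 = t \<and> A 0 0 = k \<and> base_ok A \<and> prices k A \<and> tables (Suc k) A \<and> loads k t A \<and>
     (\<forall>u<N. A 15 (ix J 0 (horizon J) (Suc u)) = UX (LN k) (Suc t) (horizon J) u))"
proof (rule hoare_sweep[where F = "FU (LN k) (Suc t)" and k = 0 and G = "DD ^ horizon J"])
  fix A A' s u assume A: "A 4 0 = t \<and> A 0 0 = k \<and> base_ok A \<and> prices k A \<and> tables (Suc k) A \<and> loads k t A"
    and a: "agree {1, 2, 3, 6, 15} A A'" "A' 1 0 = s" "A' 2 0 = u" "s < horizon J" "u < N"
  have d: "data A'" using A by (intro data_agree[OF a(1)]) (auto simp: base_ok_def)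
  have "A' 14 (ix J k (Suc s) (Suc u)) = XN (LN k) (Suc s) u"
    using A a agreeD[OF a(1), of 14] by (auto simp: tables_def)
  moreover have "A' 8 (Suc 0) = DD" "A' 8 (Suc s) = DD ^ Suc s" using d a unfolding data_def by auto
  moreover have "A' 0 0 = k" "A' 4 0 = t" using A agreeD[OF a(1), of 0] agreeD[OF a(1), of 4] by simp_all
  ultimately show "val eL (mem J A') = FU (LN k) (Suc t) s u (A' 6 0) (A' 15 (ix J 0 s (Suc u)))"
    using a by (simp add: eL_def eE_def val_same FU_def del: power_Suc)
next
  fix A A' assume A: "A 4 0 = t \<and> A 0 0 = k \<and> base_ok A \<and> prices k A \<and> tables (Suc k) A \<and> loads k t A" and a: "agree {1, 2, 3, 6, 15} A A'"
    "\<And>s u. s \<le> horizon J \<Longrightarrow> u < N \<Longrightarrow> A' 15 (ix J 0 s (Suc u)) = bkn (FU (LN k) (Suc t)) s u" "rest 15 A A' 0"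
  have "data A'" using A by (intro data_agree[OF a(1)]) (auto simp: base_ok_def)
  moreover have "idle A'" using A by (intro idle_agree[OF a(1)]) (auto simp: base_ok_def)
  moreover have "A' l = A l" if "l \<in> {0, 4, 13, 14, 16, 17, 18}" for l using that by (intro agreeD[OF a(1)]) auto
  ultimately show "A' 4 0 = t \<and> A' 0 0 = k \<and> base_ok A' \<and> prices k A' \<and> tables (Suc k) A' \<and> loads k t A' \<and>
     (\<forall>u<N. A' 15 (ix J 0 (horizon J) (Suc u)) = UX (LN k) (Suc t) (horizon J) u)"
    using A a(2) rest_zero[OF a(3), of _ 0] by (simp add: UX_FU base_ok_def prices_def tables_def loads_def)
qed (use sizes bound_U UX_step in \<open>auto simp: wfe_def base_ok_def FU_def\<close>)

lemma LD_hoare: "hoare (sumroots 15 18 (Plus (reg 4) c1))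
   (\<lambda>A. A 4 0 = t \<and> A 0 0 = k \<and> base_ok A \<and> prices k A \<and> tables (Suc k) A \<and> loads k t A \<and>
     (\<forall>u<N. A 15 (ix J 0 (horizon J) (Suc u)) = UX (LN k) (Suc t) (horizon J) u))
   (\<lambda>A. A 0 0 = k \<and> base_ok A \<and> prices k A \<and> tables (Suc k) A \<and> loads k (Suc t) A)"
proof (rule hoare_sumroots[where f = "UX (LN k) (Suc t) (horizon J)" and m = "Suc t"])
  fix A A' assume A: "A 4 0 = t \<and> A 0 0 = k \<and> base_ok A \<and> prices k A \<and> tables (Suc k) A \<and> loads k t A \<and>
     (\<forall>u<N. A 15 (ix J 0 (horizon J) (Suc u)) = UX (LN k) (Suc t) (horizon J) u)"
    and a: "agree {5, 6, 18} A A'" "A' 18 = (A 18)(Suc t := (\<Sum>i<arms J. UX (LN k) (Suc t) (horizon J) (root_node J (Suc i))))"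
  have "base_ok A'" using A by (intro base_agree[OF a(1)]) auto
  moreover have "A' l = A l" if "l \<in> {0, 14, 17}" for l using that by (intro agreeD[OF a(1)]) auto
  ultimately show "A' 0 0 = k \<and> base_ok A' \<and> prices k A' \<and> tables (Suc k) A' \<and> loads k (Suc t) A'"
    using A a(2) by (auto simp: prices_def tables_def loads_def LD_def le_Suc_eq)
next
  fix A A' assume "A 4 0 = t \<and> A 0 0 = k \<and> base_ok A \<and> prices k A \<and> tables (Suc k) A \<and> loads k t A \<and>
     (\<forall>u<N. A 15 (ix J 0 (horizon J) (Suc u)) = UX (LN k) (Suc t) (horizon J) u)" "agree {5, 6} A A'"
  then show "val (Plus (reg 4) c1) (mem J A') = Suc t" using agreeD[of _ A A' 4] by simp
next
  show "(\<Sum>i<arms J. UX (LN k) (Suc t) (horizon J) (root_node J (Suc i))) < 2 ^ bits"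
    using LD_bits unfolding LD_def .
qed (auto simp: esz_arr cmax_arr)

lemma round_hoare:
  assumes "k < KK"
  shows "hoare price_round (\<lambda>A. A 0 0 = k \<and> base_ok A \<and> prices k A \<and> tables k A)
    (\<lambda>A. base_ok A \<and> prices (Suc k) A \<and> tables (Suc k) A)"
proof -
  have h3: "hoare (For 4 eB (Seq (sweep 15 c0 eL) (sumroots 15 18 (Plus (reg 4) c1))))
      (\<lambda>A. A 0 0 = k \<and> base_ok A \<and> prices k A \<and> tables (Suc k) A)
      (\<lambda>A. A 0 0 = k \<and> base_ok A \<and> prices k A \<and> tables (Suc k) A \<and> loads k (horizon J) A)"
  proof (rule hoare_pre[OF hoare_for[where Inv = "\<lambda>t A. A 0 0 = k \<and> base_ok A \<and> prices k A \<and> tables (Suc k) A \<and> loads k t A"]])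
    fix t
    show "hoare (Seq (sweep 15 c0 eL) (sumroots 15 18 (Plus (reg 4) c1)))
      (\<lambda>A. A 4 0 = t \<and> A 0 0 = k \<and> base_ok A \<and> prices k A \<and> tables (Suc k) A \<and> loads k t A)
      (\<lambda>A. put A 4 0 (Suc t) 0 0 = k \<and> base_ok (put A 4 0 (Suc t)) \<and> prices k (put A 4 0 (Suc t))
         \<and> tables (Suc k) (put A 4 0 (Suc t)) \<and> loads k (Suc t) (put A 4 0 (Suc t)))"
      by (rule hoare_conseq[OF hoare_seq[OF U_hoare[of t k] LD_hoare[of t k]]]) (auto simp: loads_def)
  qed (use loops bound_misc in \<open>auto simp: wfp_simps writes_sweep writes_sumroots loads_def\<close>)
  \<comment> \<open>Prices are overwritten in place. Since all loads of the round are already in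
    array 18, a mixture of old and new prices during this loop does no harm.\<close>
  have h4: "hoare (For 4 eB (Asg 17 (Plus (reg 4) c1) (Minus (Plus (arr 17 (Plus (reg 4) c1)) (arr 18 (Plus (reg 4) c1))) (arr 8 eB))))
      (\<lambda>A. A 0 0 = k \<and> base_ok A \<and> prices k A \<and> tables (Suc k) A \<and> loads k (horizon J) A)
      (\<lambda>A. base_ok A \<and> prices (Suc k) A \<and> tables (Suc k) A)"
  proof (rule hoare_conseq[OF hoare_for[where Inv = "\<lambda>t A. base_ok A \<and> (\<forall>t'. 1 \<le> t' \<longrightarrow> t' \<le> horizon J \<longrightarrow> A 17 t' = (if t' \<le> t then LN (Suc k) t' else LN k t'))
      \<and> tables (Suc k) A \<and> loads k (horizon J) A"]])
    fix t assume t: "t < horizon J"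
    show "hoare (Asg 17 (Plus (reg 4) c1) (Minus (Plus (arr 17 (Plus (reg 4) c1)) (arr 18 (Plus (reg 4) c1))) (arr 8 eB)))
      (\<lambda>A. A 4 0 = t \<and> base_ok A \<and> (\<forall>t'. 1 \<le> t' \<longrightarrow> t' \<le> horizon J \<longrightarrow> A 17 t' = (if t' \<le> t then LN (Suc k) t' else LN k t'))
        \<and> tables (Suc k) A \<and> loads k (horizon J) A)
      (\<lambda>A. base_ok (put A 4 0 (Suc t)) \<and> (\<forall>t'. 1 \<le> t' \<longrightarrow> t' \<le> horizon J \<longrightarrow> put A 4 0 (Suc t) 17 t' = (if t' \<le> Suc t then LN (Suc k) t' else LN k t'))
        \<and> tables (Suc k) (put A 4 0 (Suc t)) \<and> loads k (horizon J) (put A 4 0 (Suc t)))"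
    proof (rule hoare_asg)
      fix A assume A: "A 4 0 = t \<and> base_ok A \<and> (\<forall>t'. 1 \<le> t' \<longrightarrow> t' \<le> horizon J \<longrightarrow> A 17 t' = (if t' \<le> t then LN (Suc k) t' else LN k t'))
        \<and> tables (Suc k) A \<and> loads k (horizon J) A"
      have "A 17 (Suc t) = LN k (Suc t)" "A 18 (Suc t) = LD (LN k) (Suc t)" "A 8 (horizon J) = DD ^ horizon J"
        using A t by (auto simp: loads_def base_ok_def data_def simp del: LN.simps)
      then have v: "val (Minus (Plus (arr 17 (Plus (reg 4) c1)) (arr 18 (Plus (reg 4) c1))) (arr 8 eB)) (mem J A) = LN (Suc k) (Suc t)"
        using A by simp
      show "val (Minus (Plus (arr 17 (Plus (reg 4) c1)) (arr 18 (Plus (reg 4) c1))) (arr 8 eB)) (mem J A) < 2 ^ bits \<and>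
        (\<lambda>A. base_ok (put A 4 0 (Suc t)) \<and> (\<forall>t'. 1 \<le> t' \<longrightarrow> t' \<le> horizon J \<longrightarrow> put A 4 0 (Suc t) 17 t' = (if t' \<le> Suc t then LN (Suc k) t' else LN k t'))
        \<and> tables (Suc k) (put A 4 0 (Suc t)) \<and> loads k (horizon J) (put A 4 0 (Suc t)))
         (put A 17 (val (Plus (reg 4) c1) (mem J A)) (val (Minus (Plus (arr 17 (Plus (reg 4) c1)) (arr 18 (Plus (reg 4) c1))) (arr 8 eB)) (mem J A)))"
        unfolding v using A LN_bits[of "Suc k" "Suc t"] assms by (auto simp: loads_def le_Suc_eq simp del: LN.simps)
    qed (auto simp: wfp_simps)
  qed (use loops bound_misc in \<open>auto simp: wfp_simps loads_def prices_def simp del: LN.simps\<close>)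
  show ?thesis
    unfolding price_round_def
    by (rule hoare_seq[OF hoare_seq[OF hoare_seq[OF V_hoare X_hoare[unfolded valued_def]] h3] h4])
qed

theorem offline_hoare: "hoare offline fresh (\<lambda>A. base_ok A \<and> tables KK A)"
proof -
  have "hoare (For 0 eK price_round) (\<lambda>A. base_ok A \<and> prices 0 A \<and> tables 0 A) (\<lambda>A. base_ok A \<and> tables KK A)"
  proof (rule hoare_conseq[OF hoare_for[where Inv = "\<lambda>k A. base_ok A \<and> prices k A \<and> tables k A"]])
    fix k assume k: "k < KK"
    show "hoare price_round (\<lambda>A. A 0 0 = k \<and> base_ok A \<and> prices k A \<and> tables k A)
      (\<lambda>A. base_ok (put A 0 0 (Suc k)) \<and> prices (Suc k) (put A 0 0 (Suc k)) \<and> tables (Suc k) (put A 0 0 (Suc k)))"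
      by (rule hoare_conseq[OF round_hoare[OF k]]) auto
  qed (use loops bound_misc sizes in \<open>auto simp: wfe_def esz_arr cmax_arr price_round_def writes_sweep writes_sumroots\<close>)
  then show ?thesis
    unfolding offline_def by (rule hoare_seq[OF hoare_seq[OF hoare_seq[OF prep_hoare W_hoare] WT_hoare]])
qed

end

section \<open>Commands of the online phase\<close>

lemma pick_bound: "(\<And>i. 1 \<le> i \<Longrightarrow> i \<le> m \<Longrightarrow> f i \<le> K) \<Longrightarrow> fst (pick f m) \<le> K \<and> snd (pick f m) \<le> m"
proof (induction m)
  case (Suc m)
  then have "fst (pick f m) \<le> K \<and> snd (pick f m) \<le> m" by simp
  then show ?case using Suc.prems[of "Suc m"] by simp
qed simp

lemma nx_False: "nx (\<lambda>_ _. False) s u = 0"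
  by (induction s) auto

definition obs_decode :: "nat \<Rightarrow> nat option" where
  "obs_decode k = (if k = 0 then None else Some (k - 1))"

lemma obs_decode [simp]: "obs_decode (obs_code x) = x"
  by (cases x) (auto simp: obs_decode_def obs_code_def)

abbreviation "ei \<equiv> Plus (reg 5) c1"

definition draw :: prog where
  "draw = Then (Rand (adr 19 ei) (Times (Const 3) eK))
     (compile (Seq (Asg 20 ei eB) (Asg 21 ei (Plus (Cell (Plus (Const 3) (reg 5))) c1))))"

definition select :: cmd where
  "select = Seq (Seq (Asg 27 c0 c0) (Asg 26 c0 c0)) (For 5 eA (Seq (Seq (Seq (Seq
     (Asg 23 ei (arr 14 (idx (arr 19 ei) (arr 20 ei) (arr 21 ei))))
     (Asg 24 c0 (Times (positive (arr 23 ei)) (Plus (arr 23 ei) (arr 22 ei)))))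
     (Asg 25 c0 (positive (Minus (reg 24) (reg 27)))))
     (Asg 26 c0 (Plus (Times (reg 25) ei) (Times (Minus c1 (reg 25)) (reg 26)))))
     (Asg 27 c0 (Plus (reg 27) (Minus (reg 24) (reg 27))))))"

text \<open>If no arm is selected, register 26 holds 0 and the three assignments change only entries
  of index 0, which belong to no arm.\<close>

definition update :: cmd where
  "update = Seq (Seq (Asg 20 (reg 26) (Minus (arr 23 (reg 26)) c1)) (Asg 22 (reg 26) (Plus (arr 22 (reg 26)) c1)))
     (Asg 21 (reg 26) (reg 28))"

definition play_step :: prog where
  "play_step = Then (compile select) (Then (Pull (adr 28 c0) (reg 26)) (compile update))"

definition algorithm :: prog where
  "algorithm = Then (compile offline) (Then (forp 5 eA draw) (forp 29 eB play_step))"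

lemma size_positive: "esz (positive a) = esz a + 4" "cmax (positive a) < 256 \<longleftrightarrow> cmax a < 256"
  by (auto simp: positive_def)

context inst
begin

definition triple :: "prog \<Rightarrow> (store \<Rightarrow> nat env \<Rightarrow> real \<Rightarrow> bool) \<Rightarrow> (store \<Rightarrow> nat env \<Rightarrow> real \<Rightarrow> bool) \<Rightarrow> bool" where
  "triple c Pre Post \<longleftrightarrow> ptr c (poly (time c) z) Pre Post"

lemma triple_conseq:
  assumes "triple c Pre Post" "\<And>A e v. bd bits A \<Longrightarrow> Pre' A e v \<Longrightarrow> Pre A e v" "\<And>A e v. Post A e v \<Longrightarrow> Post' A e v"
  shows "triple c Pre' Post'"
  using assms unfolding triple_def by (elim ptr_conseq) auto

lemma triple_then: "triple c Pre Mid \<Longrightarrow> triple d Mid Post \<Longrightarrow> triple (Then c d) Pre Post"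
  unfolding triple_def using ptr_then[of c "poly (time c) z" Pre Mid d "poly (time d) z" Post] by simp

lemma triple_ex: "(\<And>x. triple c (Pre x) Post) \<Longrightarrow> triple c (\<lambda>A e v. \<exists>x. Pre x A e v) Post"
  unfolding triple_def ptr_def by blast

lemma triple_det: "(\<And>e v. hoare c (\<lambda>A. Pre A e v) (\<lambda>A. Post A e v)) \<Longrightarrow> triple (compile c) Pre Post"
  unfolding triple_def hoare_def by (intro ptr_det) blast

lemma triple_for:
  assumes k: "k < 32" "wfe (Minus be (reg k))" "m < 2 ^ bits" "m \<le> MM"
    and m: "\<And>A. val be (mem J A) = m"
    and body: "\<And>j. j < m \<Longrightarrow> triple c (\<lambda>A e v. A k 0 = j \<and> Inv j A e v) (\<lambda>A e v. A k 0 = j \<and> Inv (Suc j) (put A k 0 (Suc j)) e v)"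
  shows "triple (forp k be c) (\<lambda>A e v. Inv 0 (put A k 0 0) e v) (Inv m)"
  unfolding triple_def
proof (rule ptr_conseq)
  show "ptr (forp k be c) (m * (poly (time c) z + 3 * tick) + 3 * tick) (\<lambda>A e v. Inv 0 (put A k 0 0) e v) (Inv m)"
    using body by (intro ptr_forp k m) (simp add: triple_def)
  show "m * (poly (time c) z + 3 * tick) + 3 * tick \<le> poly (time (forp k be c)) z"
    by (rule time_for[OF k(4)])
qed

lemma triple_random:
  fixes W :: "prog \<times> memory \<times> nat env \<times> nat \<Rightarrow> real"
  assumes c: "c \<noteq> Halt" "time c = tick_poly"
    and H: "\<And>A e v. bd bits A \<Longrightarrow> Pre A e v \<Longrightarrow> \<exists>W. finite (set_pmf (step I c (mem J A) e)) \<and>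
      v \<le> measure_pmf.expectation (step I c (mem J A) e) W \<and>
      (\<forall>(c', m', e', t) \<in> set_pmf (step I c (mem J A) e). c' = Halt \<and> t \<le> tick \<and>
         (\<exists>A'. m' = mem J A' \<and> bd bits A' \<and> Post A' e' (W (c', m', e', t))))"
  shows "triple c Pre Post"
  unfolding triple_def ptr_def
proof (intro allI impI)
  fix A e v and P :: "memory \<Rightarrow> nat env \<Rightarrow> nat \<Rightarrow> real \<Rightarrow> bool" and T' :: nat
  assume A: "bd bits A" "Pre A e v"
    and P: "\<forall>A' e' v' T''. T'' \<ge> T' \<longrightarrow> bd bits A' \<longrightarrow> Post A' e' v' \<longrightarrow> P (mem J A') e' T'' v'"
  obtain W where W: "finite (set_pmf (step I c (mem J A) e))" "v \<le> measure_pmf.expectation (step I c (mem J A) e) W"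
    "\<forall>(c', m', e', t) \<in> set_pmf (step I c (mem J A) e). c' = Halt \<and> t \<le> tick \<and>
         (\<exists>A'. m' = mem J A' \<and> bd bits A' \<and> Post A' e' (W (c', m', e', t)))"
    using H[OF A] by blast
  show "prov I P c (mem J A) e (poly (time c) z + T') v"
  proof (rule prov_step[where w = W])
    fix c' m' e' t assume s: "(c', m', e', t) \<in> set_pmf (step I c (mem J A) e)"
    have "c' = Halt" and t: "t \<le> tick" and "\<exists>A'. m' = mem J A' \<and> bd bits A' \<and> Post A' e' (W (c', m', e', t))"
      using bspec[OF W(3) s, unfolded prod.case] by - (elim conjE, assumption)+
    then obtain A' where "m' = mem J A'" "bd bits A'" "Post A' e' (W (c', m', e', t))" by blast
    moreover have "T' \<le> poly (time c) z + T' - t" using t c by simp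
    ultimately have "P m' e' (poly (time c) z + T' - t) (W (c', m', e', t))" using P by blast
    then show "t \<le> poly (time c) z + T' \<and> prov I P c' m' e' (poly (time c) z + T' - t) (W (c', m', e', t))"
      using t c \<open>c' = Halt\<close> by (auto intro: prov_halt)
  qed (use W c in auto)
qed

lemma triple_pull:
  assumes k: "k < 32" "wfe (adr k a)" "wfe be"
    and H: "\<And>A e v. bd bits A \<Longrightarrow> Pre A e v \<Longrightarrow> \<exists>w. finite (set_pmf (pull I (val be (mem J A)) e)) \<and>
      v \<le> measure_pmf.expectation (pull I (val be (mem J A)) e) w \<and>
      (\<forall>(x, e') \<in> set_pmf (pull I (val be (mem J A)) e). obs_code x < 2 ^ bits \<and>
         Post (put A k (val a (mem J A)) (obs_code x)) e' (w (x, e')))"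
  shows "triple (Pull (adr k a) be) Pre Post"
proof (rule triple_random)
  fix A e v assume A: "bd bits A" "Pre A e v"
  let ?p = "pull I (val be (mem J A)) e" and ?ad = "val (adr k a) (mem J A)"
  let ?f = "\<lambda>(x, e'). (Halt, (mem J A)(?ad := obs_code x), e', 1 + cost (adr k a) (mem J A) + cost be (mem J A) + bit_len (obs_code x))"
  obtain w where w: "finite (set_pmf ?p)" "v \<le> measure_pmf.expectation ?p w"
    "\<forall>(x, e') \<in> set_pmf ?p. obs_code x < 2 ^ bits \<and> Post (put A k (val a (mem J A)) (obs_code x)) e' (w (x, e'))"
    using H[OF A] by blast
  \<comment> \<open>A claim has to be a function of the resulting configuration, which does not
    contain the observation itself; it is recovered from the cell just written.\<close>
  let ?W = "\<lambda>(c', m', e', t). w (obs_decode (m' ?ad), e')"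
  have st: "step I (Pull (adr k a) be) (mem J A) e = map_pmf ?f ?p" by simp
  have "v \<le> measure_pmf.expectation (step I (Pull (adr k a) be) (mem J A) e) ?W"
    unfolding st using w(2) by (simp add: case_prod_unfold)
  moreover have "finite (set_pmf (step I (Pull (adr k a) be) (mem J A) e))" unfolding st using w(1) by simp
  moreover have "\<forall>(c', m', e', t) \<in> set_pmf (step I (Pull (adr k a) be) (mem J A) e). c' = Halt \<and> t \<le> tick \<and>
         (\<exists>A'. m' = mem J A' \<and> bd bits A' \<and> Post A' e' (?W (c', m', e', t)))"
    unfolding st set_map_pmf
  proof (intro ballI, elim imageE)
    fix y xe assume "xe \<in> set_pmf ?p" "y = ?f xe"
    then obtain x e' where x: "(x, e') \<in> set_pmf ?p" and y: "y = ?f (x, e')" by (cases xe) auto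
    let ?A' = "put A k (val a (mem J A)) (obs_code x)"
    have o: "obs_code x < 2 ^ bits" and post: "Post ?A' e' (w (x, e'))" using w(3) x by auto
    have "bit_len (obs_code x) \<le> bits" using bit_len_le[OF o] b by simp
    then have "1 + cost (adr k a) (mem J A) + cost be (mem J A) + bit_len (obs_code x) \<le> tick"
      using cost_wfe[OF k(2) A(1)] cost_wfe[OF k(3) A(1)] b by linarith
    moreover have "(mem J A)(?ad := obs_code x) = mem J ?A'" using k(1) by (simp add: val_adr mem_put)
    moreover have "bd bits ?A'" using A(1) o by (rule bd_put)
    ultimately show "case y of (c', m', e', t) \<Rightarrow> c' = Halt \<and> t \<le> tick \<and>
         (\<exists>A'. m' = mem J A' \<and> bd bits A' \<and> Post A' e' (?W (c', m', e', t)))"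
      unfolding y using post by (auto simp del: fun_upd_apply) (metis fun_upd_same obs_decode)
  qed
  ultimately show "\<exists>W. finite (set_pmf (step I (Pull (adr k a) be) (mem J A) e)) \<and>
      v \<le> measure_pmf.expectation (step I (Pull (adr k a) be) (mem J A) e) W \<and>
      (\<forall>(c', m', e', t) \<in> set_pmf (step I (Pull (adr k a) be) (mem J A) e). c' = Halt \<and> t \<le> tick \<and>
         (\<exists>A'. m' = mem J A' \<and> bd bits A' \<and> Post A' e' (W (c', m', e', t))))" by blast
qed simp_all

lemma triple_rand:
  assumes k: "k < 32" "wfe (adr k a)" "wfe be"
    and H: "\<And>A e v. bd bits A \<Longrightarrow> Pre A e v \<Longrightarrow> 0 < val be (mem J A) \<and> val be (mem J A) < 2 ^ bits \<and>
      (\<exists>w. v \<le> measure_pmf.expectation (pmf_of_set {..<val be (mem J A)}) w \<and>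
      (\<forall>x < val be (mem J A). Post (put A k (val a (mem J A)) x) e (w x)))"
  shows "triple (Rand (adr k a) be) Pre Post"
proof (rule triple_random)
  fix A e v assume A: "bd bits A" "Pre A e v"
  let ?n = "val be (mem J A)" and ?ad = "val (adr k a) (mem J A)"
  let ?p = "pmf_of_set {..<?n}"
  let ?f = "\<lambda>x. (Halt, (mem J A)(?ad := x), e, 1 + cost (adr k a) (mem J A) + cost be (mem J A))"
  have n: "0 < ?n" "?n < 2 ^ bits" using H[OF A] by auto
  have sp: "set_pmf ?p = {..<?n}" using n by (intro set_pmf_of_set) auto
  obtain w where w: "v \<le> measure_pmf.expectation ?p w"
    "\<forall>x < ?n. Post (put A k (val a (mem J A)) x) e (w x)"
    using H[OF A] by blast
  let ?W = "\<lambda>(c', m', e', t). w (m' ?ad)"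
  have st: "step I (Rand (adr k a) be) (mem J A) e = map_pmf ?f ?p" using n by (simp add: uniform_below_def)
  have "v \<le> measure_pmf.expectation (step I (Rand (adr k a) be) (mem J A) e) ?W"
    unfolding st using w(1) by simp
  moreover have "finite (set_pmf (step I (Rand (adr k a) be) (mem J A) e))" unfolding st using sp by simp
  moreover have "\<forall>(c', m', e', t) \<in> set_pmf (step I (Rand (adr k a) be) (mem J A) e). c' = Halt \<and> t \<le> tick \<and>
         (\<exists>A'. m' = mem J A' \<and> bd bits A' \<and> Post A' e' (?W (c', m', e', t)))"
    unfolding st set_map_pmf sp
  proof (intro ballI, elim imageE)
    fix y x assume x: "x \<in> {..<?n}" and y: "y = ?f x"
    let ?A' = "put A k (val a (mem J A)) x"
    have post: "Post ?A' e (w x)" and "x < 2 ^ bits" using w(2) x n by auto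
    have "1 + cost (adr k a) (mem J A) + cost be (mem J A) \<le> tick"
      using cost_wfe[OF k(2) A(1)] cost_wfe[OF k(3) A(1)] b by linarith
    moreover have "(mem J A)(?ad := x) = mem J ?A'" using k(1) by (simp add: val_adr mem_put)
    moreover have "bd bits ?A'" using A(1) \<open>x < 2 ^ bits\<close> by (rule bd_put)
    ultimately show "case y of (c', m', e', t) \<Rightarrow> c' = Halt \<and> t \<le> tick \<and>
         (\<exists>A'. m' = mem J A' \<and> bd bits A' \<and> Post A' e' (?W (c', m', e', t)))"
      unfolding y using post by (auto simp del: fun_upd_apply) (metis fun_upd_same)
  qed
  ultimately show "\<exists>W. finite (set_pmf (step I (Rand (adr k a) be) (mem J A) e)) \<and>
      v \<le> measure_pmf.expectation (step I (Rand (adr k a) be) (mem J A) e) W \<and>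
      (\<forall>(c', m', e', t) \<in> set_pmf (step I (Rand (adr k a) be) (mem J A) e). c' = Halt \<and> t \<le> tick \<and>
         (\<exists>A'. m' = mem J A' \<and> bd bits A' \<and> Post A' e' (W (c', m', e', t))))" by blast
qed simp_all

section \<open>The online phase\<close>

text \<open>The play counts include index 0, because that entry is incremented whenever no arm is
  selected and has to respect the bit bound too.\<close>

definition rel :: "(nat \<Rightarrow> nat) \<Rightarrow> nat ctrl \<Rightarrow> nat \<Rightarrow> store \<Rightarrow> bool" where
  "rel c st j A \<longleftrightarrow> tables KK A \<and>
     (\<forall>i. 1 \<le> i \<longrightarrow> i \<le> arms J \<longrightarrow> A 19 i = c i \<and> A 20 i = fst st i \<and> A 21 i = obs_code (snd (snd st) i) \<and>
        fst st i \<le> horizon J \<and> snd (snd st) i \<in> insert None (Some ` all_nodes J)) \<and>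
     (\<forall>i \<le> arms J. A 22 i = fst (snd st) i \<and> fst (snd st) i \<le> j)"

lemma rel_put: "k \<notin> {14, 19, 20, 21, 22} \<Longrightarrow> rel c st j (put A k i v) = rel c st j A"
  by (simp add: rel_def)

text \<open>One array access is right in all cases: the code 0 of an exhausted arm addresses column
  0, and the number of an idle arm addresses a block beyond the filled ones. Both contain
  zeros.\<close>

lemma rel_lookup:
  assumes "rel c st j A" "1 \<le> i" "i \<le> arms J"
  shows "A 14 (ix J (A 19 i) (A 20 i) (A 21 i)) = nxt (tabs c) st i"
proof -
  from assms have t: "tables KK A" and a: "A 19 i = c i" "A 20 i = fst st i" "A 21 i = obs_code (snd (snd st) i)"
    "fst st i \<le> horizon J" "snd (snd st) i \<in> insert None (Some ` all_nodes J)" unfolding rel_def by auto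
  show ?thesis
  proof (cases "snd (snd st) i")
    case None
    have "A 14 (ix J (c i) (fst st i) 0) = 0"
      by (rule tables_zero[OF t]) (use a in \<open>auto simp: ix_eq_iff\<close>)
    then show ?thesis using None a by (simp add: obs_code_def nxt_def)
  next
    case (Some u)
    then have u: "u < N" using a(5) nodes_lt by auto
    show ?thesis
    proof (cases "c i < KK")
      case True
      then have "A 14 (ix J (c i) (fst st i) (Suc u)) = XN (LN (c i)) (fst st i) u"
        using t u a(4) unfolding tables_def by blast
      then show ?thesis using Some a True u by (simp add: obs_code_def nxt_def tabs_def XN_table)
    next
      case False
      have "A 14 (ix J (c i) (fst st i) (Suc u)) = 0"
        by (rule tables_zero[OF t]) (use a False u in \<open>auto simp: ix_eq_iff\<close>)
      then show ?thesis using Some a False by (simp add: obs_code_def nxt_def tabs_def nx_False)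
    qed
  qed
qed

lemma nxt_le: "rel c st j A \<Longrightarrow> 1 \<le> i \<Longrightarrow> i \<le> arms J \<Longrightarrow> nxt (tabs c) st i \<le> horizon J"
proof -
  assume "rel c st j A" "1 \<le> i" "i \<le> arms J"
  then have "fst st i \<le> horizon J" unfolding rel_def by auto
  moreover have "nxt (tabs c) st i \<le> fst st i" by (auto simp: nxt_def nx_le split: option.splits)
  ultimately show ?thesis by simp
qed

lemma score_le: "rel c st j A \<Longrightarrow> 1 \<le> i \<Longrightarrow> i \<le> arms J \<Longrightarrow> score (tabs c) st i \<le> horizon J + j"
proof -
  assume r: "rel c st j A" "1 \<le> i" "i \<le> arms J"
  then have "fst (snd st) i \<le> j" unfolding rel_def by auto
  then show ?thesis using nxt_le[OF r] by (simp add: score_def)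
qed

lemma online_bits: "k \<le> 2 * horizon J + 2 \<Longrightarrow> k < 2 ^ bits" "k \<le> arms J \<Longrightarrow> k < 2 ^ bits" "u < N \<Longrightarrow> Suc u < 2 ^ bits"
  using small by (auto intro!: small_bits)

lemma obs_bits: "x \<in> insert None (Some ` all_nodes J) \<Longrightarrow> obs_code x < 2 ^ bits"
  using online_bits nodes_lt by (auto simp: obs_code_def)

definition chosen :: "(nat \<Rightarrow> nat) \<Rightarrow> nat ctrl \<Rightarrow> nat \<Rightarrow> store \<Rightarrow> bool" where
  "chosen c st j A \<longleftrightarrow> rel c st j A \<and> A 26 0 = sel (tabs c) st \<and> (\<forall>i. 1 \<le> i \<longrightarrow> i \<le> arms J \<longrightarrow> A 23 i = nxt (tabs c) st i)"

text \<open>The five assignments of the loop body form one step of the recursion of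
  \<open>pick\<close>, with the conditional replaced by a 0-1 factor in register 25.\<close>

lemma select_hoare:
  assumes j: "j \<le> horizon J"
  shows "hoare select (\<lambda>A. rel c st j A \<and> A 29 0 = t) (\<lambda>A. chosen c st j A \<and> A 29 0 = t)"
proof -
  let ?sc = "score (tabs c) st" and ?x = "nxt (tabs c) st"
  let ?M = "\<lambda>i A. rel c st j A \<and> A 29 0 = t \<and> (\<forall>l. 1 \<le> l \<longrightarrow> l \<le> i \<longrightarrow> A 23 l = ?x l)"
  let ?Inv = "\<lambda>i A. ?M i A \<and> A 26 0 = snd (pick ?sc i) \<and> A 27 0 = fst (pick ?sc i)"
  have body: "hoare (Seq (Seq (Seq (Seq
     (Asg 23 ei (arr 14 (idx (arr 19 ei) (arr 20 ei) (arr 21 ei))))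
     (Asg 24 c0 (Times (positive (arr 23 ei)) (Plus (arr 23 ei) (arr 22 ei)))))
     (Asg 25 c0 (positive (Minus (reg 24) (reg 27)))))
     (Asg 26 c0 (Plus (Times (reg 25) ei) (Times (Minus c1 (reg 25)) (reg 26)))))
     (Asg 27 c0 (Plus (reg 27) (Minus (reg 24) (reg 27)))))
     (\<lambda>A. A 5 0 = i \<and> ?Inv i A) (\<lambda>A. ?Inv (Suc i) (put A 5 0 (Suc i)))" if i: "i < arms J" for i
  proof -
    let ?f = "if fst (pick ?sc i) < ?sc (Suc i) then 1 else 0 :: nat"
    have si: "1 \<le> Suc i" "Suc i \<le> arms J" using i by auto
    have pb: "fst (pick ?sc i) \<le> horizon J + j \<and> snd (pick ?sc i) \<le> i" if "rel c st j A" for A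
      using score_le[OF that] i by (intro pick_bound) auto
    have h1: "hoare (Asg 23 ei (arr 14 (idx (arr 19 ei) (arr 20 ei) (arr 21 ei))))
      (\<lambda>A. A 5 0 = i \<and> ?Inv i A) (\<lambda>A. A 5 0 = i \<and> ?M (Suc i) A \<and> A 26 0 = snd (pick ?sc i) \<and> A 27 0 = fst (pick ?sc i))"
    proof (rule hoare_asg)
      fix A assume A: "A 5 0 = i \<and> ?Inv i A"
      then have r: "rel c st j A" by simp
      have v: "val (arr 14 (idx (arr 19 ei) (arr 20 ei) (arr 21 ei))) (mem J A) = ?x (Suc i)"
        using rel_lookup[OF r si] A by simp
      show "val (arr 14 (idx (arr 19 ei) (arr 20 ei) (arr 21 ei))) (mem J A) < 2 ^ bits \<and>
        (\<lambda>A. A 5 0 = i \<and> ?M (Suc i) A \<and> A 26 0 = snd (pick ?sc i) \<and> A 27 0 = fst (pick ?sc i))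
        (put A 23 (val ei (mem J A)) (val (arr 14 (idx (arr 19 ei) (arr 20 ei) (arr 21 ei))) (mem J A)))"
        unfolding v using A nxt_le[OF r si] online_bits by (auto simp: rel_put le_Suc_eq)
    qed (auto simp: wfp_simps)
    have h2: "hoare (Asg 24 c0 (Times (positive (arr 23 ei)) (Plus (arr 23 ei) (arr 22 ei))))
      (\<lambda>A. A 5 0 = i \<and> ?M (Suc i) A \<and> A 26 0 = snd (pick ?sc i) \<and> A 27 0 = fst (pick ?sc i))
      (\<lambda>A. A 5 0 = i \<and> ?M (Suc i) A \<and> A 26 0 = snd (pick ?sc i) \<and> A 27 0 = fst (pick ?sc i) \<and> A 24 0 = ?sc (Suc i))"
    proof (rule hoare_asg)
      fix A assume A: "A 5 0 = i \<and> ?M (Suc i) A \<and> A 26 0 = snd (pick ?sc i) \<and> A 27 0 = fst (pick ?sc i)"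
      then have r: "rel c st j A" by simp
      have "A 23 (Suc i) = ?x (Suc i)" "A 22 (Suc i) = fst (snd st) (Suc i)" using A si unfolding rel_def by auto
      then have v: "val (Times (positive (arr 23 ei)) (Plus (arr 23 ei) (arr 22 ei))) (mem J A) = ?sc (Suc i)"
        using A by (simp add: val_positive score_def)
      have "?sc (Suc i) \<le> 2 * horizon J + 2" using score_le[OF r si] j by simp
      then show "val (Times (positive (arr 23 ei)) (Plus (arr 23 ei) (arr 22 ei))) (mem J A) < 2 ^ bits \<and>
        (\<lambda>A. A 5 0 = i \<and> ?M (Suc i) A \<and> A 26 0 = snd (pick ?sc i) \<and> A 27 0 = fst (pick ?sc i) \<and> A 24 0 = ?sc (Suc i))
        (put A 24 (val c0 (mem J A)) (val (Times (positive (arr 23 ei)) (Plus (arr 23 ei) (arr 22 ei))) (mem J A)))"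
        unfolding v using A online_bits(1) by (auto simp: rel_put)
    qed (auto simp: wfp_simps size_positive)
    have h3: "hoare (Asg 25 c0 (positive (Minus (reg 24) (reg 27))))
      (\<lambda>A. A 5 0 = i \<and> ?M (Suc i) A \<and> A 26 0 = snd (pick ?sc i) \<and> A 27 0 = fst (pick ?sc i) \<and> A 24 0 = ?sc (Suc i))
      (\<lambda>A. A 5 0 = i \<and> ?M (Suc i) A \<and> A 26 0 = snd (pick ?sc i) \<and> A 27 0 = fst (pick ?sc i) \<and> A 24 0 = ?sc (Suc i) \<and> A 25 0 = ?f)"
    proof (rule hoare_asg)
      fix A assume A: "A 5 0 = i \<and> ?M (Suc i) A \<and> A 26 0 = snd (pick ?sc i) \<and> A 27 0 = fst (pick ?sc i) \<and> A 24 0 = ?sc (Suc i)"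
      have v: "val (positive (Minus (reg 24) (reg 27))) (mem J A) = ?f" using A by (simp add: val_positive)
      have "?f \<le> 2 * horizon J + 2" by simp
      then show "val (positive (Minus (reg 24) (reg 27))) (mem J A) < 2 ^ bits \<and>
        (\<lambda>A. A 5 0 = i \<and> ?M (Suc i) A \<and> A 26 0 = snd (pick ?sc i) \<and> A 27 0 = fst (pick ?sc i) \<and> A 24 0 = ?sc (Suc i) \<and> A 25 0 = ?f)
        (put A 25 (val c0 (mem J A)) (val (positive (Minus (reg 24) (reg 27))) (mem J A)))"
        unfolding v using A online_bits(1)[of ?f] by (simp add: rel_put)
    qed (auto simp: wfp_simps size_positive)
    have h4: "hoare (Asg 26 c0 (Plus (Times (reg 25) ei) (Times (Minus c1 (reg 25)) (reg 26))))
      (\<lambda>A. A 5 0 = i \<and> ?M (Suc i) A \<and> A 26 0 = snd (pick ?sc i) \<and> A 27 0 = fst (pick ?sc i) \<and> A 24 0 = ?sc (Suc i) \<and> A 25 0 = ?f)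
      (\<lambda>A. ?M (Suc i) A \<and> A 26 0 = snd (pick ?sc (Suc i)) \<and> A 27 0 = fst (pick ?sc i) \<and> A 24 0 = ?sc (Suc i))"
    proof (rule hoare_asg)
      fix A assume A: "A 5 0 = i \<and> ?M (Suc i) A \<and> A 26 0 = snd (pick ?sc i) \<and> A 27 0 = fst (pick ?sc i) \<and> A 24 0 = ?sc (Suc i) \<and> A 25 0 = ?f"
      have v: "val (Plus (Times (reg 25) ei) (Times (Minus c1 (reg 25)) (reg 26))) (mem J A) = snd (pick ?sc (Suc i))"
        using A by simp
      have "snd (pick ?sc (Suc i)) \<le> arms J" using pb[of A] A i by auto
      then show "val (Plus (Times (reg 25) ei) (Times (Minus c1 (reg 25)) (reg 26))) (mem J A) < 2 ^ bits \<and>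
        (\<lambda>A. ?M (Suc i) A \<and> A 26 0 = snd (pick ?sc (Suc i)) \<and> A 27 0 = fst (pick ?sc i) \<and> A 24 0 = ?sc (Suc i))
        (put A 26 (val c0 (mem J A)) (val (Plus (Times (reg 25) ei) (Times (Minus c1 (reg 25)) (reg 26))) (mem J A)))"
        unfolding v using A online_bits(2) by (simp add: rel_put del: pick.simps)
    qed (auto simp: wfp_simps)
    have h5: "hoare (Asg 27 c0 (Plus (reg 27) (Minus (reg 24) (reg 27))))
      (\<lambda>A. ?M (Suc i) A \<and> A 26 0 = snd (pick ?sc (Suc i)) \<and> A 27 0 = fst (pick ?sc i) \<and> A 24 0 = ?sc (Suc i))
      (\<lambda>A. ?Inv (Suc i) (put A 5 0 (Suc i)))"
    proof (rule hoare_asg)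
      fix A assume A: "?M (Suc i) A \<and> A 26 0 = snd (pick ?sc (Suc i)) \<and> A 27 0 = fst (pick ?sc i) \<and> A 24 0 = ?sc (Suc i)"
      then have r: "rel c st j A" by simp
      have v: "val (Plus (reg 27) (Minus (reg 24) (reg 27))) (mem J A) = fst (pick ?sc (Suc i))"
        using A by simp
      have "fst (pick ?sc (Suc i)) \<le> 2 * horizon J + 2" using pb[OF r] score_le[OF r si] j by auto
      then show "val (Plus (reg 27) (Minus (reg 24) (reg 27))) (mem J A) < 2 ^ bits \<and>
        (\<lambda>A. ?Inv (Suc i) (put A 5 0 (Suc i)))
        (put A 27 (val c0 (mem J A)) (val (Plus (reg 27) (Minus (reg 24) (reg 27))) (mem J A)))"
        unfolding v using A online_bits(1) by (simp add: rel_put del: pick.simps)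
    qed (auto simp: wfp_simps)
    show ?thesis by (rule hoare_seq[OF hoare_seq[OF hoare_seq[OF hoare_seq[OF h1 h2] h3] h4] h5])
  qed
  have init: "hoare (Seq (Asg 27 c0 c0) (Asg 26 c0 c0)) (\<lambda>A. rel c st j A \<and> A 29 0 = t) (\<lambda>A. ?Inv 0 (put A 5 0 0))"
    by (rule hoare_seq[of _ _ "\<lambda>A. rel c st j A \<and> A 29 0 = t \<and> A 27 0 = 0"]; rule hoare_asg)
      (auto simp: wfp_simps rel_put)
  have loop: "hoare (For 5 eA (Seq (Seq (Seq (Seq
     (Asg 23 ei (arr 14 (idx (arr 19 ei) (arr 20 ei) (arr 21 ei))))
     (Asg 24 c0 (Times (positive (arr 23 ei)) (Plus (arr 23 ei) (arr 22 ei)))))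
     (Asg 25 c0 (positive (Minus (reg 24) (reg 27)))))
     (Asg 26 c0 (Plus (Times (reg 25) ei) (Times (Minus c1 (reg 25)) (reg 26)))))
     (Asg 27 c0 (Plus (reg 27) (Minus (reg 24) (reg 27)))))) (\<lambda>A. ?Inv 0 (put A 5 0 0)) (?Inv (arms J))"
    by (rule hoare_for[where Inv = ?Inv]) (use body loops bound_misc in \<open>auto simp: wfp_simps\<close>)
  show ?thesis
    unfolding select_def
    by (rule hoare_conseq[OF hoare_seq[OF init loop]]) (auto simp: chosen_def sel_def)
qed

lemma update_hoare:
  assumes j: "j < horizon J" and x: "x \<in> insert None (Some ` all_nodes J)"
  shows "hoare update (\<lambda>A. chosen c st j A \<and> A 29 0 = t \<and> A 28 0 = obs_code x)
    (\<lambda>A. rel c (upd (tabs c) st (sel (tabs c) st) x) (Suc j) A \<and> A 29 0 = t)"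
proof -
  let ?a = "sel (tabs c) st" and ?x = "nxt (tabs c) st"
  let ?P = "\<lambda>A. tables KK A \<and> A 26 0 = ?a \<and> A 28 0 = obs_code x \<and> A 29 0 = t \<and> (\<forall>i. 1 \<le> i \<longrightarrow> i \<le> arms J \<longrightarrow> A 23 i = nxt (tabs c) st i)"
  let ?Q = "\<lambda>M D X A. ?P A \<and> (\<forall>i. 1 \<le> i \<longrightarrow> i \<le> arms J \<longrightarrow> A 19 i = c i \<and> A 20 i = M i \<and> A 21 i = X i) \<and> (\<forall>i\<le>arms J. A 22 i = D i)"
  let ?M = "(fst st)(?a := ?x ?a - 1)" and ?D = "(fst (snd st))(?a := fst (snd st) ?a + 1)"
  let ?X = "\<lambda>i. obs_code (snd (snd st) i)" and ?X' = "\<lambda>i. obs_code (((snd (snd st))(?a := x)) i)"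
  have a: "?a \<le> arms J" using pick_arm[of "score (tabs c) st" "arms J"] unfolding sel_def by fastforce
  let ?R = "(\<forall>i. 1 \<le> i \<longrightarrow> i \<le> arms J \<longrightarrow> fst st i \<le> horizon J \<and> snd (snd st) i \<in> insert None (Some ` all_nodes J)) \<and> (\<forall>i\<le>arms J. fst (snd st) i \<le> j)"
  have h1: "hoare (Asg 20 (reg 26) (Minus (arr 23 (reg 26)) c1)) (\<lambda>A. ?R \<and> ?Q (fst st) (fst (snd st)) ?X A) (\<lambda>A. ?R \<and> ?Q ?M (fst (snd st)) ?X A)"
  proof (rule hoare_asg)
    fix A assume A: "bd bits A" "?R \<and> ?Q (fst st) (fst (snd st)) ?X A"
    have "A 23 ?a - 1 < 2 ^ bits" using A(1) unfolding bd_def by (meson diff_le_self order_le_less_trans)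
    then show "val (Minus (arr 23 (reg 26)) c1) (mem J A) < 2 ^ bits \<and> (\<lambda>A. ?R \<and> ?Q ?M (fst (snd st)) ?X A)
      (put A 20 (val (reg 26) (mem J A)) (val (Minus (arr 23 (reg 26)) c1) (mem J A)))"
      using A(2) a by auto
  qed (auto simp: wfp_simps)
  have h2: "hoare (Asg 22 (reg 26) (Plus (arr 22 (reg 26)) c1)) (\<lambda>A. ?R \<and> ?Q ?M (fst (snd st)) ?X A) (\<lambda>A. ?R \<and> ?Q ?M ?D ?X A)"
  proof (rule hoare_asg)
    fix A assume A: "bd bits A" "?R \<and> ?Q ?M (fst (snd st)) ?X A"
    have "fst (snd st) ?a + 1 < 2 ^ bits" using A(2) a j by (intro online_bits(1)) fastforce
    then show "val (Plus (arr 22 (reg 26)) c1) (mem J A) < 2 ^ bits \<and> (\<lambda>A. ?R \<and> ?Q ?M ?D ?X A)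
      (put A 22 (val (reg 26) (mem J A)) (val (Plus (arr 22 (reg 26)) c1) (mem J A)))"
      using A(2) a by auto
  qed (auto simp: wfp_simps)
  have h3: "hoare (Asg 21 (reg 26) (reg 28)) (\<lambda>A. ?R \<and> ?Q ?M ?D ?X A) (\<lambda>A. ?R \<and> ?Q ?M ?D ?X' A)"
    by (rule hoare_asg) (use obs_bits[OF x] in \<open>auto simp: wfp_simps\<close>)
  have "hoare update (\<lambda>A. ?R \<and> ?Q (fst st) (fst (snd st)) ?X A) (\<lambda>A. ?R \<and> ?Q ?M ?D ?X' A)"
    unfolding update_def by (rule hoare_seq[OF hoare_seq[OF h1 h2] h3])
  then show ?thesis
  proof (rule hoare_conseq)
    fix A assume "chosen c st j A \<and> A 29 0 = t \<and> A 28 0 = obs_code x"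
    then show "?R \<and> ?Q (fst st) (fst (snd st)) ?X A" unfolding chosen_def rel_def by auto
  next
    fix A assume A: "?R \<and> ?Q ?M ?D ?X' A"
    have "?M i \<le> horizon J" if "1 \<le> i" "i \<le> arms J" for i
    proof -
      have "nxt (tabs c) st i \<le> fst st i" by (auto simp: nxt_def nx_le split: option.splits)
      then show ?thesis using A that by (auto intro: order_trans[of _ "fst st i"])
    qed
    then show "rel c (upd (tabs c) st ?a x) (Suc j) A \<and> A 29 0 = t"
      using A x unfolding rel_def upd_def by (auto simp: le_SucI)
  qed
qed

text \<open>\<open>j\<close> arms have drawn their numbers and \<open>i\<close> arms are
  initialized; the claim is bounded by the expectation over the coins still to come. There are two
  counters because drawing and initializing are separate commands.\<close>

definition drawn :: "nat \<Rightarrow> nat \<Rightarrow> store \<Rightarrow> nat env \<Rightarrow> real \<Rightarrow> bool" where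
  "drawn i j A e v \<longleftrightarrow> tables KK A \<and> A 22 = (\<lambda>_. 0) \<and> e = init_env I \<and>
     (\<forall>l. 1 \<le> l \<longrightarrow> l \<le> i \<longrightarrow> A 20 l = horizon J \<and> A 21 l = Suc (root_node J l)) \<and>
     v \<le> measure_pmf.expectation (Pi_pmf {Suc j..arms J} 0 (\<lambda>_. coin))
       (\<lambda>f. run (horizon J) (tabs (\<lambda>l. if l \<le> j then A 19 l else f l)) ctrl0 e)"

lemma drawn_put: "k \<notin> {14, 19, 20, 21, 22} \<Longrightarrow> drawn i j (put A k l x) e v = drawn i j A e v"
  by (simp add: drawn_def cong: if_cong)

lemma draw_triple:
  assumes j: "j < arms J"
  shows "triple draw (\<lambda>A e v. A 5 0 = j \<and> drawn j j A e v) (\<lambda>A e v. A 5 0 = j \<and> drawn (Suc j) (Suc j) (put A 5 0 (Suc j)) e v)"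
  unfolding draw_def
proof (rule triple_then)
  show "triple (Rand (adr 19 ei) (Times (Const 3) eK)) (\<lambda>A e v. A 5 0 = j \<and> drawn j j A e v) (\<lambda>A e v. A 5 0 = j \<and> drawn j (Suc j) A e v)"
  proof (rule triple_rand)
    fix A e v assume A: "A 5 0 = j \<and> drawn j j A e v"
    have be: "val (Times (Const 3) eK) (mem J A) = 3 * KK" by simp
    let ?F = "\<lambda>f. run (horizon J) (tabs (\<lambda>l. if l \<le> j then A 19 l else f l)) ctrl0 e"
    let ?w = "\<lambda>x. measure_pmf.expectation (Pi_pmf {Suc (Suc j)..arms J} 0 (\<lambda>_. coin))
       (\<lambda>f. run (horizon J) (tabs (\<lambda>l. if l \<le> Suc j then ((A 19)(Suc j := x)) l else f l)) ctrl0 e)"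
    have upd: "?F (f(Suc j := x)) = run (horizon J) (tabs (\<lambda>l. if l \<le> Suc j then ((A 19)(Suc j := x)) l else f l)) ctrl0 e" for f x
    proof -
      have "(\<lambda>l. if l \<le> j then A 19 l else (f(Suc j := x)) l) = (\<lambda>l. if l \<le> Suc j then ((A 19)(Suc j := x)) l else f l)"
        by (auto simp: le_Suc_eq)
      then show ?thesis by simp
    qed
    have "v \<le> measure_pmf.expectation (Pi_pmf {Suc j..arms J} 0 (\<lambda>_. coin)) ?F" using A unfolding drawn_def by blast
    also have "{Suc j..arms J} = insert (Suc j) {Suc (Suc j)..arms J}" using j by auto
    also have "measure_pmf.expectation (Pi_pmf (insert (Suc j) {Suc (Suc j)..arms J}) 0 (\<lambda>_. coin)) ?F = measure_pmf.expectation coin ?w"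
      unfolding upd[symmetric] by (rule expectation_Pi_split) (auto simp: finite_coin)
    finally have v: "v \<le> measure_pmf.expectation (pmf_of_set {..<3 * KK}) ?w" unfolding coin_def[symmetric] .
    have "A 5 0 = j \<and> drawn j (Suc j) (put A 19 (val ei (mem J A)) x) e (?w x)" for x
      using A by (simp add: drawn_def tables_def cong: if_cong)
    then show "0 < val (Times (Const 3) eK) (mem J A) \<and> val (Times (Const 3) eK) (mem J A) < 2 ^ bits \<and>
      (\<exists>w. v \<le> measure_pmf.expectation (pmf_of_set {..<val (Times (Const 3) eK) (mem J A)}) w \<and>
      (\<forall>x < val (Times (Const 3) eK) (mem J A). put A 19 (val ei (mem J A)) x 5 0 = j \<and> drawn j (Suc j) (put A 19 (val ei (mem J A)) x) e (w x)))"
      unfolding be using KK_pos bound_KK v by (intro conjI exI[of _ ?w]) auto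
  qed (use sizes in \<open>auto simp: wfp_simps\<close>)
  show "triple (compile (Seq (Asg 20 ei eB) (Asg 21 ei (Plus (Cell (Plus (Const 3) (reg 5))) c1))))
    (\<lambda>A e v. A 5 0 = j \<and> drawn j (Suc j) A e v) (\<lambda>A e v. A 5 0 = j \<and> drawn (Suc j) (Suc j) (put A 5 0 (Suc j)) e v)"
  proof (rule triple_det)
    fix e v
    have "hoare (Asg 20 ei eB) (\<lambda>A. A 5 0 = j \<and> drawn j (Suc j) A e v) (\<lambda>A. A 5 0 = j \<and> drawn j (Suc j) A e v \<and> A 20 (Suc j) = horizon J)"
      using bound_misc by (intro hoare_asg) (auto simp: wfp_simps drawn_def tables_def cong: if_cong)
    moreover have "hoare (Asg 21 ei (Plus (Cell (Plus (Const 3) (reg 5))) c1))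
      (\<lambda>A. A 5 0 = j \<and> drawn j (Suc j) A e v \<and> A 20 (Suc j) = horizon J) (\<lambda>A. A 5 0 = j \<and> drawn (Suc j) (Suc j) (put A 5 0 (Suc j)) e v)"
    proof (rule hoare_asg)
      fix A assume A: "A 5 0 = j \<and> drawn j (Suc j) A e v \<and> A 20 (Suc j) = horizon J"
      have "3 + j < inp_len J" using j by (simp add: inp_len_def)
      then have "mem J A (3 + j) = root_node J (Suc j)" using enc_root j by (simp add: mem_inp)
      then have v: "val (Plus (Cell (Plus (Const 3) (reg 5))) c1) (mem J A) = Suc (root_node J (Suc j))" using A by simp
      show "val (Plus (Cell (Plus (Const 3) (reg 5))) c1) (mem J A) < 2 ^ bits \<and>
        (\<lambda>A. A 5 0 = j \<and> drawn (Suc j) (Suc j) (put A 5 0 (Suc j)) e v) (put A 21 (val ei (mem J A)) (val (Plus (Cell (Plus (Const 3) (reg 5))) c1) (mem J A)))"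
        unfolding v using A online_bits(3)[OF root_N[OF j]] by (auto simp: drawn_def tables_def le_Suc_eq cong: if_cong)
    qed (auto simp: wfp_simps)
    ultimately show "hoare (Seq (Asg 20 ei eB) (Asg 21 ei (Plus (Cell (Plus (Const 3) (reg 5))) c1)))
      (\<lambda>A. A 5 0 = j \<and> drawn j (Suc j) A e v) (\<lambda>A. A 5 0 = j \<and> drawn (Suc j) (Suc j) (put A 5 0 (Suc j)) e v)"
      by (rule hoare_seq)
  qed
qed

text \<open>The table numbers and the control state are ghost data under an existential quantifier,
  so the loop invariant does not depend on the observations made.\<close>

definition playing :: "nat \<Rightarrow> store \<Rightarrow> nat env \<Rightarrow> real \<Rightarrow> bool" where
  "playing j A e v \<longleftrightarrow> (\<exists>cs. rel (fst cs) (snd cs) j A \<and> (\<forall>i. position e i \<in> insert None (Some ` all_nodes J)) \<and>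
     v \<le> run (horizon J - j) (tabs (fst cs)) (snd cs) e)"

lemma pull_obs:
  assumes "\<forall>j. position e j \<in> insert None (Some ` all_nodes J)" "(x, e') \<in> set_pmf (pull I i e)"
  shows "x \<in> insert None (Some ` all_nodes J)"
proof (cases "elapsed e \<ge> horizon J \<or> position e i = None")
  case True
  then show ?thesis using assms(2) by (auto simp: pull_def split: option.splits if_splits)
next
  case False
  then have "position e' i = x" using assms(2) by (auto simp: pull_def)
  then show ?thesis using pull_support(2)[of e x e' i] assms by (metis all_nodes_I)
qed

lemma play_triple:
  assumes j: "j < horizon J"
  shows "triple play_step (\<lambda>A e v. A 29 0 = j \<and> playing j A e v) (\<lambda>A e v. A 29 0 = j \<and> playing (Suc j) (put A 29 0 (Suc j)) e v)"
proof -
  let ?pos = "\<lambda>e. \<forall>i. position e i \<in> insert None (Some ` all_nodes J)"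
  have main: "triple play_step (\<lambda>A e v. (rel (fst cs) (snd cs) j A \<and> A 29 0 = j) \<and> ?pos e \<and> v \<le> run (horizon J - j) (tabs (fst cs)) (snd cs) e)
     (\<lambda>A e v. A 29 0 = j \<and> playing (Suc j) (put A 29 0 (Suc j)) e v)" for cs
  proof -
    define c st where "c = fst cs" and "st = snd cs"
    let ?a = "sel (tabs c) st"
    have "triple (compile select) (\<lambda>A e v. (rel c st j A \<and> A 29 0 = j) \<and> ?pos e \<and> v \<le> run (horizon J - j) (tabs c) st e)
       (\<lambda>A e v. (chosen c st j A \<and> A 29 0 = j) \<and> ?pos e \<and> v \<le> run (horizon J - j) (tabs c) st e)"
      using select_hoare[of j c st j] j by (intro triple_det) (auto simp: hoare_def)
    moreover have "triple (Pull (adr 28 c0) (reg 26)) (\<lambda>A e v. (chosen c st j A \<and> A 29 0 = j) \<and> ?pos e \<and> v \<le> run (horizon J - j) (tabs c) st e)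
       (\<lambda>A e v. \<exists>x. (chosen c st j A \<and> A 29 0 = j \<and> A 28 0 = obs_code x) \<and> x \<in> insert None (Some ` all_nodes J) \<and> ?pos e \<and>
          v \<le> run (horizon J - Suc j) (tabs c) (upd (tabs c) st ?a x) e)"
    proof (rule triple_pull)
      fix A e v assume A: "(chosen c st j A \<and> A 29 0 = j) \<and> ?pos e \<and> v \<le> run (horizon J - j) (tabs c) st e"
      then have be: "val (reg 26) (mem J A) = ?a" by (simp add: chosen_def)
      have pos: "\<forall>i. position e i \<in> insert None (Some ` all_nodes I)" using A by simp
      \<comment> \<open>The claim after an observation is the value of the continuation; by
        definition of \<open>run\<close> its expectation over the pull is the value before.\<close>
      let ?w = "\<lambda>(x, e'). run (horizon J - Suc j) (tabs c) (upd (tabs c) st ?a x) e'"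
      have "horizon J - j = Suc (horizon J - Suc j)" using j by simp
      then have "v \<le> measure_pmf.expectation (pull I ?a e) ?w" using A by (metis run.simps(2))
      moreover have "\<forall>(x, e') \<in> set_pmf (pull I ?a e). obs_code x < 2 ^ bits \<and> (\<exists>y. (chosen c st j (put A 28 (val c0 (mem J A)) (obs_code x)) \<and>
           put A 28 (val c0 (mem J A)) (obs_code x) 29 0 = j \<and> put A 28 (val c0 (mem J A)) (obs_code x) 28 0 = obs_code y) \<and>
           y \<in> insert None (Some ` all_nodes J) \<and> ?pos e' \<and> ?w (x, e') \<le> run (horizon J - Suc j) (tabs c) (upd (tabs c) st ?a y) e')"
      proof (clarify, rule conjI)
        fix x e' assume x: "(x, e') \<in> set_pmf (pull I ?a e)"
        have xo: "x \<in> insert None (Some ` all_nodes J)" using pull_obs x A by blast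
        then show "obs_code x < 2 ^ bits" by (rule obs_bits)
        have "?pos e'" using pull_support(2)[OF pos x] by simp
        moreover have "chosen c st j (put A 28 (val c0 (mem J A)) (obs_code x))" using A by (simp add: chosen_def rel_put)
        ultimately show "\<exists>y. (chosen c st j (put A 28 (val c0 (mem J A)) (obs_code x)) \<and>
           put A 28 (val c0 (mem J A)) (obs_code x) 29 0 = j \<and> put A 28 (val c0 (mem J A)) (obs_code x) 28 0 = obs_code y) \<and>
           y \<in> insert None (Some ` all_nodes J) \<and> ?pos e' \<and>
           run (horizon J - Suc j) (tabs c) (upd (tabs c) st ?a x) e' \<le> run (horizon J - Suc j) (tabs c) (upd (tabs c) st ?a y) e'"
          using A xo by (intro exI[of _ x]) simp
      qed
      ultimately show "\<exists>w. finite (set_pmf (pull I (val (reg 26) (mem J A)) e)) \<and>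
        v \<le> measure_pmf.expectation (pull I (val (reg 26) (mem J A)) e) w \<and>
        (\<forall>(x, e') \<in> set_pmf (pull I (val (reg 26) (mem J A)) e). obs_code x < 2 ^ bits \<and>
         (\<exists>y. (chosen c st j (put A 28 (val c0 (mem J A)) (obs_code x)) \<and>
           put A 28 (val c0 (mem J A)) (obs_code x) 29 0 = j \<and> put A 28 (val c0 (mem J A)) (obs_code x) 28 0 = obs_code y) \<and>
           y \<in> insert None (Some ` all_nodes J) \<and> ?pos e' \<and> w (x, e') \<le> run (horizon J - Suc j) (tabs c) (upd (tabs c) st ?a y) e'))"
        unfolding be using pull_support(1)[OF pos] by (intro exI[of _ ?w] conjI)
    qed (auto simp: wfp_simps)
    moreover have "triple (compile update) (\<lambda>A e v. \<exists>x. (chosen c st j A \<and> A 29 0 = j \<and> A 28 0 = obs_code x) \<and> x \<in> insert None (Some ` all_nodes J) \<and> ?pos e \<and>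
          v \<le> run (horizon J - Suc j) (tabs c) (upd (tabs c) st ?a x) e) (\<lambda>A e v. A 29 0 = j \<and> playing (Suc j) (put A 29 0 (Suc j)) e v)"
    proof (rule triple_ex)
      fix x
      show "triple (compile update) (\<lambda>A e v. (chosen c st j A \<and> A 29 0 = j \<and> A 28 0 = obs_code x) \<and> x \<in> insert None (Some ` all_nodes J) \<and> ?pos e \<and>
          v \<le> run (horizon J - Suc j) (tabs c) (upd (tabs c) st ?a x) e) (\<lambda>A e v. A 29 0 = j \<and> playing (Suc j) (put A 29 0 (Suc j)) e v)"
      proof (cases "x \<in> insert None (Some ` all_nodes J)")
        case True
        have "triple (compile update) (\<lambda>A e v. (chosen c st j A \<and> A 29 0 = j \<and> A 28 0 = obs_code x) \<and> ?pos e \<and>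
            v \<le> run (horizon J - Suc j) (tabs c) (upd (tabs c) st ?a x) e)
          (\<lambda>A e v. (rel c (upd (tabs c) st ?a x) (Suc j) A \<and> A 29 0 = j) \<and> ?pos e \<and> v \<le> run (horizon J - Suc j) (tabs c) (upd (tabs c) st ?a x) e)"
          using update_hoare[OF j True, of c st j] by (intro triple_det) (auto simp: hoare_def)
        then show ?thesis
        proof (rule triple_conseq)
          fix A e v assume "(rel c (upd (tabs c) st ?a x) (Suc j) A \<and> A 29 0 = j) \<and> ?pos e \<and> v \<le> run (horizon J - Suc j) (tabs c) (upd (tabs c) st ?a x) e"
          then show "A 29 0 = j \<and> playing (Suc j) (put A 29 0 (Suc j)) e v"
            unfolding playing_def by (intro conjI exI[of _ "(c, upd (tabs c) st ?a x)"]) (simp_all add: rel_put)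
        qed blast
      next
        case False
        then show ?thesis by (auto simp: triple_def ptr_def)
      qed
    qed
    ultimately show ?thesis unfolding play_step_def c_def st_def by (intro triple_then)
  qed
  show ?thesis
  proof (rule triple_conseq[OF triple_ex[OF main]])
    fix A e v assume "A 29 0 = j \<and> playing j A e v"
    then show "\<exists>cs. (rel (fst cs) (snd cs) j A \<and> A 29 0 = j) \<and> ?pos e \<and> v \<le> run (horizon J - j) (tabs (fst cs)) (snd cs) e"
      unfolding playing_def by blast
  qed
qed

lemma drawn_playing: "drawn (arms J) (arms J) A e v \<Longrightarrow> playing 0 A e v"
proof -
  assume d: "drawn (arms J) (arms J) A e v"
  let ?c = "\<lambda>l. if l \<le> arms J then A 19 l else 0"
  have "v \<le> measure_pmf.expectation (Pi_pmf {Suc (arms J)..arms J} 0 (\<lambda>_. coin))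
       (\<lambda>f. run (horizon J) (tabs (\<lambda>l. if l \<le> arms J then A 19 l else f l)) ctrl0 e)"
    using d unfolding drawn_def by blast
  then have "v \<le> run (horizon J) (tabs ?c) ctrl0 e" by simp
  moreover have "rel ?c ctrl0 0 A"
  proof -
    have ri: "root_node J i \<in> all_nodes J" if "1 \<le> i" "i \<le> arms J" for i using root_in[of i] that by simp
    have "tables KK A" "A 22 = (\<lambda>_. 0)" "\<forall>l. 1 \<le> l \<longrightarrow> l \<le> arms J \<longrightarrow> A 20 l = horizon J \<and> A 21 l = Suc (root_node J l)"
      using d unfolding drawn_def by blast+
    then show ?thesis using ri by (auto simp: rel_def ctrl0_def init_env_def obs_code_def)
  qed
  moreover have "\<forall>i. position e i \<in> insert None (Some ` all_nodes J)" using d position_init by (simp add: drawn_def)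
  ultimately show ?thesis unfolding playing_def by (intro exI[of _ "(?c, ctrl0)"]) simp
qed

theorem algorithm_triple:
  "triple algorithm (\<lambda>A e v. fresh A \<and> e = init_env I \<and> v \<le> 4 / 27 * opt_lp I) (\<lambda>A e v. v \<le> gained e)"
  unfolding algorithm_def
proof (intro triple_then)
  show "triple (compile offline) (\<lambda>A e v. fresh A \<and> e = init_env I \<and> v \<le> 4 / 27 * opt_lp I)
    (\<lambda>A e v. (base_ok A \<and> tables KK A) \<and> e = init_env I \<and> v \<le> 4 / 27 * opt_lp I)"
    using offline_hoare by (intro triple_det) (auto simp: hoare_def)
  show "triple (forp 5 eA draw) (\<lambda>A e v. (base_ok A \<and> tables KK A) \<and> e = init_env I \<and> v \<le> 4 / 27 * opt_lp I) (drawn (arms J) (arms J))"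
  proof (rule triple_conseq)
    show "triple (forp 5 eA draw) (\<lambda>A e v. drawn 0 0 (put A 5 0 0) e v) (drawn (arms J) (arms J))"
      by (rule triple_for[where Inv = "\<lambda>j. drawn j j"]) (use draw_triple loops bound_misc in \<open>auto simp: wfp_simps\<close>)
    fix A e v assume A: "(base_ok A \<and> tables KK A) \<and> e = init_env I \<and> v \<le> 4 / 27 * opt_lp I"
    have z: "A 19 = (\<lambda>_. 0)" "A 22 = (\<lambda>_. 0)" using A unfolding base_ok_def idle_def by auto
    have "v \<le> measure_pmf.expectation (Pi_pmf {1..arms J} 0 (\<lambda>_. coin)) (\<lambda>c. run (horizon J) (tabs c) ctrl0 (init_env I))"
      using A average_run_ge_opt_lp by simp
    also have "\<dots> = measure_pmf.expectation (Pi_pmf {1..arms J} 0 (\<lambda>_. coin))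
       (\<lambda>f. run (horizon J) (tabs (\<lambda>l. if l \<le> 0 then A 19 l else f l)) ctrl0 (init_env I))"
    \<comment> \<open>Index 0 is no arm: the stored 0 there coincides with the default value of
      \<open>Pi_pmf\<close>, so both sides use the same function.\<close>
    proof (rule expectation_cong)
      fix f assume "f \<in> set_pmf (Pi_pmf {1..arms J} 0 (\<lambda>_. coin))"
      then have "f 0 = 0" by (auto simp: set_Pi_pmf PiE_dflt_def)
      then have "(\<lambda>l. if l \<le> 0 then A 19 l else f l) = f" using z by (auto simp: fun_eq_iff)
      then show "run (horizon J) (tabs f) ctrl0 (init_env I) = run (horizon J) (tabs (\<lambda>l. if l \<le> 0 then A 19 l else f l)) ctrl0 (init_env I)" by simp
    qed
    finally show "drawn 0 0 (put A 5 0 0) e v" using A z by (simp add: drawn_def cong: if_cong)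
  qed
  show "triple (forp 29 eB play_step) (drawn (arms J) (arms J)) (\<lambda>A e v. v \<le> gained e)"
  proof (rule triple_conseq)
    show "triple (forp 29 eB play_step) (\<lambda>A e v. playing 0 (put A 29 0 0) e v) (playing (horizon J))"
      by (rule triple_for) (use play_triple loops bound_misc in \<open>auto simp: wfp_simps\<close>)
    fix A e v
    show "drawn (arms J) (arms J) A e v \<Longrightarrow> playing 0 (put A 29 0 0) e v"
      by (rule drawn_playing) (simp add: drawn_put)
    show "playing (horizon J) A e v \<Longrightarrow> v \<le> gained e" by (auto simp: playing_def)
  qed
qed

lemma algorithm_steps:
  assumes "poly (time algorithm) z \<le> j"
  shows "\<forall>(c', m, e, k) \<in> set_pmf (run_for j algorithm J). c' = Halt \<and> k \<le> poly (time algorithm) z"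
    and "4 / 27 * opt_lp I \<le> measure_pmf.expectation (run_for j algorithm J) (\<lambda>(c', m, e, k). gained e)"
proof -
  have "prov I (\<lambda>m e T v. v \<le> gained e) algorithm (mem J (\<lambda>_ _. 0)) (init_env I) (poly (time algorithm) z) (4 / 27 * opt_lp I)"
    by (rule ptrD[OF algorithm_triple[unfolded triple_def], where T' = 0]) (auto simp: bd_def fresh_def)
  from prov_sound[OF this assms, of 0]
  show "\<forall>(c', m, e, k) \<in> set_pmf (run_for j algorithm J). c' = Halt \<and> k \<le> poly (time algorithm) z"
    and "4 / 27 * opt_lp I \<le> measure_pmf.expectation (run_for j algorithm J) (\<lambda>(c', m, e, k). gained e)"
    unfolding run_for_def mem_init by simp_all
qed

text \<open>Beyond the time bound all runs have halted, so the sequence defining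
  \<open>expected_reward\<close> is constant from there on and the bound at that index passes to the
  limit.\<close>

theorem algorithm_reward: "4 / 27 * opt_lp I \<le> expected_reward algorithm J"
proof -
  let ?X = "\<lambda>T. measure_pmf.expectation (run_for T algorithm J) (\<lambda>(c', m, e, k). gained e)"
  let ?T = "poly (time algorithm) z"
  have st: "run_for (Suc j) algorithm J = run_for j algorithm J" if "?T \<le> j" for j
  proof -
    have "run_for (Suc j) algorithm J = bind_pmf (run_for j algorithm J)
       (\<lambda>(c, m, e, k). bind_pmf (step I c m e) (\<lambda>(c', m', e', k'). return_pmf (c', m', e', k + k')))"
      by (simp add: run_for_def)
    also have "\<dots> = bind_pmf (run_for j algorithm J) return_pmf"
    proof (rule bind_pmf_cong[OF refl])
      fix x assume "x \<in> set_pmf (run_for j algorithm J)"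
      then show "(case x of (c, m, e, k) \<Rightarrow> bind_pmf (step I c m e) (\<lambda>(c', m', e', k'). return_pmf (c', m', e', k + k'))) = return_pmf x"
        using algorithm_steps(1)[OF that] by (cases x) (auto simp: bind_return_pmf)
    qed
    finally show ?thesis by (simp add: bind_return_pmf')
  qed
  have const: "run_for (?T + j) algorithm J = run_for ?T algorithm J" for j
    by (induction j) (auto simp: st)
  have "?X j = ?X ?T" if "?T \<le> j" for j
    using const[of "j - ?T"] that by simp
  then have "eventually (\<lambda>j. ?X j = ?X ?T) sequentially" by (intro eventually_sequentiallyI[of ?T])
  then have "?X \<longlonglongrightarrow> ?X ?T" by (rule tendsto_eventually)
  then have "expected_reward algorithm J = ?X ?T" unfolding expected_reward_def by (rule limI)
  then show ?thesis using algorithm_steps(2)[OF order_refl] by simp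
qed

end

theorem theorem1:
  shows "(\<exists>c. polynomial_time c \<and>
            (\<forall>J. input_bandit J \<longrightarrow> expected_reward c J \<ge> 4 / 27 * opt_lp (real_bandit J))) \<and>
         (\<forall>I :: ('u, real) bandit. valid_bandit I \<longrightarrow> opt_lp I \<le> 27 / 4 * opt_policy I)"
proof (intro conjI exI[of _ algorithm] allI impI)
  show "polynomial_time algorithm"
    unfolding polynomial_time_def
  proof (intro exI[of _ "time algorithm"] allI impI)
    fix J :: "(nat, rat) bandit" assume "input_bandit J"
    then interpret inst J by unfold_locales
    show "halts_within (poly (time algorithm) (input_size J)) algorithm J"
      using algorithm_steps(1)[OF order_refl] unfolding halts_within_def z_def .
  qed
  fix J :: "(nat, rat) bandit" assume "input_bandit J"
  then interpret inst J by unfold_locales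
  show "4 / 27 * opt_lp (real_bandit J) \<le> expected_reward algorithm J" by (rule algorithm_reward)
next
  fix I :: "('u, real) bandit" assume "valid_bandit I"
  then interpret mab I by unfold_locales
  show "opt_lp I \<le> 27 / 4 * opt_policy I" by (rule opt_lp_le_opt_policy)
qed

end
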